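(* Let $\Omega_1,\Omega_2\subset\mathbb{R}^d$ be non-empty bounded open sets with Lipschitz boundary such that $\Omega_1$ is connected, and let $0\neq U:C_0(\Omega_1)\to C_0(\Omega_2)$ be a bounded linear operator satisfying (a) $f\cdot g=0$ implies $(Uf)\cdot(Ug)=0$, for all $f,g\in C_0(\Omega_1)$; and (b) $U(\Delta f)=\Delta(Uf)$ in the sense of distributions on $\Omega_2$, for all $f\in C_c^\infty(\Omega_1)$. Suppose in addition that at least one of the following conditions holds: (1) $|\Omega_1|=|\Omega_2|$; or (2) $U$ has dense range; or (3) $\Omega_2$ is connected and the Dirichlet Laplacians on $\Omega_1$ and $\Omega_2$ have the same first eigenvalue. Then $\Omega_1$ and $\Omega_2$ are congruent, and there exist an isometry $\tau:\mathbb{R}^d\to\mathbb{R}^d$ with $\tau(\Omega_2)=\Omega_1$ and a constant $c\in\mathbb{C}\setminus\{0\}$ such that $Uf=c\,f\circ\tau$ for all $f\in C_0(\Omega_1)$.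
   Context: Functions are complex-valued. For an open set $\Omega\subset\mathbb{R}^d$, $C_c^\infty(\Omega)$ is the space of smooth functions with compact support in $\Omega$, and $C_0(\Omega)$ is the closure of $C_c^\infty(\Omega)$ with respect to the supremum norm $\|\cdot\|_\infty$; it is equipped with this norm. $|\Omega|$ is Lebesgue measure. The Dirichlet Laplacian on $\Omega$ is the self-adjoint operator $-\Delta$ on $L^2(\Omega)$ with domain $\{u\in H_0^1(\Omega):\Delta u\in L^2(\Omega)\}$ ($\Delta u$ distributional); its first eigenvalue is its smallest eigenvalue. Two open sets are congruent if one is the image of the other under an isometry of $\mathbb{R}^d$. *)

theory Defs
  imports "HOL-Analysis.Analysis"
begin

section \<open>Test functions and the space $C_0$\<close>

definition partial_deriv :: "'a::euclidean_space \<Rightarrow> ('a \<Rightarrow> complex) \<Rightarrow> 'a \<Rightarrow> complex"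
  where "partial_deriv b f x = frechet_derivative f (at x) b"

definition laplacian :: "('a::euclidean_space \<Rightarrow> complex) \<Rightarrow> 'a \<Rightarrow> complex"
  where "laplacian f x = (\<Sum>b\<in>Basis. partial_deriv b (partial_deriv b f) x)"

text \<open>$f$ is of class $C^k$ on the whole space, with respect to the real structure of both sides.\<close>

primrec C_k :: "nat \<Rightarrow> ('a::euclidean_space \<Rightarrow> complex) \<Rightarrow> bool"
  where
    "C_k 0 f \<longleftrightarrow> continuous_on UNIV f"
  | "C_k (Suc k) f \<longleftrightarrow> f differentiable_on UNIV \<and> (\<forall>b\<in>Basis. C_k k (partial_deriv b f))"

definition smooth :: "('a::euclidean_space \<Rightarrow> complex) \<Rightarrow> bool"
  where "smooth f \<longleftrightarrow> (\<forall>k. C_k k f)"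

text \<open>Functions with compact support in $\Omega$, and uniform limits of such functions, are
  identified with their extensions by zero to the whole space.\<close>

definition Cc_infty :: "'a::euclidean_space set \<Rightarrow> ('a \<Rightarrow> complex) set"
  where "Cc_infty \<Omega> =
    {f. smooth f \<and> compact (closure {x. f x \<noteq> 0}) \<and> closure {x. f x \<noteq> 0} \<subseteq> \<Omega>}"

text \<open>The type of bounded continuous functions carries the supremum norm, so the closure below is
  the one with respect to uniform convergence.\<close>

definition C_0 :: "'a::euclidean_space set \<Rightarrow> ('a \<Rightarrow>\<^sub>C complex) set"
  where "C_0 \<Omega> = closure {f. apply_bcontfun f \<in> Cc_infty \<Omega>}"

lemma C_k_add:
  assumes "C_k k f" "C_k k g"
  shows "C_k k (\<lambda>x. f x + g x)"
  using assms
proof (induction k arbitrary: f g)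
  case 0
  then show ?case by (simp add: continuous_on_add)
next
  case (Suc k)
  have d: "f differentiable (at x)" "g differentiable (at x)" for x
    using Suc.prems by (auto simp: differentiable_on_def)
  have "partial_deriv b (\<lambda>x. f x + g x) = (\<lambda>x. partial_deriv b f x + partial_deriv b g x)" for b
  proof
    fix x
    have "((\<lambda>x. f x + g x) has_derivative
        (\<lambda>h. frechet_derivative f (at x) h + frechet_derivative g (at x) h)) (at x)"
      using d frechet_derivative_works by (blast intro: has_derivative_add)
    then show "partial_deriv b (\<lambda>x. f x + g x) x = partial_deriv b f x + partial_deriv b g x"
      by (simp add: partial_deriv_def frechet_derivative_at[symmetric])
  qed
  with Suc show ?case by simp
qed

lemma C_k_zero: "C_k k (\<lambda>x. 0)"
  by (induction k) (auto simp: partial_deriv_def[abs_def])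

lemma C_k_sum:
  assumes "finite A" "\<And>i. i \<in> A \<Longrightarrow> C_k k (F i)"
  shows "C_k k (\<lambda>x. \<Sum>i\<in>A. F i x)"
  using assms by (induction A rule: finite_induct) (auto simp: C_k_zero intro: C_k_add)

lemma smooth_partial_deriv: "smooth f \<Longrightarrow> b \<in> Basis \<Longrightarrow> smooth (partial_deriv b f)"
  unfolding smooth_def by (metis C_k.simps(2))

lemma smooth_laplacian:
  fixes f :: "'a::euclidean_space \<Rightarrow> complex"
  shows "smooth f \<Longrightarrow> smooth (laplacian f)"
proof -
  assume f: "smooth f"
  have "C_k k (partial_deriv b (partial_deriv b f))" if "b \<in> Basis" for b k
    using smooth_partial_deriv[OF smooth_partial_deriv[OF f that] that] by (simp add: smooth_def)
  then show ?thesis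
    unfolding smooth_def laplacian_def[abs_def] by (intro allI C_k_sum) auto
qed

lemma partial_deriv_eq_0:
  assumes "x \<notin> closure {x. f x \<noteq> 0}"
  shows "partial_deriv b f x = 0"
proof -
  have "(f has_derivative (\<lambda>h. 0)) (at x)"
  proof (rule has_derivative_transform_within_open[where s = "- closure {x. f x \<noteq> 0}"])
    show "((\<lambda>x. 0) has_derivative (\<lambda>h. 0)) (at x)" by simp
    show "0 = f y" if "y \<in> - closure {x. f x \<noteq> 0}" for y
      using that closure_subset[of "{x. f x \<noteq> 0}"] by auto
  qed (use assms in auto)
  then show ?thesis
    by (simp add: partial_deriv_def frechet_derivative_at[symmetric])
qed

lemma support_partial_deriv:
  "closure {x. partial_deriv b f x \<noteq> 0} \<subseteq> closure {x. f x \<noteq> 0}"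
  by (rule closure_minimal) (use partial_deriv_eq_0 in auto)

lemma support_laplacian: "closure {x. laplacian f x \<noteq> 0} \<subseteq> closure {x. f x \<noteq> 0}"
proof (rule closure_minimal)
  show "{x. laplacian f x \<noteq> 0} \<subseteq> closure {x. f x \<noteq> 0}"
  proof (rule ccontr)
    assume "\<not> ?thesis"
    then obtain x where x: "laplacian f x \<noteq> 0" "x \<notin> closure {x. f x \<noteq> 0}" by auto
    then have "partial_deriv b (partial_deriv b f) x = 0" for b
      using partial_deriv_eq_0 support_partial_deriv by blast
    then show False using x by (simp add: laplacian_def)
  qed
qed auto

lemma laplacian_Cc_infty: "f \<in> Cc_infty \<Omega> \<Longrightarrow> laplacian f \<in> Cc_infty \<Omega>"
  unfolding Cc_infty_def using support_laplacian[of f] smooth_laplacian[of f]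
  by (auto simp: compact_eq_bounded_closed intro: bounded_subset)

lemma Cc_infty_bcontfun:
  assumes "f \<in> Cc_infty \<Omega>"
  shows "f \<in> bcontfun"
proof -
  let ?K = "closure {x. f x \<noteq> 0}"
  have cont: "continuous_on UNIV f" and K: "compact ?K"
    using assms by (auto simp: Cc_infty_def smooth_def dest: spec[of _ 0])
  have "range f \<subseteq> insert 0 (f ` ?K)"
    using closure_subset[of "{x. f x \<noteq> 0}"] by auto
  moreover have "bounded (insert 0 (f ` ?K))"
    using K cont by (metis bounded_insert compact_continuous_image compact_imp_bounded
        continuous_on_subset subset_UNIV)
  ultimately have "bounded (range f)"
    by (rule bounded_subset[rotated])
  then show ?thesis
    using cont by (simp add: bcontfun_def)
qed

lemma C_0_vanishes_outside:
  assumes "f \<in> C_0 \<Omega>" "x \<notin> \<Omega>"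
  shows "apply_bcontfun f x = 0"
proof (rule ccontr)
  assume "apply_bcontfun f x \<noteq> 0"
  then obtain g where g: "apply_bcontfun g \<in> Cc_infty \<Omega>" "dist g f < norm (apply_bcontfun f x)"
    using assms(1)[unfolded C_0_def closure_approachable, rule_format, of "norm (apply_bcontfun f x)"]
    by auto
  have "apply_bcontfun g x = 0"
    using g(1) assms(2) closure_subset[of "{x. apply_bcontfun g x \<noteq> 0}"]
    by (auto simp: Cc_infty_def)
  then show False
    using dist_bounded[of g x f] g(2) by simp
qed


section \<open>Bounded operators on $C_0$\<close>

definition cscale :: "complex \<Rightarrow> ('a::topological_space \<Rightarrow>\<^sub>C complex) \<Rightarrow> ('a \<Rightarrow>\<^sub>C complex)"
  where "cscale c f = Bcontfun (\<lambda>x. c * apply_bcontfun f x)"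

lemma apply_cscale [simp]: "apply_bcontfun (cscale c f) x = c * apply_bcontfun f x"
proof -
  obtain B where "\<And>x. norm (apply_bcontfun f x) \<le> B"
    using bounded_apply_bcontfun[of f] by (auto simp: bounded_iff)
  then have "norm (c * apply_bcontfun f x) \<le> norm c * B" for x
    by (simp add: norm_mult mult_left_mono)
  then have "(\<lambda>x. c * apply_bcontfun f x) \<in> bcontfun"
    using continuous_on_mult_left[OF continuous_on_apply_bcontfun[of UNIV f], of c]
    by (auto simp: bcontfun_def bounded_iff)
  then show ?thesis
    by (simp add: cscale_def Bcontfun_inverse)
qed

text \<open>Only the values of $U$ on $C_0(\Omega_1)$ matter.\<close>

definition bounded_operator_C_0 ::
    "'a::euclidean_space set \<Rightarrow> 'a set \<Rightarrow> (('a \<Rightarrow>\<^sub>C complex) \<Rightarrow> ('a \<Rightarrow>\<^sub>C complex)) \<Rightarrow> bool"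
  where "bounded_operator_C_0 \<Omega>\<^sub>1 \<Omega>\<^sub>2 U \<longleftrightarrow>
    U \<in> C_0 \<Omega>\<^sub>1 \<rightarrow> C_0 \<Omega>\<^sub>2 \<and>
    (\<forall>f\<in>C_0 \<Omega>\<^sub>1. \<forall>g\<in>C_0 \<Omega>\<^sub>1. U (f + g) = U f + U g) \<and>
    (\<forall>c. \<forall>f\<in>C_0 \<Omega>\<^sub>1. U (cscale c f) = cscale c (U f)) \<and>
    (\<exists>K. \<forall>f\<in>C_0 \<Omega>\<^sub>1. norm (U f) \<le> K * norm f)"


section \<open>Weak derivatives and the Dirichlet Laplacian\<close>

text \<open>$\Delta u = w$ in the sense of distributions on $\Omega$, for locally integrable $u$, $w$.\<close>

definition distr_laplacian ::
    "'a::euclidean_space set \<Rightarrow> ('a \<Rightarrow> complex) \<Rightarrow> ('a \<Rightarrow> complex) \<Rightarrow> bool"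
  where "distr_laplacian \<Omega> u w \<longleftrightarrow>
    (\<forall>\<phi>\<in>Cc_infty \<Omega>.
      (LINT x|lebesgue_on \<Omega>. u x * laplacian \<phi> x) = (LINT x|lebesgue_on \<Omega>. w x * \<phi> x))"

definition weak_partial_deriv ::
    "'a::euclidean_space set \<Rightarrow> 'a \<Rightarrow> ('a \<Rightarrow> complex) \<Rightarrow> ('a \<Rightarrow> complex) \<Rightarrow> bool"
  where "weak_partial_deriv \<Omega> b u g \<longleftrightarrow>
    (\<forall>\<phi>\<in>Cc_infty \<Omega>.
      (LINT x|lebesgue_on \<Omega>. u x * partial_deriv b \<phi> x) = - (LINT x|lebesgue_on \<Omega>. g x * \<phi> x))"

text \<open>Elements of $L^2$ and of the Sobolev spaces are represented by functions; no quotient by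
  almost everywhere equality is taken, and values outside $\Omega$ are irrelevant.\<close>

definition L2 :: "'a::euclidean_space set \<Rightarrow> ('a \<Rightarrow> complex) set"
  where "L2 \<Omega> = {u. u \<in> borel_measurable (lebesgue_on \<Omega>) \<and>
                     integrable (lebesgue_on \<Omega>) (\<lambda>x. (norm (u x))\<^sup>2)}"

definition L2_norm_sq :: "'a::euclidean_space set \<Rightarrow> ('a \<Rightarrow> complex) \<Rightarrow> real"
  where "L2_norm_sq \<Omega> u = (LINT x|lebesgue_on \<Omega>. (norm (u x))\<^sup>2)"

text \<open>$H^1_0(\Omega)$ is the closure of the test functions in $H^1(\Omega)$; here $g_b$ is the weak
  partial derivative of $u$ in direction $b$.\<close>

definition H1_0 :: "'a::euclidean_space set \<Rightarrow> ('a \<Rightarrow> complex) set"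
  where "H1_0 \<Omega> = {u. u \<in> L2 \<Omega> \<and>
    (\<exists>g. (\<forall>b\<in>Basis. g b \<in> L2 \<Omega> \<and> weak_partial_deriv \<Omega> b u (g b)) \<and>
         (\<forall>\<epsilon>>0. \<exists>\<phi>\<in>Cc_infty \<Omega>.
            L2_norm_sq \<Omega> (\<lambda>x. u x - \<phi> x) +
            (\<Sum>b\<in>Basis. L2_norm_sq \<Omega> (\<lambda>x. g b x - partial_deriv b \<phi> x)) < \<epsilon>))}"

text \<open>The graph of the operator $-\Delta$ with domain
  $\{u \in H^1_0(\Omega) : \Delta u \in L^2(\Omega)\}$.\<close>

definition dirichlet_laplacian ::
    "'a::euclidean_space set \<Rightarrow> ('a \<Rightarrow> complex) \<Rightarrow> ('a \<Rightarrow> complex) \<Rightarrow> bool"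
  where "dirichlet_laplacian \<Omega> u w \<longleftrightarrow>
    u \<in> H1_0 \<Omega> \<and> w \<in> L2 \<Omega> \<and> distr_laplacian \<Omega> u (\<lambda>x. - w x)"

text \<open>The operator is self-adjoint, so only real eigenvalues have to be considered.\<close>

definition dirichlet_eigenvalue :: "'a::euclidean_space set \<Rightarrow> real \<Rightarrow> bool"
  where "dirichlet_eigenvalue \<Omega> \<mu> \<longleftrightarrow>
    (\<exists>u. \<not> (AE x in lebesgue_on \<Omega>. u x = 0) \<and>
         dirichlet_laplacian \<Omega> u (\<lambda>x. complex_of_real \<mu> * u x))"

definition first_dirichlet_eigenvalue :: "'a::euclidean_space set \<Rightarrow> real \<Rightarrow> bool"
  where "first_dirichlet_eigenvalue \<Omega> \<mu> \<longleftrightarrow>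
    dirichlet_eigenvalue \<Omega> \<mu> \<and> (\<forall>\<nu>. dirichlet_eigenvalue \<Omega> \<nu> \<longrightarrow> \<mu> \<le> \<nu>)"


section \<open>Lipschitz boundary and congruence\<close>

text \<open>Near each boundary point, after a rotation taking the unit vector $e$ to the last coordinate
  direction, $\Omega$ is the set of points lying above the graph of a Lipschitz function $\gamma$ on
  the hyperplane orthogonal to $e$.\<close>

definition lipschitz_boundary :: "'a::euclidean_space set \<Rightarrow> bool"
  where "lipschitz_boundary \<Omega> \<longleftrightarrow>
    (\<forall>p\<in>frontier \<Omega>. \<exists>e (\<gamma>::'a \<Rightarrow> real) L r.
        norm e = 1 \<and> 0 < r \<and> L-lipschitz_on {y. y \<bullet> e = 0} \<gamma> \<and>
        \<Omega> \<inter> ball p r = {x \<in> ball p r. \<gamma> (x - (x \<bullet> e) *\<^sub>R e) < x \<bullet> e})"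

definition is_isometry :: "('a::metric_space \<Rightarrow> 'a) \<Rightarrow> bool"
  where "is_isometry \<tau> \<longleftrightarrow> (\<forall>x y. dist (\<tau> x) (\<tau> y) = dist x y)"

definition congruent_sets :: "'a::metric_space set \<Rightarrow> 'a set \<Rightarrow> bool"
  where "congruent_sets S T \<longleftrightarrow> (\<exists>\<tau>. is_isometry \<tau> \<and> \<tau> ` S = T)"

end

theory Submission
  imports Defs "HOL-Library.Diagonal_Subsequence" "HOL-Complex_Analysis.Great_Picard"
begin

text \<open>A functional $f \mapsto Uf(x)$ that preserves disjointness is a multiple of a point evaluation, so
  $Uf = w \cdot (f \circ \tau)$ on the open set where $w \neq 0$. Applied to cut-off versions of $1$,
  $x_i$ and $x_i x_j$, the intertwining relation says that $w$ and $w\tau_i$ are weakly harmonic (hence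
  smooth, by Weyl's lemma) and that $\Delta(w\tau_i\tau_j) = 2\delta_{ij}w$; together these identities force
  $D\tau$ to be orthogonal. Differentiating the orthogonality relations and using the symmetry of second
  derivatives gives $D^2\tau = 0$ and then $\nabla w = 0$, so that $\tau$ is locally a rigid motion and
  $w$ is locally constant. Take the set $V$ where $\tau$ and $w$ agree locally with one such rigid motion
  and one such constant. The continuity of all $Uf$ shows that the rigid motion maps $V$ onto a
  relatively closed and open subset of the connected set $\Omega_1$, that is, onto $\Omega_1$.

  If $V \neq \Omega_2$, the Lipschitz condition provides a nonempty open subset of $\Omega_2 \setminus V$. This
  contradicts the equality of the measures; and if $U$ had dense range, the values of $Uf$ at a point of
  $\Omega_2 \setminus V$ could not be multiples of its values at a point of $V$. For equal first eigenvalues,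
  compactness of the embedding of $H^1_0$ shows that the first eigenvalue $\mu$ of $\Omega_2$ is bounded by
  all Rayleigh quotients, so the modulus of an eigenfunction of $V$ is a minimiser on $\Omega_2$. It thus
  solves $-\Delta u = \mu u$ on $\Omega_2$ and is a nonnegative superharmonic function vanishing on an
  open set, which contradicts the strong minimum principle.\<close>

section \<open>Smooth functions\<close>

text \<open>The obstacle is that \<tau> is not known to be continuous and is arbitrary where w
  vanishes; only the products w (f \<circ> \<tau>) are continuous. Regularity is therefore obtained
  for w and w \<tau>_i, which solve equations, and \<tau>_i is recovered as a quotient. Means are
  taken with smooth radial weights instead of spheres. The profile comes from e^(-1/s), chosen so
  that differentiating the weight in its radius produces the Laplacian of a test function; one
  kernel then serves Weyl's lemma, the minimum principle and the mollifier. The first eigenvalue is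
  the least element of a set of eigenvalues, without reference to Rayleigh quotients. Comparing
  domains needs that the infimum of the quotients on \<Omega>_2 is itself an eigenvalue, and this is
  where compactness enters. The minimisation runs through test functions, which can be moved rigidly
  and extended by zero; limits are taken in L^2. The Lipschitz condition excludes that \<Omega>_2
  exceeds V by a thin set such as a slit, which neither measure nor eigenvalues need detect.\<close>

lemma partial_deriv_eq: "(f has_derivative f') (at x) \<Longrightarrow> partial_deriv b f x = f' b"
  by (simp add: partial_deriv_def frechet_derivative_at[symmetric])

text \<open>\<open>partial_deriv\<close> is defined through \<open>frechet_derivative\<close>. With
  this rule and \<open>C_k_SucE\<close> any explicit derivative may be used instead, and each
  closure property of \<open>C_k\<close> becomes an induction on k in which the derivative only has
  to be assembled from C^k pieces.\<close>

lemma C_k_SucI: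
  assumes "\<And>x. (f has_derivative f' x) (at x)" "\<And>b. b \<in> Basis \<Longrightarrow> C_k k (\<lambda>x. f' x b)"
  shows "C_k (Suc k) f"
proof -
  have "partial_deriv b f = (\<lambda>x. f' x b)" for b
    using partial_deriv_eq[OF assms(1)] by blast
  moreover have "f differentiable_on UNIV"
    using assms(1) by (auto simp: differentiable_on_def differentiable_def)
  ultimately show ?thesis using assms(2) by simp
qed

lemma C_k_SucE:
  assumes "C_k (Suc k) f"
  obtains f' where "\<And>x. (f has_derivative f' x) (at x)" "\<And>b. b \<in> Basis \<Longrightarrow> C_k k (\<lambda>x. f' x b)"
proof -
  show ?thesis
  proof (rule that)
    show "(f has_derivative frechet_derivative f (at x)) (at x)" for x
      using assms frechet_derivative_works[of f "at x"] by (auto simp: differentiable_on_def)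
    show "C_k k (\<lambda>x. frechet_derivative f (at x) b)" if "b \<in> Basis" for b
      using assms that by (auto simp: partial_deriv_def[abs_def])
  qed
qed

lemma C_k_SucD: "C_k (Suc k) f \<Longrightarrow> C_k k f"
proof (induction k arbitrary: f)
  case 0
  then show ?case by (auto intro: differentiable_imp_continuous_on)
qed auto

lemma C_k_const: "C_k k (\<lambda>x. c)"
proof (induction k arbitrary: c)
  case (Suc k)
  show ?case by (rule C_k_SucI[where f' = "\<lambda>x h. 0"]) (auto intro: C_k_zero)
qed auto

lemma C_k_mult:
  assumes "C_k k f" "C_k k g"
  shows "C_k k (\<lambda>x. f x * g x)"
  using assms
proof (induction k arbitrary: f g)
  case 0
  then show ?case by (simp add: continuous_on_mult)
next
  case (Suc k)
  obtain f' where f': "\<And>x. (f has_derivative f' x) (at x)" "\<And>b. b \<in> Basis \<Longrightarrow> C_k k (\<lambda>x. f' x b)"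
    using C_k_SucE[OF Suc.prems(1)] by blast
  obtain g' where g': "\<And>x. (g has_derivative g' x) (at x)" "\<And>b. b \<in> Basis \<Longrightarrow> C_k k (\<lambda>x. g' x b)"
    using C_k_SucE[OF Suc.prems(2)] by blast
  show ?case
    by (rule C_k_SucI[OF has_derivative_mult[OF f'(1) g'(1)]])
      (auto intro!: C_k_add Suc.IH f'(2) g'(2) C_k_SucD[OF Suc.prems(1)] C_k_SucD[OF Suc.prems(2)])
qed

text \<open>The derivative of 1/f is - (1/f) f' (1/f), again a product of 1/f with C^k functions, so
  the induction hypothesis for 1/f itself closes the step.\<close>

lemma C_k_inverse:
  assumes "C_k k f" "\<And>x. f x \<noteq> 0"
  shows "C_k k (\<lambda>x. inverse (f x))"
  using assms
proof (induction k arbitrary: f)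
  case 0
  then show ?case by (simp add: continuous_on_inverse)
next
  case (Suc k)
  obtain f' where f': "\<And>x. (f has_derivative f' x) (at x)" "\<And>b. b \<in> Basis \<Longrightarrow> C_k k (\<lambda>x. f' x b)"
    using C_k_SucE[OF Suc.prems(1)] by blast
  have 1: "((\<lambda>x. inverse (f x)) has_derivative
      (\<lambda>h. - 1 * (inverse (f x) * f' x h * inverse (f x)))) (at x)" for x
    using Deriv.has_derivative_inverse[OF _ f'(1)] Suc.prems(2) by simp
  have "C_k k (\<lambda>x. inverse (f x))"
    using Suc.IH[OF C_k_SucD[OF Suc.prems(1)] Suc.prems(2)] .
  then show ?case
    by (intro C_k_SucI[OF 1] C_k_mult C_k_const f'(2))
qed

lemma C_k_bounded_linear:
  assumes "bounded_linear L" "C_k k f"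
  shows "C_k k (\<lambda>x. L (f x))"
  using assms(2)
proof (induction k arbitrary: f)
  case 0
  then show ?case
    using linear_continuous_on_compose[OF _ bounded_linear.linear[OF assms(1)]] by auto
next
  case (Suc k)
  obtain f' where f': "\<And>x. (f has_derivative f' x) (at x)" "\<And>b. b \<in> Basis \<Longrightarrow> C_k k (\<lambda>x. f' x b)"
    using C_k_SucE[OF Suc.prems(1)] by blast
  show ?case
    by (rule C_k_SucI[OF bounded_linear.has_derivative[OF assms(1) f'(1)]]) (intro Suc.IH f'(2))
qed

lemma C_k_inner: "C_k k (\<lambda>x. complex_of_real (x \<bullet> c))"
proof (cases k)
  case (Suc n)
  show ?thesis unfolding Suc
    by (rule C_k_SucI[where f' = "\<lambda>x h. complex_of_real (h \<bullet> c)"])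
      (auto intro!: derivative_eq_intros C_k_const)
qed (auto intro!: continuous_intros)

text \<open>\<open>C_k\<close> speaks about complex-valued functions, so a real function enters
  through its coercion. The real derivative is the real part of the complex one, and uniqueness of
  derivatives shows that nothing is lost.\<close>

lemma C_k_of_realE:
  fixes g :: "'a::euclidean_space \<Rightarrow> real"
  assumes "C_k (Suc k) (\<lambda>x. complex_of_real (g x))"
  obtains g' where "\<And>x. (g has_derivative g' x) (at x)"
    "\<And>b. b \<in> Basis \<Longrightarrow> C_k k (\<lambda>x. complex_of_real (g' x b))"
proof -
  obtain f' where f': "\<And>x. ((\<lambda>x. complex_of_real (g x)) has_derivative f' x) (at x)"
    "\<And>b. b \<in> Basis \<Longrightarrow> C_k k (\<lambda>x. f' x b)"
    using C_k_SucE[OF assms] by blast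
  have g: "(g has_derivative (\<lambda>h. Re (f' x h))) (at x)" for x
    using bounded_linear.has_derivative[OF bounded_linear_Re f'(1)[of x]] by simp
  have "f' x = (\<lambda>h. complex_of_real (Re (f' x h)))" for x
    by (rule has_derivative_unique[OF f'(1) has_derivative_of_real[OF g]])
  then have "(\<lambda>x. complex_of_real (Re (f' x b))) = (\<lambda>x. f' x b)" for b
    by (metis (no_types, lifting))
  then have "C_k k (\<lambda>x. complex_of_real (Re (f' x b)))" if "b \<in> Basis" for b
    using f'(2)[OF that] by simp
  then show ?thesis using that[OF g] by blast
qed

text \<open>As for the inverse: the derivative g' / (2 sqrt g) is built from g' and 1 / sqrt g only.
  Positivity on the whole space keeps the argument away from the singularity at 0.\<close>

lemma C_k_sqrt:
  assumes "C_k k (\<lambda>x. complex_of_real (g x))" "\<And>x. 0 < g x"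
  shows "C_k k (\<lambda>x. complex_of_real (sqrt (g x)))"
  using assms(1)
proof (induction k)
  case 0
  have "continuous_on UNIV (\<lambda>x. Re (complex_of_real (g x)))"
    using 0 by (intro continuous_on_Re) simp
  then show ?case by (auto intro!: continuous_intros)
next
  case (Suc k)
  obtain g' where g': "\<And>x. (g has_derivative g' x) (at x)"
    "\<And>b. b \<in> Basis \<Longrightarrow> C_k k (\<lambda>x. complex_of_real (g' x b))"
    using C_k_of_realE[OF Suc.prems] by blast
  have 1: "((\<lambda>x. complex_of_real (sqrt (g x))) has_derivative
      (\<lambda>h. (1/2) * inverse (complex_of_real (sqrt (g x))) * complex_of_real (g' x h))) (at x)" for x
    using assms(2)[of x]
    by (auto intro!: derivative_eq_intros g'(1) simp: field_simps)
  have "C_k k (\<lambda>x. complex_of_real (sqrt (g x)))"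
    using Suc.IH[OF C_k_SucD[OF Suc.prems]] .
  moreover have "complex_of_real (sqrt (g x)) \<noteq> 0" for x
    using assms(2)[of x] by simp
  ultimately show ?case
    by (intro C_k_SucI[OF 1] C_k_mult C_k_const g'(2) C_k_inverse)
qed

text \<open>The partial derivatives of f after an affine map are combinations, with constant
  coefficients, of the partial derivatives of f after the same map; hence the induction over all f
  at once.\<close>

lemma C_k_affine:
  fixes A :: "'a::euclidean_space \<Rightarrow> 'b::euclidean_space"
  assumes "linear A" "C_k k f"
  shows "C_k k (\<lambda>x. f (A x + v))"
  using assms(2)
proof (induction k arbitrary: f)
  case 0
  then show ?case
    using continuous_on_compose2[of UNIV f UNIV "\<lambda>x. A x + v"]
      linear_continuous_on[OF linear_conv_bounded_linear[THEN iffD1, OF assms(1)], of UNIV]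
    by (simp add: continuous_on_add)
next
  case (Suc k)
  obtain f' where f': "\<And>x. (f has_derivative f' x) (at x)" "\<And>b. b \<in> Basis \<Longrightarrow> C_k k (\<lambda>x. f' x b)"
    using C_k_SucE[OF Suc.prems(1)] by blast
  have A: "((\<lambda>x. A x + v) has_derivative A) (at x)" for x
    using assms(1) by (auto intro!: derivative_eq_intros linear_imp_has_derivative)
  have 1: "((\<lambda>x. f (A x + v)) has_derivative (\<lambda>h. f' (A x + v) (A h))) (at x)" for x
    using has_derivative_compose[OF A f'(1)] by simp
  have 2: "f' y (A h) = (\<Sum>c\<in>Basis. complex_of_real (A h \<bullet> c) * f' y c)" for y h
  proof -
    have "linear (f' y)" using f'(1) has_derivative_linear by blast
    then have "f' y (\<Sum>c\<in>Basis. (A h \<bullet> c) *\<^sub>R c) = (\<Sum>c\<in>Basis. (A h \<bullet> c) *\<^sub>R f' y c)"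
      by (simp add: linear_sum linear_cmul)
    then show ?thesis by (simp add: euclidean_representation scaleR_conv_of_real)
  qed
  show ?case
    by (rule C_k_SucI[OF 1], unfold 2) (intro C_k_sum C_k_mult C_k_const Suc.IH f'(2) finite_Basis)
qed

lemma C_k_norm_sq: "C_k k (\<lambda>x. complex_of_real ((norm x)\<^sup>2))"
proof -
  have "complex_of_real ((norm x)\<^sup>2) = (\<Sum>b\<in>Basis. complex_of_real (x \<bullet> b) * complex_of_real (x \<bullet> b))" for x :: 'a
    by (simp add: power2_norm_eq_inner euclidean_inner[of x x])
  then show ?thesis by (simp only:) (intro C_k_sum C_k_mult C_k_inner finite_Basis)
qed

lemma smooth_add: "smooth f \<Longrightarrow> smooth g \<Longrightarrow> smooth (\<lambda>x. f x + g x)"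
  and smooth_mult: "smooth f \<Longrightarrow> smooth g \<Longrightarrow> smooth (\<lambda>x. f x * g x)"
  and smooth_const: "smooth (\<lambda>x. c)"
  and smooth_inverse: "smooth f \<Longrightarrow> (\<And>x. f x \<noteq> 0) \<Longrightarrow> smooth (\<lambda>x. inverse (f x))"
  and smooth_bounded_linear: "bounded_linear L \<Longrightarrow> smooth f \<Longrightarrow> smooth (\<lambda>x. L (f x))"
  and smooth_inner: "smooth (\<lambda>x. complex_of_real (x \<bullet> v))"
  and smooth_sqrt: "smooth (\<lambda>x. complex_of_real (r x)) \<Longrightarrow> (\<And>x. 0 < r x) \<Longrightarrow>
    smooth (\<lambda>x. complex_of_real (sqrt (r x)))"
  and smooth_norm_sq: "smooth (\<lambda>x. complex_of_real ((norm x)\<^sup>2))"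
  by (simp_all add: smooth_def C_k_add C_k_mult C_k_const C_k_inverse C_k_bounded_linear C_k_inner
      C_k_sqrt C_k_norm_sq del: of_real_power)

lemma smooth_affine: "linear A \<Longrightarrow> smooth f \<Longrightarrow> smooth (\<lambda>x. f (A x + v))"
  by (simp add: smooth_def C_k_affine)

lemma smooth_sum: "finite A \<Longrightarrow> (\<And>i. i \<in> A \<Longrightarrow> smooth (F i)) \<Longrightarrow> smooth (\<lambda>x. \<Sum>i\<in>A. F i x)"
  by (simp add: smooth_def C_k_sum)

lemma smooth_cnj: "smooth f \<Longrightarrow> smooth (\<lambda>x. cnj (f x))"
  by (rule smooth_bounded_linear[OF bounded_linear_cnj])

lemma smooth_diff: "smooth f \<Longrightarrow> smooth g \<Longrightarrow> smooth (\<lambda>x. f x - g x)"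
  using smooth_bounded_linear[OF bounded_linear_minus[OF bounded_linear_ident]] smooth_add[of f "\<lambda>x. - g x"]
  by auto

lemma smooth_has_derivative:
  assumes "smooth f"
  shows "(f has_derivative frechet_derivative f (at x)) (at x)"
  using assms frechet_derivative_works[of f "at x"]
  by (auto simp: differentiable_on_def smooth_def dest: spec[of _ "Suc 0"])

lemma smooth_continuous: "smooth f \<Longrightarrow> continuous_on S f"
  using C_k.simps(1)[of f] continuous_on_subset[of UNIV f S] unfolding smooth_def by blast

section \<open>Calculus of partial derivatives and of the Laplacian\<close>

lemma frechet_derivative_expand:
  fixes f :: "'a::euclidean_space \<Rightarrow> complex"
  assumes "(f has_derivative f') (at x)"
  shows "f' h = (\<Sum>b\<in>Basis. (h \<bullet> b) *\<^sub>R partial_deriv b f x)"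
proof -
  have "linear f'" using assms has_derivative_linear by blast
  then have "f' (\<Sum>b\<in>Basis. (h \<bullet> b) *\<^sub>R b) = (\<Sum>b\<in>Basis. (h \<bullet> b) *\<^sub>R f' b)"
    by (simp add: linear_sum linear_cmul)
  then show ?thesis using partial_deriv_eq[OF assms] by (simp add: euclidean_representation)
qed

lemma smooth_has_derivative_sum:
  "smooth f \<Longrightarrow> (f has_derivative (\<lambda>h. \<Sum>b\<in>Basis. (h \<bullet> b) *\<^sub>R partial_deriv b f x)) (at x)"
  using smooth_has_derivative[of f x] frechet_derivative_expand[OF smooth_has_derivative[of f x]]
  by (metis (no_types, lifting) ext)

lemma partial_deriv_mult:
  assumes "smooth f" "smooth g"
  shows "partial_deriv b (\<lambda>x. f x * g x) = (\<lambda>x. f x * partial_deriv b g x + partial_deriv b f x * g x)"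
  using partial_deriv_eq[OF has_derivative_mult[OF smooth_has_derivative[OF assms(1)]
        smooth_has_derivative[OF assms(2)]]]
  by (auto simp: partial_deriv_def)

lemma partial_deriv_add:
  assumes "smooth f" "smooth g"
  shows "partial_deriv b (\<lambda>x. f x + g x) = (\<lambda>x. partial_deriv b f x + partial_deriv b g x)"
  using partial_deriv_eq[OF has_derivative_add[OF smooth_has_derivative[OF assms(1)]
        smooth_has_derivative[OF assms(2)]]]
  by (auto simp: partial_deriv_def)

lemma partial_deriv_bounded_linear:
  assumes "bounded_linear L" "smooth f"
  shows "partial_deriv b (\<lambda>x. L (f x)) = (\<lambda>x. L (partial_deriv b f x))"
  using partial_deriv_eq[OF bounded_linear.has_derivative[OF assms(1) smooth_has_derivative[OF assms(2)]]]
  by (auto simp: partial_deriv_def)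

lemma partial_deriv_const: "partial_deriv b (\<lambda>x. c) = (\<lambda>x. 0)"
  by (auto simp: partial_deriv_def)

lemma partial_deriv_inner: "partial_deriv b (\<lambda>x. complex_of_real (x \<bullet> v)) = (\<lambda>x. complex_of_real (b \<bullet> v))"
proof
  fix x :: 'a
  have "((\<lambda>x. complex_of_real (x \<bullet> v)) has_derivative (\<lambda>h. complex_of_real (h \<bullet> v))) (at x)"
    by (auto intro!: derivative_eq_intros)
  then show "partial_deriv b (\<lambda>x. complex_of_real (x \<bullet> v)) x = complex_of_real (b \<bullet> v)"
    by (rule partial_deriv_eq)
qed

lemma partial_deriv_cong_open:
  assumes "open S" "\<And>y. y \<in> S \<Longrightarrow> f y = g y" "smooth g" "x \<in> S"
  shows "partial_deriv b f x = partial_deriv b g x"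
proof -
  have "(f has_derivative frechet_derivative g (at x)) (at x)"
    by (rule has_derivative_transform_within_open[OF smooth_has_derivative[OF assms(3)] assms(1,4)])
      (use assms(2) in simp)
  from partial_deriv_eq[OF this] show ?thesis
    by (simp add: partial_deriv_def)
qed

lemma laplacian_cong_open:
  assumes "open S" "\<And>y. y \<in> S \<Longrightarrow> f y = g y" "smooth g" "x \<in> S"
  shows "laplacian f x = laplacian g x"
  unfolding laplacian_def
proof (rule sum.cong)
  fix b :: 'a assume b: "b \<in> Basis"
  show "partial_deriv b (partial_deriv b f) x = partial_deriv b (partial_deriv b g) x"
    by (rule partial_deriv_cong_open[OF assms(1) partial_deriv_cong_open[OF assms(1-3)]
          smooth_partial_deriv[OF assms(3) b] assms(4)])
qed simp

lemma laplacian_mult: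
  assumes "smooth f" "smooth g"
  shows "laplacian (\<lambda>x. f x * g x) x =
    f x * laplacian g x + 2 * (\<Sum>b\<in>Basis. partial_deriv b f x * partial_deriv b g x) + laplacian f x * g x"
proof -
  have "partial_deriv b (partial_deriv b (\<lambda>x. f x * g x)) x =
     f x * partial_deriv b (partial_deriv b g) x + 2 * (partial_deriv b f x * partial_deriv b g x) +
     partial_deriv b (partial_deriv b f) x * g x" if "b \<in> Basis" for b
  proof -
    note s = smooth_partial_deriv[OF assms(1) that] smooth_partial_deriv[OF assms(2) that]
    show ?thesis
      unfolding partial_deriv_mult[OF assms]
        partial_deriv_add[OF smooth_mult[OF assms(1) s(2)] smooth_mult[OF s(1) assms(2)]]
        partial_deriv_mult[OF assms(1) s(2)] partial_deriv_mult[OF s(1) assms(2)]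
      by (simp add: algebra_simps)
  qed
  then show ?thesis
    unfolding laplacian_def by (simp add: sum.distrib sum_distrib_left sum_distrib_right)
qed

lemma laplacian_const: "laplacian (\<lambda>x. c) x = 0"
  by (simp add: laplacian_def partial_deriv_const)

lemma laplacian_inner: "laplacian (\<lambda>x. complex_of_real (x \<bullet> v)) x = 0"
  by (simp add: laplacian_def partial_deriv_const partial_deriv_inner)

section \<open>Test functions\<close>

text \<open>The classical function e^(-1/s), divided by s^n. The index makes the family closed under
  differentiation up to linear combinations, so that smoothness of all members is a single
  induction.\<close>

definition flat :: "nat \<Rightarrow> real \<Rightarrow> real"
  where "flat n s = (if s > 0 then exp (- 1 / s) / s ^ n else 0)"

lemma flat_nonneg: "0 \<le> flat n s" and flat_pos: "0 < s \<Longrightarrow> 0 < flat n s" and flat_eq_0: "s \<le> 0 \<Longrightarrow> flat n s = 0"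
  by (auto simp: flat_def)

lemma power_div_fact_le_exp:
  assumes "0 \<le> (x::real)" shows "x ^ n / fact n \<le> exp x"
proof -
  have "(\<Sum>i\<in>{n}. x ^ i /\<^sub>R fact i) \<le> (\<Sum>i. x ^ i /\<^sub>R fact i)"
    by (rule sum_le_suminf[OF summable_exp_generic]) (auto simp: assms)
  then show ?thesis by (simp add: exp_def divide_inverse mult.commute)
qed

text \<open>The term of degree n + 1 in the series of e^x at x = 1/s, one degree more than has to be
  absorbed, leaves a factor s. The function thus vanishes at least linearly at 0, with an explicit
  constant that later bounds kernels too.\<close>

lemma flat_le: "flat n s \<le> fact (Suc n) * \<bar>s\<bar>"
proof (cases "s > 0")
  case True
  have *: "(1/s) ^ Suc n / fact (Suc n) \<le> exp (1/s)"
    by (rule power_div_fact_le_exp) (use True in auto)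
  then have "exp (- 1 / s) \<le> fact (Suc n) * s ^ Suc n"
  proof -
    have "1 \<le> exp (1/s) * (fact (Suc n) * s ^ Suc n)"
      using mult_right_mono[OF *, of "fact (Suc n) * s ^ Suc n"] True by (simp add: power_divide)
    then have "exp (- (1/s)) * 1 \<le> exp (- (1/s)) * (exp (1/s) * (fact (Suc n) * s ^ Suc n))"
      by (intro mult_left_mono) auto
    moreover have "exp (- (1/s)) * (exp (1/s) * X) = X" for X :: real
      by (simp add: mult.assoc[symmetric] mult_exp_exp)
    ultimately show ?thesis by (simp only: mult_1_right minus_divide_left)
  qed
  then show ?thesis using True by (simp add: flat_def field_simps)
next
  case False
  have "0 \<le> fact (Suc n) * \<bar>s\<bar>" by (intro mult_nonneg_nonneg) auto
  then show ?thesis using False by (simp add: flat_def)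
qed

text \<open>Away from 0 this is the quotient rule. At 0 the difference quotient of
  \<open>flat n\<close> is \<open>flat (Suc n)\<close>, which \<open>flat_le\<close> bounds by a
  multiple of |h|; so the derivative is 0, in agreement with the formula, all of whose terms vanish
  there.\<close>

lemma DERIV_flat: "(flat n has_real_derivative (flat (Suc (Suc n)) s - real n * flat (Suc n) s)) (at s)"
proof -
  consider "s > 0" | "s < 0" | "s = 0" by linarith
  then show ?thesis
  proof cases
    case 1
    have "((\<lambda>s. exp (- 1 / s) / s ^ n) has_real_derivative
        (flat (Suc (Suc n)) s - real n * flat (Suc n) s)) (at s)"
    proof (cases n)
      case 0
      then show ?thesis using 1 by (auto intro!: derivative_eq_intros simp: flat_def field_simps power2_eq_square)
    next
      case (Suc m)
      have "((\<lambda>s. exp (- 1 / s) / s ^ Suc m) has_real_derivative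
          exp (- 1 / s) * (1 / s\<^sup>2) / s ^ Suc m - exp (- 1 / s) * (real (Suc m) * s ^ m) / (s ^ Suc m)\<^sup>2) (at s)"
        using 1 by (auto intro!: derivative_eq_intros simp: divide_simps power2_eq_square)
          (cases m; simp add: algebra_simps)
      moreover have "exp (- 1 / s) * (1 / s\<^sup>2) / s ^ Suc m - exp (- 1 / s) * (real (Suc m) * s ^ m) / (s ^ Suc m)\<^sup>2 =
          flat (Suc (Suc n)) s - real n * flat (Suc n) s"
        using 1 by (simp add: Suc flat_def divide_simps power2_eq_square)
      ultimately show ?thesis by (simp add: Suc)
    qed
    then show ?thesis
      by (rule DERIV_cong_ev[THEN iffD1, rotated -1])
        (use 1 eventually_nhds_in_open[of "{0<..}" s] in \<open>auto simp: flat_def elim: eventually_mono\<close>)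
  next
    case 2
    have "((\<lambda>s. 0) has_real_derivative (flat (Suc (Suc n)) s - real n * flat (Suc n) s)) (at s)"
      using 2 by (simp add: flat_def)
    then show ?thesis
      by (rule DERIV_cong_ev[THEN iffD1, rotated -1])
        (use 2 eventually_nhds_in_open[of "{..<0}" s] in \<open>auto simp: flat_def elim: eventually_mono\<close>)
  next
    case 3
    have "((\<lambda>h. fact (Suc (Suc n)) * \<bar>h\<bar> :: real) \<longlongrightarrow> 0) (at 0)"
      by (auto intro!: tendsto_eq_intros)
    moreover have "norm (flat n h / h) \<le> fact (Suc (Suc n)) * \<bar>h\<bar>" for h
    proof -
      have "flat n h / h = flat (Suc n) h"
        by (auto simp: flat_def)
      then show ?thesis using flat_le[of "Suc n" h] flat_nonneg[of "Suc n" h] by simp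
    qed
    ultimately have "((\<lambda>h. flat n h / h) \<longlongrightarrow> 0) (at 0)"
      by (rule Lim_null_comparison[OF always_eventually, rotated, OF _ allI])
    then show ?thesis using 3 by (simp add: DERIV_def flat_eq_0)
  qed
qed

lemma C_k_flat:
  assumes "smooth (\<lambda>x. complex_of_real (g x))"
  shows "C_k k (\<lambda>x. complex_of_real (flat n (g x)))"
proof (induction k arbitrary: n)
  case 0
  have "continuous_on UNIV (\<lambda>x. Re (complex_of_real (g x)))"
    using assms by (intro continuous_on_Re smooth_continuous)
  moreover have "continuous_on UNIV (flat n)"
    using DERIV_flat DERIV_isCont by (blast intro: continuous_at_imp_continuous_on)
  ultimately have "continuous_on UNIV (\<lambda>x. flat n (g x))"
    using continuous_on_compose2[of UNIV "flat n" UNIV g] by simp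
  then show ?case by (simp add: continuous_on_of_real)
next
  case (Suc k)
  obtain g' where g': "\<And>x. (g has_derivative g' x) (at x)"
    "\<And>b. b \<in> Basis \<Longrightarrow> C_k k (\<lambda>x. complex_of_real (g' x b))"
    using C_k_of_realE[of k g] assms unfolding smooth_def by blast
  have "((\<lambda>x. flat n (g x)) has_derivative
      (\<lambda>h. g' x h * (flat (Suc (Suc n)) (g x) - real n * flat (Suc n) (g x)))) (at x)" for x
    using has_derivative_compose[OF g'(1) DERIV_flat[unfolded has_field_derivative_def]]
    by (simp add: mult.commute)
  from has_derivative_of_real[OF this]
  have 1: "((\<lambda>x. complex_of_real (flat n (g x))) has_derivative
      (\<lambda>h. complex_of_real (g' x h) * (complex_of_real (flat (Suc (Suc n)) (g x)) +
        complex_of_real (- real n) * complex_of_real (flat (Suc n) (g x))))) (at x)" for x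
    by simp
  show ?case
    by (intro C_k_SucI[OF 1] C_k_mult C_k_add C_k_const Suc.IH g'(2))
qed

lemma smooth_flat: "smooth (\<lambda>x. complex_of_real (g x)) \<Longrightarrow> smooth (\<lambda>x. complex_of_real (flat n (g x)))"
  by (simp add: smooth_def[of "\<lambda>x. complex_of_real (flat n (g x))"] C_k_flat)

text \<open>The squared distance in units of r. Squaring keeps it smooth at the centre, and the
  balls of radius r and 2 r become the sublevel sets at 1 and 4.\<close>

definition radial_sq :: "'a::euclidean_space \<Rightarrow> real \<Rightarrow> 'a \<Rightarrow> real"
  where "radial_sq a r z = (norm (z - a))\<^sup>2 / r\<^sup>2"

lemma smooth_radial_sq: "smooth (\<lambda>z. complex_of_real (radial_sq a r z))"
proof -
  have "smooth (\<lambda>z. complex_of_real (1 / r\<^sup>2) * complex_of_real ((norm (id z + - a))\<^sup>2))"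
    by (intro smooth_mult smooth_const smooth_affine[OF linear_id smooth_norm_sq])
  moreover have "(\<lambda>z. complex_of_real (1 / r\<^sup>2) * complex_of_real ((norm (id z + - a))\<^sup>2)) =
      (\<lambda>z. complex_of_real (radial_sq a r z))"
    by (simp add: radial_sq_def fun_eq_iff)
  ultimately show ?thesis by simp
qed

lemma radial_sq_less_iff: "0 < r \<Longrightarrow> radial_sq a r z < 1 \<longleftrightarrow> dist a z < r"
  and radial_sq_le_iff: "0 < r \<Longrightarrow> radial_sq a r z \<le> 1 \<longleftrightarrow> dist a z \<le> r"
  and radial_sq_less_4_iff: "0 < r \<Longrightarrow> radial_sq a r z < 4 \<longleftrightarrow> dist a z < 2 * r"
  using abs_le_square_iff[of "dist a z" r] abs_le_square_iff[of r "dist a z"]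
    abs_le_square_iff[of "2 * r" "dist a z"]
  by (auto simp: radial_sq_def dist_norm norm_minus_commute divide_simps not_less[symmetric] power_mult_distrib)

text \<open>Together with \<open>Cc_inftyE\<close>, this handles membership through any compact set
  off which f vanishes, rather than through the closure of the set where f is non-zero.\<close>

lemma Cc_inftyI:
  assumes "smooth f" "compact K" "K \<subseteq> \<Omega>" "\<And>x. x \<notin> K \<Longrightarrow> f x = 0"
  shows "f \<in> Cc_infty \<Omega>"
proof -
  have "closure {x. f x \<noteq> 0} \<subseteq> K"
    using assms by (intro closure_minimal) (auto intro: compact_imp_closed)
  then show ?thesis
    using assms unfolding Cc_infty_def
    by (auto intro: compact_closure[THEN iffD2] bounded_subset[OF compact_imp_bounded]
        simp: compact_eq_bounded_closed)
qed

lemma Cc_inftyE: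
  assumes "f \<in> Cc_infty \<Omega>"
  obtains K where "smooth f" "compact K" "K \<subseteq> \<Omega>" "\<And>x. x \<notin> K \<Longrightarrow> f x = 0"
proof (rule that)
  show "smooth f" "compact (closure {x. f x \<noteq> 0})" "closure {x. f x \<noteq> 0} \<subseteq> \<Omega>"
    using assms by (auto simp: Cc_infty_def)
  show "f x = 0" if "x \<notin> closure {x. f x \<noteq> 0}" for x
    using that closure_subset[of "{x. f x \<noteq> 0}"] by auto
qed

lemma Cc_infty_smooth: "f \<in> Cc_infty \<Omega> \<Longrightarrow> smooth f"
  by (simp add: Cc_infty_def)

lemma Cc_infty_mono: "\<Omega> \<subseteq> \<Omega>' \<Longrightarrow> f \<in> Cc_infty \<Omega> \<Longrightarrow> f \<in> Cc_infty \<Omega>'"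
  by (auto simp: Cc_infty_def)

lemma Cc_infty_vanishes: "f \<in> Cc_infty \<Omega> \<Longrightarrow> x \<notin> \<Omega> \<Longrightarrow> f x = 0"
  by (metis Cc_inftyE subsetD)

lemma Cc_infty_mult:
  assumes "f \<in> Cc_infty \<Omega>" "smooth g"
  shows "(\<lambda>x. f x * g x) \<in> Cc_infty \<Omega>"
proof -
  obtain K where "smooth f" "compact K" "K \<subseteq> \<Omega>" "\<And>x. x \<notin> K \<Longrightarrow> f x = 0"
    using Cc_inftyE[OF assms(1)] by blast
  then show ?thesis using smooth_mult[OF _ assms(2)] by (intro Cc_inftyI[of _ K]) auto
qed

lemma Cc_infty_add:
  assumes "f \<in> Cc_infty \<Omega>" "g \<in> Cc_infty \<Omega>"
  shows "(\<lambda>x. f x + g x) \<in> Cc_infty \<Omega>"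
proof -
  obtain K where "smooth f" "compact K" "K \<subseteq> \<Omega>" "\<And>x. x \<notin> K \<Longrightarrow> f x = 0"
    using Cc_inftyE[OF assms(1)] by blast
  moreover obtain L where "smooth g" "compact L" "L \<subseteq> \<Omega>" "\<And>x. x \<notin> L \<Longrightarrow> g x = 0"
    using Cc_inftyE[OF assms(2)] by blast
  ultimately show ?thesis by (intro Cc_inftyI[of _ "K \<union> L"] smooth_add compact_Un) auto
qed

lemma Cc_infty_bounded_linear:
  assumes "bounded_linear L" "f \<in> Cc_infty \<Omega>"
  shows "(\<lambda>x. L (f x)) \<in> Cc_infty \<Omega>"
proof -
  obtain K where "smooth f" "compact K" "K \<subseteq> \<Omega>" "\<And>x. x \<notin> K \<Longrightarrow> f x = 0"
    using Cc_inftyE[OF assms(2)] by blast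
  then show ?thesis using smooth_bounded_linear[OF assms(1)] linear_0[OF bounded_linear.linear[OF assms(1)]]
    by (intro Cc_inftyI[of _ K]) auto
qed

lemma Cc_infty_diff:
  assumes "f \<in> Cc_infty \<Omega>" "g \<in> Cc_infty \<Omega>"
  shows "(\<lambda>x. f x - g x) \<in> Cc_infty \<Omega>"
  using Cc_infty_add[OF assms(1) Cc_infty_bounded_linear[OF bounded_linear_minus[OF bounded_linear_ident] assms(2)]]
  by simp

lemma Cc_infty_partial_deriv:
  assumes "f \<in> Cc_infty \<Omega>" "b \<in> Basis"
  shows "partial_deriv b f \<in> Cc_infty \<Omega>"
  unfolding Cc_infty_def using assms support_partial_deriv[of b f] smooth_partial_deriv
  by (auto simp: Cc_infty_def compact_eq_bounded_closed intro: bounded_subset)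

section \<open>Bump functions and cut-off functions\<close>

definition bump :: "'a::euclidean_space \<Rightarrow> real \<Rightarrow> 'a \<Rightarrow> complex"
  where "bump a r z = complex_of_real (flat 0 (1 - radial_sq a r z))"

lemma smooth_flat_radial_sq: "smooth (\<lambda>z. complex_of_real (flat n (c + d * radial_sq a r z)))"
proof -
  have "smooth (\<lambda>z. complex_of_real c + complex_of_real d * complex_of_real (radial_sq a r z))"
    by (intro smooth_add smooth_mult smooth_const smooth_radial_sq)
  then show ?thesis by (intro smooth_flat) simp
qed

lemma flat_radial_sq_Cc_infty:
  assumes "0 < r" "cball a r \<subseteq> \<Omega>"
  shows "(\<lambda>z. complex_of_real (flat n (1 - radial_sq a r z))) \<in> Cc_infty \<Omega>"
proof (rule Cc_inftyI[OF _ compact_cball assms(2)])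
  show "smooth (\<lambda>z. complex_of_real (flat n (1 - radial_sq a r z)))"
    using smooth_flat_radial_sq[of n 1 "-1"] by simp
  show "complex_of_real (flat n (1 - radial_sq a r z)) = 0" if "z \<notin> cball a r" for z
    using that radial_sq_le_iff[OF assms(1), of a z] by (simp add: flat_eq_0)
qed

lemma bump_Cc_infty: "0 < r \<Longrightarrow> cball a r \<subseteq> \<Omega> \<Longrightarrow> bump a r \<in> Cc_infty \<Omega>"
  using flat_radial_sq_Cc_infty[of r a \<Omega> 0] by (simp add: bump_def[abs_def])

lemma bump_eq_0_iff: "0 < r \<Longrightarrow> bump a r z = 0 \<longleftrightarrow> r \<le> dist a z"
  using radial_sq_less_iff[of r a z] flat_pos[of "1 - radial_sq a r z" 0] flat_eq_0[of "1 - radial_sq a r z" 0]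
  by (cases "radial_sq a r z < 1") (auto simp: bump_def)

text \<open>The usual quotient of flat functions. The numerator vanishes beyond radius 2 r, where
  \<open>radial_sq\<close> is at least 4, and the second summand of the denominator vanishes within
  radius r, where it is at most 1. The two summands never vanish together, so the denominator is
  positive.\<close>

definition plateau :: "'a::euclidean_space \<Rightarrow> real \<Rightarrow> 'a \<Rightarrow> complex"
  where "plateau a r z = complex_of_real
    (flat 0 (4 - radial_sq a r z) / (flat 0 (4 - radial_sq a r z) + flat 0 (radial_sq a r z - 1)))"

lemma plateau_denom_pos: "0 < flat 0 (4 - radial_sq a r z) + flat 0 (radial_sq a r z - 1)"
  using flat_pos[of "4 - radial_sq a r z" 0] flat_pos[of "radial_sq a r z - 1" 0]
    flat_nonneg[of 0 "4 - radial_sq a r z"] flat_nonneg[of 0 "radial_sq a r z - 1"]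
  by (cases "radial_sq a r z < 4") auto

lemma smooth_plateau: "smooth (plateau a r)"
proof -
  have 1: "smooth (\<lambda>z. complex_of_real (flat 0 (4 - radial_sq a r z)))"
    using smooth_flat_radial_sq[of 0 4 "-1"] by simp
  have 2: "smooth (\<lambda>z. complex_of_real (flat 0 (radial_sq a r z - 1)))"
    using smooth_flat_radial_sq[of 0 "-1" 1] by simp
  have "smooth (\<lambda>z. complex_of_real (flat 0 (4 - radial_sq a r z)) *
     inverse (complex_of_real (flat 0 (4 - radial_sq a r z)) + complex_of_real (flat 0 (radial_sq a r z - 1))))"
    using plateau_denom_pos[of a r]
    by (intro smooth_mult smooth_inverse smooth_add 1 2) (metis less_irrefl of_real_add of_real_eq_0_iff)
  then show ?thesis by (simp add: plateau_def[abs_def] divide_inverse)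
qed

lemma plateau_eq_1: "0 < r \<Longrightarrow> dist a z \<le> r \<Longrightarrow> plateau a r z = 1"
  using radial_sq_le_iff[of r a z] plateau_denom_pos[of a r z] flat_eq_0[of "radial_sq a r z - 1" 0]
  by (simp add: plateau_def)

lemma plateau_eq_0: "0 < r \<Longrightarrow> 2 * r \<le> dist a z \<Longrightarrow> plateau a r z = 0"
  using radial_sq_less_4_iff[of r a z] flat_eq_0[of "4 - radial_sq a r z" 0] by (simp add: plateau_def)

lemma norm_plateau_le: "norm (plateau a r z) \<le> 1"
  using plateau_denom_pos[of a r z] flat_nonneg[of 0 "4 - radial_sq a r z"] flat_nonneg[of 0 "radial_sq a r z - 1"]
  unfolding plateau_def norm_of_real by (simp add: divide_simps)

lemma plateau_Cc_infty: "0 < r \<Longrightarrow> cball a (2 * r) \<subseteq> \<Omega> \<Longrightarrow> plateau a r \<in> Cc_infty \<Omega>"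
  by (rule Cc_inftyI[OF smooth_plateau compact_cball]) (auto intro: plateau_eq_0)

section \<open>Integration\<close>

lemma sum_Basis_inner:
  fixes f :: "'a::euclidean_space \<Rightarrow> 'b::real_vector"
  shows "b \<in> Basis \<Longrightarrow> (\<Sum>c\<in>Basis. (b \<bullet> c) *\<^sub>R f c) = f b"
proof -
  assume b: "b \<in> Basis"
  have "(\<Sum>c\<in>Basis. (b \<bullet> c) *\<^sub>R f c) = (\<Sum>c\<in>Basis. if c = b then f c else 0)"
    using b by (intro sum.cong) (auto simp: inner_Basis)
  then show ?thesis using b by simp
qed

text \<open>Dominated convergence for difference quotients: by the mean value inequality on the
  convex ball, the remainder divided by the norm of t - t0 is bounded by 2 g, and it tends to 0
  pointwise.\<close>

lemma has_derivative_integral: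
  fixes F :: "'b::euclidean_space \<Rightarrow> 'c \<Rightarrow> 'v::{banach, second_countable_topology}"
  assumes r: "0 < r"
    and int: "\<And>t. t \<in> ball t0 r \<Longrightarrow> integrable M (F t)"
    and der: "\<And>t z. t \<in> ball t0 r \<Longrightarrow> ((\<lambda>t. F t z) has_derivative D t z) (at t)"
    and bnd: "\<And>t z. t \<in> ball t0 r \<Longrightarrow> onorm (D t z) \<le> g z"
    and g: "integrable M g"
    and meas: "\<And>h. (\<lambda>z. D t0 z h) \<in> borel_measurable M"
  shows "((\<lambda>t. integral\<^sup>L M (F t)) has_derivative (\<lambda>h. \<integral>z. D t0 z h \<partial>M)) (at t0)"
proof -
  have t0: "t0 \<in> ball t0 r" using r by simp
  have D_le: "norm (D t0 z h) \<le> g z * norm h" for z h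
    using onorm[OF has_derivative_bounded_linear[OF der[OF t0]], of z h] bnd[OF t0, of z]
    by (meson mult_right_mono norm_ge_zero order_trans)
  have D_int: "integrable M (\<lambda>z. D t0 z h)" for h
  proof (rule Bochner_Integration.integrable_bound[OF _ meas])
    show "integrable M (\<lambda>z. g z * norm h)" using g by simp
    show "AE z in M. norm (D t0 z h) \<le> norm (g z * norm h)"
      using order_trans[OF D_le abs_ge_self] by (intro AE_I2) (simp only: real_norm_def)
  qed
  have lin: "linear (D t0 z)" for z
    using has_derivative_linear[OF der[OF t0]] .
  have "linear (\<lambda>h. \<integral>z. D t0 z h \<partial>M)"
    by (intro linearI) (simp_all add: D_int linear_add[OF lin] linear_cmul[OF lin])
  then have bl: "bounded_linear (\<lambda>h. \<integral>z. D t0 z h \<partial>M)"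
    by (simp add: linear_conv_bounded_linear)
  \<comment> \<open>Outside the ball the remainder is set to 0, so that the bound holds for every t;
    the limit at t0 is not affected.\<close>
  define R where "R t z = (if t \<in> ball t0 r then (F t z - F t0 z - D t0 z (t - t0)) /\<^sub>R norm (t - t0) else 0)" for t z
  have F_diff: "norm (F t z - F t0 z) \<le> g z * norm (t - t0)" if "t \<in> ball t0 r" for t z
    by (rule differentiable_bound[OF convex_ball, where f' = "\<lambda>t. D t z"])
      (use der bnd that t0 in \<open>auto intro: has_derivative_at_withinI\<close>)
  have R_meas: "R t \<in> borel_measurable M" for t
    using int[of t] int[OF t0] meas[of "t - t0"] unfolding R_def
    by (cases "t \<in> ball t0 r") (auto intro!: borel_measurable_scaleR borel_measurable_diff)
  have R_bound: "norm (R t z) \<le> 2 * norm (g z)" for t z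
  proof (cases "t \<in> ball t0 r \<and> t \<noteq> t0")
    case True
    have "norm (F t z - F t0 z - D t0 z (t - t0)) \<le> 2 * g z * norm (t - t0)"
      using norm_triangle_ineq4[of "F t z - F t0 z" "D t0 z (t - t0)"] F_diff[of t z] D_le[of z "t - t0"] True
      by simp
    moreover have "norm (R t z) = norm (F t z - F t0 z - D t0 z (t - t0)) / norm (t - t0)"
      using True by (simp add: R_def divide_inverse mult.commute)
    ultimately have "norm (R t z) \<le> 2 * g z"
      using True by (simp add: pos_divide_le_eq)
    then show ?thesis by simp
  qed (auto simp: R_def)
  have R_lim: "((\<lambda>t. R t z) \<longlongrightarrow> 0) (at t0)" for z
  proof -
    have "((\<lambda>t. (F t z - F t0 z - D t0 z (t - t0)) /\<^sub>R norm (t - t0)) \<longlongrightarrow> 0) (at t0)"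
      using der[OF t0, of z] by (simp add: has_derivative_at_within)
    moreover have "eventually (\<lambda>t. (F t z - F t0 z - D t0 z (t - t0)) /\<^sub>R norm (t - t0) = R t z) (at t0)"
      using r eventually_at_ball[of r t0 UNIV] by (auto simp: R_def elim!: eventually_mono)
    ultimately show ?thesis by (rule Lim_transform_eventually)
  qed
  have "((\<lambda>t. integral\<^sup>L M (R t)) \<longlongrightarrow> integral\<^sup>L M (\<lambda>z. 0 :: 'v)) (at t0)"
    unfolding tendsto_at_iff_sequentially comp_def
  proof (intro allI impI)
    fix X assume X: "\<forall>i. X i \<in> UNIV - {t0}" "X \<longlonglongrightarrow> t0"
    show "(\<lambda>i. integral\<^sup>L M (R (X i))) \<longlonglongrightarrow> integral\<^sup>L M (\<lambda>z. 0)"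
    proof (rule integral_dominated_convergence)
      show "AE z in M. (\<lambda>i. R (X i) z) \<longlonglongrightarrow> 0"
        using R_lim X by (auto simp: tendsto_at_iff_sequentially comp_def)
      show "integrable M (\<lambda>z. 2 * norm (g z))" using g by simp
    qed (use R_meas R_bound in auto)
  qed
  then have "((\<lambda>t. integral\<^sup>L M (R t)) \<longlongrightarrow> 0) (at t0)"
    by simp
  moreover have "eventually (\<lambda>t. integral\<^sup>L M (R t) =
      (integral\<^sup>L M (F t) - integral\<^sup>L M (F t0) - (\<integral>z. D t0 z (t - t0) \<partial>M)) /\<^sub>R norm (t - t0)) (at t0)"
    using eventually_at_ball[OF r, of t0 UNIV]
  proof (rule eventually_mono)
    fix t assume "t \<in> ball t0 r \<and> t \<in> UNIV"
    then show "integral\<^sup>L M (R t) = (integral\<^sup>L M (F t) - integral\<^sup>L M (F t0) - (\<integral>z. D t0 z (t - t0) \<partial>M)) /\<^sub>R norm (t - t0)"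
      using int[of t] int[OF t0] D_int unfolding R_def[abs_def] by simp
  qed
  ultimately show ?thesis
    using bl unfolding has_derivative_at_within
    by (auto intro: Lim_transform_eventually)
qed

lemma integrable_compact_support:
  fixes f :: "'a::euclidean_space \<Rightarrow> 'b::{banach, second_countable_topology}"
  assumes "continuous_on UNIV f" "compact K" "\<And>x. x \<notin> K \<Longrightarrow> f x = 0"
  shows "integrable lborel f"
proof -
  have "(\<lambda>x. indicator K x *\<^sub>R f x) = f"
    using assms(3) by (auto simp: fun_eq_iff indicator_def)
  then show ?thesis
    using borel_integrable_compact[OF assms(2) continuous_on_subset[OF assms(1)]] by simp
qed

lemma bounded_compact_support:
  fixes f :: "'a::euclidean_space \<Rightarrow> 'b::real_normed_vector"
  assumes "continuous_on UNIV f" "compact K" "\<And>x. x \<notin> K \<Longrightarrow> f x = 0"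
  obtains C where "0 < C" "\<And>x. norm (f x) \<le> C"
proof -
  have "bounded (f ` K)"
    using assms by (intro compact_imp_bounded compact_continuous_image continuous_on_subset[OF assms(1)]) auto
  then obtain C where "0 < C" "\<And>x. x \<in> K \<Longrightarrow> norm (f x) \<le> C"
    by (auto simp: bounded_pos)
  moreover then have "norm (f x) \<le> C" for x
    using assms(3)[of x] by (cases "x \<in> K") auto
  ultimately show ?thesis using that by blast
qed

lemma Cc_infty_integrable: "f \<in> Cc_infty \<Omega> \<Longrightarrow> integrable lborel f"
  by (metis Cc_inftyE integrable_compact_support smooth_continuous)

lemma Cc_infty_integrable_mult:
  "f \<in> Cc_infty \<Omega> \<Longrightarrow> continuous_on UNIV g \<Longrightarrow> integrable lborel (\<lambda>x. f x * g x)"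
  by (erule Cc_inftyE, rule integrable_compact_support)
    (auto intro!: continuous_on_mult intro: smooth_continuous)

lemma Cc_infty_bounded:
  assumes "f \<in> Cc_infty \<Omega>"
  obtains C where "0 < C" "\<And>x. norm (f x) \<le> C"
  using assms by (metis Cc_inftyE bounded_compact_support smooth_continuous)

section \<open>Translation invariance and integration by parts\<close>

lemma lborel_integral_translation:
  fixes f :: "'a::euclidean_space \<Rightarrow> 'b::{banach, second_countable_topology}"
  assumes "f \<in> borel_measurable borel"
  shows "(\<integral>x. f (x + c) \<partial>lborel) = integral\<^sup>L lborel f"
proof -
  have "integral\<^sup>L lborel f = integral\<^sup>L (distr lborel borel ((+) c)) f"
    by (simp add: lborel_distr_plus)
  also have "\<dots> = (\<integral>x. f (c + x) \<partial>lborel)"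
    by (rule integral_distr) (use assms in auto)
  finally show ?thesis by (simp add: add.commute)
qed

text \<open>Translation invariance replaces the fundamental theorem of calculus: the integral of f(z
  + t b) is constant in t, and its derivative at t = 0 is the integral of the partial
  derivative.\<close>

lemma integral_partial_deriv_eq_0:
  assumes f: "f \<in> Cc_infty \<Omega>" and b: "b \<in> Basis"
  shows "(\<integral>x. partial_deriv b f x \<partial>lborel) = 0"
proof -
  have g: "partial_deriv b f \<in> Cc_infty \<Omega>" by (rule Cc_infty_partial_deriv[OF assms])
  obtain K where K: "compact K" "\<And>x. x \<notin> K \<Longrightarrow> partial_deriv b f x = 0"
    using g Cc_inftyE by metis
  obtain L where L: "compact L" "\<And>x. x \<notin> L \<Longrightarrow> f x = 0"
    using f Cc_inftyE by metis
  obtain C where C: "0 < C" "\<And>x. norm (partial_deriv b f x) \<le> C"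
    using Cc_infty_bounded[OF g] by blast
  obtain R where R: "\<And>x. x \<in> K \<Longrightarrow> norm x \<le> R"
    using compact_imp_bounded[OF K(1)] by (auto simp: bounded_iff)
  have sm: "smooth f" using f by (rule Cc_infty_smooth)
  have meas: "f \<in> borel_measurable borel" "partial_deriv b f \<in> borel_measurable borel"
    using smooth_continuous[OF sm] smooth_continuous[OF smooth_partial_deriv[OF sm b]]
    by (auto intro: borel_measurable_continuous_onI)
  have const: "(\<integral>z. f (z + t *\<^sub>R b) \<partial>lborel) = integral\<^sup>L lborel f" for t
    by (rule lborel_integral_translation) (rule meas)
  have "((\<lambda>t. \<integral>z. f (z + t *\<^sub>R b) \<partial>lborel) has_derivative
      (\<lambda>h. \<integral>z. h *\<^sub>R partial_deriv b f (z + 0 *\<^sub>R b) \<partial>lborel)) (at (0::real))"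
  \<comment> \<open>For |t| < 1 the derivative is supported in a unit neighbourhood of its original
    support, which the ball of radius R + 1 contains; there the constant C dominates.\<close>
  proof (rule has_derivative_integral[where r = 1 and g = "\<lambda>z. indicator (cball 0 (R + 1)) z *\<^sub>R C"
        and D = "\<lambda>t z h. h *\<^sub>R partial_deriv b f (z + t *\<^sub>R b)"])
    fix t z
    show "integrable lborel (\<lambda>z. f (z + t *\<^sub>R b))"
    proof (rule integrable_compact_support)
      show "compact ((\<lambda>z. z - t *\<^sub>R b) ` L)"
        using L(1) by (intro compact_continuous_image continuous_intros)
      show "f (x + t *\<^sub>R b) = 0" if "x \<notin> (\<lambda>z. z - t *\<^sub>R b) ` L" for x
        using that L(2)[of "x + t *\<^sub>R b"] by (force simp: image_iff)
      show "continuous_on UNIV (\<lambda>x. f (x + t *\<^sub>R b))"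
        by (rule continuous_on_compose2[OF smooth_continuous[OF sm, of UNIV]]) (auto intro!: continuous_intros)
    qed
    have "((\<lambda>t. z + t *\<^sub>R b) has_derivative (\<lambda>h. h *\<^sub>R b)) (at t)"
      by (auto intro!: derivative_eq_intros)
    from has_derivative_compose[OF this smooth_has_derivative_sum[OF sm]]
    show "((\<lambda>t. f (z + t *\<^sub>R b)) has_derivative (\<lambda>h. h *\<^sub>R partial_deriv b f (z + t *\<^sub>R b))) (at t)"
      by (simp add: sum_Basis_inner[OF b] flip: scaleR_scaleR scaleR_sum_right)
    show "onorm (\<lambda>h. h *\<^sub>R partial_deriv b f (z + t *\<^sub>R b)) \<le> indicator (cball 0 (R + 1)) z *\<^sub>R C"
      if "t \<in> ball 0 1"
    proof (rule onorm_le)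
      fix h :: real
      show "norm (h *\<^sub>R partial_deriv b f (z + t *\<^sub>R b)) \<le> indicator (cball 0 (R + 1)) z *\<^sub>R C * norm h"
      proof (cases "z + t *\<^sub>R b \<in> K")
        case True
        have "norm z \<le> norm (z + t *\<^sub>R b) + norm (t *\<^sub>R b)"
          using norm_triangle_ineq4[of "z + t *\<^sub>R b" "t *\<^sub>R b"] by simp
        also have "\<dots> \<le> R + 1" using R[OF True] that b by (simp add: dist_norm)
        finally show ?thesis
          using mult_left_mono[OF C(2)[of "z + t *\<^sub>R b"], of "\<bar>h\<bar>"] by (simp add: mult.commute)
      next
        case False
        then show ?thesis using K(2) C(1) by (simp add: indicator_def)
      qed
    qed
    show "integrable lborel (\<lambda>z. indicator (cball 0 (R + 1)) z *\<^sub>R C)"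
      by (rule borel_integrable_compact) auto
    show "(\<lambda>z. t *\<^sub>R partial_deriv b f (z + 0 *\<^sub>R b)) \<in> borel_measurable lborel"
      using meas by simp
  qed auto
  then have "((\<lambda>t. integral\<^sup>L lborel f) has_derivative
      (\<lambda>h::real. \<integral>z. h *\<^sub>R partial_deriv b f z \<partial>lborel)) (at 0)"
    by (simp add: const)
  from has_derivative_unique[OF this has_derivative_const[of "integral\<^sup>L lborel f"]]
  have "(\<integral>z. 1 *\<^sub>R partial_deriv b f z \<partial>lborel) = 0" by meson
  then show ?thesis by simp
qed

lemma integration_by_parts:
  assumes "\<phi> \<in> Cc_infty \<Omega>" "smooth f" "b \<in> Basis"
  shows "(\<integral>x. f x * partial_deriv b \<phi> x \<partial>lborel) = - (\<integral>x. partial_deriv b f x * \<phi> x \<partial>lborel)"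
proof -
  note sm = Cc_infty_smooth[OF assms(1)]
  have "(\<integral>x. partial_deriv b (\<lambda>x. \<phi> x * f x) x \<partial>lborel) = 0"
    by (rule integral_partial_deriv_eq_0[OF Cc_infty_mult[OF assms(1,2)] assms(3)])
  then have "(\<integral>x. \<phi> x * partial_deriv b f x + partial_deriv b \<phi> x * f x \<partial>lborel) = 0"
    by (simp add: partial_deriv_mult[OF sm assms(2)])
  moreover have "integrable lborel (\<lambda>x. \<phi> x * partial_deriv b f x)"
    by (intro Cc_infty_integrable_mult[OF assms(1)] smooth_continuous smooth_partial_deriv assms)
  moreover have "integrable lborel (\<lambda>x. partial_deriv b \<phi> x * f x)"
    by (intro Cc_infty_integrable_mult[OF Cc_infty_partial_deriv[OF assms(1,3)]] smooth_continuous assms)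
  ultimately show ?thesis by (simp add: mult.commute add_eq_0_iff)
qed

lemma integral_mult_laplacian:
  assumes "\<phi> \<in> Cc_infty \<Omega>" "smooth f"
  shows "(\<integral>x. f x * laplacian \<phi> x \<partial>lborel) = (\<integral>x. laplacian f x * \<phi> x \<partial>lborel)"
proof -
  have 1: "integrable lborel (\<lambda>x. f x * partial_deriv b (partial_deriv b \<phi>) x)" if "b \<in> Basis" for b
    using Cc_infty_integrable_mult[OF Cc_infty_partial_deriv[OF Cc_infty_partial_deriv[OF assms(1) that] that]
        smooth_continuous[OF assms(2)]] by (simp add: mult.commute)
  have 2: "integrable lborel (\<lambda>x. partial_deriv b (partial_deriv b f) x * \<phi> x)" if "b \<in> Basis" for b
    using Cc_infty_integrable_mult[OF assms(1)
        smooth_continuous[OF smooth_partial_deriv[OF smooth_partial_deriv[OF assms(2) that] that]]]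
    by (simp add: mult.commute)
  have "(\<integral>x. f x * partial_deriv b (partial_deriv b \<phi>) x \<partial>lborel) =
      (\<integral>x. partial_deriv b (partial_deriv b f) x * \<phi> x \<partial>lborel)" if b: "b \<in> Basis" for b
    using integration_by_parts[OF Cc_infty_partial_deriv[OF assms(1) b] assms(2) b]
      integration_by_parts[OF assms(1) smooth_partial_deriv[OF assms(2) b] b] by simp
  then show ?thesis
    unfolding laplacian_def sum_distrib_left sum_distrib_right using 1 2
    by (simp add: Bochner_Integration.integral_sum)
qed

lemma lborel_integral_pos:
  fixes f :: "'a::euclidean_space \<Rightarrow> real"
  assumes "integrable lborel f" "\<And>x. 0 \<le> f x" "open S" "S \<noteq> {}" "\<And>x. x \<in> S \<Longrightarrow> 0 < f x"
  shows "0 < integral\<^sup>L lborel f"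
proof (rule ccontr)
  assume "\<not> ?thesis"
  then have "integral\<^sup>L lborel f = 0"
    using Bochner_Integration.integral_nonneg[of lborel f] assms(2) by (simp add: order.antisym)
  then have "AE x in lborel. f x = 0"
    using integral_nonneg_eq_0_iff_AE[OF assms(1)] assms(2) by simp
  then have "AE x in lebesgue. x \<notin> S"
    using assms(5) by (intro AE_completion) (force elim: eventually_mono)
  then have "S \<in> null_sets lebesgue"
    by (simp add: AE_iff_null_sets assms(3))
  then show False
    using open_not_negligible[OF assms(3,4)] by (simp add: negligible_iff_null_sets)
qed

lemma integral_bump_pos:
  assumes "0 < r" shows "0 < (\<integral>z. flat n (1 - radial_sq a r z) \<partial>lborel)"
proof (rule lborel_integral_pos[where S = "ball a r"])
  have "integrable lborel (\<lambda>z. complex_of_real (flat n (1 - radial_sq a r z)))"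
    by (rule Cc_infty_integrable[OF flat_radial_sq_Cc_infty[OF assms subset_UNIV]])
  then show "integrable lborel (\<lambda>z. flat n (1 - radial_sq a r z))"
    using complex_of_real_integrable_eq by blast
qed (use assms in \<open>auto intro!: flat_pos flat_nonneg simp: radial_sq_less_iff\<close>)

text \<open>Near x the function g differs from g(x) by at most half of |g(x)|. Against a small
  positive bump, the integral of g(x) - g is then at most half of |g(x)| times the mass, although by
  hypothesis its modulus is the full amount. Testing only with bumps centred at x makes explicit
  formulas for the test functions usable, for instance in the symmetry of second
  derivatives.\<close>

lemma du_Bois_Reymond:
  fixes g :: "'a::euclidean_space \<Rightarrow> complex"
  assumes "open \<Omega>" "continuous_on UNIV g"
    and "\<And>r. 0 < r \<Longrightarrow> cball x r \<subseteq> \<Omega> \<Longrightarrow> (\<integral>z. g z * bump x r z \<partial>lborel) = 0" and x: "x \<in> \<Omega>"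
  shows "g x = 0"
proof (rule ccontr)
  assume gx: "g x \<noteq> 0"
  obtain e where e: "0 < e" "cball x e \<subseteq> \<Omega>"
    using assms(1) x open_contains_cball by blast
  have "isCont g x" using assms(2) continuous_on_eq_continuous_at by blast
  then obtain d where d: "0 < d" "\<And>y. dist y x < d \<Longrightarrow> dist (g y) (g x) < norm (g x) / 2"
    using gx unfolding continuous_at by (metis half_gt_zero zero_less_norm_iff continuous_at_eps_delta isCont_def)
  define r where "r = min e (d / 2)"
  have r: "0 < r" "cball x r \<subseteq> \<Omega>" "r < d" using e d by (auto simp: r_def)
  have b: "bump x r \<in> Cc_infty \<Omega>" by (rule bump_Cc_infty[OF r(1,2)])
  let ?I = "\<integral>z. flat 0 (1 - radial_sq x r z) \<partial>lborel"
  have I: "(\<integral>z. bump x r z \<partial>lborel) = complex_of_real ?I"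
    by (simp add: bump_def)
  have i: "integrable lborel (\<lambda>z. flat 0 (1 - radial_sq x r z))"
    using Cc_infty_integrable[OF b] complex_of_real_integrable_eq unfolding bump_def by blast
  have "(\<integral>z. (g x - g z) * bump x r z \<partial>lborel) = g x * ?I"
    using assms(3)[OF r(1,2)] Cc_infty_integrable[OF b] Cc_infty_integrable_mult[OF b assms(2)] I
    by (simp add: left_diff_distrib) (simp add: mult.commute)
  then have "norm (g x) * ?I = norm (\<integral>z. (g x - g z) * bump x r z \<partial>lborel)"
    using integral_bump_pos[OF r(1), of 0 x] by (simp add: norm_mult)
  also have "\<dots> \<le> (\<integral>z. norm (g x) / 2 * flat 0 (1 - radial_sq x r z) \<partial>lborel)"
  proof (rule order_trans[OF integral_norm_bound integral_mono])
    show "norm ((g x - g z) * bump x r z) \<le> norm (g x) / 2 * flat 0 (1 - radial_sq x r z)" for z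
    proof (cases "bump x r z = 0")
      case True
      then show ?thesis by (simp add: flat_nonneg)
    next
      case False
      then have "dist z x < d" using bump_eq_0_iff[OF r(1), of x z] r(3) by (simp add: dist_commute)
      then have "norm (g x - g z) \<le> norm (g x) / 2" using d(2)[of z] by (simp add: dist_norm norm_minus_commute)
      from mult_right_mono[OF this flat_nonneg[of 0 "1 - radial_sq x r z"]] show ?thesis
        by (simp add: norm_mult bump_def flat_nonneg)
    qed
    show "integrable lborel (\<lambda>z. norm ((g x - g z) * bump x r z))"
      unfolding integrable_norm_iff[OF borel_measurable_integrable]
      using Cc_infty_integrable_mult[OF b continuous_on_diff[OF continuous_on_const[of _ "g x"] assms(2)]]
      by (simp add: mult.commute)
    show "integrable lborel (\<lambda>z. norm (g x) / 2 * flat 0 (1 - radial_sq x r z))" using i by simp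
  qed
  also have "\<dots> = norm (g x) / 2 * ?I" by simp
  finally show False using integral_bump_pos[OF r(1), of 0 x] gx by simp
qed

text \<open>Differentiation in x falls on the kernel, and the partial derivatives of k, with a sign
  from z - x, are test functions again; hence an induction over all kernels at once.\<close>

lemma smooth_convolution:
  fixes u :: "'a::euclidean_space \<Rightarrow> complex"
  assumes u: "integrable lborel u" and k: "k \<in> Cc_infty \<Omega>"
  shows "smooth (\<lambda>x. \<integral>z. u z * k (z - x) \<partial>lborel)"
  unfolding smooth_def
proof
  fix n
  have um: "u \<in> borel_measurable borel" using u by simp
  have der: "((\<lambda>x. \<integral>z. u z * k (z - x) \<partial>lborel) has_derivative
      (\<lambda>h. \<integral>z. u z * - (\<Sum>b\<in>Basis. (h \<bullet> b) *\<^sub>R partial_deriv b k (z - x)) \<partial>lborel)) (at x)"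
    if k: "k \<in> Cc_infty \<Omega>" for k x
  proof -
    note sm = Cc_infty_smooth[OF k]
    have meas: "k \<in> borel_measurable borel" "\<And>b. b \<in> Basis \<Longrightarrow> partial_deriv b k \<in> borel_measurable borel"
      using smooth_continuous[OF sm] smooth_continuous[OF smooth_partial_deriv[OF sm]]
      by (auto intro: borel_measurable_continuous_onI)
    obtain C where C: "\<And>x. norm (k x) \<le> C" using Cc_infty_bounded[OF k] by metis
    have "\<exists>C. \<forall>x. norm (partial_deriv b k x) \<le> C" if "b \<in> Basis" for b
      using Cc_infty_bounded[OF Cc_infty_partial_deriv[OF k that]] by metis
    then obtain B where B: "\<And>b x. b \<in> Basis \<Longrightarrow> norm (partial_deriv b k x) \<le> B b" by metis
    show ?thesis
    proof (rule has_derivative_integral[where r = 1 and g = "\<lambda>z. norm (u z) * (\<Sum>b\<in>Basis. B b)"])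
      fix t z
      show "integrable lborel (\<lambda>z. u z * k (z - t))"
      proof (rule Bochner_Integration.integrable_bound)
        show "integrable lborel (\<lambda>z. norm (u z) * C)" using u by simp
        show "(\<lambda>z. u z * k (z - t)) \<in> borel_measurable lborel" using um meas by simp
        have "norm (u z * k (z - t)) \<le> norm (norm (u z) * C)" for z
          using mult_left_mono[OF C[of "z - t"], of "norm (u z)"] abs_ge_self[of "norm (u z) * C"]
          by (simp add: norm_mult)
        then show "AE z in lborel. norm (u z * k (z - t)) \<le> norm (norm (u z) * C)" by simp
      qed
      have "((\<lambda>t. z - t) has_derivative (\<lambda>h. - h)) (at t)"
        by (auto intro!: derivative_eq_intros)
      from has_derivative_compose[OF this smooth_has_derivative_sum[OF sm]]
      show "((\<lambda>t. u z * k (z - t)) has_derivative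
          (\<lambda>h. u z * - (\<Sum>b\<in>Basis. (h \<bullet> b) *\<^sub>R partial_deriv b k (z - t)))) (at t)"
        by (intro has_derivative_mult_right) (simp add: sum_negf)
      show "onorm (\<lambda>h. u z * - (\<Sum>b\<in>Basis. (h \<bullet> b) *\<^sub>R partial_deriv b k (z - t)))
          \<le> norm (u z) * (\<Sum>b\<in>Basis. B b)"
      proof (rule onorm_le)
        fix h :: 'a
        have "norm (\<Sum>b\<in>Basis. (h \<bullet> b) *\<^sub>R partial_deriv b k (z - t)) \<le> (\<Sum>b\<in>Basis. norm h * B b)"
        proof (rule sum_norm_le)
          fix b :: 'a assume b: "b \<in> Basis"
          show "norm ((h \<bullet> b) *\<^sub>R partial_deriv b k (z - t)) \<le> norm h * B b"
            using mult_mono[OF Basis_le_norm[OF b] B[OF b]] by simp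
        qed
        then have "norm (u z) * norm (\<Sum>b\<in>Basis. (h \<bullet> b) *\<^sub>R partial_deriv b k (z - t)) \<le>
            norm (u z) * (norm h * (\<Sum>b\<in>Basis. B b))"
          by (intro mult_left_mono) (simp_all add: sum_distrib_left)
        then show "norm (u z * - (\<Sum>b\<in>Basis. (h \<bullet> b) *\<^sub>R partial_deriv b k (z - t)))
            \<le> norm (u z) * (\<Sum>b\<in>Basis. B b) * norm h"
          by (simp add: norm_mult algebra_simps)
      qed
      show "integrable lborel (\<lambda>z. norm (u z) * (\<Sum>b\<in>Basis. B b))" using u by simp
      show "(\<lambda>z. u z * - (\<Sum>b\<in>Basis. (t \<bullet> b) *\<^sub>R partial_deriv b k (z - x))) \<in> borel_measurable lborel"
        using um by (auto intro!: borel_measurable_times borel_measurable_sum borel_measurable_uminus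
            borel_measurable_scaleR measurable_compose[OF _ meas(2)])
    qed auto
  qed
  show "C_k n (\<lambda>x. \<integral>z. u z * k (z - x) \<partial>lborel)"
    using k
  proof (induction n arbitrary: k)
    case 0
    then show ?case
      using has_derivative_continuous[OF der] by (auto intro!: continuous_at_imp_continuous_on)
  next
    case (Suc n)
    show ?case
    proof (rule C_k_SucI[OF der[OF Suc.prems]])
      fix b :: 'a assume b: "b \<in> Basis"
      have "(\<Sum>c\<in>Basis. (b \<bullet> c) *\<^sub>R partial_deriv c k y) = partial_deriv b k y" for y
        by (rule sum_Basis_inner[OF b])
      moreover have "C_k n (\<lambda>x. \<integral>z. u z * (- partial_deriv b k (z - x)) \<partial>lborel)"
        by (rule Suc.IH[OF Cc_infty_bounded_linear[OF bounded_linear_minus[OF bounded_linear_ident]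
                Cc_infty_partial_deriv[OF Suc.prems b]]])
      ultimately show "C_k n (\<lambda>x. \<integral>z. u z * - (\<Sum>c\<in>Basis. (b \<bullet> c) *\<^sub>R partial_deriv c k (z - x)) \<partial>lborel)"
        by simp
    qed
  qed
qed

text \<open>The image measure under A is again translation invariant, hence a multiple of Lebesgue
  measure. The unit ball, which A maps onto itself, has positive finite measure and shows that the
  factor is 1; the translation by v is then absorbed by invariance.\<close>

lemma lborel_isometry:
  fixes \<tau> :: "'a::euclidean_space \<Rightarrow> 'a"
  assumes A: "orthogonal_transformation A" and \<tau>: "\<And>x. \<tau> x = A x + v"
  shows "distr lborel borel \<tau> = lborel"
proof -
  have lin: "linear A" using A orthogonal_transformation_linear by blast
  have Am: "A \<in> borel_measurable borel"
    using linear_continuous_on[OF linear_conv_bounded_linear[THEN iffD1, OF lin]]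
    by (rule borel_measurable_continuous_onI)
  let ?N = "distr lborel borel A :: 'a measure"
  let ?B = "ball 0 1 :: 'a set"
  have vimage: "A -` ?B = ?B"
    using A by (auto simp: orthogonal_transformation)
  have NB: "emeasure ?N ?B = emeasure lborel ?B"
    using Am by (simp add: emeasure_distr vimage)
  have B: "emeasure lborel ?B \<noteq> 0" "emeasure lborel ?B \<noteq> \<infinity>"
  proof -
    have "?B \<notin> null_sets lebesgue"
      using open_not_negligible[of ?B] by (simp add: negligible_iff_null_sets)
    then show "emeasure lborel ?B \<noteq> 0"
      using null_sets_completionI[of ?B lborel] by auto
    show "emeasure lborel ?B \<noteq> \<infinity>"
      using emeasure_bounded_finite[of ?B] by (simp add: less_top)
  qed
  obtain A' where A': "orthogonal_transformation A'" "\<And>x. A (A' x) = x" "\<And>x. A' (A x) = x"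
    using A orthogonal_transformation_inv orthogonal_transformation_bij
    by (metis bij_inv_eq_iff inv_f_f orthogonal_transformation_inj)
  have N_shift: "(\<integral>\<^sup>+x. f (x + c) \<partial>?N) = (\<integral>\<^sup>+x. f x \<partial>?N)" if [measurable]: "f \<in> borel_measurable borel" for f c
  proof -
    have "(\<integral>\<^sup>+x. f (x + c) \<partial>?N) = (\<integral>\<^sup>+x. f (A (A' c + x)) \<partial>lborel)"
      using Am A'(2) by (subst nn_integral_distr) (auto simp: linear_add[OF lin] add.commute)
    also have "\<dots> = (\<integral>\<^sup>+x. f (A x) \<partial>(distr lborel borel ((+) (A' c))))"
      using Am by (subst nn_integral_distr) auto
    also have "\<dots> = (\<integral>\<^sup>+x. f x \<partial>?N)"
      unfolding lborel_distr_plus using Am by (subst nn_integral_distr) auto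
    finally show ?thesis .
  qed
  have L_shift: "(\<integral>\<^sup>+x. f (x + c) \<partial>lborel) = (\<integral>\<^sup>+x. f x \<partial>lborel)" if [measurable]: "f \<in> borel_measurable borel" for f c
    by (subst (2) lborel_distr_plus[of c, symmetric], subst nn_integral_distr) (auto simp: add.commute)
  have L_refl: "(\<integral>\<^sup>+x. f (c - x) \<partial>lborel) = (\<integral>\<^sup>+x. f x \<partial>lborel)" if [measurable]: "f \<in> borel_measurable borel" for f c
  proof -
    have "(\<integral>\<^sup>+x. f x \<partial>lborel) = (\<integral>\<^sup>+x. f x \<partial>(density (distr lborel borel (\<lambda>x. c + (-1) *\<^sub>R x)) (\<lambda>_. \<bar>(-1)::real\<bar> ^ DIM('a))))"
      by (subst lborel_affine[of "-1" c]) auto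
    also have "\<dots> = (\<integral>\<^sup>+x. f (c - x) \<partial>lborel)"
      by (simp add: density_1 nn_integral_distr)
    finally show ?thesis by simp
  qed
  \<comment> \<open>Uniqueness of Haar measure: compute $\int\int 1_S(x)\,1_B(x+y)$ in both orders.\<close>
  show ?thesis
  proof (rule measure_eqI)
    fix S assume "S \<in> sets (distr lborel borel \<tau>)"
    then have S: "S \<in> sets borel" by simp
    have [measurable]: "indicator S \<in> borel_measurable borel" "indicator ?B \<in> borel_measurable borel"
      "A \<in> borel_measurable borel"
      using S Am by (auto intro!: borel_measurable_indicator borel_open)
    let ?f = "indicator S :: 'a \<Rightarrow> ennreal" and ?g = "indicator ?B :: 'a \<Rightarrow> ennreal"
    have "(\<integral>\<^sup>+y. (\<integral>\<^sup>+x. ?f (A x) * ?g (A x + y) \<partial>lborel) \<partial>lborel) =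
        (\<integral>\<^sup>+x. (\<integral>\<^sup>+y. ?f (A x) * ?g (A x + y) \<partial>lborel) \<partial>lborel)"
      by (rule lborel_pair.Fubini') measurable
    also have "\<dots> = (\<integral>\<^sup>+x. ?f (A x) * emeasure lborel ?B \<partial>lborel)"
      using L_shift[of ?g "A _"] by (simp add: nn_integral_cmult add.commute)
    also have "\<dots> = emeasure ?N S * emeasure lborel ?B"
      using S by (simp add: nn_integral_multc nn_integral_distr[of A lborel borel ?f, symmetric])
    finally have 1: "(\<integral>\<^sup>+y. (\<integral>\<^sup>+x. ?f (A x) * ?g (A x + y) \<partial>lborel) \<partial>lborel) =
      emeasure ?N S * emeasure lborel ?B" .
    have "(\<integral>\<^sup>+x. ?f (A x) * ?g (A x + y) \<partial>lborel) = (\<integral>\<^sup>+x. ?f (A x - y) * ?g (A x) \<partial>lborel)" for y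
      using N_shift[of "\<lambda>x. ?f x * ?g (x + y)" "- y"] by (simp add: nn_integral_distr)
    then have "(\<integral>\<^sup>+y. (\<integral>\<^sup>+x. ?f (A x) * ?g (A x + y) \<partial>lborel) \<partial>lborel) =
        (\<integral>\<^sup>+y. (\<integral>\<^sup>+x. ?f (A x - y) * ?g (A x) \<partial>lborel) \<partial>lborel)"
      by simp
    also have "\<dots> = (\<integral>\<^sup>+x. (\<integral>\<^sup>+y. ?f (A x - y) * ?g (A x) \<partial>lborel) \<partial>lborel)"
      by (rule lborel_pair.Fubini') measurable
    also have "\<dots> = (\<integral>\<^sup>+x. emeasure lborel S * ?g (A x) \<partial>lborel)"
      using L_refl[of ?f "A _"] S by (simp add: nn_integral_multc)
    also have "\<dots> = emeasure lborel S * emeasure ?N ?B"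
      using S by (simp add: nn_integral_cmult nn_integral_distr[of A lborel borel ?g, symmetric])
    finally have "emeasure ?N S * emeasure lborel ?B = emeasure lborel S * emeasure lborel ?B"
      using 1 NB by simp
    then have NS: "emeasure ?N S = emeasure lborel S"
      using B by (metis ennreal_mult_cancel_left mult.commute infinity_ennreal_def)
    have \<tau>m: "\<tau> \<in> borel_measurable borel" unfolding \<tau>[abs_def] using Am by simp
    have "emeasure (distr lborel borel \<tau>) S = (\<integral>\<^sup>+x. ?f (A x + v) \<partial>lborel)"
      using S \<tau>m \<tau> by (simp add: nn_integral_distr flip: nn_integral_indicator)
    also have "\<dots> = (\<integral>\<^sup>+x. ?f (x + v) \<partial>?N)"
      by (simp add: nn_integral_distr)
    also have "\<dots> = emeasure ?N S"
      using N_shift[of ?f v] S by simp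
    finally show "emeasure (distr lborel borel \<tau>) S = emeasure lborel S" using NS by simp
  qed simp
qed

section \<open>Mean value properties\<close>

lemma DERIV_flat_0: "(flat 0 has_real_derivative flat 2 s) (at s)"
  using DERIV_flat[of 0 s] by (simp add: numeral_2_eq_2)

lemma DERIV_flat_2: "(flat 2 has_real_derivative flat 4 s - 2 * flat 3 s) (at s)"
  using DERIV_flat[of 2 s] by (simp add: eval_nat_numeral)

text \<open>The kernel is proportional to $\delta^{-d}\rho((z-x)/\delta)$ with $\nabla P = -2 y \rho(y)$ for
  the bump function $P$, so that its derivative in the radius $\delta$ is a multiple of the Laplacian
  of the bump function of radius $\delta$.\<close>

definition kern :: "real \<Rightarrow> 'a::euclidean_space \<Rightarrow> 'a \<Rightarrow> real"
  where "kern \<delta> x z = flat 2 (1 - radial_sq x \<delta> z) / \<delta> ^ DIM('a)"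

definition kern_deriv :: "real \<Rightarrow> 'a::euclidean_space \<Rightarrow> 'a \<Rightarrow> real"
  where "kern_deriv \<delta> x z = (2 * radial_sq x \<delta> z * (flat 4 (1 - radial_sq x \<delta> z) - 2 * flat 3 (1 - radial_sq x \<delta> z))
    - real DIM('a) * flat 2 (1 - radial_sq x \<delta> z)) / (\<delta> * \<delta> ^ DIM('a))"

lemma radial_sq_has_derivative:
  "(radial_sq x \<delta> has_derivative (\<lambda>h. 2 * ((z - x) \<bullet> h) / \<delta>\<^sup>2)) (at z)"
proof -
  have "radial_sq x \<delta> = (\<lambda>z. inverse (\<delta>\<^sup>2) * ((z - x) \<bullet> (z - x)))"
    by (simp add: fun_eq_iff radial_sq_def power2_norm_eq_inner divide_inverse mult.commute)
  moreover have "((\<lambda>z. inverse (\<delta>\<^sup>2) * ((z - x) \<bullet> (z - x))) has_derivative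
      (\<lambda>h. inverse (\<delta>\<^sup>2) * ((z - x) \<bullet> h + h \<bullet> (z - x)))) (at z)"
    by (auto intro!: derivative_eq_intros)
  moreover have "inverse (\<delta>\<^sup>2) * ((z - x) \<bullet> h + h \<bullet> (z - x)) = 2 * ((z - x) \<bullet> h) / \<delta>\<^sup>2" for h
    by (simp add: inner_commute divide_inverse mult.commute)
  ultimately show ?thesis by simp
qed

lemma partial_deriv_bump:
  "partial_deriv b (bump x \<delta>) z = complex_of_real (flat 2 (1 - radial_sq x \<delta> z) * (- 2 * ((z - x) \<bullet> b) / \<delta>\<^sup>2))"
proof -
  have "((\<lambda>z. 1 - radial_sq x \<delta> z) has_derivative (\<lambda>h. - (2 * ((z - x) \<bullet> h) / \<delta>\<^sup>2))) (at z)"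
    by (auto intro!: derivative_eq_intros radial_sq_has_derivative)
  from has_derivative_of_real[OF has_derivative_compose[OF this DERIV_flat_0[unfolded has_field_derivative_def]]]
  have "(bump x \<delta> has_derivative (\<lambda>h. complex_of_real (flat 2 (1 - radial_sq x \<delta> z) * (- (2 * ((z - x) \<bullet> h) / \<delta>\<^sup>2))))) (at z)"
    unfolding bump_def[abs_def] .
  from partial_deriv_eq[OF this] show ?thesis by simp
qed

lemma partial_deriv2_bump:
  "partial_deriv c (partial_deriv b (bump x \<delta>)) z = complex_of_real
    ((flat 4 (1 - radial_sq x \<delta> z) - 2 * flat 3 (1 - radial_sq x \<delta> z)) * (4 * ((z - x) \<bullet> b) * ((z - x) \<bullet> c) / \<delta>\<^sup>2 / \<delta>\<^sup>2)
      - 2 * flat 2 (1 - radial_sq x \<delta> z) * (b \<bullet> c) / \<delta>\<^sup>2)"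
proof -
  have 0: "((\<lambda>z. 1 - radial_sq x \<delta> z) has_derivative (\<lambda>h. - (2 * ((z - x) \<bullet> h) / \<delta>\<^sup>2))) (at z)"
    by (auto intro!: derivative_eq_intros radial_sq_has_derivative)
  have "((\<lambda>z. (- 2 / \<delta>\<^sup>2) * ((z - x) \<bullet> b)) has_derivative (\<lambda>h. (- 2 / \<delta>\<^sup>2) * (h \<bullet> b))) (at z)"
    by (rule has_derivative_mult_right) (auto intro!: derivative_eq_intros)
  then have "((\<lambda>z. - 2 * ((z - x) \<bullet> b) / \<delta>\<^sup>2) has_derivative (\<lambda>h. - 2 * (h \<bullet> b) / \<delta>\<^sup>2)) (at z)"
    by simp
  note has_derivative_mult[OF has_derivative_compose[OF 0 DERIV_flat_2[unfolded has_field_derivative_def]] this]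
  from partial_deriv_eq[OF has_derivative_of_real[OF this], of c]
  show ?thesis
    unfolding partial_deriv_bump[abs_def]
    by (simp add: field_simps inner_commute)
qed

text \<open>This identity drives all statements about means. Summing the squared coordinates turns
  the second derivatives into the combination of \<open>flat 2\<close>, \<open>flat 3\<close> and
  \<open>flat 4\<close> that arises from differentiating \<open>kern\<close> in its radius. So if u
  annihilates the Laplacians of bumps at x, its means around x do not depend on the radius.\<close>

lemma laplacian_bump:
  fixes x z :: "'a::euclidean_space"
  assumes "0 < \<delta>"
  shows "laplacian (bump x \<delta>) z = complex_of_real (2 * kern_deriv \<delta> x z * \<delta> ^ DIM('a) / \<delta>)"
proof -
  have "(\<Sum>b\<in>Basis. ((z - x) \<bullet> b) * ((z - x) \<bullet> b)) = \<delta>\<^sup>2 * radial_sq x \<delta> z"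
    using assms by (simp add: radial_sq_def power2_norm_eq_inner euclidean_inner[of "z - x" "z - x"])
  moreover have "laplacian (bump x \<delta>) z = complex_of_real
    ((flat 4 (1 - radial_sq x \<delta> z) - 2 * flat 3 (1 - radial_sq x \<delta> z)) * (4 * (\<Sum>b\<in>Basis. ((z - x) \<bullet> b) * ((z - x) \<bullet> b)) / \<delta>\<^sup>2 / \<delta>\<^sup>2)
      - 2 * flat 2 (1 - radial_sq x \<delta> z) * DIM('a) / \<delta>\<^sup>2)"
    unfolding laplacian_def partial_deriv2_bump of_real_sum[symmetric]
    by (simp add: sum_subtractf sum_distrib_left sum_divide_distrib mult.assoc)
  ultimately show ?thesis
    using assms unfolding kern_deriv_def of_real_eq_iff
    by (simp add: divide_simps power2_eq_square)
qed

lemma kern_DERIV: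
  assumes "0 < \<delta>"
  shows "((\<lambda>\<delta>. kern \<delta> x z) has_real_derivative kern_deriv \<delta> x z) (at \<delta>)"
proof -
  let ?d = "DIM('a)"
  obtain m where m: "?d = Suc m" using DIM_positive[where 'a='a] by (metis Suc_pred)
  have "((\<lambda>\<delta>. 1 - radial_sq x \<delta> z) has_real_derivative 2 * radial_sq x \<delta> z / \<delta>) (at \<delta>)"
  proof -
    have "((\<lambda>\<delta>. 1 - c / \<delta>\<^sup>2) has_real_derivative (0 - (0 * \<delta>\<^sup>2 - c * (2 * \<delta>)) / (\<delta>\<^sup>2 * \<delta>\<^sup>2))) (at \<delta>)" for c
      using assms by (auto intro!: derivative_eq_intros)
    moreover have "0 - (0 * \<delta>\<^sup>2 - c * (2 * \<delta>)) / (\<delta>\<^sup>2 * \<delta>\<^sup>2) = 2 * (c / \<delta>\<^sup>2) / \<delta>" for c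
      using assms by (simp add: field_simps power2_eq_square)
    ultimately show ?thesis unfolding radial_sq_def by simp
  qed
  from DERIV_chain2[OF DERIV_flat_2 this]
  have 1: "((\<lambda>\<delta>. flat 2 (1 - radial_sq x \<delta> z)) has_real_derivative
     (flat 4 (1 - radial_sq x \<delta> z) - 2 * flat 3 (1 - radial_sq x \<delta> z)) * (2 * radial_sq x \<delta> z / \<delta>)) (at \<delta>)" .
  have 2: "((\<lambda>\<delta>::real. \<delta> ^ ?d) has_real_derivative ?d * \<delta> ^ m) (at \<delta>)"
    unfolding m using DERIV_pow[of "Suc m" \<delta>] by simp
  have "\<delta> ^ ?d \<noteq> 0" using assms by simp
  from DERIV_divide[OF 1 2 this]
  show ?thesis unfolding kern_def
    by (rule DERIV_cong) (use assms in \<open>simp add: kern_deriv_def m divide_simps\<close>, cases m, auto simp: algebra_simps)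
qed

lemma kern_nonneg: "0 < \<delta> \<Longrightarrow> 0 \<le> kern \<delta> x z"
  by (simp add: kern_def flat_nonneg)

lemma kern_pos: "0 < \<delta> \<Longrightarrow> dist x z < \<delta> \<Longrightarrow> 0 < kern \<delta> x z"
  by (simp add: kern_def flat_pos radial_sq_less_iff)

lemma kern_eq_0: "0 < \<delta> \<Longrightarrow> \<delta> \<le> dist x z \<Longrightarrow> kern \<delta> x z = 0"
  using radial_sq_less_iff[of \<delta> x z] by (simp add: kern_def flat_eq_0)

lemma kern_deriv_eq_0:
  fixes x z :: "'a::euclidean_space"
  shows "0 < \<delta> \<Longrightarrow> \<delta> \<le> dist x z \<Longrightarrow> kern_deriv \<delta> x z = 0"
  using radial_sq_less_iff[of \<delta> x z] by (simp add: kern_deriv_def flat_eq_0)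

lemma kern_Cc_infty:
  fixes x :: "'a::euclidean_space"
  assumes "0 < \<delta>"
  shows "(\<lambda>z. complex_of_real (kern \<delta> x z)) \<in> Cc_infty UNIV"
  using Cc_infty_mult[OF flat_radial_sq_Cc_infty[OF assms, of x UNIV 2] smooth_const[of "complex_of_real (1 / \<delta> ^ DIM('a))"]]
  by (simp add: kern_def)

lemma kern_measurable [measurable]: "kern \<delta> x \<in> borel_measurable borel"
  and kern_deriv_measurable [measurable]: "kern_deriv \<delta> x \<in> borel_measurable borel"
proof -
  have [measurable]: "flat n \<in> borel_measurable borel" for n
    using DERIV_flat DERIV_isCont by (blast intro: borel_measurable_continuous_onI continuous_at_imp_continuous_on)
  have [measurable]: "radial_sq x \<delta> \<in> borel_measurable borel"
    unfolding radial_sq_def[abs_def] by measurable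
  show "kern \<delta> x \<in> borel_measurable borel" "kern_deriv \<delta> x \<in> borel_measurable borel"
    unfolding kern_def[abs_def] kern_deriv_def[abs_def] by measurable
qed

text \<open>Differentiating in the radius under the integral requires a bound uniform in the radius,
  and one exists as long as the radius stays away from 0. The factorials are those of
  \<open>flat_le\<close> for arguments in [0, 1].\<close>

lemma kern_deriv_bound:
  fixes x :: "'a::euclidean_space"
  assumes "0 < \<delta>\<^sub>0"
  obtains C where "0 \<le> C" "\<And>\<delta> z. \<delta>\<^sub>0 \<le> \<delta> \<Longrightarrow> \<bar>kern_deriv \<delta> x z\<bar> \<le> C"
proof -
  have bfb: "\<bar>flat n s\<bar> \<le> fact (Suc n)" if "0 \<le> s" "s \<le> 1" for n s
  proof -
    have "fact (Suc n) * \<bar>s\<bar> \<le> fact (Suc n) * 1" using that by (intro mult_left_mono) auto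
    then show ?thesis using flat_le[of n s] flat_nonneg[of n s] by linarith
  qed
  define C where "C = (2 * (fact 5 + 2 * fact 4) + real DIM('a) * fact 3) / (\<delta>\<^sub>0 * \<delta>\<^sub>0 ^ DIM('a))"
  have "\<bar>kern_deriv \<delta> x z\<bar> \<le> C" if \<delta>: "\<delta>\<^sub>0 \<le> \<delta>" for \<delta> z
  proof (cases "\<delta> \<le> dist x z")
    case True
    then show ?thesis using \<delta> assms by (simp add: kern_deriv_eq_0 C_def)
  next
    case False
    let ?q = "radial_sq x \<delta> z"
    have q: "0 \<le> ?q" "?q \<le> 1" using False \<delta> assms radial_sq_le_iff[of \<delta> x z] by (auto simp: radial_sq_def)
    have b: "\<bar>flat 4 (1 - ?q)\<bar> \<le> fact 5" "\<bar>flat 3 (1 - ?q)\<bar> \<le> fact 4" "\<bar>flat 2 (1 - ?q)\<bar> \<le> fact 3"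
      using bfb[of "1 - ?q" 4] bfb[of "1 - ?q" 3] bfb[of "1 - ?q" 2] q by (simp_all add: eval_nat_numeral)
    have "\<bar>2 * ?q * (flat 4 (1 - ?q) - 2 * flat 3 (1 - ?q)) - real DIM('a) * flat 2 (1 - ?q)\<bar>
        \<le> \<bar>2 * ?q * (flat 4 (1 - ?q) - 2 * flat 3 (1 - ?q))\<bar> + \<bar>real DIM('a) * flat 2 (1 - ?q)\<bar>"
      by (rule abs_triangle_ineq4)
    also have "\<bar>2 * ?q * (flat 4 (1 - ?q) - 2 * flat 3 (1 - ?q))\<bar> \<le> 2 * 1 * (fact 5 + 2 * fact 4)"
      unfolding abs_mult using q b by (intro mult_mono) (auto simp: abs_if split: if_splits)
    also have "\<bar>real DIM('a) * flat 2 (1 - ?q)\<bar> \<le> real DIM('a) * fact 3"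
      unfolding abs_mult using b by (intro mult_mono) auto
    finally have num: "\<bar>2 * ?q * (flat 4 (1 - ?q) - 2 * flat 3 (1 - ?q)) - real DIM('a) * flat 2 (1 - ?q)\<bar> \<le>
        2 * (fact 5 + 2 * fact 4) + real DIM('a) * fact 3" by simp
    have den: "\<delta>\<^sub>0 * \<delta>\<^sub>0 ^ DIM('a) \<le> \<delta> * \<delta> ^ DIM('a)"
      using \<delta> assms by (intro mult_mono power_mono) auto
    have "\<bar>kern_deriv \<delta> x z\<bar> = \<bar>2 * ?q * (flat 4 (1 - ?q) - 2 * flat 3 (1 - ?q)) - real DIM('a) * flat 2 (1 - ?q)\<bar> / (\<delta> * \<delta> ^ DIM('a))"
      using \<delta> assms by (simp add: kern_deriv_def abs_mult)
    also have "\<dots> \<le> C"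
      unfolding C_def by (rule frac_le) (use num den assms in \<open>auto simp del: of_nat_mult\<close>)
    finally show ?thesis .
  qed
  moreover have "0 \<le> C" using assms by (simp add: C_def)
  ultimately show ?thesis using that by blast
qed

text \<open>The measurability hypothesis is what \<open>lborel\<close> and
  \<open>lebesgue_on \<Omega>\<close> have in common: Weyl's lemma works with the former, the
  minimum principle with the latter.\<close>

lemma kern_integrable:
  fixes u :: "'a::euclidean_space \<Rightarrow> 'v::{banach, second_countable_topology}"
  assumes M: "\<And>f::'a \<Rightarrow> real. f \<in> borel_measurable borel \<Longrightarrow> f \<in> borel_measurable M"
    and u: "integrable M u" and "0 < \<delta>"
  shows "integrable M (\<lambda>z. kern \<delta> x z *\<^sub>R u z)"
proof -
  obtain C where C: "\<And>z. norm (complex_of_real (kern \<delta> x z)) \<le> C"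
    using Cc_infty_bounded[OF kern_Cc_infty[OF assms(3)]] by metis
  show ?thesis
  proof (rule Bochner_Integration.integrable_bound)
    show "integrable M (\<lambda>z. C *\<^sub>R u z)" using u by simp
    show "(\<lambda>z. kern \<delta> x z *\<^sub>R u z) \<in> borel_measurable M"
      using u by (intro borel_measurable_scaleR M) auto
    have "norm (kern \<delta> x z *\<^sub>R u z) \<le> norm (C *\<^sub>R u z)" for z
      using C[of z] by (simp add: mult_right_mono)
    then show "AE z in M. norm (kern \<delta> x z *\<^sub>R u z) \<le> norm (C *\<^sub>R u z)" by simp
  qed
qed

lemma kern_integral_has_vector_derivative:
  fixes u :: "'a::euclidean_space \<Rightarrow> 'v::{banach, second_countable_topology}"
  assumes M: "\<And>f::'a \<Rightarrow> real. f \<in> borel_measurable borel \<Longrightarrow> f \<in> borel_measurable M"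
    and u: "integrable M u" and \<delta>: "0 < \<delta>"
  shows "((\<lambda>\<delta>. \<integral>z. kern \<delta> x z *\<^sub>R u z \<partial>M) has_vector_derivative
      (\<integral>z. kern_deriv \<delta> x z *\<^sub>R u z \<partial>M)) (at \<delta>)"
proof -
  obtain C where C: "0 \<le> C" "\<And>\<delta>' z. \<delta> / 2 \<le> \<delta>' \<Longrightarrow> \<bar>kern_deriv \<delta>' x z\<bar> \<le> C"
    using kern_deriv_bound[of "\<delta> / 2" x] \<delta> by auto
  have "((\<lambda>\<delta>. \<integral>z. kern \<delta> x z *\<^sub>R u z \<partial>M) has_derivative
      (\<lambda>h. \<integral>z. (h * kern_deriv \<delta> x z) *\<^sub>R u z \<partial>M)) (at \<delta>)"
  \<comment> \<open>With r = \<delta>/2 all radii that occur exceed \<delta>/2, where the bound C is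
    available.\<close>
  proof (rule has_derivative_integral[where r = "\<delta> / 2" and g = "\<lambda>z. C * norm (u z)"])
    fix t z assume t: "t \<in> ball \<delta> (\<delta> / 2)"
    then have t': "\<delta> / 2 \<le> t" "0 < t" using \<delta> by (auto simp: dist_real_def abs_if split: if_splits)
    show "integrable M (\<lambda>z. kern t x z *\<^sub>R u z)" by (rule kern_integrable[OF M u t'(2)])
    show "((\<lambda>t. kern t x z *\<^sub>R u z) has_derivative (\<lambda>h. (h * kern_deriv t x z) *\<^sub>R u z)) (at t)"
      using kern_DERIV[OF t'(2), of x z] unfolding has_field_derivative_def
      by (auto intro!: derivative_eq_intros simp: mult.commute)
    show "onorm (\<lambda>h. (h * kern_deriv t x z) *\<^sub>R u z) \<le> C * norm (u z)"
    proof (rule onorm_le)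
      fix h :: real
      show "norm ((h * kern_deriv t x z) *\<^sub>R u z) \<le> C * norm (u z) * norm h"
        using mult_left_mono[OF C(2)[OF t'(1), of z], of "\<bar>h\<bar> * norm (u z)"]
        by (simp add: abs_mult algebra_simps)
    qed
  next
    show "(\<lambda>z. (h * kern_deriv \<delta> x z) *\<^sub>R u z) \<in> borel_measurable M" for h
      using u by (intro borel_measurable_scaleR M borel_measurable_times) auto
  qed (use u \<delta> in auto)
  moreover have "(\<lambda>h. \<integral>z. (h * kern_deriv \<delta> x z) *\<^sub>R u z \<partial>M) = (\<lambda>h. h *\<^sub>R (\<integral>z. kern_deriv \<delta> x z *\<^sub>R u z \<partial>M))"
    by (simp flip: scaleR_scaleR)
  ultimately show ?thesis by (simp add: has_vector_derivative_def)
qed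

lemma kern_deriv_eq_laplacian:
  fixes x z :: "'a::euclidean_space"
  assumes "0 < \<delta>"
  shows "kern_deriv \<delta> x z = \<delta> / (2 * \<delta> ^ DIM('a)) * Re (laplacian (bump x \<delta>) z)"
  using assms by (simp add: laplacian_bump)

lemma kern_mean_const:
  fixes u :: "'a::euclidean_space \<Rightarrow> 'v::{banach, second_countable_topology}"
  assumes u: "integrable lborel u"
    and harm: "\<And>\<delta>. 0 < \<delta> \<Longrightarrow> \<delta> \<le> r \<Longrightarrow> (\<integral>z. Re (laplacian (bump x \<delta>) z) *\<^sub>R u z \<partial>lborel) = 0"
    and "0 < \<delta>" "\<delta> \<le> r"
  shows "(\<integral>z. kern \<delta> x z *\<^sub>R u z \<partial>lborel) = (\<integral>z. kern r x z *\<^sub>R u z \<partial>lborel)"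
proof -
  have "((\<lambda>\<delta>. \<integral>z. kern \<delta> x z *\<^sub>R u z \<partial>lborel) has_vector_derivative 0) (at \<delta> within {0<..r})"
    if "\<delta> \<in> {0<..r}" for \<delta>
  proof -
    have "(\<integral>z. kern_deriv \<delta> x z *\<^sub>R u z \<partial>lborel) = 0"
      using that harm[of \<delta>]
      by (simp only: kern_deriv_eq_laplacian scaleR_scaleR[symmetric] integral_scaleR_right greaterThanAtMost_iff scaleR_zero_right)
    then show ?thesis
      using kern_integral_has_vector_derivative[OF _ u, of \<delta> x] that
      by (auto intro: has_vector_derivative_at_within)
  qed
  from has_vector_derivative_zero_constant[OF _ this]
  obtain c where "\<And>\<delta>. \<delta> \<in> {0<..r} \<Longrightarrow> (\<integral>z. kern \<delta> x z *\<^sub>R u z \<partial>lborel) = c"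
    by auto
  then show ?thesis using assms(3,4) by simp
qed

lemma kern_integral_lborel_integrable: "0 < \<delta> \<Longrightarrow> integrable lborel (kern \<delta> x)"
  using Cc_infty_integrable[OF kern_Cc_infty, of \<delta> x] complex_of_real_integrable_eq by blast

lemma integral_laplacian_eq_0:
  assumes "f \<in> Cc_infty \<Omega>" shows "(\<integral>x. laplacian f x \<partial>lborel) = 0"
  using integral_mult_laplacian[OF assms smooth_const[of 1]] by (simp add: laplacian_const[abs_def])

text \<open>A scaling property, obtained without a change of variables. Laplacians of test functions
  have integral 0, so the indicator of the closed ball of radius r annihilates the Laplacians of all
  bumps with smaller or equal radius, and \<open>kern_mean_const\<close> applies to it.\<close>

lemma kern_mass:
  fixes x :: "'a::euclidean_space"
  assumes "0 < \<delta>" "\<delta> \<le> r"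
  shows "integral\<^sup>L lborel (kern \<delta> x) = integral\<^sup>L lborel (kern r x)"
proof -
  let ?u = "indicator (cball x r) :: 'a \<Rightarrow> real"
  have r: "0 < r" using assms by simp
  have "emeasure lborel (cball x r) < \<infinity>"
    by (rule emeasure_bounded_finite) simp
  then have u: "integrable lborel ?u" by simp
  have eq: "kern \<delta> x z *\<^sub>R ?u z = kern \<delta> x z" if "0 < \<delta>" "\<delta> \<le> r" for \<delta> z
    using kern_eq_0[of \<delta> x z] that by (cases "z \<in> cball x r") auto
  have "(\<integral>z. Re (laplacian (bump x \<delta>) z) *\<^sub>R ?u z \<partial>lborel) = 0" if d: "0 < \<delta>" "\<delta> \<le> r" for \<delta>
  proof -
    have b: "laplacian (bump x \<delta>) \<in> Cc_infty (cball x r)"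
      by (intro laplacian_Cc_infty bump_Cc_infty) (use d in auto)
    have "(\<integral>z. Re (laplacian (bump x \<delta>) z) *\<^sub>R ?u z \<partial>lborel) = (\<integral>z. Re (laplacian (bump x \<delta>) z) \<partial>lborel)"
      using Cc_infty_vanishes[OF b] by (intro Bochner_Integration.integral_cong) (auto simp: indicator_def)
    also have "\<dots> = Re (\<integral>z. laplacian (bump x \<delta>) z \<partial>lborel)"
      by (rule integral_Re[OF Cc_infty_integrable[OF b]])
    also have "\<dots> = 0"
      using integral_laplacian_eq_0[OF bump_Cc_infty[OF d(1) subset_UNIV, of x]] by simp
    finally show ?thesis .
  qed
  from kern_mean_const[OF u this assms]
  have "(\<integral>z. kern \<delta> x z *\<^sub>R ?u z \<partial>lborel) = (\<integral>z. kern r x z *\<^sub>R ?u z \<partial>lborel)" .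
  moreover have "(\<integral>z. kern \<delta> x z *\<^sub>R ?u z \<partial>lborel) = integral\<^sup>L lborel (kern \<delta> x)"
    if "0 < \<delta>" "\<delta> \<le> r" for \<delta>
    by (rule Bochner_Integration.integral_cong[OF refl eq[OF that]])
  ultimately show ?thesis using assms r by (simp del: real_scaleR_def)
qed

lemma kern_mass_pos: "0 < r \<Longrightarrow> 0 < integral\<^sup>L lborel (kern r x)"
  by (rule lborel_integral_pos[where S = "ball x r"])
    (auto intro: kern_integral_lborel_integrable kern_nonneg kern_pos)

text \<open>The means do not change while the radius shrinks, and by continuity they approach u(x)
  times the mass of the kernel. The kernel is not normalised, so its mass stays as a factor.\<close>

lemma kern_mean_value:
  fixes u :: "'a::euclidean_space \<Rightarrow> 'v::{banach, second_countable_topology}"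
  assumes u: "integrable lborel u" and cont: "isCont u x"
    and harm: "\<And>\<delta>. 0 < \<delta> \<Longrightarrow> \<delta> \<le> r \<Longrightarrow> (\<integral>z. Re (laplacian (bump x \<delta>) z) *\<^sub>R u z \<partial>lborel) = 0"
    and r: "0 < r"
  shows "(\<integral>z. kern r x z *\<^sub>R u z \<partial>lborel) = integral\<^sup>L lborel (kern r x) *\<^sub>R u x"
proof (rule ccontr)
  let ?c = "integral\<^sup>L lborel (kern r x)"
  assume neq: "\<not> ?thesis"
  \<comment> \<open>Half of the discrepancy per unit of mass; the estimate below then bounds the
    discrepancy by half of itself.\<close>
  define e where "e = norm ((\<integral>z. kern r x z *\<^sub>R u z \<partial>lborel) - ?c *\<^sub>R u x) / (2 * ?c)"
  have e: "0 < e"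
    using neq kern_mass_pos[OF r, of x] by (simp add: e_def)
  then have "\<exists>d>0. \<forall>y. dist y x < d \<longrightarrow> dist (u y) (u x) < e"
    using cont unfolding continuous_at_eps_delta by blast
  then obtain d where d: "0 < d" "\<And>y. dist y x < d \<Longrightarrow> norm (u y - u x) < e"
    by (auto simp: dist_norm)
  define \<delta> where "\<delta> = min r d"
  have \<delta>: "0 < \<delta>" "\<delta> \<le> r" "\<delta> \<le> d" using d r by (auto simp: \<delta>_def)
  note ki = kern_integral_lborel_integrable[OF \<delta>(1), of x]
  have I: "integrable lborel (\<lambda>z. kern \<delta> x z *\<^sub>R u z)" by (rule kern_integrable[OF _ u \<delta>(1)]) simp
  have "norm ((\<integral>z. kern r x z *\<^sub>R u z \<partial>lborel) - ?c *\<^sub>R u x) =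
      norm (\<integral>z. kern \<delta> x z *\<^sub>R (u z - u x) \<partial>lborel)"
    using kern_mean_const[OF u harm \<delta>(1,2)] kern_mass[OF \<delta>(1,2), of x] I ki by (simp add: scaleR_diff_right)
  also have "\<dots> \<le> (\<integral>z. e * kern \<delta> x z \<partial>lborel)"
  proof (rule order_trans[OF integral_norm_bound integral_mono])
    show "integrable lborel (\<lambda>z. norm (kern \<delta> x z *\<^sub>R (u z - u x)))"
      using I ki by (intro integrable_norm) (simp add: scaleR_diff_right)
    show "integrable lborel (\<lambda>z. e * kern \<delta> x z)" using ki by simp
    show "norm (kern \<delta> x z *\<^sub>R (u z - u x)) \<le> e * kern \<delta> x z" for z
    proof (cases "dist x z < \<delta>")
      case True
      then show ?thesis
        using mult_left_mono[OF less_imp_le[OF d(2)[of z]] kern_nonneg[OF \<delta>(1), of x z]] \<delta>(3) kern_nonneg[OF \<delta>(1), of x z]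
        by (simp add: dist_commute mult.commute)
    qed (simp add: kern_eq_0 \<delta>(1))
  qed
  also have "\<dots> = e * ?c" using kern_mass[OF \<delta>(1,2), of x] by simp
  also have "\<dots> = norm ((\<integral>z. kern r x z *\<^sub>R u z \<partial>lborel) - ?c *\<^sub>R u x) / 2"
    using kern_mass_pos[OF r, of x] by (simp add: e_def)
  finally show False using e kern_mass_pos[OF r, of x] by (simp add: e_def zero_less_divide_iff)
qed

text \<open>Convolution of u with the normalised kernel of one fixed radius r is smooth on the whole
  space, and by the mean value property it reproduces u at every centre whose r-ball lies in S. A
  global v is wanted because \<open>smooth\<close> refers to the whole space.\<close>

lemma Weyl_lemma:
  fixes u :: "'a::euclidean_space \<Rightarrow> complex"
  assumes u: "integrable lborel u" and cont: "continuous_on UNIV u" and r: "0 < r"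
    and harm: "\<And>\<phi>. \<phi> \<in> Cc_infty S \<Longrightarrow> (\<integral>z. u z * laplacian \<phi> z \<partial>lborel) = 0"
  obtains v where "smooth v" "\<And>x::'a. cball x r \<subseteq> S \<Longrightarrow> v x = u x"
proof -
  let ?k = "\<lambda>y::'a. complex_of_real (kern r 0 y)"
  let ?c = "integral\<^sup>L lborel (kern r (0::'a))"
  define v where "v x = complex_of_real (1 / ?c) * (\<integral>z. u z * ?k (z - x) \<partial>lborel)" for x
  have k0: "kern r x z = kern r 0 (z - x)" for x z :: 'a
    by (simp add: kern_def radial_sq_def)
  have c: "integral\<^sup>L lborel (kern r x) = ?c" for x :: 'a
    using lborel_integral_translation[of "kern r 0" "- x"] by (simp add: k0[of x, abs_def])
  have "smooth v"
    unfolding v_def by (intro smooth_mult smooth_const smooth_convolution[OF u kern_Cc_infty[OF r]])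
  moreover have "v x = u x" if "cball x r \<subseteq> S" for x
  proof -
    have "(\<integral>z. Re (laplacian (bump x \<delta>) z) *\<^sub>R u z \<partial>lborel) = 0" if d: "0 < \<delta>" "\<delta> \<le> r" for \<delta>
    proof -
      have "complex_of_real (Re (laplacian (bump x \<delta>) z)) = laplacian (bump x \<delta>) z" for z
        by (simp add: laplacian_bump[OF d(1)])
      then have "(\<integral>z. Re (laplacian (bump x \<delta>) z) *\<^sub>R u z \<partial>lborel) = (\<integral>z. u z * laplacian (bump x \<delta>) z \<partial>lborel)"
        by (simp add: scaleR_conv_of_real mult.commute)
      also have "\<dots> = 0"
        by (rule harm[OF bump_Cc_infty[OF d(1)]]) (use d \<open>cball x r \<subseteq> S\<close> in auto)
      finally show ?thesis .
    qed
    from kern_mean_value[OF u _ this r]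
    have "(\<integral>z. kern r x z *\<^sub>R u z \<partial>lborel) = ?c *\<^sub>R u x"
      using cont c by (simp add: continuous_on_eq_continuous_at)
    then show ?thesis
      using kern_mass_pos[OF r, of "0::'a"]
      by (simp add: v_def k0[of x] scaleR_conv_of_real mult.commute)
  qed
  ultimately show ?thesis using that by blast
qed

section \<open>The strong minimum principle\<close>

lemma lebesgue_on_measurable_borel:
  "f \<in> borel_measurable borel \<Longrightarrow> f \<in> borel_measurable (lebesgue_on S)"
  by (simp add: measurable_completion measurable_restrict_space1)

text \<open>Superharmonicity makes the kernel means non-increasing in the radius. If v vanishes
  almost everywhere near x, a small mean is 0, hence the larger ones are too, and positivity of the
  kernel spreads the zeros over every ball around x inside \<Omega>. As v is merely integrable, the
  role of the zeros is played by points with a ball on which v vanishes almost everywhere.\<close>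

lemma strong_minimum_principle:
  fixes v :: "'a::euclidean_space \<Rightarrow> real"
  assumes \<Omega>: "open \<Omega>" "connected \<Omega>"
    and v: "integrable (lebesgue_on \<Omega>) v" "\<And>z. 0 \<le> v z"
    and super: "\<And>x r. 0 < r \<Longrightarrow> cball x r \<subseteq> \<Omega> \<Longrightarrow>
        (\<integral>z. Re (laplacian (bump x r) z) * v z \<partial>lebesgue_on \<Omega>) \<le> 0"
    and G: "open G" "G \<subseteq> \<Omega>" "G \<noteq> {}" "AE z in lebesgue_on \<Omega>. z \<in> G \<longrightarrow> v z = 0"
  shows "AE z in lebesgue_on \<Omega>. v z = 0"
proof -
  let ?M = "lebesgue_on \<Omega>"
  have Mm: "f \<in> borel_measurable ?M" if "f \<in> borel_measurable borel" for f :: "'a \<Rightarrow> real"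
    using that by (rule lebesgue_on_measurable_borel)
  let ?A = "\<lambda>x \<delta>. \<integral>z. kern \<delta> x z * v z \<partial>?M"
  have int: "integrable ?M (\<lambda>z. kern \<delta> x z * v z)" if "0 < \<delta>" for \<delta> x
    using kern_integrable[OF Mm v(1) that] by simp
  have mono: "?A x r \<le> ?A x e" if "0 < e" "e \<le> r" "cball x r \<subseteq> \<Omega>" for x e r
  proof (rule DERIV_nonpos_imp_nonincreasing[OF that(2)])
    fix \<delta> assume d: "e \<le> \<delta>" "\<delta> \<le> r"
    have d0: "0 < \<delta>" using d that by simp
    have "(?A x has_real_derivative (\<integral>z. kern_deriv \<delta> x z * v z \<partial>?M)) (at \<delta>)"
      using kern_integral_has_vector_derivative[OF Mm v(1) d0, of x]
      by (simp add: has_real_derivative_iff_has_vector_derivative)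
    moreover have "(\<integral>z. kern_deriv \<delta> x z * v z \<partial>?M) =
        \<delta> / (2 * \<delta> ^ DIM('a)) * (\<integral>z. Re (laplacian (bump x \<delta>) z) * v z \<partial>?M)"
      by (simp add: kern_deriv_eq_laplacian[OF d0] mult.assoc flip: integral_mult_right_zero)
    moreover have "\<delta> / (2 * \<delta> ^ DIM('a)) * (\<integral>z. Re (laplacian (bump x \<delta>) z) * v z \<partial>?M) \<le> 0"
      using super[OF d0, of x] order_trans[OF subset_cball[OF d(2)] that(3)] d0
      by (intro mult_nonneg_nonpos) auto
    ultimately show "\<exists>y. (?A x has_real_derivative y) (at \<delta>) \<and> y \<le> 0" by auto
  qed
  have spread: "AE z in ?M. z \<in> ball x r \<longrightarrow> v z = 0"
    if e: "0 < e" "AE z in ?M. z \<in> ball x e \<longrightarrow> v z = 0" and r: "0 < r" "cball x r \<subseteq> \<Omega>" for x e r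
  proof -
    \<comment> \<open>The minimum covers the case that e exceeds r.\<close>
    have "?A x (min e r) = 0"
    proof (rule integral_eq_zero_AE)
      show "AE z in ?M. kern (min e r) x z * v z = 0"
        using e(2) kern_eq_0[of "min e r" x] e(1) r(1) by (auto elim!: eventually_mono simp: not_less[symmetric])
    qed
    then have "?A x r \<le> 0" using mono[of "min e r" r x] e r by simp
    moreover have "0 \<le> ?A x r"
      by (intro Bochner_Integration.integral_nonneg mult_nonneg_nonneg kern_nonneg r v)
    ultimately have "AE z in ?M. kern r x z * v z = 0"
      using integral_nonneg_eq_0_iff_AE[OF int[OF r(1)], of x] mult_nonneg_nonneg[OF kern_nonneg[OF r(1), of x] v(2)]
      by auto
    then show ?thesis
      using kern_pos[OF r(1), of x] by (force elim!: eventually_mono)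
  qed
  define Z where "Z = {x\<in>\<Omega>. \<exists>e>0. AE z in ?M. z \<in> ball x e \<longrightarrow> v z = 0}"
  have Z_open: "open Z"
    unfolding open_contains_ball
  proof
    fix x assume "x \<in> Z"
    then obtain e where e: "0 < e" "AE z in ?M. z \<in> ball x e \<longrightarrow> v z = 0" and x: "x \<in> \<Omega>"
      by (auto simp: Z_def)
    obtain d where d: "0 < d" "ball x d \<subseteq> \<Omega>" using \<Omega>(1) x open_contains_ball by blast
    have "y \<in> Z" if "y \<in> ball x (min d (e / 2))" for y
    proof -
      have "ball y (e / 2) \<subseteq> ball x e"
      proof
        fix z assume "z \<in> ball y (e / 2)"
        then show "z \<in> ball x e" using that dist_triangle[of x z y] by simp
      qed
      then have "AE z in ?M. z \<in> ball y (e / 2) \<longrightarrow> v z = 0"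
        using e(2) by (auto elim!: eventually_mono)
      then show ?thesis using that d e(1) unfolding Z_def by (auto intro!: exI[of _ "e/2"])
    qed
    then show "\<exists>e>0. ball x e \<subseteq> Z" using d e by (intro exI[of _ "min d (e / 2)"]) auto
  qed
  \<comment> \<open>If some y in \<open>Z\<close> lay within d/4 of x, the zeros around y would
    spread to radius d/2 and cover the ball of radius d/4 around x, which puts x into
    \<open>Z\<close>.\<close>
  have W_open: "open (\<Omega> - Z)"
    unfolding open_contains_ball
  proof
    fix x assume x: "x \<in> \<Omega> - Z"
    then obtain d where d: "0 < d" "ball x d \<subseteq> \<Omega>" using \<Omega>(1) open_contains_ball by blast
    have "y \<notin> Z" if y: "y \<in> ball x (d / 4)" for y
    proof
      assume "y \<in> Z"
      then obtain e where e: "0 < e" "AE z in ?M. z \<in> ball y e \<longrightarrow> v z = 0" by (auto simp: Z_def)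
      have "cball y (d / 2) \<subseteq> \<Omega>"
      proof
        fix z assume "z \<in> cball y (d / 2)"
        then have "dist x z < d" using y d(1) dist_triangle[of x z y] by simp
        then show "z \<in> \<Omega>" using d(2) by auto
      qed
      from spread[OF e _ this] d(1) have "AE z in ?M. z \<in> ball y (d / 2) \<longrightarrow> v z = 0" by simp
      moreover have "ball x (d / 4) \<subseteq> ball y (d / 2)"
      proof
        fix z assume "z \<in> ball x (d / 4)"
        then show "z \<in> ball y (d / 2)" using y d(1) dist_triangle[of y z x] by (simp add: dist_commute)
      qed
      ultimately have "AE z in ?M. z \<in> ball x (d / 4) \<longrightarrow> v z = 0"
        by (auto elim!: eventually_mono)
      then have "x \<in> Z" using x d(1) unfolding Z_def by (auto intro!: exI[of _ "d / 4"])
      then show False using x by simp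
    qed
    moreover have "ball x (d / 4) \<subseteq> \<Omega>" using d subset_ball[of "d / 4" d x] by auto
    ultimately show "\<exists>e>0. ball x e \<subseteq> \<Omega> - Z" using d(1) by (intro exI[of _ "d / 4"]) auto
  qed
  have GZ: "G \<subseteq> Z"
  proof
    fix x assume x: "x \<in> G"
    then obtain e where e: "0 < e" "ball x e \<subseteq> G" using G(1) open_contains_ball by blast
    then have "AE z in ?M. z \<in> ball x e \<longrightarrow> v z = 0"
      using G(4) by (auto elim!: eventually_mono)
    then show "x \<in> Z" using x G(2) e(1) by (auto simp: Z_def)
  qed
  have "Z \<inter> \<Omega> = {} \<or> (\<Omega> - Z) \<inter> \<Omega> = {}"
    by (rule connectedD[OF \<Omega>(2) Z_open W_open]) auto
  then have "\<Omega> \<subseteq> Z" using GZ G(2,3) by blast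
  then have "\<exists>e>0. AE z in ?M. z \<in> ball x e \<longrightarrow> v z = 0" if "x \<in> \<Omega>" for x
    using that by (auto simp: Z_def)
  then obtain e where e: "\<And>x. x \<in> \<Omega> \<Longrightarrow> 0 < e x" "\<And>x. x \<in> \<Omega> \<Longrightarrow> AE z in ?M. z \<in> ball x (e x) \<longrightarrow> v z = 0"
    by metis
  \<comment> \<open>Countably many of the balls suffice, so the exceptional null sets may be
    united.\<close>
  obtain F where F: "F \<subseteq> (\<lambda>x. ball x (e x)) ` \<Omega>" "countable F" "\<Union>F = (\<Union>x\<in>\<Omega>. ball x (e x))"
    using Lindelof[of "(\<lambda>x. ball x (e x)) ` \<Omega>"] by auto
  have "AE z in ?M. \<forall>B\<in>F. z \<in> B \<longrightarrow> v z = 0"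
    using F(1) e(2) by (subst AE_ball_countable[OF F(2)]) blast
  moreover have "AE z in ?M. z \<in> \<Omega>"
    by (rule AE_I2) simp
  ultimately show ?thesis
  proof eventually_elim
    case (elim z)
    then have "z \<in> \<Union>F" unfolding F(3) using e(1) by force
    then show ?case using elim by blast
  qed
qed

section \<open>Disjointness preserving operators\<close>

text \<open>The functional is supported at a single point. Compactness and cut-offs give a point p
  such that L is non-zero on functions concentrated arbitrarily near p. Disjointness from these
  kills every function vanishing near p, and boundedness extends this to every function vanishing at
  p, so that L f depends on f(p) alone.\<close>

lemma disjointness_preserving_functional:
  fixes L :: "('a::euclidean_space \<Rightarrow> complex) \<Rightarrow> complex"
  assumes \<Omega>: "open \<Omega>"
    and add: "\<And>f g. f \<in> Cc_infty \<Omega> \<Longrightarrow> g \<in> Cc_infty \<Omega> \<Longrightarrow> L (\<lambda>x. f x + g x) = L f + L g"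
    and scale: "\<And>f c. f \<in> Cc_infty \<Omega> \<Longrightarrow> L (\<lambda>x. c * f x) = c * L f"
    and bound: "\<And>f B. f \<in> Cc_infty \<Omega> \<Longrightarrow> (\<And>x. norm (f x) \<le> B) \<Longrightarrow> norm (L f) \<le> K * B"
    and disj: "\<And>f g. f \<in> Cc_infty \<Omega> \<Longrightarrow> g \<in> Cc_infty \<Omega> \<Longrightarrow> (\<And>x. f x * g x = 0) \<Longrightarrow> L f * L g = 0"
    and nz: "\<exists>f\<in>Cc_infty \<Omega>. L f \<noteq> 0"
  obtains p w where "p \<in> \<Omega>" "w \<noteq> 0" "\<And>f. f \<in> Cc_infty \<Omega> \<Longrightarrow> L f = w * f p"
proof -
  have L0: "L (\<lambda>x. 0) = 0" using scale[of _ 0] nz by auto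
  have "\<exists>p\<in>\<Omega>. \<forall>e>0. \<exists>f\<in>Cc_infty \<Omega>. (\<forall>x. e \<le> dist p x \<longrightarrow> f x = 0) \<and> L f \<noteq> 0"
  proof (rule ccontr)
    assume neg: "\<not> ?thesis"
    have "\<exists>e>0. \<forall>f\<in>Cc_infty \<Omega>. (\<forall>x. e \<le> dist p x \<longrightarrow> f x = 0) \<longrightarrow> L f = 0" if "p \<in> \<Omega>" for p
      using neg that by blast
    then have "\<forall>p\<in>\<Omega>. \<exists>e. 0 < e \<and> (\<forall>f\<in>Cc_infty \<Omega>. (\<forall>x. e \<le> dist p x \<longrightarrow> f x = 0) \<longrightarrow> L f = 0)" by blast
    from bchoice[OF this] obtain e where e0:
      "\<forall>p\<in>\<Omega>. 0 < e p \<and> (\<forall>f\<in>Cc_infty \<Omega>. (\<forall>x. e p \<le> dist p x \<longrightarrow> f x = 0) \<longrightarrow> L f = 0)" ..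
    have e: "0 < e p" if "p \<in> \<Omega>" for p
      using bspec[OF e0 that] by simp
    have e': "L f = 0" if "p \<in> \<Omega>" "f \<in> Cc_infty \<Omega>" "\<And>x. e p \<le> dist p x \<Longrightarrow> f x = 0" for p f
      using bspec[OF e0 that(1)] that(2,3) by simp
    obtain f where f: "f \<in> Cc_infty \<Omega>" "L f \<noteq> 0" using nz by blast
    obtain C where "smooth f" and C: "compact C" "C \<subseteq> \<Omega>" "\<And>x. x \<notin> C \<Longrightarrow> f x = 0"
      using Cc_inftyE[OF f(1)] by metis
    have "C \<subseteq> (\<Union>p\<in>\<Omega>. ball p (e p / 2))"
    proof
      fix x assume "x \<in> C"
      then have "x \<in> \<Omega>" "x \<in> ball x (e x / 2)" using C(2) e[of x] by auto
      then show "x \<in> (\<Union>p\<in>\<Omega>. ball p (e p / 2))" by blast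
    qed
    then obtain D where D: "D \<subseteq> \<Omega>" "finite D" "C \<subseteq> (\<Union>p\<in>D. ball p (e p / 2))"
      using compactE_image[OF C(1), of \<Omega> "\<lambda>p. ball p (e p / 2)"] by auto
    \<comment> \<open>Factors 1 - \<open>plateau\<close> remove one ball after the other. The piece
      that is cut off vanishes at distance e p from p and beyond, so L is 0 on it and the value of L
      is unchanged.\<close>
    have "\<exists>g\<in>Cc_infty \<Omega>. L g = L f \<and> (\<forall>x. f x = 0 \<or> (\<exists>p\<in>D. dist p x < e p / 2) \<longrightarrow> g x = 0)"
      using D(2,1)
    proof (induction D rule: finite_induct)
      case empty
      then show ?case using f by auto
    next
      case (insert p D)
      then obtain g where g: "g \<in> Cc_infty \<Omega>" "L g = L f"
        "\<And>x. f x = 0 \<or> (\<exists>p\<in>D. dist p x < e p / 2) \<Longrightarrow> g x = 0" by auto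
      have ep: "0 < e p / 2" using e[of p] insert.prems by simp
      let ?h = "\<lambda>x. g x * (1 - plateau p (e p / 2) x)" and ?k = "\<lambda>x. g x * plateau p (e p / 2) x"
      have h: "?h \<in> Cc_infty \<Omega>" and k: "?k \<in> Cc_infty \<Omega>"
        by (intro Cc_infty_mult g(1) smooth_diff smooth_const smooth_plateau)+
      have "L ?k = 0"
        by (rule e'[OF _ k]) (use insert.prems plateau_eq_0[OF ep, of p] in auto)
      moreover have "L (\<lambda>x. ?h x + ?k x) = L ?h + L ?k" by (rule add[OF h k])
      moreover have "(\<lambda>x. ?h x + ?k x) = g" by (auto simp: algebra_simps)
      ultimately have "L ?h = L f" using g(2) by simp
      moreover have "?h x = 0" if "f x = 0 \<or> (\<exists>p\<in>insert p D. dist p x < e p / 2)" for x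
        using that g(3)[of x] plateau_eq_1[OF ep, of p x] by auto
      ultimately show ?case using h by blast
    qed
    then obtain g where g: "L g = L f" "\<And>x. f x = 0 \<or> (\<exists>p\<in>D. dist p x < e p / 2) \<Longrightarrow> g x = 0" by blast
    have "g x = 0" for x
    proof (cases "x \<in> C")
      case True
      then obtain p where "p \<in> D" "dist p x < e p / 2" using D(3) by auto
      then show ?thesis using g(2) by blast
    qed (use g(2) C(3) in auto)
    then have "g = (\<lambda>x. 0)" by auto
    then show False using g(1) f(2) L0 by simp
  qed
  then obtain p where p: "p \<in> \<Omega>"
    "\<And>e. 0 < e \<Longrightarrow> \<exists>f\<in>Cc_infty \<Omega>. (\<forall>x. e \<le> dist p x \<longrightarrow> f x = 0) \<and> L f \<noteq> 0" by blast
  have near: "L g = 0" if g: "g \<in> Cc_infty \<Omega>" "0 < e" "\<And>x. dist p x < e \<Longrightarrow> g x = 0" for g e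
  proof -
    obtain f where f: "f \<in> Cc_infty \<Omega>" "\<And>x. e \<le> dist p x \<Longrightarrow> f x = 0" "L f \<noteq> 0"
      using p(2)[OF g(2)] by blast
    have "f x * g x = 0" for x
      using f(2)[of x] g(3)[of x] by (cases "dist p x < e") auto
    then show ?thesis using disj[OF f(1) g(1)] f(3) by simp
  qed
  have zero: "L g = 0" if g: "g \<in> Cc_infty \<Omega>" "g p = 0" for g
  proof (rule ccontr)
    assume nz: "L g \<noteq> 0"
    \<comment> \<open>Small enough to keep |K| \<epsilon> below half of |L g|; the added 1 keeps the
      denominator positive.\<close>
    define \<epsilon> where "\<epsilon> = norm (L g) / (2 * (\<bar>K\<bar> + 1))"
    have \<epsilon>: "0 < \<epsilon>" using nz by (simp add: \<epsilon>_def add_nonneg_pos)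
    have "isCont g p" using smooth_continuous[OF Cc_infty_smooth[OF g(1)], of UNIV]
      by (simp add: continuous_on_eq_continuous_at)
    then have "\<exists>d>0. \<forall>y. dist y p < d \<longrightarrow> dist (g y) (g p) < \<epsilon>"
      using \<epsilon> unfolding continuous_at_eps_delta by blast
    then obtain d where d: "0 < d" "\<And>y. dist p y < d \<Longrightarrow> norm (g y) < \<epsilon>"
      using g(2) by (auto simp: dist_commute)
    have d2: "0 < d / 2" using d by simp
    let ?h = "\<lambda>x. g x * (1 - plateau p (d / 2) x)" and ?k = "\<lambda>x. g x * plateau p (d / 2) x"
    have h: "?h \<in> Cc_infty \<Omega>" and k: "?k \<in> Cc_infty \<Omega>"
      by (intro Cc_infty_mult g(1) smooth_diff smooth_const smooth_plateau)+
    have "L ?h = 0"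
      by (rule near[OF h d2]) (simp add: plateau_eq_1[OF d2])
    moreover have "L (\<lambda>x. ?h x + ?k x) = L ?h + L ?k" by (rule add[OF h k])
    moreover have "(\<lambda>x. ?h x + ?k x) = g" by (auto simp: algebra_simps)
    ultimately have Lg: "L g = L ?k" by simp
    have "norm (L ?k) \<le> K * \<epsilon>"
    proof (rule bound[OF k])
      fix x
      show "norm (g x * plateau p (d / 2) x) \<le> \<epsilon>"
      proof (cases "dist p x < d")
        case True
        have "norm (g x) * norm (plateau p (d / 2) x) \<le> \<epsilon> * 1"
          using d(2)[OF True] \<epsilon> by (intro mult_mono norm_plateau_le) auto
        then show ?thesis by (simp add: norm_mult)
      qed (use \<epsilon> plateau_eq_0[OF d2, of p x] in auto)
    qed
    moreover have "K * \<epsilon> \<le> \<bar>K\<bar> * \<epsilon>" using \<epsilon> by (intro mult_right_mono) auto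
    moreover have "\<bar>K\<bar> * \<epsilon> < (\<bar>K\<bar> + 1) * \<epsilon>" using \<epsilon> by (simp add: algebra_simps)
    moreover have "(\<bar>K\<bar> + 1) * \<epsilon> = norm (L g) / 2" by (simp add: \<epsilon>_def field_simps add_nonneg_eq_0_iff)
    ultimately have "norm (L g) < norm (L g) / 2" unfolding Lg by linarith
    then show False using norm_ge_zero[of "L g"] by linarith
  qed
  obtain r where r: "0 < r" "cball p r \<subseteq> \<Omega>" using \<Omega> p(1) open_contains_cball by blast
  define e where "e x = plateau p (r / 2) x" for x
  have e: "e \<in> Cc_infty \<Omega>" "e p = 1"
    using plateau_Cc_infty[of "r/2" p \<Omega>] r by (auto simp: e_def[abs_def] plateau_eq_1)
  have rep: "L f = L e * f p" if f: "f \<in> Cc_infty \<Omega>" for f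
  proof -
    have m: "(\<lambda>x. - f p * e x) \<in> Cc_infty \<Omega>"
      using Cc_infty_mult[OF e(1) smooth_const[of "- f p"]] by (simp add: mult.commute)
    have "L (\<lambda>x. f x + - f p * e x) = 0"
      by (rule zero[OF Cc_infty_add[OF f m]]) (simp add: e(2))
    then show ?thesis using add[OF f m] scale[OF e(1), of "- f p"] by (simp add: mult.commute)
  qed
  show ?thesis
  proof (rule that[OF p(1) _ rep])
    show "L e \<noteq> 0" using rep nz by force
  qed
qed

section \<open>Passage from test functions to their uniform limits\<close>

lemma apply_Bcontfun: "f \<in> Cc_infty \<Omega> \<Longrightarrow> apply_bcontfun (Bcontfun f) = f"
  by (simp add: Bcontfun_inverse Cc_infty_bcontfun)

lemma Bcontfun_C_0: "f \<in> Cc_infty \<Omega> \<Longrightarrow> Bcontfun f \<in> C_0 \<Omega>"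
  using closure_subset unfolding C_0_def by (force simp: apply_Bcontfun)

lemma C_0_diff:
  assumes "f \<in> C_0 \<Omega>" "apply_bcontfun g \<in> Cc_infty \<Omega>"
  shows "f - g \<in> C_0 \<Omega>"
proof -
  let ?S = "{f. apply_bcontfun f \<in> Cc_infty \<Omega>}"
  obtain F where F: "\<And>n. F n \<in> ?S" "F \<longlonglongrightarrow> f"
    using assms(1) unfolding C_0_def closure_sequential by blast
  have "apply_bcontfun (F n - g) = (\<lambda>x. apply_bcontfun (F n) x - apply_bcontfun g x)" for n
    by (simp add: fun_eq_iff)
  then have "F n - g \<in> ?S" for n
    using F(1)[of n] assms(2) Cc_infty_diff by auto
  moreover have "(\<lambda>n. F n - g) \<longlonglongrightarrow> f - g"
    using F(2) by (intro tendsto_intros)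
  ultimately show ?thesis unfolding C_0_def closure_sequential by (intro exI[of _ "\<lambda>n. F n - g"]) auto
qed

text \<open>U is additive on \<open>C_0\<close> only, so the estimate of U f - U (F n) requires f -
  F n to lie in that space. The purpose is to transfer identities known for test functions to all of
  \<open>C_0\<close>, pointwise.\<close>

lemma operator_approx:
  assumes U: "bounded_operator_C_0 \<Omega>\<^sub>1 \<Omega>\<^sub>2 U" and f: "f \<in> C_0 \<Omega>\<^sub>1"
  obtains F where "\<And>n. F n \<in> Cc_infty \<Omega>\<^sub>1" "\<And>x. (\<lambda>n. F n x) \<longlonglongrightarrow> apply_bcontfun f x"
    "\<And>x. (\<lambda>n. apply_bcontfun (U (Bcontfun (F n))) x) \<longlonglongrightarrow> apply_bcontfun (U f) x"
proof -
  obtain F where F: "\<And>n. apply_bcontfun (F n) \<in> Cc_infty \<Omega>\<^sub>1" "F \<longlonglongrightarrow> f"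
    using f unfolding C_0_def closure_sequential by auto
  obtain K where K: "\<And>f. f \<in> C_0 \<Omega>\<^sub>1 \<Longrightarrow> norm (U f) \<le> K * norm f"
    using U unfolding bounded_operator_C_0_def by blast
  have FC: "F n \<in> C_0 \<Omega>\<^sub>1" for n
    using Bcontfun_C_0[OF F(1)[of n]] by (simp add: apply_bcontfun_inverse)
  have pt: "(\<lambda>n. apply_bcontfun (G n) x) \<longlonglongrightarrow> apply_bcontfun g x" if "G \<longlonglongrightarrow> g" for G :: "nat \<Rightarrow> 'a \<Rightarrow>\<^sub>C complex" and g x
  proof (rule metric_tendsto_imp_tendsto[OF that])
    show "\<forall>\<^sub>F n in sequentially. dist (apply_bcontfun (G n) x) (apply_bcontfun g x) \<le> dist (G n) g"
      by (intro always_eventually allI dist_bounded)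
  qed
  have "norm (U (F n) - U f) \<le> K * norm (f - F n)" for n
  proof -
    have "U (f - F n + F n) = U (f - F n) + U (F n)"
      using U C_0_diff[OF f F(1)[of n]] FC[of n] unfolding bounded_operator_C_0_def by blast
    then have "U f - U (F n) = U (f - F n)" by simp
    then show ?thesis using K[OF C_0_diff[OF f F(1)[of n]]] by (simp add: norm_minus_commute)
  qed
  moreover have "(\<lambda>n. K * norm (f - F n)) \<longlonglongrightarrow> 0"
    using F(2) by (auto intro!: tendsto_eq_intros)
  ultimately have "(\<lambda>n. U (F n) - U f) \<longlonglongrightarrow> 0"
    by (rule Lim_null_comparison[OF always_eventually, OF allI])
  then have "(\<lambda>n. U (F n)) \<longlonglongrightarrow> U f" by (rule LIM_zero_cancel)
  from pt[OF this] pt[OF F(2)] show ?thesis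
    by (intro that[of "\<lambda>n. apply_bcontfun (F n)"]) (auto simp: F(1) apply_bcontfun_inverse)
qed

text \<open>At each x the functional f \<mapsto> U f x is bounded and preserves disjointness, so it
  is zero or a multiple of a point evaluation. In the first case w x = 0 and \<tau> x is arbitrary,
  which is why the localisation of x and \<tau> x is claimed for w x \<noteq> 0.\<close>

lemma operator_representation:
  assumes \<Omega>: "open \<Omega>\<^sub>1" and U: "bounded_operator_C_0 \<Omega>\<^sub>1 \<Omega>\<^sub>2 U"
    and disj: "\<And>f g. f \<in> C_0 \<Omega>\<^sub>1 \<Longrightarrow> g \<in> C_0 \<Omega>\<^sub>1 \<Longrightarrow>
         (\<forall>x\<in>\<Omega>\<^sub>1. apply_bcontfun f x * apply_bcontfun g x = 0) \<Longrightarrow>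
         (\<forall>x\<in>\<Omega>\<^sub>2. apply_bcontfun (U f) x * apply_bcontfun (U g) x = 0)"
  obtains \<tau> w where
    "\<And>f x. f \<in> C_0 \<Omega>\<^sub>1 \<Longrightarrow> apply_bcontfun (U f) x = w x * apply_bcontfun f (\<tau> x)"
    "\<And>x. w x \<noteq> 0 \<Longrightarrow> x \<in> \<Omega>\<^sub>2 \<and> \<tau> x \<in> \<Omega>\<^sub>1"
proof -
  note UU = U[unfolded bounded_operator_C_0_def]
  obtain K where K: "\<And>f. f \<in> C_0 \<Omega>\<^sub>1 \<Longrightarrow> norm (U f) \<le> K * norm f" using UU by blast
  have "\<exists>w p. (\<forall>f\<in>C_0 \<Omega>\<^sub>1. apply_bcontfun (U f) x = w * apply_bcontfun f p) \<and> (w \<noteq> 0 \<longrightarrow> x \<in> \<Omega>\<^sub>2 \<and> p \<in> \<Omega>\<^sub>1)" for x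
  proof (cases "\<exists>f\<in>C_0 \<Omega>\<^sub>1. apply_bcontfun (U f) x \<noteq> 0")
    case True
    then obtain f where f: "f \<in> C_0 \<Omega>\<^sub>1" "apply_bcontfun (U f) x \<noteq> 0" by blast
    have x: "x \<in> \<Omega>\<^sub>2" using f UU C_0_vanishes_outside by blast
    let ?L = "\<lambda>f. apply_bcontfun (U (Bcontfun f)) x"
    have "\<exists>p w. p \<in> \<Omega>\<^sub>1 \<and> w \<noteq> 0 \<and> (\<forall>f\<in>Cc_infty \<Omega>\<^sub>1. ?L f = w * f p)"
    \<comment> \<open>The bound has to be monotone in B, hence the absolute value of K.\<close>
    proof (rule disjointness_preserving_functional[OF \<Omega>, of ?L "\<bar>K\<bar>"])
      fix f g assume fg: "f \<in> Cc_infty \<Omega>\<^sub>1" "g \<in> Cc_infty \<Omega>\<^sub>1"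
      have "Bcontfun (\<lambda>x. f x + g x) = Bcontfun f + Bcontfun g"
        by (rule bcontfun_eqI) (simp add: apply_Bcontfun[OF Cc_infty_add[OF fg]] apply_Bcontfun[OF fg(1)] apply_Bcontfun[OF fg(2)])
      then show "?L (\<lambda>x. f x + g x) = ?L f + ?L g"
        using UU Bcontfun_C_0[OF fg(1)] Bcontfun_C_0[OF fg(2)] by simp
      show "?L f * ?L g = 0" if "\<And>x. f x * g x = 0"
        using disj[OF Bcontfun_C_0[OF fg(1)] Bcontfun_C_0[OF fg(2)]] that x
        by (simp add: apply_Bcontfun[OF fg(1)] apply_Bcontfun[OF fg(2)])
    next
      fix f c assume f: "f \<in> Cc_infty \<Omega>\<^sub>1"
      show "?L (\<lambda>x. c * f x) = c * ?L f"
      proof -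
        have "(\<lambda>x. c * f x) \<in> Cc_infty \<Omega>\<^sub>1"
          using Cc_infty_mult[OF f smooth_const[of c]] by (simp add: mult.commute)
        from apply_Bcontfun[OF this] have "Bcontfun (\<lambda>x. c * f x) = cscale c (Bcontfun f)"
          by (intro bcontfun_eqI) (simp add: apply_Bcontfun[OF f])
        then show ?thesis using UU Bcontfun_C_0[OF f] by simp
      qed
    next
      fix f B assume f: "f \<in> Cc_infty \<Omega>\<^sub>1" "\<And>x. norm (f x) \<le> B"
      have "norm (?L f) \<le> norm (U (Bcontfun f))" by (rule norm_bounded)
      also have "\<dots> \<le> \<bar>K\<bar> * norm (Bcontfun f)"
        using K[OF Bcontfun_C_0[OF f(1)]] mult_right_mono[OF abs_ge_self[of K] norm_ge_zero[of "Bcontfun f"]] by simp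
      also have "norm (Bcontfun f) \<le> B"
        by (rule norm_bound) (simp add: apply_Bcontfun[OF f(1)] f(2))
      then have "\<bar>K\<bar> * norm (Bcontfun f) \<le> \<bar>K\<bar> * B" by (intro mult_left_mono) auto
      finally show "norm (?L f) \<le> \<bar>K\<bar> * B" by simp
    next
      obtain F where F: "\<And>n. F n \<in> Cc_infty \<Omega>\<^sub>1" "(\<lambda>n. ?L (F n)) \<longlonglongrightarrow> apply_bcontfun (U f) x"
        using operator_approx[OF U f(1)] by metis
      show "\<exists>f\<in>Cc_infty \<Omega>\<^sub>1. ?L f \<noteq> 0"
      proof (rule ccontr)
        assume "\<not> ?thesis"
        then have "?L (F n) = 0" for n using F(1) by blast
        then have "(\<lambda>n. ?L (F n)) \<longlonglongrightarrow> 0" by simp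
        then show False using LIMSEQ_unique[OF F(2)] f(2) by blast
      qed
    qed blast
    then obtain p w where p: "p \<in> \<Omega>\<^sub>1" "w \<noteq> 0" "\<And>f. f \<in> Cc_infty \<Omega>\<^sub>1 \<Longrightarrow> ?L f = w * f p" by blast
    have "apply_bcontfun (U f) x = w * apply_bcontfun f p" if f: "f \<in> C_0 \<Omega>\<^sub>1" for f
    proof -
      obtain F where F: "\<And>n. F n \<in> Cc_infty \<Omega>\<^sub>1" "(\<lambda>n. ?L (F n)) \<longlonglongrightarrow> apply_bcontfun (U f) x"
        "(\<lambda>n. F n p) \<longlonglongrightarrow> apply_bcontfun f p"
        using operator_approx[OF U f] by metis
      have "(\<lambda>n. ?L (F n)) \<longlonglongrightarrow> w * apply_bcontfun f p"
        using F(3) by (simp add: p(3) F(1) tendsto_mult_left)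
      then show ?thesis using F(2) LIMSEQ_unique by blast
    qed
    then show ?thesis using p x by blast
  next
    case False
    then show ?thesis by (intro exI[of _ 0]) auto
  qed
  then obtain w \<tau> where "\<And>x f. f \<in> C_0 \<Omega>\<^sub>1 \<Longrightarrow> apply_bcontfun (U f) x = w x * apply_bcontfun f (\<tau> x)"
    "\<And>x. w x \<noteq> 0 \<Longrightarrow> x \<in> \<Omega>\<^sub>2 \<and> \<tau> x \<in> \<Omega>\<^sub>1" by metis
  then show ?thesis using that by blast
qed

section \<open>Local structure of intertwining operators\<close>

text \<open>Two integrations by parts move both derivatives onto a bump, whose second derivatives
  are symmetric by their explicit formula; testing with the bumps at x gives equality at x.\<close>

lemma partial_deriv_commute:
  assumes f: "smooth f" and a: "a \<in> Basis" and b: "b \<in> Basis"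
  shows "partial_deriv a (partial_deriv b f) x = partial_deriv b (partial_deriv a f) x"
proof -
  have sm: "smooth (partial_deriv a (partial_deriv b f))" "smooth (partial_deriv b (partial_deriv a f))"
    by (intro smooth_partial_deriv f a b)+
  have "partial_deriv a (partial_deriv b f) x - partial_deriv b (partial_deriv a f) x = 0"
  proof (rule du_Bois_Reymond[of UNIV "\<lambda>x. partial_deriv a (partial_deriv b f) x - partial_deriv b (partial_deriv a f) x"])
    show "continuous_on UNIV (\<lambda>x. partial_deriv a (partial_deriv b f) x - partial_deriv b (partial_deriv a f) x)"
      by (intro smooth_continuous smooth_diff sm)
    fix r :: real assume r: "0 < r"
    let ?\<phi> = "bump x r"
    have \<phi>: "?\<phi> \<in> Cc_infty UNIV" by (rule bump_Cc_infty[OF r]) simp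
    have ibp: "(\<integral>z. partial_deriv c (partial_deriv d f) z * ?\<phi> z \<partial>lborel) =
        (\<integral>z. f z * partial_deriv d (partial_deriv c ?\<phi>) z \<partial>lborel)"
      if "c \<in> Basis" "d \<in> Basis" for c d
      using integration_by_parts[OF \<phi> smooth_partial_deriv[OF f that(2)] that(1)]
        integration_by_parts[OF Cc_infty_partial_deriv[OF \<phi> that(1)] f that(2)] by simp
    have "partial_deriv a (partial_deriv b ?\<phi>) z = partial_deriv b (partial_deriv a ?\<phi>) z" for z
      by (simp add: partial_deriv2_bump inner_commute algebra_simps)
    then have "(\<integral>z. partial_deriv a (partial_deriv b f) z * ?\<phi> z \<partial>lborel) =
        (\<integral>z. partial_deriv b (partial_deriv a f) z * ?\<phi> z \<partial>lborel)"
      using ibp[OF a b] ibp[OF b a] by simp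
    moreover have "integrable lborel (\<lambda>z. partial_deriv a (partial_deriv b f) z * ?\<phi> z)"
      "integrable lborel (\<lambda>z. partial_deriv b (partial_deriv a f) z * ?\<phi> z)"
      using Cc_infty_integrable_mult[OF \<phi> smooth_continuous[OF sm(1)]]
        Cc_infty_integrable_mult[OF \<phi> smooth_continuous[OF sm(2)]]
      by (simp_all add: mult.commute)
    ultimately show "(\<integral>z. (partial_deriv a (partial_deriv b f) z - partial_deriv b (partial_deriv a f) z) * ?\<phi> z \<partial>lborel) = 0"
      by (simp add: left_diff_distrib)
  qed auto
  then show ?thesis by simp
qed

lemma linear_sum_inner: "linear (\<lambda>v. \<Sum>i\<in>S. (v \<bullet> i) *\<^sub>R q i)"
  by (intro linearI) (simp_all add: inner_add_left scaleR_left_distrib sum.distrib scaleR_right.sum)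

text \<open>For a square matrix one orthogonality relation implies the other: the linear map P with
  entries a preserves inner products, so it is injective, hence surjective, and the preimages of b
  and c have the coordinates a b i and a c i.\<close>

lemma orthonormal_rows_imp_columns:
  fixes a :: "'a::euclidean_space \<Rightarrow> 'a \<Rightarrow> real"
  assumes rows: "\<And>i j. i \<in> Basis \<Longrightarrow> j \<in> Basis \<Longrightarrow> (\<Sum>b\<in>Basis. a b i * a b j) = i \<bullet> j"
    and "b \<in> Basis" "c \<in> Basis"
  shows "(\<Sum>i\<in>Basis. a b i * a c i) = b \<bullet> c"
proof -
  define P where "P v = (\<Sum>i\<in>Basis. (v \<bullet> i) *\<^sub>R (\<Sum>b\<in>Basis. a b i *\<^sub>R b))" for v :: 'a
  have P_inner: "P v \<bullet> d = (\<Sum>i\<in>Basis. (v \<bullet> i) * a d i)" if "d \<in> Basis" for v d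
    unfolding P_def by (subst inner_sum_left) (simp add: that)
  have lin: "linear P"
    unfolding P_def by (rule linear_sum_inner)
  have P_Basis: "P i \<bullet> d = a d i" if "d \<in> Basis" "i \<in> Basis" for i d
  proof -
    have "P i \<bullet> d = (\<Sum>j\<in>Basis. (i \<bullet> j) *\<^sub>R a d j)" using P_inner[OF that(1)] by simp
    then show ?thesis using sum_Basis_inner[OF that(2), of "\<lambda>j. a d j"] by simp
  qed
  have PP: "P i \<bullet> P j = i \<bullet> j" if "i \<in> Basis" "j \<in> Basis" for i j
    using rows[OF that] that by (simp add: euclidean_inner[of "P i" "P j"] P_Basis)
  have Pv: "P v = (\<Sum>i\<in>Basis. (v \<bullet> i) *\<^sub>R P i)" for v
  proof -
    have "P v = P (\<Sum>i\<in>Basis. (v \<bullet> i) *\<^sub>R i)" by (simp add: euclidean_representation)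
    then show ?thesis by (simp add: linear_sum[OF lin] linear_cmul[OF lin])
  qed
  have Pj: "P v \<bullet> P j = v \<bullet> j" if "j \<in> Basis" for v j
  proof -
    have "P v \<bullet> P j = (\<Sum>i\<in>Basis. (v \<bullet> i) * (P i \<bullet> P j))"
      by (subst Pv) (simp add: inner_sum_left)
    also have "\<dots> = (\<Sum>i\<in>Basis. (j \<bullet> i) *\<^sub>R (v \<bullet> i))"
      using that by (intro sum.cong) (auto simp: PP inner_commute)
    also have "\<dots> = v \<bullet> j" by (rule sum_Basis_inner[OF that])
    finally show ?thesis .
  qed
  have inner: "P v \<bullet> P u = v \<bullet> u" for v u
  proof -
    have "P v \<bullet> P u = (\<Sum>i\<in>Basis. (u \<bullet> i) * (P v \<bullet> P i))"
      by (subst Pv[of u]) (simp add: inner_sum_right)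
    also have "\<dots> = v \<bullet> u"
      by (simp add: Pj euclidean_inner[of v u] mult.commute)
    finally show ?thesis .
  qed
  have "inj P"
    unfolding linear_injective_0[OF lin] using inner by (metis inner_eq_zero_iff)
  then have "surj P" using linear_injective_imp_surjective[OF lin] by simp
  then obtain v u where vu: "P v = b" "P u = c" by (metis surjD)
  have "v \<bullet> i = a b i" "u \<bullet> i = a c i" if "i \<in> Basis" for i
    using inner[of v i] inner[of u i] vu P_Basis that assms(2,3) by (simp_all add: inner_commute)
  then show ?thesis
    using inner[of v u] vu by (simp add: euclidean_inner[of v u])
qed

lemma partial_deriv_eq_const_on:
  assumes "open B" "smooth f" "\<And>y. y \<in> B \<Longrightarrow> f y = c" "x \<in> B"
  shows "partial_deriv b f x = 0"
  using partial_deriv_cong_open[OF assms(1,3) smooth_const assms(4), where b = b]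
  by (simp add: partial_deriv_const)

lemma smooth_const_on_ball:
  assumes "smooth f" "\<And>y b. y \<in> ball x r \<Longrightarrow> b \<in> Basis \<Longrightarrow> partial_deriv b f y = 0" "y \<in> ball x r"
  shows "f y = f x"
proof -
  have "\<exists>c. \<forall>y\<in>ball x r. f y = c"
  proof (rule has_derivative_zero_constant[OF convex_ball])
    fix y assume "y \<in> ball x r"
    then show "(f has_derivative (\<lambda>h. 0)) (at y within ball x r)"
      using smooth_has_derivative_sum[OF assms(1), of y] assms(2)
      by (auto intro: has_derivative_at_withinI)
  qed
  moreover have "x \<in> ball x r" using assms(3) by (metis centre_in_ball dist_not_less_zero mem_ball order.strict_trans1 not_le zero_le_dist)
  ultimately show ?thesis using assms(3) by metis
qed

text \<open>W and T are smooth on the whole space but represent w and the coordinates of \<tau> only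
  on the ball. Expanding the equations by the product rule, all terms with the Laplacian of T_j
  cancel, and what remains is the product of the gradients of T_i and T_j being i \<bullet> j,
  multiplied by W, which has no zeros on the ball.\<close>

lemma local_rigidity:
  fixes W :: "'a::euclidean_space \<Rightarrow> complex" and T :: "'a \<Rightarrow> 'a \<Rightarrow> complex" and \<tau> :: "'a \<Rightarrow> 'a"
  assumes s: "0 < s" and W: "smooth W" "\<And>x. x \<in> ball x0 s \<Longrightarrow> W x \<noteq> 0"
    and T: "\<And>i. i \<in> Basis \<Longrightarrow> smooth (T i)"
    and T\<tau>: "\<And>x i. x \<in> ball x0 s \<Longrightarrow> i \<in> Basis \<Longrightarrow> T i x = complex_of_real (\<tau> x \<bullet> i)"
    and harm: "\<And>x. x \<in> ball x0 s \<Longrightarrow> laplacian W x = 0"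
      "\<And>x i. x \<in> ball x0 s \<Longrightarrow> i \<in> Basis \<Longrightarrow> laplacian (\<lambda>x. W x * T i x) x = 0"
    and quad: "\<And>x i j. x \<in> ball x0 s \<Longrightarrow> i \<in> Basis \<Longrightarrow> j \<in> Basis \<Longrightarrow>
      laplacian (\<lambda>x. (W x * T i x) * T j x) x = 2 * complex_of_real (i \<bullet> j) * W x"
  shows "\<exists>A v. orthogonal_transformation A \<and> (\<forall>x\<in>ball x0 s. \<tau> x = A x + v \<and> W x = W x0)"
proof -
  let ?B = "ball x0 s"
  let ?D = "\<lambda>b i. partial_deriv b (T i)"
  have sD: "smooth (?D b i)" if "b \<in> Basis" "i \<in> Basis" for b i
    by (intro smooth_partial_deriv T that)
  have sDD: "smooth (partial_deriv c (?D b i))" if "b \<in> Basis" "i \<in> Basis" "c \<in> Basis" for b c i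
    by (intro smooth_partial_deriv T that)
  \<comment> \<open>The product rule for W T_j with W harmonic. The relation cancels terms in
    \<open>rows\<close> and, once the second derivatives of T are gone, forces the gradient of W to
    vanish.\<close>
  have h1: "W x * laplacian (T j) x + 2 * (\<Sum>b\<in>Basis. partial_deriv b W x * ?D b j x) = 0"
    if "x \<in> ?B" "j \<in> Basis" for x j
    using harm(2)[OF that] harm(1)[OF that(1)] laplacian_mult[OF W(1) T[OF that(2)], of x] by simp
  have rows: "(\<Sum>b\<in>Basis. ?D b i x * ?D b j x) = complex_of_real (i \<bullet> j)"
    if x: "x \<in> ?B" and i: "i \<in> Basis" and j: "j \<in> Basis" for x i j
  proof -
    have "laplacian (\<lambda>x. (W x * T i x) * T j x) x = (W x * T i x) * laplacian (T j) x +
        2 * (\<Sum>b\<in>Basis. (W x * ?D b i x + partial_deriv b W x * T i x) * ?D b j x)"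
      using laplacian_mult[OF smooth_mult[OF W(1) T[OF i]] T[OF j], of x] harm(2)[OF x i]
      by (simp add: partial_deriv_mult[OF W(1) T[OF i]])
    also have "(\<Sum>b\<in>Basis. (W x * ?D b i x + partial_deriv b W x * T i x) * ?D b j x) =
        W x * (\<Sum>b\<in>Basis. ?D b i x * ?D b j x) + T i x * (\<Sum>b\<in>Basis. partial_deriv b W x * ?D b j x)"
      by (simp add: sum.distrib sum_distrib_left algebra_simps)
    finally have "2 * complex_of_real (i \<bullet> j) * W x =
        T i x * (W x * laplacian (T j) x + 2 * (\<Sum>b\<in>Basis. partial_deriv b W x * ?D b j x)) +
        2 * W x * (\<Sum>b\<in>Basis. ?D b i x * ?D b j x)"
      using quad[OF x i j] by (simp add: algebra_simps)
    then show ?thesis using h1[OF x j] W(2)[OF x] by simp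
  qed
  \<comment> \<open>The orthogonality lemma is about real matrices. On the ball T is real, so the
    imaginary parts of its derivatives vanish there.\<close>
  have real: "?D b i x = complex_of_real (Re (?D b i x))" if x: "x \<in> ?B" and i: "i \<in> Basis" and b: "b \<in> Basis" for b i x
  proof -
    let ?L = "\<lambda>z. complex_of_real (Im z)"
    have L: "bounded_linear ?L"
      using bounded_linear_compose[OF bounded_linear_of_real bounded_linear_Im] .
    have "partial_deriv b (\<lambda>y. ?L (T i y)) x = 0"
      by (rule partial_deriv_eq_const_on[OF open_ball smooth_bounded_linear[OF L T[OF i]] _ x]) (simp add: T\<tau>[OF _ i])
    then have "Im (?D b i x) = 0"
      by (simp add: partial_deriv_bounded_linear[OF L T[OF i]])
    then show ?thesis by (simp add: complex_eq_iff)
  qed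
  have cols: "(\<Sum>i\<in>Basis. ?D b i x * ?D c i x) = complex_of_real (b \<bullet> c)"
    if x: "x \<in> ?B" and b: "b \<in> Basis" and c: "c \<in> Basis" for x b c
  proof -
    have "(\<Sum>b\<in>Basis. Re (?D b i x) * Re (?D b j x)) = i \<bullet> j" if "i \<in> Basis" "j \<in> Basis" for i j
    proof -
      have "complex_of_real (\<Sum>b\<in>Basis. Re (?D b i x) * Re (?D b j x)) = (\<Sum>b\<in>Basis. ?D b i x * ?D b j x)"
        unfolding of_real_sum of_real_mult using real[OF x] that by (intro sum.cong) auto
      then show ?thesis using rows[OF x that] by (simp only: of_real_eq_iff)
    qed
    from orthonormal_rows_imp_columns[where a = "\<lambda>b i. Re (?D b i x)", OF this b c]
    have "complex_of_real (\<Sum>i\<in>Basis. Re (?D b i x) * Re (?D c i x)) = complex_of_real (b \<bullet> c)" by simp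
    moreover have "complex_of_real (\<Sum>i\<in>Basis. Re (?D b i x) * Re (?D c i x)) = (\<Sum>i\<in>Basis. ?D b i x * ?D c i x)"
      unfolding of_real_sum of_real_mult using real[OF x _ b] real[OF x _ c] by (intro sum.cong) auto
    ultimately show ?thesis by simp
  qed
  \<comment> \<open>These coefficients are symmetric in $l,k$ and antisymmetric in $k,j$, hence zero.\<close>
  define \<Gamma> where "\<Gamma> x l k j = (\<Sum>i\<in>Basis. partial_deriv l (?D k i) x * ?D j i x)" for x l k j
  have \<Gamma>1: "\<Gamma> x l k j = - \<Gamma> x l j k" if x: "x \<in> ?B" and "l \<in> Basis" "k \<in> Basis" "j \<in> Basis" for x l k j
  proof -
    have "partial_deriv l (\<lambda>y. \<Sum>i\<in>Basis. ?D k i y * ?D j i y) x = 0"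
      by (rule partial_deriv_eq_const_on[OF open_ball _ cols[OF _ that(3,4)] x])
        (intro smooth_sum smooth_mult sD that finite_Basis)
    moreover have "((\<lambda>y. \<Sum>i\<in>Basis. ?D k i y * ?D j i y) has_derivative
        (\<lambda>h. \<Sum>i\<in>Basis. ?D k i x * frechet_derivative (?D j i) (at x) h + frechet_derivative (?D k i) (at x) h * ?D j i x)) (at x)"
      by (intro has_derivative_sum has_derivative_mult smooth_has_derivative sD that)
    ultimately have "(\<Sum>i\<in>Basis. ?D k i x * partial_deriv l (?D j i) x + partial_deriv l (?D k i) x * ?D j i x) = 0"
      using partial_deriv_eq by (metis (no_types, lifting) partial_deriv_def sum.cong)
    then show ?thesis
      by (simp add: \<Gamma>_def sum.distrib add_eq_0_iff mult.commute)
  qed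
  have \<Gamma>2: "\<Gamma> x l k j = \<Gamma> x k l j" if "l \<in> Basis" "k \<in> Basis" for x l k j
    unfolding \<Gamma>_def using partial_deriv_commute[OF T that] by (intro sum.cong) auto
  \<comment> \<open>Exchanging the last two and the first two indices alternately, three times each,
    returns to the same coefficient with three changes of sign.\<close>
  have \<Gamma>0: "\<Gamma> x l k j = 0" if "x \<in> ?B" "l \<in> Basis" "k \<in> Basis" "j \<in> Basis" for x l k j
    using \<Gamma>1[of x l k j] \<Gamma>2[of l j x k] \<Gamma>1[of x j l k] \<Gamma>2[of j k x l] \<Gamma>1[of x k j l] \<Gamma>2[of k l x j] that
    by simp
  \<comment> \<open>Contracting \<Gamma> with the orthogonal matrix of first derivatives recovers
    the second derivatives themselves.\<close>
  have DD0: "partial_deriv l (?D k m) x = 0"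
    if x: "x \<in> ?B" and l: "l \<in> Basis" and k: "k \<in> Basis" and m: "m \<in> Basis" for x l k m
  proof -
    have "0 = (\<Sum>j\<in>Basis. \<Gamma> x l k j * ?D j m x)" using \<Gamma>0[OF x l k] by simp
    also have "\<dots> = (\<Sum>i\<in>Basis. partial_deriv l (?D k i) x * (\<Sum>j\<in>Basis. ?D j i x * ?D j m x))"
      unfolding \<Gamma>_def sum_distrib_right sum_distrib_left by (subst sum.swap) (simp add: mult.assoc)
    also have "\<dots> = (\<Sum>i\<in>Basis. (m \<bullet> i) *\<^sub>R partial_deriv l (?D k i) x)"
      using rows[OF x _ m] by (intro sum.cong) (auto simp: scaleR_conv_of_real inner_commute)
    also have "\<dots> = partial_deriv l (?D k m) x" by (rule sum_Basis_inner[OF m])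
    finally show ?thesis by simp
  qed
  define a where "a b i = Re (?D b i x0)" for b i
  have x0: "x0 \<in> ?B" using s by simp
  have Dconst: "?D b i x = complex_of_real (a b i)" if x: "x \<in> ?B" and "b \<in> Basis" "i \<in> Basis" for x b i
    using smooth_const_on_ball[OF sD[OF that(2,3)] DD0 x] real[OF x0 that(3,2)] that
    by (simp add: a_def)
  \<comment> \<open>Without second derivatives, \<open>h1\<close> says that the matrix of first
    derivatives annihilates the gradient of W, and \<open>cols\<close> inverts this matrix.\<close>
  have W0: "partial_deriv c W x = 0" if x: "x \<in> ?B" and c: "c \<in> Basis" for x c
  proof -
    have "(\<Sum>b\<in>Basis. partial_deriv b W x * ?D b j x) = 0" if j: "j \<in> Basis" for j
      using h1[OF x j] DD0[OF x _ _ j] by (simp add: laplacian_def)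
    then have "0 = (\<Sum>j\<in>Basis. (\<Sum>b\<in>Basis. partial_deriv b W x * ?D b j x) * ?D c j x)" by simp
    also have "\<dots> = (\<Sum>b\<in>Basis. partial_deriv b W x * (\<Sum>j\<in>Basis. ?D b j x * ?D c j x))"
      unfolding sum_distrib_right sum_distrib_left by (subst sum.swap) (simp add: mult.assoc)
    also have "\<dots> = (\<Sum>b\<in>Basis. (c \<bullet> b) *\<^sub>R partial_deriv b W x)"
      using cols[OF x _ c] by (intro sum.cong) (auto simp: scaleR_conv_of_real inner_commute)
    also have "\<dots> = partial_deriv c W x" by (rule sum_Basis_inner[OF c])
    finally show ?thesis by simp
  qed
  define A where "A h = (\<Sum>b\<in>Basis. (h \<bullet> b) *\<^sub>R (\<Sum>i\<in>Basis. a b i *\<^sub>R i))" for h :: 'a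
  have A_inner: "A h \<bullet> i = (\<Sum>b\<in>Basis. (h \<bullet> b) * a b i)" if "i \<in> Basis" for h i
    unfolding A_def by (subst inner_sum_left) (simp add: that)
  have lin: "linear A"
    unfolding A_def by (rule linear_sum_inner)
  have acols: "(\<Sum>i\<in>Basis. a b i * a c i) = b \<bullet> c" if "b \<in> Basis" "c \<in> Basis" for b c
  proof -
    have "complex_of_real (\<Sum>i\<in>Basis. a b i * a c i) = complex_of_real (b \<bullet> c)"
      using cols[OF x0 that] Dconst[OF x0] that by simp
    then show ?thesis by (simp only: of_real_eq_iff)
  qed
  have "A h \<bullet> A h = h \<bullet> h" for h
  proof -
    have "A h \<bullet> A h = (\<Sum>i\<in>Basis. (\<Sum>b\<in>Basis. (h \<bullet> b) * a b i) * (\<Sum>c\<in>Basis. (h \<bullet> c) * a c i))"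
      by (simp add: euclidean_inner[of "A h" "A h"] A_inner)
    also have "\<dots> = (\<Sum>i\<in>Basis. \<Sum>b\<in>Basis. \<Sum>c\<in>Basis. (h \<bullet> b) * (h \<bullet> c) * (a b i * a c i))"
      by (simp add: sum_product algebra_simps)
    also have "\<dots> = (\<Sum>b\<in>Basis. \<Sum>c\<in>Basis. \<Sum>i\<in>Basis. (h \<bullet> b) * (h \<bullet> c) * (a b i * a c i))"
      by (subst sum.swap, rule sum.cong[OF refl], subst sum.swap) simp
    also have "\<dots> = (\<Sum>b\<in>Basis. \<Sum>c\<in>Basis. (h \<bullet> b) * (h \<bullet> c) * (b \<bullet> c))"
      by (simp add: acols flip: sum_distrib_left)
    also have "\<dots> = (\<Sum>b\<in>Basis. (h \<bullet> b) * (\<Sum>c\<in>Basis. (b \<bullet> c) *\<^sub>R (h \<bullet> c)))"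
      by (simp add: sum_distrib_left algebra_simps)
    also have "\<dots> = (\<Sum>b\<in>Basis. (h \<bullet> b) * (h \<bullet> b))"
      using sum_Basis_inner[of _ "\<lambda>c. h \<bullet> c"] by (intro sum.cong) auto
    also have "\<dots> = h \<bullet> h" by (simp add: euclidean_inner[of h h])
    finally show ?thesis .
  qed
  then have orth: "orthogonal_transformation A"
    using lin by (simp add: orthogonal_transformation norm_eq_sqrt_inner)
  have \<tau>: "\<tau> x = A x + (\<tau> x0 - A x0)" if x: "x \<in> ?B" for x
  proof (rule euclidean_eqI)
    fix i :: 'a assume i: "i \<in> Basis"
    \<comment> \<open>The deviation of T_i from its linear part. The adjoint turns A y \<bullet> i
      into the inner product of y with a fixed vector, the form in which smoothness is
      known.\<close>
    define G where "G y = T i y - complex_of_real (A y \<bullet> i)" for y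
    have Ai: "A y \<bullet> i = y \<bullet> adjoint A i" for y
      using adjoint_works[OF lin] by (simp add: inner_commute)
    have Gs: "smooth G"
      unfolding G_def Ai by (intro smooth_diff T i smooth_inner)
    have "partial_deriv b G y = 0" if y: "y \<in> ?B" and b: "b \<in> Basis" for y b
    proof -
      have "(G has_derivative (\<lambda>h. frechet_derivative (T i) (at y) h - complex_of_real (h \<bullet> adjoint A i))) (at y)"
        unfolding G_def Ai
        by (intro has_derivative_diff smooth_has_derivative T i) (auto intro!: derivative_eq_intros)
      from partial_deriv_eq[OF this, of b]
      have "partial_deriv b G y = ?D b i y - complex_of_real (A b \<bullet> i)"
        by (simp add: partial_deriv_def Ai)
      moreover have "A b \<bullet> i = a b i"
        using A_inner[OF i, of b] sum_Basis_inner[OF b, of "\<lambda>c. a c i"] by simp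
      ultimately show ?thesis using Dconst[OF y b i] by simp
    qed
    from smooth_const_on_ball[OF Gs this x]
    have "complex_of_real (\<tau> x \<bullet> i - A x \<bullet> i) = complex_of_real (\<tau> x0 \<bullet> i - A x0 \<bullet> i)"
      using T\<tau>[OF x i] T\<tau>[OF x0 i] by (simp add: G_def)
    then have "\<tau> x \<bullet> i - A x \<bullet> i = \<tau> x0 \<bullet> i - A x0 \<bullet> i" by (simp only: of_real_eq_iff)
    then show "\<tau> x \<bullet> i = (A x + (\<tau> x0 - A x0)) \<bullet> i" by (simp add: inner_add_left inner_diff_left)
  qed
  show ?thesis
    using orth \<tau> smooth_const_on_ball[OF W(1) W0] by blast
qed

text \<open>A bridge from the measure in the definitions to \<open>lborel\<close>, for which
  translation invariance and Fubini's theorem are at hand; the integrands are extended by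
  zero.\<close>

lemma integral_lebesgue_on_eq_lborel:
  fixes f :: "'a::euclidean_space \<Rightarrow> 'b::{banach, second_countable_topology}"
  assumes "open \<Omega>" "f \<in> borel_measurable borel" "\<And>x. x \<notin> \<Omega> \<Longrightarrow> f x = 0"
  shows "integral\<^sup>L (lebesgue_on \<Omega>) f = integral\<^sup>L lborel f"
proof -
  have "integral\<^sup>L (lebesgue_on \<Omega>) f = (\<integral>x. indicator \<Omega> x *\<^sub>R f x \<partial>lebesgue)"
    using assms(1) by (intro integral_restrict_space) auto
  also have "\<dots> = integral\<^sup>L lebesgue f"
    using assms(3) by (intro Bochner_Integration.integral_cong) (auto simp: indicator_def)
  also have "\<dots> = integral\<^sup>L lborel f"
    using assms(2) by (intro integral_completion) simp
  finally show ?thesis .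
qed

text \<open>All information about w and \<tau> sits in the continuous functions w (F \<circ> \<tau>)
  with F a test function. For F a cut-off of 1 or of a coordinate, Weyl's lemma makes them smooth
  near x0. Quotients then give smooth representatives of the coordinates of \<tau>, and the weak
  equations become the pointwise ones of \<open>local_rigidity\<close>.\<close>

lemma operator_locally_rigid:
  fixes \<Omega>\<^sub>1 \<Omega>\<^sub>2 :: "'a::euclidean_space set"
  assumes \<Omega>: "open \<Omega>\<^sub>1" "open \<Omega>\<^sub>2" "bounded \<Omega>\<^sub>2"
    and U: "bounded_operator_C_0 \<Omega>\<^sub>1 \<Omega>\<^sub>2 U"
    and lap: "\<And>f. f \<in> Cc_infty \<Omega>\<^sub>1 \<Longrightarrow>
         distr_laplacian \<Omega>\<^sub>2 (apply_bcontfun (U (Bcontfun f)))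
                            (apply_bcontfun (U (Bcontfun (laplacian f))))"
    and rep: "\<And>f x. f \<in> C_0 \<Omega>\<^sub>1 \<Longrightarrow> apply_bcontfun (U f) x = w x * apply_bcontfun f (\<tau> x)"
    and w: "\<And>x. w x \<noteq> 0 \<Longrightarrow> x \<in> \<Omega>\<^sub>2 \<and> \<tau> x \<in> \<Omega>\<^sub>1"
    and x0: "w x0 \<noteq> 0"
  shows "\<exists>A v s. 0 < s \<and> orthogonal_transformation A \<and>
    (\<forall>x\<in>ball x0 s. w x = w x0 \<and> \<tau> x = A x + v)"
proof -
  define u where "u F = apply_bcontfun (U (Bcontfun F))" for F
  have u: "u F x = w x * F (\<tau> x)" if "F \<in> Cc_infty \<Omega>\<^sub>1" for F x
    using rep[OF Bcontfun_C_0[OF that]] by (simp add: u_def apply_Bcontfun[OF that])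
  have u_cont: "continuous_on UNIV (u F)" for F
    unfolding u_def by (rule continuous_on_apply_bcontfun)
  have u_meas: "u F \<in> borel_measurable borel" for F
    by (rule borel_measurable_continuous_onI[OF u_cont])
  have u_int: "integrable lborel (u F)" if "F \<in> Cc_infty \<Omega>\<^sub>1" for F
  proof (rule integrable_compact_support[OF u_cont])
    show "compact (closure \<Omega>\<^sub>2)" using \<Omega>(3) by (simp add: compact_closure)
    show "u F x = 0" if "x \<notin> closure \<Omega>\<^sub>2" for x
      using u[OF \<open>F \<in> Cc_infty \<Omega>\<^sub>1\<close>, of x] w[of x] that closure_subset[of \<Omega>\<^sub>2] by auto
  qed
  have u_lap: "(\<integral>x. u F x * laplacian \<phi> x \<partial>lborel) = (\<integral>x. u (laplacian F) x * \<phi> x \<partial>lborel)"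
    if F: "F \<in> Cc_infty \<Omega>\<^sub>1" and \<phi>: "\<phi> \<in> Cc_infty \<Omega>\<^sub>2" for F \<phi>
  proof -
    have to_lborel: "(\<integral>x. u G x * \<psi> x \<partial>lebesgue_on \<Omega>\<^sub>2) = (\<integral>x. u G x * \<psi> x \<partial>lborel)"
      if \<psi>: "\<psi> \<in> Cc_infty \<Omega>\<^sub>2" for G \<psi>
    proof (rule integral_lebesgue_on_eq_lborel[OF \<Omega>(2)])
      show "(\<lambda>x. u G x * \<psi> x) \<in> borel_measurable borel"
        using u_meas borel_measurable_continuous_onI[OF smooth_continuous[OF Cc_infty_smooth[OF \<psi>]]]
        by (rule borel_measurable_times)
    qed (simp add: Cc_infty_vanishes[OF \<psi>])
    show ?thesis
      using lap[OF F, unfolded distr_laplacian_def, rule_format, OF \<phi>]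
        to_lborel[OF \<phi>] to_lborel[OF laplacian_Cc_infty[OF \<phi>]]
      by (simp add: u_def)
  qed
  define p where "p = \<tau> x0"
  have p: "p \<in> \<Omega>\<^sub>1" using w[OF x0] by (simp add: p_def)
  obtain R where R: "0 < R" "cball p (2 * R) \<subseteq> \<Omega>\<^sub>1"
  proof -
    obtain e where "0 < e" "cball p e \<subseteq> \<Omega>\<^sub>1" using \<Omega>(1) p open_contains_cball by blast
    then show ?thesis using that[of "e / 2"] by simp
  qed
  have R': "cball p R \<subseteq> \<Omega>\<^sub>1" using R subset_cball[of R "2 * R" p] by auto
  define cut where "cut = plateau p R"
  have cut: "cut \<in> Cc_infty \<Omega>\<^sub>1" unfolding cut_def by (rule plateau_Cc_infty[OF R])
  have b: "bump p R \<in> Cc_infty \<Omega>\<^sub>1" by (rule bump_Cc_infty[OF R(1) R'])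
  \<comment> \<open>The set where a continuous function is non-zero is open. On it w is non-zero and
    \<tau> stays in the ball where the cut-off equals 1, so x0 has a neighbourhood with control of
    \<tau> although \<tau> is not known to be continuous.\<close>
  define M where "M = {x. u (bump p R) x \<noteq> 0}"
  have M_open: "open M"
    unfolding M_def using u_cont by (intro open_Collect_neq continuous_on_const) auto
  have M: "w x \<noteq> 0" "\<tau> x \<in> ball p R" if "x \<in> M" for x
    using that u[OF b, of x] bump_eq_0_iff[OF R(1), of p "\<tau> x"] by (auto simp: M_def)
  have x0M: "x0 \<in> M"
    using x0 bump_eq_0_iff[OF R(1), of p p] R(1) by (simp add: M_def u[OF b] flip: p_def)
  have M\<Omega>: "M \<subseteq> \<Omega>\<^sub>2" using M(1) w by blast
  define F where "F q = (\<lambda>y. cut y * q y)" for q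
  have F: "F q \<in> Cc_infty \<Omega>\<^sub>1" if "smooth q" for q
    unfolding F_def by (rule Cc_infty_mult[OF cut that])
  have Fu: "u (F q) x = w x * q (\<tau> x)" if "smooth q" "x \<in> M" for q x
    using u[OF F[OF that(1)], of x] M(2)[OF that(2)] plateau_eq_1[OF R(1), of p "\<tau> x"]
    by (simp add: F_def cut_def)
  \<comment> \<open>The cut-off is invisible on M: it is 1 on the whole open ball into which \<tau>
    maps M, so its derivatives vanish at \<tau> x.\<close>
  have Fu_lap: "u (laplacian (F q)) x = w x * laplacian q (\<tau> x)" if "smooth q" "x \<in> M" for q x
  proof -
    have "laplacian (F q) (\<tau> x) = laplacian q (\<tau> x)"
      by (rule laplacian_cong_open[OF open_ball[of p R] _ that(1) M(2)[OF that(2)]])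
        (simp add: F_def cut_def plateau_eq_1[OF R(1)])
    then show ?thesis using u[OF laplacian_Cc_infty[OF F[OF that(1)]], of x] by simp
  qed
  have F_lap: "(\<integral>x. u (F q) x * laplacian \<phi> x \<partial>lborel) = (\<integral>x. w x * laplacian q (\<tau> x) * \<phi> x \<partial>lborel)"
    if "smooth q" "\<phi> \<in> Cc_infty M" for q \<phi>
  proof -
    have "u (laplacian (F q)) x * \<phi> x = w x * laplacian q (\<tau> x) * \<phi> x" for x
      using Fu_lap[OF that(1), of x] Cc_infty_vanishes[OF that(2), of x] by (cases "x \<in> M") auto
    then have "(\<lambda>x. u (laplacian (F q)) x * \<phi> x) = (\<lambda>x. w x * laplacian q (\<tau> x) * \<phi> x)" by blast
    then show ?thesis
      using u_lap[OF F[OF that(1)] Cc_infty_mono[OF M\<Omega> that(2)]] by simp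
  qed
  \<comment> \<open>Twice the radius leaves room for a ball of radius \<rho> around every point
    within \<rho> of x0, as Weyl's lemma requires.\<close>
  obtain \<rho> where \<rho>: "0 < \<rho>" "cball x0 (2 * \<rho>) \<subseteq> M"
  proof -
    obtain e where "0 < e" "cball x0 e \<subseteq> M" using M_open x0M open_contains_cball by blast
    then show ?thesis using that[of "e / 2"] by simp
  qed
  have regular: "\<exists>v. smooth v \<and> (\<forall>x\<in>ball x0 \<rho>. v x = w x * q (\<tau> x))"
    if q: "smooth q" "\<And>y. laplacian q y = 0" for q
  proof -
    obtain v where v: "smooth v" "\<And>x. cball x \<rho> \<subseteq> M \<Longrightarrow> v x = u (F q) x"
      using Weyl_lemma[OF u_int[OF F[OF q(1)]] u_cont \<rho>(1), of M] F_lap[OF q(1)] q(2) by auto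
    have "v x = w x * q (\<tau> x)" if x: "x \<in> ball x0 \<rho>" for x
    proof -
      have "cball x \<rho> \<subseteq> cball x0 (2 * \<rho>)"
      proof
        fix z assume "z \<in> cball x \<rho>"
        then show "z \<in> cball x0 (2 * \<rho>)" using x dist_triangle[of x0 z x] by simp
      qed
      then have c: "cball x \<rho> \<subseteq> M" using \<rho>(2) by blast
      then have "x \<in> M" using \<rho>(1) by (metis centre_in_cball less_imp_le subsetD)
      then show ?thesis using v(2)[OF c] Fu[OF q(1)] by simp
    qed
    then show ?thesis using v(1) by blast
  qed
  define X where "X i y = complex_of_real (y \<bullet> i)" for i y :: 'a
  have X: "smooth (X i)" "\<And>y. laplacian (X i) y = 0" for i
    unfolding X_def by (simp_all add: smooth_inner laplacian_inner)
  have lapXX: "laplacian (\<lambda>y. X i y * X j y) y = 2 * complex_of_real (i \<bullet> j)" for i j y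
  proof -
    have "(\<Sum>b\<in>Basis. partial_deriv b (X i) y * partial_deriv b (X j) y) = complex_of_real (i \<bullet> j)"
      unfolding X_def partial_deriv_inner
      by (simp add: euclidean_inner[of i j] inner_commute flip: of_real_mult of_real_sum)
    then show ?thesis by (simp add: laplacian_mult[OF X(1) X(1)] X(2))
  qed
  obtain W where W: "smooth W" "\<And>x. x \<in> ball x0 \<rho> \<Longrightarrow> W x = w x"
    using regular[of "\<lambda>y. 1", OF smooth_const laplacian_const] by auto
  have "\<exists>v. smooth v \<and> (\<forall>x\<in>ball x0 \<rho>. v x = w x * X i (\<tau> x))" for i
    using regular[of "X i"] X by simp
  then obtain P where P: "\<And>i. smooth (P i)" "\<And>i x. x \<in> ball x0 \<rho> \<Longrightarrow> P i x = w x * X i (\<tau> x)"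
    by metis
  have Wx0: "W x0 \<noteq> 0" using W(2)[of x0] x0 \<rho>(1) by simp
  have "isCont W x0" using smooth_continuous[OF W(1), of UNIV] by (simp add: continuous_on_eq_continuous_at)
  then have "\<exists>d>0. \<forall>y. dist y x0 < d \<longrightarrow> dist (W y) (W x0) < norm (W x0)"
    using Wx0 unfolding continuous_at_eps_delta by simp
  then obtain d where d: "0 < d" "\<And>y. dist x0 y < d \<Longrightarrow> norm (W y - W x0) < norm (W x0)"
    by (auto simp: dist_commute dist_norm)
  define s where "s = min (d / 2) \<rho>"
  have s: "0 < s" "2 * s \<le> d" "s \<le> \<rho>" using d \<rho> by (auto simp: s_def)
  \<comment> \<open>W is known to be non-zero only near x0, whereas \<open>smooth_inverse\<close>
    asks for a function without zeros on the whole space. Blending W into the constant W x0, within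
    a region where the two differ by less than |W x0|, produces one.\<close>
  define g where "g x = W x0 + plateau x0 s x * (W x - W x0)" for x
  have g_smooth: "smooth g"
    unfolding g_def by (intro smooth_add smooth_mult smooth_diff smooth_const smooth_plateau W)
  have g_nz: "g x \<noteq> 0" for x
  proof (cases "dist x0 x < 2 * s")
    case True
    have "norm (plateau x0 s x) * norm (W x - W x0) \<le> 1 * norm (W x - W x0)"
      by (intro mult_right_mono norm_plateau_le) auto
    also have "\<dots> < norm (W x0)" using d(2)[of x] True s(2) by simp
    finally have "norm (plateau x0 s x * (W x - W x0)) < norm (W x0)" by (simp add: norm_mult)
    then show ?thesis unfolding g_def
      by (metis add.commute add_eq_0_iff less_irrefl norm_minus_cancel)
  qed (simp add: g_def plateau_eq_0[OF s(1)] Wx0)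
  have g_W: "g x = W x" if "x \<in> ball x0 s" for x
    using that plateau_eq_1[OF s(1), of x0 x] by (simp add: g_def)
  define T where "T i x = P i x * inverse (g x)" for i x
  have T: "smooth (T i)" for i
    unfolding T_def by (intro smooth_mult P smooth_inverse g_smooth g_nz)
  have in\<rho>: "x \<in> ball x0 \<rho>" and inM: "x \<in> M" if "x \<in> ball x0 s" for x
    using that s(1,3) \<rho> by (auto intro!: subsetD[OF \<rho>(2)])
  have T\<tau>: "T i x = complex_of_real (\<tau> x \<bullet> i)" if "x \<in> ball x0 s" for i x
    using that P(2)[OF in\<rho>[OF that], of i] W(2)[OF in\<rho>[OF that]] g_nz[of x] g_W[OF that]
    by (simp add: T_def X_def field_simps)
  have sM: "ball x0 s \<subseteq> M" using inM by blast
  \<comment> \<open>Once both sides have smooth representatives, the weak equation can be integrated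
    by parts back and then holds pointwise.\<close>
  have classical: "laplacian f x = h x"
    if f: "smooth f" "smooth h" "smooth q" and fq: "\<And>x. x \<in> ball x0 s \<Longrightarrow> f x = w x * q (\<tau> x)"
      and hq: "\<And>x. x \<in> ball x0 s \<Longrightarrow> h x = w x * laplacian q (\<tau> x)" and x: "x \<in> ball x0 s" for f h q x
  proof -
    have "laplacian f x - h x = 0"
    proof (rule du_Bois_Reymond[OF open_ball, of "\<lambda>x. laplacian f x - h x" x x0 s])
      show "continuous_on UNIV (\<lambda>x. laplacian f x - h x)"
        by (intro smooth_continuous smooth_diff smooth_laplacian f)
      show "x \<in> ball x0 s" by (rule x)
      fix r assume r: "0 < r" "cball x r \<subseteq> ball x0 s"
      let ?\<phi> = "bump x r"
      have \<phi>: "?\<phi> \<in> Cc_infty (ball x0 s)" by (rule bump_Cc_infty[OF r])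
      have "(\<integral>z. laplacian f z * ?\<phi> z \<partial>lborel) = (\<integral>z. f z * laplacian ?\<phi> z \<partial>lborel)"
        by (rule integral_mult_laplacian[OF \<phi> f(1), symmetric])
      also have "\<dots> = (\<integral>z. u (F q) z * laplacian ?\<phi> z \<partial>lborel)"
      proof (rule Bochner_Integration.integral_cong[OF refl])
        fix z
        show "f z * laplacian ?\<phi> z = u (F q) z * laplacian ?\<phi> z"
          using fq[of z] Fu[OF f(3) inM, of z] Cc_infty_vanishes[OF laplacian_Cc_infty[OF \<phi>], of z]
          by (cases "z \<in> ball x0 s") auto
      qed
      also have "\<dots> = (\<integral>z. w z * laplacian q (\<tau> z) * ?\<phi> z \<partial>lborel)"
        by (rule F_lap[OF f(3) Cc_infty_mono[OF sM \<phi>]])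
      also have "\<dots> = (\<integral>z. h z * ?\<phi> z \<partial>lborel)"
      proof (rule Bochner_Integration.integral_cong[OF refl])
        fix z
        show "w z * laplacian q (\<tau> z) * ?\<phi> z = h z * ?\<phi> z"
          using hq[of z] Cc_infty_vanishes[OF \<phi>, of z] by (cases "z \<in> ball x0 s") auto
      qed
      finally have eq: "(\<integral>z. laplacian f z * ?\<phi> z \<partial>lborel) = (\<integral>z. h z * ?\<phi> z \<partial>lborel)" .
      have "integrable lborel (\<lambda>z. laplacian f z * ?\<phi> z)" "integrable lborel (\<lambda>z. h z * ?\<phi> z)"
        using Cc_infty_integrable_mult[OF \<phi> smooth_continuous[OF smooth_laplacian[OF f(1)]]]
          Cc_infty_integrable_mult[OF \<phi> smooth_continuous[OF f(2)]] by (simp_all add: mult.commute)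
      then show "(\<integral>z. (laplacian f z - h z) * ?\<phi> z \<partial>lborel) = 0"
        using eq by (simp add: left_diff_distrib)
    qed
    then show ?thesis by simp
  qed
  have WT: "W x * T i x = w x * X i (\<tau> x)" if "x \<in> ball x0 s" for i x
    using T\<tau>[OF that] W(2)[OF in\<rho>[OF that]] by (simp add: X_def)
  have "\<exists>A v. orthogonal_transformation A \<and> (\<forall>x\<in>ball x0 s. \<tau> x = A x + v \<and> W x = W x0)"
  proof (rule local_rigidity[OF s(1) W(1)])
    show "W x \<noteq> 0" if "x \<in> ball x0 s" for x using g_nz[of x] g_W[OF that] by simp
    show "T i x = complex_of_real (\<tau> x \<bullet> i)" if "x \<in> ball x0 s" for x i using T\<tau>[OF that] .
    show "laplacian W x = 0" if "x \<in> ball x0 s" for x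
      by (rule classical[where q = "\<lambda>y. 1", OF W(1) smooth_const smooth_const _ _ that])
        (use W(2)[OF in\<rho>] laplacian_const in auto)
    show "laplacian (\<lambda>x. W x * T i x) x = 0" if "x \<in> ball x0 s" for x i
      by (rule classical[where q = "X i", OF smooth_mult[OF W(1) T] smooth_const X(1) _ _ that])
        (auto simp: WT X(2))
    show "laplacian (\<lambda>x. (W x * T i x) * T j x) x = 2 * complex_of_real (i \<bullet> j) * W x"
      if "x \<in> ball x0 s" for x i j
    proof (rule classical[where q = "\<lambda>y. X i y * X j y", OF smooth_mult[OF smooth_mult[OF W(1) T] T]
          smooth_mult[OF smooth_const W(1)] smooth_mult[OF X(1) X(1)] _ _ that])
      fix x assume x: "x \<in> ball x0 s"
      show "W x * T i x * T j x = w x * (X i (\<tau> x) * X j (\<tau> x))"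
        using WT[OF x] T\<tau>[OF x] by (simp add: X_def)
      show "2 * complex_of_real (i \<bullet> j) * W x = w x * laplacian (\<lambda>y. X i y * X j y) (\<tau> x)"
        using W(2)[OF in\<rho>[OF x]] by (simp add: lapXX)
    qed
  qed (rule T)
  then obtain A v where A: "orthogonal_transformation A" "\<And>x. x \<in> ball x0 s \<Longrightarrow> \<tau> x = A x + v"
    "\<And>x. x \<in> ball x0 s \<Longrightarrow> W x = W x0" by blast
  have "w x = w x0 \<and> \<tau> x = A x + v" if "x \<in> ball x0 s" for x
    using A(2,3)[OF that] W(2)[OF in\<rho>[OF that]] W(2)[of x0] \<rho>(1) by simp
  then show ?thesis using s(1) A(1) by blast
qed

section \<open>Global structure\<close>

lemma affine_eq_on_open:
  fixes A B :: "'a::euclidean_space \<Rightarrow> 'a"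
  assumes "linear A" "linear B" "open S" "y \<in> S" "\<And>x. x \<in> S \<Longrightarrow> A x + v = B x + v'"
  shows "A x + v = B x + v'"
proof -
  obtain e where e: "0 < e" "ball y e \<subseteq> S" using assms(3,4) open_contains_ball by blast
  have D: "A h = B h" for h
  proof (cases "h = 0")
    case True
    then show ?thesis using assms(1,2) by (simp add: linear_0)
  next
    case False
    define t where "t = e / (2 * norm h)"
    have t: "t > 0" using e False by (simp add: t_def)
    have "y + t *\<^sub>R h \<in> ball y e" using e False by (simp add: t_def dist_norm)
    then have "A (y + t *\<^sub>R h) + v = B (y + t *\<^sub>R h) + v'" using assms(5) e(2) by blast
    then have "(A y + v) + t *\<^sub>R A h = (B y + v') + t *\<^sub>R B h"
      by (simp add: linear_add[OF assms(1)] linear_add[OF assms(2)] linear_cmul[OF assms(1)]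
          linear_cmul[OF assms(2)] add_ac)
    then have "t *\<^sub>R A h = t *\<^sub>R B h" unfolding assms(5)[OF assms(4)] by simp
    then show ?thesis using t by simp
  qed
  show ?thesis using assms(5)[OF assms(4)] D by simp
qed

text \<open>The delicate point is that the image of V is relatively closed in \<Omega>_1. At a limit
  point q of V with w q \<noteq> 0, local rigidity applies and the two affine maps agree on an open
  set. If w q = 0 and q has its image p in \<Omega>_1, a bump f at p gives a contradiction: along V
  the values of U f tend to w x0 times f(p), which is not 0, while U f vanishes at q.\<close>

lemma operator_global_structure:
  fixes \<Omega>\<^sub>1 \<Omega>\<^sub>2 :: "'a::euclidean_space set"
  assumes \<Omega>: "open \<Omega>\<^sub>1" "open \<Omega>\<^sub>2" "bounded \<Omega>\<^sub>2" "connected \<Omega>\<^sub>1"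
    and U: "bounded_operator_C_0 \<Omega>\<^sub>1 \<Omega>\<^sub>2 U"
    and lap: "\<And>f. f \<in> Cc_infty \<Omega>\<^sub>1 \<Longrightarrow>
         distr_laplacian \<Omega>\<^sub>2 (apply_bcontfun (U (Bcontfun f)))
                            (apply_bcontfun (U (Bcontfun (laplacian f))))"
    and rep: "\<And>f x. f \<in> C_0 \<Omega>\<^sub>1 \<Longrightarrow> apply_bcontfun (U f) x = w x * apply_bcontfun f (\<tau> x)"
    and w: "\<And>x. w x \<noteq> 0 \<Longrightarrow> x \<in> \<Omega>\<^sub>2 \<and> \<tau> x \<in> \<Omega>\<^sub>1"
    and x0: "w x0 \<noteq> 0"
  shows "\<exists>A v. orthogonal_transformation A \<and>
    (\<forall>x. A x + v \<in> \<Omega>\<^sub>1 \<longrightarrow> x \<in> \<Omega>\<^sub>2 \<and> w x = w x0 \<and> \<tau> x = A x + v)"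
proof -
  have rigid: "\<exists>A v s. 0 < s \<and> orthogonal_transformation A \<and>
    (\<forall>x\<in>ball q s. w x = w q \<and> \<tau> x = A x + v)" if "w q \<noteq> 0" for q
    by (rule operator_locally_rigid[where \<Omega>\<^sub>1 = \<Omega>\<^sub>1 and \<Omega>\<^sub>2 = \<Omega>\<^sub>2 and U = U and w = w and \<tau> = \<tau>])
      (fact \<Omega> U lap rep w that)+
  obtain A v s where A: "0 < s" "orthogonal_transformation A"
    "\<And>x. x \<in> ball x0 s \<Longrightarrow> w x = w x0 \<and> \<tau> x = A x + v"
    using rigid[OF x0] by blast
  define V where "V = {x. w x \<noteq> 0 \<and> (\<exists>S. open S \<and> x \<in> S \<and> (\<forall>y\<in>S. \<tau> y = A y + v \<and> w y = w x0))}"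
  have V: "\<tau> x = A x + v" "w x = w x0" if "x \<in> V" for x
    using that by (auto simp: V_def)
  have V_open: "open V"
    unfolding open_subopen[of V]
  proof
    fix x assume "x \<in> V"
    then obtain S where "open S" "x \<in> S" "\<forall>y\<in>S. \<tau> y = A y + v \<and> w y = w x0"
      by (auto simp: V_def)
    then show "\<exists>T. open T \<and> x \<in> T \<and> T \<subseteq> V"
      using x0 by (intro exI[of _ S]) (auto simp: V_def)
  qed
  have V_closed: "q \<in> V" if q: "q \<in> closure V" "w q \<noteq> 0" for q
  proof -
    obtain B v' r where B: "0 < r" "orthogonal_transformation B"
      "\<And>x. x \<in> ball q r \<Longrightarrow> w x = w q \<and> \<tau> x = B x + v'"
      using rigid[OF q(2)] by blast
    obtain y where y: "y \<in> V" "dist y q < r" using q(1) B(1) closure_approachable by blast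
    have yS: "y \<in> V \<inter> ball q r" using y by (simp add: dist_commute)
    have "A x + v = B x + v'" for x
    proof (rule affine_eq_on_open[where A = A and B = B, OF _ _ open_Int[OF V_open open_ball[of q r]] yS])
      show "linear A" "linear B" using A(2) B(2) orthogonal_transformation_linear by blast+
      show "A x + v = B x + v'" if "x \<in> V \<inter> ball q r" for x using that V(1)[of x] B(3)[of x] by simp
    qed
    moreover have "w q = w x0" using B(3)[of y] V(2)[OF y(1)] yS by simp
    ultimately have "\<tau> y = A y + v \<and> w y = w x0" if "y \<in> ball q r" for y
      using B(3)[OF that] by simp
    moreover have "q \<in> ball q r" using B(1) by simp
    ultimately show "q \<in> V"
      unfolding V_def using q(2) open_ball[of q r] by blast
  qed
  define A' where "A' = inv A"
  have bij: "bij A" by (rule orthogonal_transformation_bij[OF A(2)])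
  have A'1: "A (A' x) = x" for x unfolding A'_def by (rule surj_f_inv_f[OF bij_is_surj[OF bij]])
  have A'2: "A' (A x) = x" for x unfolding A'_def by (rule inv_f_f[OF bij_is_inj[OF bij]])
  have A'3: "linear A'" unfolding A'_def
    by (rule orthogonal_transformation_linear[OF orthogonal_transformation_inv[OF A(2)]])
  note A' = A'1 A'2 A'3
  \<comment> \<open>The inverse of the rigid motion. Connectedness is known for \<Omega>_1, so V and
    the complement of its closure are pulled back to \<Omega>_1 by g.\<close>
  define g where "g p = A' (p - v)" for p
  have g: "A (g p) + v = p" "g (A x + v) = x" for p x by (simp_all add: g_def A')
  have g_cont: "continuous_on UNIV g"
    unfolding g_def using A'(3)
    by (intro continuous_on_compose2[OF linear_continuous_on[OF linear_conv_bounded_linear[THEN iffD1, OF A'(3)], of UNIV]]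
        continuous_intros) auto
  have not_closure: "g p \<notin> closure V" if p: "p \<in> \<Omega>\<^sub>1" "g p \<notin> V" for p
  proof
    assume c: "g p \<in> closure V"
    then have w0: "w (g p) = 0" using V_closed p(2) by blast
    obtain r where r: "0 < r" "cball p r \<subseteq> \<Omega>\<^sub>1" using \<Omega>(1) p(1) open_contains_cball by blast
    have b: "bump p r \<in> Cc_infty \<Omega>\<^sub>1" by (rule bump_Cc_infty[OF r])
    obtain X where X: "\<And>n. X n \<in> V" "X \<longlonglongrightarrow> g p" using c closure_sequential by blast
    let ?u = "apply_bcontfun (U (Bcontfun (bump p r)))"
    have u: "?u x = w x * bump p r (\<tau> x)" for x
      using rep[OF Bcontfun_C_0[OF b]] by (simp add: apply_Bcontfun[OF b])
    have "isCont ?u (g p)"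
      using continuous_on_eq_continuous_at[OF open_UNIV] continuous_on_apply_bcontfun by blast
    then have "(\<lambda>n. ?u (X n)) \<longlonglongrightarrow> ?u (g p)" using X(2) isCont_tendsto_compose by blast
    then have 1: "(\<lambda>n. w x0 * bump p r (A (X n) + v)) \<longlonglongrightarrow> 0"
      using V[OF X(1)] w0 by (simp add: u)
    have "isCont (\<lambda>x. w x0 * bump p r (A x + v)) (g p)"
      using smooth_continuous[OF smooth_mult[OF smooth_const smooth_affine[OF orthogonal_transformation_linear[OF A(2)] Cc_infty_smooth[OF b]]], of UNIV]
      by (simp add: continuous_on_eq_continuous_at)
    then have "(\<lambda>n. w x0 * bump p r (A (X n) + v)) \<longlonglongrightarrow> w x0 * bump p r (A (g p) + v)"
      using X(2) isCont_tendsto_compose[of "g p" "\<lambda>x. w x0 * bump p r (A x + v)"] by blast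
    from LIMSEQ_unique[OF 1 this] have "w x0 * bump p r p = 0" by (simp only: g(1))
    then show False using x0 bump_eq_0_iff[OF r(1), of p p] r(1) by simp
  qed
  have "g -` V \<inter> \<Omega>\<^sub>1 = {} \<or> g -` (- closure V) \<inter> \<Omega>\<^sub>1 = {}"
  proof (rule connectedD[OF \<Omega>(4)])
    show "open (g -` V)" "open (g -` (- closure V))"
      using g_cont V_open by (auto intro!: open_vimage)
    show "g -` V \<inter> g -` (- closure V) \<inter> \<Omega>\<^sub>1 = {}" using closure_subset[of V] by auto
    show "\<Omega>\<^sub>1 \<subseteq> g -` V \<union> g -` (- closure V)" using not_closure by auto
  qed
  moreover have "A x0 + v \<in> g -` V \<inter> \<Omega>\<^sub>1"
  proof -
    have "x0 \<in> ball x0 s" using A(1) by simp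
    moreover have "\<forall>y\<in>ball x0 s. \<tau> y = A y + v \<and> w y = w x0" using A(3) by blast
    ultimately have "x0 \<in> V" unfolding V_def using open_ball[of x0 s] x0 by blast
    then show ?thesis using V(1)[of x0] w[OF x0] g(2)[of x0] by simp
  qed
  ultimately have sub: "g -` (- closure V) \<inter> \<Omega>\<^sub>1 = {}" by blast
  have "x \<in> \<Omega>\<^sub>2 \<and> w x = w x0 \<and> \<tau> x = A x + v" if "A x + v \<in> \<Omega>\<^sub>1" for x
  proof -
    have "x \<in> V"
      using not_closure[OF that] sub that g(2)[of x] by auto
    then show ?thesis using V w[of x] x0 by auto
  qed
  then show ?thesis using A(2) by blast
qed

text \<open>A boundary point may lie on the graph itself, where the strict inequality just fails. A
  small step in the direction -e keeps the base point of the graph and leads strictly below it, and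
  the points strictly below the graph form an open set.\<close>

lemma lipschitz_boundary_exterior:
  assumes \<Omega>: "lipschitz_boundary \<Omega>" and x: "x \<notin> \<Omega>" and N: "open N" "x \<in> N"
  obtains G where "open G" "G \<noteq> {}" "G \<subseteq> N" "G \<inter> \<Omega> = {}"
proof (cases "x \<in> closure \<Omega>")
  case False
  show ?thesis
    by (rule that[of "N - closure \<Omega>"]) (use N False closure_subset in auto)
next
  case True
  then have "x \<in> frontier \<Omega>" using x interior_subset by (auto simp: frontier_def)
  then obtain e \<gamma> L r where e: "norm e = 1" "0 < r" "L-lipschitz_on {y. y \<bullet> e = 0} \<gamma>"
    "\<Omega> \<inter> ball x r = {y \<in> ball x r. \<gamma> (y - (y \<bullet> e) *\<^sub>R e) < y \<bullet> e}"
    using \<Omega> unfolding lipschitz_boundary_def by blast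
  have ee: "e \<bullet> e = 1" using e(1) by (simp add: norm_eq_1)
  let ?\<pi> = "\<lambda>y. y - (y \<bullet> e) *\<^sub>R e"
  have cont: "continuous_on UNIV (\<lambda>y. \<gamma> (?\<pi> y))"
    by (rule continuous_on_compose2[OF lipschitz_on_continuous_on[OF e(3)]])
      (auto intro!: continuous_intros simp: inner_diff_left ee)
  define G where "G = N \<inter> ball x r \<inter> {y. y \<bullet> e < \<gamma> (?\<pi> y)}"
  have G_open: "open G"
    unfolding G_def using N(1) cont by (intro open_Int open_ball open_Collect_less continuous_intros)
  obtain d where d: "0 < d" "ball x d \<subseteq> N" using N open_contains_ball by blast
  define t where "t = min d r / 2"
  have t: "0 < t" "t < d" "t < r" using d(1) e(2) by (auto simp: t_def)
  have "x \<notin> {y \<in> ball x r. \<gamma> (?\<pi> y) < y \<bullet> e}" using x e(4) by blast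
  then have "x \<bullet> e \<le> \<gamma> (?\<pi> x)" using e(2) by simp
  moreover have "\<gamma> (?\<pi> (x - t *\<^sub>R e)) = \<gamma> (?\<pi> x)"
    by (rule arg_cong[where f = \<gamma>]) (simp add: inner_diff_left ee algebra_simps)
  moreover have "(x - t *\<^sub>R e) \<bullet> e = x \<bullet> e - t" by (simp add: inner_diff_left ee)
  ultimately have "(x - t *\<^sub>R e) \<bullet> e < \<gamma> (?\<pi> (x - t *\<^sub>R e))" using t(1) by linarith
  moreover have "dist x (x - t *\<^sub>R e) = t" using t(1) e(1) by (simp add: dist_norm)
  ultimately have "x - t *\<^sub>R e \<in> G" using t d(2) by (auto simp: G_def)
  moreover have "G \<inter> \<Omega> = {}" using e(4) by (force simp: G_def)
  moreover have "G \<subseteq> N" by (auto simp: G_def)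
  ultimately show ?thesis using that G_open by blast
qed

section \<open>Square integrable functions\<close>

lemma L2I: "f \<in> borel_measurable (lebesgue_on \<Omega>) \<Longrightarrow> integrable (lebesgue_on \<Omega>) (\<lambda>x. (norm (f x))\<^sup>2) \<Longrightarrow> f \<in> L2 \<Omega>"
  and L2_measurable: "f \<in> L2 \<Omega> \<Longrightarrow> f \<in> borel_measurable (lebesgue_on \<Omega>)"
  and L2_integrable: "f \<in> L2 \<Omega> \<Longrightarrow> integrable (lebesgue_on \<Omega>) (\<lambda>x. (norm (f x))\<^sup>2)"
  by (simp_all add: L2_def)

lemma L2_norm_sq_nonneg: "0 \<le> L2_norm_sq \<Omega> f"
  by (simp add: L2_norm_sq_def)

lemma L2_integrable_norm_mult:
  assumes "f \<in> L2 \<Omega>" "g \<in> L2 \<Omega>"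
  shows "integrable (lebesgue_on \<Omega>) (\<lambda>x. norm (f x) * norm (g x))"
proof (rule Bochner_Integration.integrable_bound)
  show "integrable (lebesgue_on \<Omega>) (\<lambda>x. (norm (f x))\<^sup>2 + (norm (g x))\<^sup>2)"
    using L2_integrable[OF assms(1)] L2_integrable[OF assms(2)] by simp
  show "(\<lambda>x. norm (f x) * norm (g x)) \<in> borel_measurable (lebesgue_on \<Omega>)"
    using L2_measurable[OF assms(1)] L2_measurable[OF assms(2)] by simp
  have "norm (f x) * norm (g x) \<le> (norm (f x))\<^sup>2 + (norm (g x))\<^sup>2" for x
    using sum_squares_bound[of "norm (f x)" "norm (g x)"] mult_nonneg_nonneg[OF norm_ge_zero[of "f x"] norm_ge_zero[of "g x"]]
    by linarith
  then show "AE x in lebesgue_on \<Omega>. norm (norm (f x) * norm (g x)) \<le> norm ((norm (f x))\<^sup>2 + (norm (g x))\<^sup>2)"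
    by simp
qed

lemma L2_integrable_mult:
  assumes "f \<in> L2 \<Omega>" "g \<in> L2 \<Omega>"
  shows "integrable (lebesgue_on \<Omega>) (\<lambda>x. f x * g x)"
  by (rule Bochner_Integration.integrable_bound[OF L2_integrable_norm_mult[OF assms]])
    (use L2_measurable[OF assms(1)] L2_measurable[OF assms(2)] in \<open>auto simp: norm_mult\<close>)

lemma L2_add:
  assumes "f \<in> L2 \<Omega>" "g \<in> L2 \<Omega>"
  shows "(\<lambda>x. f x + g x) \<in> L2 \<Omega>"
proof (rule L2I)
  show m: "(\<lambda>x. f x + g x) \<in> borel_measurable (lebesgue_on \<Omega>)"
    using L2_measurable[OF assms(1)] L2_measurable[OF assms(2)] by simp
  show "integrable (lebesgue_on \<Omega>) (\<lambda>x. (norm (f x + g x))\<^sup>2)"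
  proof (rule Bochner_Integration.integrable_bound)
    show "integrable (lebesgue_on \<Omega>) (\<lambda>x. 2 * (norm (f x))\<^sup>2 + 2 * (norm (g x))\<^sup>2)"
      using L2_integrable[OF assms(1)] L2_integrable[OF assms(2)] by simp
    have "(norm (f x + g x))\<^sup>2 \<le> 2 * (norm (f x))\<^sup>2 + 2 * (norm (g x))\<^sup>2" for x
    proof -
      have "(norm (f x + g x))\<^sup>2 \<le> (norm (f x) + norm (g x))\<^sup>2"
        by (intro power_mono norm_triangle_ineq) auto
      then show ?thesis using sum_squares_bound[of "norm (f x)" "norm (g x)"] by (simp add: power2_sum)
    qed
    then show "AE x in lebesgue_on \<Omega>. norm ((norm (f x + g x))\<^sup>2) \<le> norm (2 * (norm (f x))\<^sup>2 + 2 * (norm (g x))\<^sup>2)"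
      by simp
  qed (use m in simp)
qed

lemma L2_cmult: "f \<in> L2 \<Omega> \<Longrightarrow> (\<lambda>x. c * f x) \<in> L2 \<Omega>"
  using L2_measurable[of f \<Omega>] L2_integrable[of f \<Omega>]
  by (intro L2I) (simp_all add: norm_mult power_mult_distrib)

lemma L2_diff: "f \<in> L2 \<Omega> \<Longrightarrow> g \<in> L2 \<Omega> \<Longrightarrow> (\<lambda>x. f x - g x) \<in> L2 \<Omega>"
  using L2_add[of f \<Omega> "\<lambda>x. - 1 * g x"] L2_cmult[of g \<Omega> "- 1"] by simp

text \<open>The common source of the Cauchy-Schwarz inequalities below: for L^2, for the mollifier
  as a weight, and for the energy form shifted by a multiple of the norm.\<close>

lemma discriminant_le:
  fixes a b c :: real
  assumes "\<And>t. 0 \<le> a + 2 * t * b + t\<^sup>2 * c" "0 \<le> c"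
  shows "b\<^sup>2 \<le> a * c"
proof (cases "c = 0")
  case True
  have "b = 0"
  proof (rule ccontr)
    assume "b \<noteq> 0"
    \<comment> \<open>At this t the polynomial, linear because c = 0, takes the value -1.\<close>
    then show False using assms(1)[of "- (a + 1) / (2 * b)"] True by (simp add: field_simps)
  qed
  then show ?thesis using True by simp
next
  case False
  then have c: "0 < c" using assms(2) by simp
  have "0 \<le> a + 2 * (- b / c) * b + (- b / c)\<^sup>2 * c" by (rule assms(1))
  also have "\<dots> = a - b\<^sup>2 / c" using c by (simp add: power2_eq_square field_simps)
  finally show ?thesis using c by (simp add: field_simps)
qed

lemma L2_Cauchy_Schwarz:
  assumes "f \<in> L2 \<Omega>" "g \<in> L2 \<Omega>"
  shows "(\<integral>x. norm (f x) * norm (g x) \<partial>lebesgue_on \<Omega>)\<^sup>2 \<le> L2_norm_sq \<Omega> f * L2_norm_sq \<Omega> g"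
proof (rule discriminant_le)
  fix t :: real
  let ?M = "lebesgue_on \<Omega>"
  note i = L2_integrable[OF assms(1)] L2_integrable[OF assms(2)] L2_integrable_norm_mult[OF assms]
  have "0 \<le> (\<integral>x. (norm (f x) + t * norm (g x))\<^sup>2 \<partial>?M)" by simp
  also have "\<dots> = (\<integral>x. (norm (f x))\<^sup>2 + 2 * t * (norm (f x) * norm (g x)) + t\<^sup>2 * (norm (g x))\<^sup>2 \<partial>?M)"
    by (simp add: power2_eq_square algebra_simps)
  also have "\<dots> = L2_norm_sq \<Omega> f + 2 * t * (\<integral>x. norm (f x) * norm (g x) \<partial>?M) + t\<^sup>2 * L2_norm_sq \<Omega> g"
    unfolding L2_norm_sq_def using i by simp
  finally show "0 \<le> L2_norm_sq \<Omega> f + 2 * t * (\<integral>x. norm (f x) * norm (g x) \<partial>?M) + t\<^sup>2 * L2_norm_sq \<Omega> g" .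
qed (rule L2_norm_sq_nonneg)

lemma L2_Cauchy_Schwarz_norm:
  assumes "f \<in> L2 \<Omega>" "g \<in> L2 \<Omega>"
  shows "(norm (\<integral>x. f x * g x \<partial>lebesgue_on \<Omega>))\<^sup>2 \<le> L2_norm_sq \<Omega> f * L2_norm_sq \<Omega> g"
proof -
  have "norm (\<integral>x. f x * g x \<partial>lebesgue_on \<Omega>) \<le> (\<integral>x. norm (f x * g x) \<partial>lebesgue_on \<Omega>)"
    by (rule integral_norm_bound)
  then have "(norm (\<integral>x. f x * g x \<partial>lebesgue_on \<Omega>))\<^sup>2 \<le> (\<integral>x. norm (f x) * norm (g x) \<partial>lebesgue_on \<Omega>)\<^sup>2"
    by (intro power_mono) (simp_all add: norm_mult)
  from order_trans[OF this L2_Cauchy_Schwarz[OF assms]] show ?thesis .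
qed

lemma tendsto_0_of_power2_le:
  fixes a b :: "nat \<Rightarrow> real"
  assumes "\<And>n. (a n)\<^sup>2 \<le> b n" "b \<longlonglongrightarrow> 0"
  shows "a \<longlonglongrightarrow> 0"
proof -
  have "(\<lambda>n. sqrt (b n)) \<longlonglongrightarrow> sqrt 0" by (intro tendsto_real_sqrt assms(2))
  moreover have "norm (a n) \<le> sqrt (b n)" for n
    using assms(1)[of n] real_le_rsqrt by (simp add: abs_le_square_iff flip: real_sqrt_abs)
  ultimately show ?thesis by (intro Lim_null_comparison[of a "\<lambda>n. sqrt (b n)"]) auto
qed

lemma L2_tendsto_mult:
  assumes "\<And>n. F n \<in> L2 \<Omega>" "f \<in> L2 \<Omega>" "g \<in> L2 \<Omega>" "(\<lambda>n. L2_norm_sq \<Omega> (\<lambda>x. F n x - f x)) \<longlonglongrightarrow> 0"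
  shows "(\<lambda>n. \<integral>x. F n x * g x \<partial>lebesgue_on \<Omega>) \<longlonglongrightarrow> (\<integral>x. f x * g x \<partial>lebesgue_on \<Omega>)"
proof -
  have "(\<lambda>n. norm (\<integral>x. (F n x - f x) * g x \<partial>lebesgue_on \<Omega>)) \<longlonglongrightarrow> 0"
  proof (rule tendsto_0_of_power2_le)
    show "(norm (\<integral>x. (F n x - f x) * g x \<partial>lebesgue_on \<Omega>))\<^sup>2 \<le> L2_norm_sq \<Omega> (\<lambda>x. F n x - f x) * L2_norm_sq \<Omega> g" for n
      by (rule L2_Cauchy_Schwarz_norm[OF L2_diff[OF assms(1,2)] assms(3)])
    show "(\<lambda>n. L2_norm_sq \<Omega> (\<lambda>x. F n x - f x) * L2_norm_sq \<Omega> g) \<longlonglongrightarrow> 0"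
      using tendsto_mult_left_zero[OF assms(4)] by simp
  qed
  moreover have "(\<integral>x. (F n x - f x) * g x \<partial>lebesgue_on \<Omega>) =
      (\<integral>x. F n x * g x \<partial>lebesgue_on \<Omega>) - (\<integral>x. f x * g x \<partial>lebesgue_on \<Omega>)" for n
    using L2_integrable_mult[OF assms(1,3), of n] L2_integrable_mult[OF assms(2,3)] by (simp add: left_diff_distrib)
  ultimately show ?thesis using LIM_zero_cancel tendsto_norm_zero_cancel by fastforce
qed

lemma L2_norm_sq_add_le:
  assumes "f \<in> L2 \<Omega>" "g \<in> L2 \<Omega>"
  shows "L2_norm_sq \<Omega> (\<lambda>x. f x + g x) \<le> 2 * L2_norm_sq \<Omega> f + 2 * L2_norm_sq \<Omega> g"
proof -
  have "L2_norm_sq \<Omega> (\<lambda>x. f x + g x) \<le> (\<integral>x. 2 * (norm (f x))\<^sup>2 + 2 * (norm (g x))\<^sup>2 \<partial>lebesgue_on \<Omega>)"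
    unfolding L2_norm_sq_def
  proof (rule integral_mono)
    show "integrable (lebesgue_on \<Omega>) (\<lambda>x. 2 * (norm (f x))\<^sup>2 + 2 * (norm (g x))\<^sup>2)"
      using L2_integrable[OF assms(1)] L2_integrable[OF assms(2)] by simp
    show "(norm (f x + g x))\<^sup>2 \<le> 2 * (norm (f x))\<^sup>2 + 2 * (norm (g x))\<^sup>2" for x
    proof -
      have "(norm (f x + g x))\<^sup>2 \<le> (norm (f x) + norm (g x))\<^sup>2"
        by (intro power_mono norm_triangle_ineq) auto
      then show ?thesis using sum_squares_bound[of "norm (f x)" "norm (g x)"] by (simp add: power2_sum)
    qed
  qed (rule L2_integrable[OF L2_add[OF assms]])
  then show ?thesis using L2_integrable[OF assms(1)] L2_integrable[OF assms(2)] by (simp add: L2_norm_sq_def)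
qed

lemma L2_norm_sq_uminus: "L2_norm_sq \<Omega> (\<lambda>x. f x - g x) = L2_norm_sq \<Omega> (\<lambda>x. g x - f x)"
  by (simp add: L2_norm_sq_def norm_minus_commute)

lemma L2_const:
  assumes "bounded \<Omega>" "open \<Omega>" shows "(\<lambda>x. c) \<in> L2 \<Omega>"
proof (rule L2I)
  have "emeasure lebesgue \<Omega> < \<infinity>"
    using assms emeasure_bounded_finite[of \<Omega>] by simp
  then have "finite_measure (lebesgue_on \<Omega>)"
    using assms(2) by (intro finite_measureI) (auto simp: emeasure_restrict_space)
  then show "integrable (lebesgue_on \<Omega>) (\<lambda>x. (norm c)\<^sup>2)"
    by (simp add: finite_measure.integrable_const)
qed simp

lemma L2_imp_integrable:
  assumes "bounded \<Omega>" "open \<Omega>" "f \<in> L2 \<Omega>"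
  shows "integrable (lebesgue_on \<Omega>) f"
  using L2_integrable_mult[OF assms(3) L2_const[OF assms(1,2), of 1]] by simp

lemma L2_integral_norm_bound:
  assumes "bounded \<Omega>" "open \<Omega>" "f \<in> L2 \<Omega>"
  shows "(\<integral>x. norm (f x) \<partial>lebesgue_on \<Omega>)\<^sup>2 \<le> L2_norm_sq \<Omega> f * L2_norm_sq \<Omega> (\<lambda>x. 1)"
  using L2_Cauchy_Schwarz[OF assms(3) L2_const[OF assms(1,2), of 1]] by simp

text \<open>The argument of Riesz and Fischer. On a bounded set an L^2-Cauchy sequence is
  L^1-Cauchy, so a subsequence converges almost everywhere, and Fatou's lemma carries the L^2 bounds
  over to the limit. The limit is a function and not a class, in keeping with
  \<open>L2\<close>.\<close>

lemma L2_complete: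
  assumes \<Omega>: "bounded \<Omega>" "open \<Omega>" and F: "\<And>n. F n \<in> L2 \<Omega>"
    and cauchy: "\<And>e. 0 < e \<Longrightarrow> \<exists>N. \<forall>i\<ge>N. \<forall>j\<ge>N. L2_norm_sq \<Omega> (\<lambda>x. F i x - F j x) < e"
  shows "\<exists>f\<in>L2 \<Omega>. (\<lambda>n. L2_norm_sq \<Omega> (\<lambda>x. F n x - f x)) \<longlonglongrightarrow> 0"
proof -
  let ?M = "lebesgue_on \<Omega>" and ?m = "L2_norm_sq \<Omega> (\<lambda>x. 1)"
  have m: "0 \<le> ?m" by (rule L2_norm_sq_nonneg)
  have L1: "\<exists>N. \<forall>i\<ge>N. \<forall>j\<ge>N. (\<integral>x. norm (F i x - F j x) \<partial>?M) < e" if e: "0 < e" for e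
  proof -
    have "0 < e\<^sup>2 / (?m + 1)" using e m by simp
    then obtain N where N: "\<And>i j. N \<le> i \<Longrightarrow> N \<le> j \<Longrightarrow> L2_norm_sq \<Omega> (\<lambda>x. F i x - F j x) < e\<^sup>2 / (?m + 1)"
      using cauchy by blast
    have "(\<integral>x. norm (F i x - F j x) \<partial>?M) < e" if "N \<le> i" "N \<le> j" for i j
    proof -
      have "(\<integral>x. norm (F i x - F j x) \<partial>?M)\<^sup>2 \<le> L2_norm_sq \<Omega> (\<lambda>x. F i x - F j x) * ?m"
        by (rule L2_integral_norm_bound[OF \<Omega> L2_diff[OF F F]])
      also have "\<dots> \<le> e\<^sup>2 / (?m + 1) * ?m"
        using N[OF that] m by (intro mult_right_mono) auto
      also have "\<dots> < e\<^sup>2" using e m by (simp add: divide_less_eq)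
      finally show ?thesis using e by (simp add: power2_less_imp_less)
    qed
    then show ?thesis by blast
  qed
  obtain r where r: "strict_mono r" "AE x in ?M. Cauchy (\<lambda>i. F (r i) x)"
    using cauchy_L1_AE_cauchy_subseq[OF L2_imp_integrable[OF \<Omega> F] L1] by blast
  define f where "f x = lim (\<lambda>i. F (r i) x)" for x
  have fm: "f \<in> borel_measurable ?M"
    unfolding f_def by (intro borel_measurable_lim_metric L2_measurable F)
  have lim: "AE x in ?M. (\<lambda>i. F (r i) x) \<longlonglongrightarrow> f x"
    using r(2) by eventually_elim (simp add: f_def Cauchy_convergent_iff convergent_LIMSEQ_iff)
  have key: "(\<lambda>x. f x - F n x) \<in> L2 \<Omega> \<and> L2_norm_sq \<Omega> (\<lambda>x. F n x - f x) \<le> e"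
    if e: "0 < e" and N: "\<And>i j. N \<le> i \<Longrightarrow> N \<le> j \<Longrightarrow> L2_norm_sq \<Omega> (\<lambda>x. F i x - F j x) < e" and n: "N \<le> n" for e N n
  proof -
    have mm: "(\<lambda>x. f x - F n x) \<in> borel_measurable ?M" using fm L2_measurable[OF F] by simp
    have "(\<integral>\<^sup>+x. ennreal ((norm (f x - F n x))\<^sup>2) \<partial>?M) = (\<integral>\<^sup>+x. liminf (\<lambda>i. ennreal ((norm (F (r i) x - F n x))\<^sup>2)) \<partial>?M)"
    proof (rule nn_integral_cong_AE)
      show "AE x in ?M. ennreal ((norm (f x - F n x))\<^sup>2) = liminf (\<lambda>i. ennreal ((norm (F (r i) x - F n x))\<^sup>2))"
        using lim
      proof eventually_elim
        case (elim x)
        have "(\<lambda>i. ennreal ((norm (F (r i) x - F n x))\<^sup>2)) \<longlonglongrightarrow> ennreal ((norm (f x - F n x))\<^sup>2)"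
          by (intro tendsto_intros elim)
        from lim_imp_Liminf[OF trivial_limit_sequentially this] show ?case by (rule sym)
      qed
    qed
    also have "\<dots> \<le> liminf (\<lambda>i. \<integral>\<^sup>+x. ennreal ((norm (F (r i) x - F n x))\<^sup>2) \<partial>?M)"
      using L2_measurable[OF F] by (intro nn_integral_liminf) simp
    also have "\<dots> \<le> ennreal e"
    proof -
      have "eventually (\<lambda>i. (\<integral>\<^sup>+x. ennreal ((norm (F (r i) x - F n x))\<^sup>2) \<partial>?M) \<le> ennreal e) sequentially"
      proof (rule eventually_sequentiallyI[of N])
        fix i assume "N \<le> i"
        then have "N \<le> r i" using seq_suble[OF r(1), of i] by simp
        then show "(\<integral>\<^sup>+x. ennreal ((norm (F (r i) x - F n x))\<^sup>2) \<partial>?M) \<le> ennreal e"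
          using N[OF _ n] L2_integrable[OF L2_diff[OF F F]]
          by (subst nn_integral_eq_integral) (auto simp: L2_norm_sq_def intro!: ennreal_leI intro: less_imp_le)
      qed
      then show ?thesis by (rule Liminf_le[OF trivial_limit_sequentially])
    qed
    finally have bound: "(\<integral>\<^sup>+x. ennreal ((norm (f x - F n x))\<^sup>2) \<partial>?M) \<le> ennreal e" .
    have int: "integrable ?M (\<lambda>x. (norm (f x - F n x))\<^sup>2)"
      using mm bound by (intro integrableI_bounded) (auto simp: le_less_trans)
    have "ennreal (L2_norm_sq \<Omega> (\<lambda>x. f x - F n x)) \<le> ennreal e"
      using bound int by (simp add: L2_norm_sq_def nn_integral_eq_integral)
    then have "L2_norm_sq \<Omega> (\<lambda>x. f x - F n x) \<le> e" using e by simp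
    then show ?thesis using mm int L2_norm_sq_uminus[of \<Omega> f "F n"] by (auto intro: L2I)
  qed
  obtain N1 where N1: "\<And>i j. N1 \<le> i \<Longrightarrow> N1 \<le> j \<Longrightarrow> L2_norm_sq \<Omega> (\<lambda>x. F i x - F j x) < 1"
    using cauchy[of 1] by auto
  have "(\<lambda>x. (f x - F N1 x) + F N1 x) \<in> L2 \<Omega>"
    using key[OF _ N1] by (intro L2_add F) auto
  then have fL2: "f \<in> L2 \<Omega>" by simp
  have "(\<lambda>n. L2_norm_sq \<Omega> (\<lambda>x. F n x - f x)) \<longlonglongrightarrow> 0"
  proof (rule LIMSEQ_I)
    fix e :: real assume e: "0 < e"
    then have e2: "0 < e / 2" by simp
    obtain N where N: "\<And>i j. N \<le> i \<Longrightarrow> N \<le> j \<Longrightarrow> L2_norm_sq \<Omega> (\<lambda>x. F i x - F j x) < e / 2"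
      using cauchy[OF e2] by blast
    then show "\<exists>N. \<forall>n\<ge>N. norm (L2_norm_sq \<Omega> (\<lambda>x. F n x - f x) - 0) < e"
      using key[OF e2 N] e L2_norm_sq_nonneg[of \<Omega>] by (intro exI[of _ N]) fastforce
  qed
  then show ?thesis using fL2 by blast
qed

lemma Cc_infty_L2:
  assumes "f \<in> Cc_infty \<Omega>'" "open \<Omega>"
  shows "f \<in> L2 \<Omega>"
proof (rule L2I)
  note sm = smooth_continuous[OF Cc_infty_smooth[OF assms(1)], of UNIV]
  show "f \<in> borel_measurable (lebesgue_on \<Omega>)"
    using borel_measurable_continuous_onI[OF sm] by (simp add: measurable_completion measurable_restrict_space1)
  have "integrable lborel (\<lambda>x. f x * cnj (f x))"
    using sm by (intro Cc_infty_integrable_mult[OF assms(1)] continuous_on_cnj)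
  then have "integrable lborel (\<lambda>x. complex_of_real ((norm (f x))\<^sup>2))"
    by (simp only: complex_norm_square)
  then have "integrable lborel (\<lambda>x. (norm (f x))\<^sup>2)"
    using complex_of_real_integrable_eq by blast
  then have i: "integrable lebesgue (\<lambda>x. (norm (f x))\<^sup>2)"
    by (simp add: integrable_completion)
  show "integrable (lebesgue_on \<Omega>) (\<lambda>x. (norm (f x))\<^sup>2)"
    using integrable_mult_indicator[OF _ i, of \<Omega>] assms(2) by (subst integrable_restrict_space) auto
qed

lemma L2_norm_sq_lborel:
  assumes "f \<in> Cc_infty \<Omega>" "open \<Omega>"
  shows "L2_norm_sq \<Omega> f = (\<integral>x. (norm (f x))\<^sup>2 \<partial>lborel)"
  unfolding L2_norm_sq_def
  using borel_measurable_continuous_onI[OF smooth_continuous[OF Cc_infty_smooth[OF assms(1)]]]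
  by (intro integral_lebesgue_on_eq_lborel[OF assms(2)]) (simp_all add: Cc_infty_vanishes[OF assms(1)])

section \<open>Compactness\<close>

lemma Cc_infty_zero: "(\<lambda>x. 0) \<in> Cc_infty \<Omega>"
  by (rule Cc_inftyI[where K = "{}"]) (auto simp: smooth_const)

lemma Cc_infty_sum:
  "finite S \<Longrightarrow> (\<And>i. i \<in> S \<Longrightarrow> F i \<in> Cc_infty \<Omega>) \<Longrightarrow> (\<lambda>x. \<Sum>i\<in>S. F i x) \<in> Cc_infty \<Omega>"
  by (induction S rule: finite_induct) (auto simp: Cc_infty_zero intro: Cc_infty_add)

definition dir_deriv :: "'a::euclidean_space \<Rightarrow> ('a \<Rightarrow> complex) \<Rightarrow> 'a \<Rightarrow> complex"
  where "dir_deriv h f x = (\<Sum>b\<in>Basis. (h \<bullet> b) *\<^sub>R partial_deriv b f x)"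

lemma Cc_infty_dir_deriv: "f \<in> Cc_infty \<Omega> \<Longrightarrow> dir_deriv h f \<in> Cc_infty \<Omega>"
  unfolding dir_deriv_def[abs_def]
  by (intro Cc_infty_sum Cc_infty_bounded_linear[OF bounded_linear_scaleR_right] Cc_infty_partial_deriv) auto

lemma dir_deriv_scaleR: "dir_deriv (t *\<^sub>R h) f x = t *\<^sub>R dir_deriv h f x"
  by (simp add: dir_deriv_def scaleR_right.sum)

lemma norm_dir_deriv_sq_le:
  "(norm (dir_deriv h f x))\<^sup>2 \<le> (norm h)\<^sup>2 * (\<Sum>b\<in>Basis. (norm (partial_deriv b f x))\<^sup>2)"
proof -
  have "norm (dir_deriv h f x) \<le> (\<Sum>b\<in>Basis. \<bar>h \<bullet> b\<bar> * norm (partial_deriv b f x))"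
    unfolding dir_deriv_def by (rule sum_norm_le) simp
  then have "(norm (dir_deriv h f x))\<^sup>2 \<le> (\<Sum>b\<in>Basis. \<bar>h \<bullet> b\<bar> * norm (partial_deriv b f x))\<^sup>2"
    by (intro power_mono) auto
  also have "\<dots> \<le> (\<Sum>b\<in>Basis. \<bar>h \<bullet> b\<bar>\<^sup>2) * (\<Sum>b\<in>Basis. (norm (partial_deriv b f x))\<^sup>2)"
    by (rule Cauchy_Schwarz_ineq_sum)
  also have "(\<Sum>b\<in>Basis. \<bar>h \<bullet> b\<bar>\<^sup>2) = (norm h)\<^sup>2"
    by (subst power2_norm_eq_inner, subst euclidean_inner) (simp add: power2_eq_square)
  finally show ?thesis .
qed

lemma Cc_infty_continuous: "f \<in> Cc_infty \<Omega> \<Longrightarrow> continuous_on UNIV f"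
  by (intro smooth_continuous Cc_infty_smooth)

lemma Cc_infty_measurable: "f \<in> Cc_infty \<Omega> \<Longrightarrow> f \<in> borel_measurable borel"
  by (intro borel_measurable_continuous_onI Cc_infty_continuous)

lemma Cc_infty_integrable_inner:
  assumes "f \<in> Cc_infty \<Omega>" "continuous_on UNIV g"
  shows "integrable lborel (\<lambda>x. f x \<bullet> g x)" "integrable lborel (\<lambda>x. g x \<bullet> f x)"
proof -
  obtain K where K: "compact K" "\<And>x. x \<notin> K \<Longrightarrow> f x = 0" using Cc_inftyE[OF assms(1)] by metis
  show "integrable lborel (\<lambda>x. f x \<bullet> g x)"
    by (rule integrable_compact_support[OF _ K(1)]) (auto intro!: continuous_on_inner Cc_infty_continuous[OF assms(1)] assms(2) simp: K(2))
  then show "integrable lborel (\<lambda>x. g x \<bullet> f x)" by (simp add: inner_commute)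
qed

lemma continuous_on_translate: "continuous_on UNIV f \<Longrightarrow> continuous_on UNIV (\<lambda>x. f (x + c :: 'a::real_normed_vector))"
  by (rule continuous_on_compose2[where g = f and f = "\<lambda>x. x + c"]) (auto intro!: continuous_intros)

section \<open>Continuity of translations in L^2, controlled by the gradient\<close>

lemma translation_DERIV:
  fixes a c :: "'a::euclidean_space \<Rightarrow> complex"
  assumes a: "a \<in> Cc_infty \<Omega>" and c: "c \<in> Cc_infty \<Omega>'"
  shows "((\<lambda>t. \<integral>x. a (x + t *\<^sub>R h) \<bullet> c x \<partial>lborel) has_real_derivative
     (\<integral>x. dir_deriv h a (x + t *\<^sub>R h) \<bullet> c x \<partial>lborel)) (at t)"
proof -
  have d: "dir_deriv h a \<in> Cc_infty \<Omega>" by (rule Cc_infty_dir_deriv[OF a])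
  obtain B where B: "\<And>x. norm (dir_deriv h a x) \<le> B" using Cc_infty_bounded[OF d] by metis
  note c_cont = Cc_infty_continuous[OF c]
  have "((\<lambda>t. \<integral>x. a (x + t *\<^sub>R h) \<bullet> c x \<partial>lborel) has_derivative
     (\<lambda>s. \<integral>x. s * (dir_deriv h a (x + t *\<^sub>R h) \<bullet> c x) \<partial>lborel)) (at t)"
  proof (rule has_derivative_integral[where r = 1 and g = "\<lambda>x. B * norm (c x)"])
    fix t x
    show "integrable lborel (\<lambda>x. a (x + t *\<^sub>R h) \<bullet> c x)"
      by (rule Cc_infty_integrable_inner(2)[OF c continuous_on_translate[OF Cc_infty_continuous[OF a]]])
    have "((\<lambda>t. x + t *\<^sub>R h) has_derivative (\<lambda>s. s *\<^sub>R h)) (at t)"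
      by (auto intro!: derivative_eq_intros)
    from has_derivative_compose[OF this smooth_has_derivative_sum[OF Cc_infty_smooth[OF a]]]
    have "((\<lambda>t. a (x + t *\<^sub>R h)) has_derivative (\<lambda>s. s *\<^sub>R dir_deriv h a (x + t *\<^sub>R h))) (at t)"
      unfolding dir_deriv_def[symmetric] dir_deriv_scaleR .
    then show "((\<lambda>t. a (x + t *\<^sub>R h) \<bullet> c x) has_derivative (\<lambda>s. s * (dir_deriv h a (x + t *\<^sub>R h) \<bullet> c x))) (at t)"
      by (auto intro!: derivative_eq_intros)
    show "onorm (\<lambda>s. s * (dir_deriv h a (x + t *\<^sub>R h) \<bullet> c x)) \<le> B * norm (c x)"
    proof (rule onorm_le)
      fix s :: real
      have "\<bar>dir_deriv h a (x + t *\<^sub>R h) \<bullet> c x\<bar> \<le> B * norm (c x)"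
        by (rule order_trans[OF Cauchy_Schwarz_ineq2 mult_right_mono[OF B norm_ge_zero]])
      from mult_left_mono[OF this, of "\<bar>s\<bar>"]
      show "norm (s * (dir_deriv h a (x + t *\<^sub>R h) \<bullet> c x)) \<le> B * norm (c x) * norm s"
        by (simp add: abs_mult mult_ac)
    qed
  next
    show "integrable lborel (\<lambda>x. B * norm (c x))" using Cc_infty_integrable[OF c] by simp
    show "(\<lambda>x. s * (dir_deriv h a (x + t *\<^sub>R h) \<bullet> c x)) \<in> borel_measurable lborel" for s
      using Cc_infty_measurable[OF c] Cc_infty_measurable[OF d] by simp
  qed auto
  moreover have "(\<lambda>s. \<integral>x. s * (dir_deriv h a (x + t *\<^sub>R h) \<bullet> c x) \<partial>lborel) =
      (*) (\<integral>x. dir_deriv h a (x + t *\<^sub>R h) \<bullet> c x \<partial>lborel)"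
    by (simp add: fun_eq_iff)
  ultimately show ?thesis by (simp only: has_field_derivative_def)
qed

lemma translation_flip:
  fixes a c :: "'a::euclidean_space \<Rightarrow> complex"
  assumes "a \<in> Cc_infty \<Omega>" "c \<in> Cc_infty \<Omega>'"
  shows "(\<integral>x. a (x + h) \<bullet> c x \<partial>lborel) = (\<integral>x. c (x - h) \<bullet> a x \<partial>lborel)"
  using lborel_integral_translation[of "\<lambda>x. c (x - h) \<bullet> a x" h]
    Cc_infty_measurable[OF assms(1)] Cc_infty_measurable[OF assms(2)]
  by (simp add: inner_commute)

text \<open>The auto-correlation $q(t) = \int f(x+th)\cdot f(x)\,dx$ is even and $q'' \ge -\|\partial_h f\|^2$.\<close>

lemma translation_estimate:
  fixes f :: "'a::euclidean_space \<Rightarrow> complex"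
  assumes f: "f \<in> Cc_infty \<Omega>"
  shows "(\<integral>x. (norm (f (x + h) - f x))\<^sup>2 \<partial>lborel) \<le> (\<integral>x. (norm (dir_deriv h f x))\<^sup>2 \<partial>lborel)"
proof -
  let ?d = "dir_deriv h f"
  have d: "?d \<in> Cc_infty \<Omega>" by (rule Cc_infty_dir_deriv[OF f])
  define e where "e = (\<integral>x. (norm (?d x))\<^sup>2 \<partial>lborel)"
  define q where "q t = (\<integral>x. f (x + t *\<^sub>R h) \<bullet> f x \<partial>lborel)" for t
  define q1 where "q1 t = (\<integral>x. ?d (x + t *\<^sub>R h) \<bullet> f x \<partial>lborel)" for t
  define q2 where "q2 t = - (\<integral>x. ?d (x - t *\<^sub>R h) \<bullet> ?d x \<partial>lborel)" for t
  have dq: "(q has_real_derivative q1 t) (at t)" for t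
    unfolding q_def q1_def by (rule translation_DERIV[OF f f])
  \<comment> \<open>Substituting x - t h shifts f instead of its derivative. The second
    differentiation then also yields a first derivative of f, and no second derivatives enter
    \<open>q2\<close>.\<close>
  have q1': "q1 t = (\<integral>x. f (x + t *\<^sub>R (- h)) \<bullet> ?d x \<partial>lborel)" for t
    unfolding q1_def by (subst translation_flip[OF d f]) simp
  have dneg: "dir_deriv (- h) f x = - ?d x" for x
    using dir_deriv_scaleR[of "-1" h f x] by simp
  have dq1: "(q1 has_real_derivative q2 t) (at t)" for t
    using translation_DERIV[OF f d, of "- h" t] unfolding q1'[abs_def] q2_def by (simp add: dneg)
  have dd: "integrable lborel (\<lambda>x. (norm (?d x))\<^sup>2)"
    using Cc_infty_integrable_inner(1)[OF d Cc_infty_continuous[OF d]] by (simp add: power2_norm_eq_inner)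
  have dd': "integrable lborel (\<lambda>x. (norm (?d (x - v)))\<^sup>2)" and ddv: "(\<integral>x. (norm (?d (x - v)))\<^sup>2 \<partial>lborel) = e" for v
  proof -
    have m: "(\<lambda>x. (norm (?d x))\<^sup>2) \<in> borel_measurable borel" using Cc_infty_measurable[OF d] by simp
    show "(\<integral>x. (norm (?d (x - v)))\<^sup>2 \<partial>lborel) = e"
      using lborel_integral_translation[OF m, of "- v"] by (simp add: e_def)
    obtain K where K: "compact K" "\<And>x. x \<notin> K \<Longrightarrow> ?d x = 0" using Cc_inftyE[OF d] by metis
    show "integrable lborel (\<lambda>x. (norm (?d (x - v)))\<^sup>2)"
    proof (rule integrable_compact_support)
      show "compact ((\<lambda>x. x + v) ` K)" using K(1) by (intro compact_continuous_image continuous_intros)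
      show "(norm (?d (x - v)))\<^sup>2 = 0" if "x \<notin> (\<lambda>x. x + v) ` K" for x
        using that K(2)[of "x - v"] by (force simp: image_iff)
      show "continuous_on UNIV (\<lambda>x. (norm (?d (x - v)))\<^sup>2)"
        using continuous_on_translate[OF Cc_infty_continuous[OF d], of "- v"] by (intro continuous_intros) simp
    qed
  qed
  have q2_ge: "- e \<le> q2 t" for t
  proof -
    have "(\<integral>x. ?d (x - t *\<^sub>R h) \<bullet> ?d x \<partial>lborel) \<le> (\<integral>x. (norm (?d (x - t *\<^sub>R h)))\<^sup>2 / 2 + (norm (?d x))\<^sup>2 / 2 \<partial>lborel)"
    proof (rule integral_mono)
      show "integrable lborel (\<lambda>x. ?d (x - t *\<^sub>R h) \<bullet> ?d x)"
        using Cc_infty_integrable_inner(2)[OF d continuous_on_translate[OF Cc_infty_continuous[OF d], of "- t *\<^sub>R h"]] by simp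
      show "integrable lborel (\<lambda>x. (norm (?d (x - t *\<^sub>R h)))\<^sup>2 / 2 + (norm (?d x))\<^sup>2 / 2)"
        using dd dd' by simp
      show "?d (x - t *\<^sub>R h) \<bullet> ?d x \<le> (norm (?d (x - t *\<^sub>R h)))\<^sup>2 / 2 + (norm (?d x))\<^sup>2 / 2" for x
        using norm_cauchy_schwarz[of "?d (x - t *\<^sub>R h)" "?d x"] sum_squares_bound[of "norm (?d (x - t *\<^sub>R h))" "norm (?d x)"]
        by linarith
    qed
    also have "\<dots> = e" using dd dd' by (simp add: ddv) (simp add: e_def)
    finally show ?thesis by (simp add: q2_def)
  qed
  have even: "q (- t) = q t" for t
    unfolding q_def using translation_flip[OF f f, of "t *\<^sub>R h"] by simp
  have q10: "q1 0 = 0"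
  proof -
    have "((\<lambda>t. q (- t)) has_real_derivative q1 0 * - 1) (at 0)"
      by (rule DERIV_chain2[of q]) (use dq[of 0] in \<open>auto intro!: derivative_eq_intros\<close>)
    then have "(q has_real_derivative - q1 0) (at 0)" unfolding even by simp
    from DERIV_unique[OF dq[of 0] this] show ?thesis by simp
  qed
  have q1_ge: "- e * t \<le> q1 t" if "0 \<le> t" for t
  proof -
    have "q1 0 + e * 0 \<le> q1 t + e * t"
    proof (rule DERIV_nonneg_imp_nondecreasing[OF that])
      fix x
      have "((\<lambda>t. q1 t + e * t) has_real_derivative (q2 x + e)) (at x)"
        by (auto intro!: derivative_eq_intros dq1)
      then show "\<exists>y. ((\<lambda>t. q1 t + e * t) has_real_derivative y) (at x) \<and> 0 \<le> y"
        using q2_ge[of x] by (intro exI[of _ "q2 x + e"]) simp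
    qed
    then show ?thesis using q10 by simp
  qed
  \<comment> \<open>Two monotonicity arguments replace Taylor's formula: q(1) is at least q(0) -
    e/2, which is what the expansion of the squared difference calls for.\<close>
  have "q 0 + e * 0\<^sup>2 / 2 \<le> q 1 + e * 1\<^sup>2 / 2"
  proof (rule DERIV_nonneg_imp_nondecreasing[of 0 1])
    fix x :: real assume "0 \<le> x"
    moreover have "((\<lambda>t. q t + e * t\<^sup>2 / 2) has_real_derivative (q1 x + e * x)) (at x)"
      by (auto intro!: derivative_eq_intros dq)
    ultimately show "\<exists>y. ((\<lambda>t. q t + e * t\<^sup>2 / 2) has_real_derivative y) (at x) \<and> 0 \<le> y"
      using q1_ge[of x] by (intro exI[of _ "q1 x + e * x"]) simp
  qed simp
  then have q01: "2 * q 0 - 2 * q 1 \<le> e" by simp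
  have ff: "integrable lborel (\<lambda>x. f x \<bullet> f x)" "integrable lborel (\<lambda>x. f (x + h) \<bullet> f x)"
    using Cc_infty_integrable_inner(1)[OF f Cc_infty_continuous[OF f]]
      Cc_infty_integrable_inner(2)[OF f continuous_on_translate[OF Cc_infty_continuous[OF f]]] by auto
  have fm: "(\<lambda>x. f x \<bullet> f x) \<in> borel_measurable borel" using Cc_infty_measurable[OF f] by simp
  have fh: "integrable lborel (\<lambda>x. f (x + h) \<bullet> f (x + h))"
  proof -
    have "integrable (distr lborel borel ((+) h)) (\<lambda>x. f x \<bullet> f x)"
      using ff(1) by (simp add: lborel_distr_plus)
    then show ?thesis using fm by (subst (asm) integrable_distr_eq) (auto simp: add.commute)
  qed
  have "(\<integral>x. (norm (f (x + h) - f x))\<^sup>2 \<partial>lborel) =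
      (\<integral>x. f (x + h) \<bullet> f (x + h) + f x \<bullet> f x - 2 * (f (x + h) \<bullet> f x) \<partial>lborel)"
    by (simp add: power2_norm_eq_inner inner_diff_left inner_diff_right inner_commute algebra_simps)
  also have "\<dots> = (\<integral>x. f (x + h) \<bullet> f (x + h) \<partial>lborel) + q 0 - 2 * q 1"
    using ff fh by (simp add: q_def)
  also have "(\<integral>x. f (x + h) \<bullet> f (x + h) \<partial>lborel) = q 0"
    using lborel_integral_translation[OF fm, of h] by (simp add: q_def)
  finally show ?thesis using q01 by (simp add: e_def)
qed

definition dirichlet_energy :: "'a::euclidean_space set \<Rightarrow> ('a \<Rightarrow> complex) \<Rightarrow> real"
  where "dirichlet_energy \<Omega> f = (\<Sum>b\<in>Basis. L2_norm_sq \<Omega> (partial_deriv b f))"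

lemma dirichlet_energy_nonneg: "0 \<le> dirichlet_energy \<Omega> f"
  by (simp add: dirichlet_energy_def L2_norm_sq_nonneg sum_nonneg)

lemma Cc_infty_integrable_norm_sq:
  assumes "f \<in> Cc_infty \<Omega>" shows "integrable lborel (\<lambda>x. (norm (f x))\<^sup>2)"
  using Cc_infty_integrable_inner(1)[OF assms Cc_infty_continuous[OF assms]] by (simp add: power2_norm_eq_inner)

lemma translation_energy:
  assumes \<Omega>: "open \<Omega>" and f: "f \<in> Cc_infty \<Omega>"
  shows "(\<integral>x. (norm (f (x + h) - f x))\<^sup>2 \<partial>lborel) \<le> (norm h)\<^sup>2 * dirichlet_energy \<Omega> f"
proof -
  have i: "integrable lborel (\<lambda>x. (norm (partial_deriv b f x))\<^sup>2)" if "b \<in> Basis" for b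
    by (rule Cc_infty_integrable_norm_sq[OF Cc_infty_partial_deriv[OF f that]])
  have "(\<integral>x. (norm (f (x + h) - f x))\<^sup>2 \<partial>lborel) \<le> (\<integral>x. (norm (dir_deriv h f x))\<^sup>2 \<partial>lborel)"
    by (rule translation_estimate[OF f])
  also have "\<dots> \<le> (\<integral>x. (norm h)\<^sup>2 * (\<Sum>b\<in>Basis. (norm (partial_deriv b f x))\<^sup>2) \<partial>lborel)"
    by (intro integral_mono norm_dir_deriv_sq_le Cc_infty_integrable_norm_sq[OF Cc_infty_dir_deriv[OF f]]
        integrable_mult_right Bochner_Integration.integrable_sum i)
  also have "\<dots> = (norm h)\<^sup>2 * (\<Sum>b\<in>Basis. \<integral>x. (norm (partial_deriv b f x))\<^sup>2 \<partial>lborel)"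
    using i by (simp add: Bochner_Integration.integral_sum)
  also have "\<dots> = (norm h)\<^sup>2 * dirichlet_energy \<Omega> f"
    by (simp add: dirichlet_energy_def L2_norm_sq_lborel[OF Cc_infty_partial_deriv[OF f] \<Omega>])
  finally show ?thesis .
qed

lemma Cc_infty_Lipschitz:
  assumes f: "f \<in> Cc_infty \<Omega>"
  obtains L where "0 \<le> L" "\<And>x y. norm (f x - f y) \<le> L * norm (x - y)"
proof -
  have "\<exists>C. \<forall>x. norm (partial_deriv b f x) \<le> C" if "b \<in> Basis" for b
    using Cc_infty_bounded[OF Cc_infty_partial_deriv[OF f that]] by metis
  then obtain B where B: "\<And>b x. b \<in> Basis \<Longrightarrow> norm (partial_deriv b f x) \<le> B b" by metis
  have "norm (f x - f y) \<le> (\<Sum>b\<in>Basis. B b) * norm (x - y)" for x y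
  proof (rule differentiable_bound[OF convex_UNIV, where f' = "\<lambda>x h. \<Sum>b\<in>Basis. (h \<bullet> b) *\<^sub>R partial_deriv b f x"])
    show "(f has_derivative (\<lambda>h. \<Sum>b\<in>Basis. (h \<bullet> b) *\<^sub>R partial_deriv b f x)) (at x within UNIV)" for x
      using smooth_has_derivative_sum[OF Cc_infty_smooth[OF f]] by simp
    show "onorm (\<lambda>h. \<Sum>b\<in>Basis. (h \<bullet> b) *\<^sub>R partial_deriv b f x) \<le> (\<Sum>b\<in>Basis. B b)" for x
    proof (rule onorm_le)
      fix h :: 'a
      have "norm (\<Sum>b\<in>Basis. (h \<bullet> b) *\<^sub>R partial_deriv b f x) \<le> (\<Sum>b\<in>Basis. B b * norm h)"
      proof (rule sum_norm_le)
        fix b :: 'a assume b: "b \<in> Basis"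
        show "norm ((h \<bullet> b) *\<^sub>R partial_deriv b f x) \<le> B b * norm h"
          using mult_mono[OF Basis_le_norm[OF b, of h] B[OF b]] by (simp add: mult.commute)
      qed
      then show "norm (\<Sum>b\<in>Basis. (h \<bullet> b) *\<^sub>R partial_deriv b f x) \<le> (\<Sum>b\<in>Basis. B b) * norm h"
        by (simp add: sum_distrib_right)
    qed
  qed auto
  moreover have "0 \<le> (\<Sum>b\<in>Basis. B b)"
    using B norm_ge_zero order_trans by (intro sum_nonneg) blast
  ultimately show ?thesis using that by blast
qed

section \<open>Mollification\<close>

definition mollifier :: "real \<Rightarrow> 'a::euclidean_space \<Rightarrow> real"
  where "mollifier \<epsilon> y = kern \<epsilon> 0 y / integral\<^sup>L lborel (kern \<epsilon> (0::'a))"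

definition mollify :: "real \<Rightarrow> ('a::euclidean_space \<Rightarrow> complex) \<Rightarrow> 'a \<Rightarrow> complex"
  where "mollify \<epsilon> f x = (\<integral>y. mollifier \<epsilon> y *\<^sub>R f (x + y) \<partial>lborel)"

context
  fixes \<epsilon> :: real assumes \<epsilon>: "0 < \<epsilon>"
begin

lemma mollifier_nonneg: "0 \<le> mollifier \<epsilon> y"
  unfolding mollifier_def by (intro divide_nonneg_nonneg kern_nonneg[OF \<epsilon>] less_imp_le kern_mass_pos[OF \<epsilon>])

lemma mollifier_eq_0: "\<epsilon> \<le> norm y \<Longrightarrow> mollifier \<epsilon> y = 0"
  unfolding mollifier_def using kern_eq_0[OF \<epsilon>, of 0 y] by simp

lemma mollifier_Cc_infty: "(\<lambda>y. complex_of_real (mollifier \<epsilon> y)) \<in> Cc_infty UNIV"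
  using Cc_infty_mult[OF kern_Cc_infty[OF \<epsilon>] smooth_const]
  unfolding mollifier_def divide_inverse of_real_mult by blast

lemma mollifier_continuous: "continuous_on UNIV (mollifier \<epsilon>)"
  using continuous_on_Re[OF Cc_infty_continuous[OF mollifier_Cc_infty]] by simp

lemma mollifier_measurable: "mollifier \<epsilon> \<in> borel_measurable borel"
  by (rule borel_measurable_continuous_onI[OF mollifier_continuous])

lemma mollifier_integrable_mult:
  fixes g :: "'a::euclidean_space \<Rightarrow> 'b::{banach, second_countable_topology}"
  assumes "continuous_on UNIV g"
  shows "integrable lborel (\<lambda>y. mollifier \<epsilon> y *\<^sub>R g y)"
proof (rule integrable_compact_support)
  show "continuous_on UNIV (\<lambda>y. mollifier \<epsilon> y *\<^sub>R g y)"
    by (intro continuous_on_scaleR mollifier_continuous assms)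
  show "compact (cball (0::'a) \<epsilon>)" by simp
qed (simp add: mollifier_eq_0)

lemma mollifier_integrable: "integrable lborel (mollifier \<epsilon> :: 'a::euclidean_space \<Rightarrow> real)"
  using mollifier_integrable_mult[of "\<lambda>y. 1 :: real"] by simp

lemma integral_mollifier: "integral\<^sup>L lborel (mollifier \<epsilon> :: 'a::euclidean_space \<Rightarrow> real) = 1"
  using kern_mass_pos[OF \<epsilon>, of "0::'a"] unfolding mollifier_def[abs_def] by simp

lemma mollify_conv:
  assumes "f \<in> borel_measurable borel"
  shows "mollify \<epsilon> f x = (\<integral>z. f z * complex_of_real (mollifier \<epsilon> (z - x)) \<partial>lborel)"
proof -
  note [measurable] = assms mollifier_measurable
  have "(\<lambda>z. f z * complex_of_real (mollifier \<epsilon> (z - x))) \<in> borel_measurable borel" by measurable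
  from lborel_integral_translation[OF this, of x] show ?thesis
    by (simp add: mollify_def scaleR_conv_of_real mult.commute add.commute)
qed

text \<open>Jensen's inequality for a probability density, read off from the quadratic polynomial in
  t given by integrating (|g| + t)^2 against the density.\<close>

lemma mollifier_Jensen:
  fixes g :: "'a::euclidean_space \<Rightarrow> complex"
  assumes g: "continuous_on UNIV g"
  shows "(norm (\<integral>y. mollifier \<epsilon> y *\<^sub>R g y \<partial>lborel))\<^sup>2 \<le> (\<integral>y. mollifier \<epsilon> y * (norm (g y))\<^sup>2 \<partial>lborel)"
proof -
  have i: "integrable lborel (\<lambda>y. mollifier \<epsilon> y * norm (g y))" "integrable lborel (\<lambda>y. mollifier \<epsilon> y * (norm (g y))\<^sup>2)"
    using mollifier_integrable_mult[of "\<lambda>y. norm (g y)"] mollifier_integrable_mult[of "\<lambda>y. (norm (g y))\<^sup>2"] g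
    by (simp_all add: continuous_on_norm continuous_on_power)
  have "norm (\<integral>y. mollifier \<epsilon> y *\<^sub>R g y \<partial>lborel) \<le> (\<integral>y. mollifier \<epsilon> y * norm (g y) \<partial>lborel)"
    using integral_norm_bound[of lborel "\<lambda>y. mollifier \<epsilon> y *\<^sub>R g y"] by (simp add: mollifier_nonneg)
  then have "(norm (\<integral>y. mollifier \<epsilon> y *\<^sub>R g y \<partial>lborel))\<^sup>2 \<le> (\<integral>y. mollifier \<epsilon> y * norm (g y) \<partial>lborel)\<^sup>2"
    by (intro power_mono) auto
  also have "\<dots> \<le> (\<integral>y. mollifier \<epsilon> y * (norm (g y))\<^sup>2 \<partial>lborel) * 1"
  proof (rule discriminant_le)
    fix t :: real
    have "0 \<le> (\<integral>y. mollifier \<epsilon> y * (norm (g y) + t)\<^sup>2 \<partial>lborel)"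
      by (intro Bochner_Integration.integral_nonneg mult_nonneg_nonneg mollifier_nonneg) simp
    also have "\<dots> = (\<integral>y. mollifier \<epsilon> y * (norm (g y))\<^sup>2 + 2 * t * (mollifier \<epsilon> y * norm (g y)) + t\<^sup>2 * mollifier \<epsilon> y \<partial>lborel)"
      by (simp add: power2_eq_square algebra_simps)
    also have "\<dots> = (\<integral>y. mollifier \<epsilon> y * (norm (g y))\<^sup>2 \<partial>lborel) + 2 * t * (\<integral>y. mollifier \<epsilon> y * norm (g y) \<partial>lborel) + t\<^sup>2 * 1"
      using i mollifier_integrable[where 'a='a] by (simp add: integral_mollifier)
    finally show "0 \<le> \<dots>" .
  qed simp
  finally show ?thesis by simp
qed

lemma mollify_measurable:
  assumes "f \<in> Cc_infty \<Omega>" shows "mollify \<epsilon> f \<in> borel_measurable borel"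
proof -
  have "mollify \<epsilon> f = (\<lambda>x. \<integral>z. f z * complex_of_real (mollifier \<epsilon> (z - x)) \<partial>lborel)"
    using mollify_conv[OF Cc_infty_measurable[OF assms]] by blast
  then show ?thesis
    using smooth_convolution[OF Cc_infty_integrable[OF assms] mollifier_Cc_infty]
    by (simp add: borel_measurable_continuous_onI smooth_continuous)
qed

text \<open>The error is a weighted average of f(x + y) - f(x) over |y| < \<epsilon>; Jensen's
  inequality, an exchange of integrals and the translation estimate bound it. The rate depends on f
  through its energy alone, which is what compactness requires.\<close>

lemma mollify_error:
  assumes \<Omega>: "open \<Omega>" and f: "f \<in> Cc_infty \<Omega>"
  shows "(\<lambda>x. mollify \<epsilon> f x - f x) \<in> L2 \<Omega>"
    and "L2_norm_sq \<Omega> (\<lambda>x. mollify \<epsilon> f x - f x) \<le> \<epsilon>\<^sup>2 * dirichlet_energy \<Omega> f"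
proof -
  let ?E = "dirichlet_energy \<Omega> f"
  note fc = Cc_infty_continuous[OF f] and [measurable] = Cc_infty_measurable[OF f] mollifier_measurable mollify_measurable[OF f]
  have g_cont: "continuous_on UNIV (\<lambda>y. f (x + y) - f x)" for x
    using continuous_on_translate[OF fc, of x] by (intro continuous_intros) (simp add: add.commute)
  have pointwise: "ennreal ((norm (mollify \<epsilon> f x - f x))\<^sup>2) \<le>
      (\<integral>\<^sup>+y. ennreal (mollifier \<epsilon> y * (norm (f (x + y) - f x))\<^sup>2) \<partial>lborel)" for x
  proof -
    have fx: "integrable lborel (\<lambda>y. mollifier \<epsilon> y *\<^sub>R f (x + y))"
      using mollifier_integrable_mult[OF continuous_on_translate[OF fc, of x]] by (simp add: add.commute)
    have "mollify \<epsilon> f x - f x = (\<integral>y. mollifier \<epsilon> y *\<^sub>R (f (x + y) - f x) \<partial>lborel)"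
      using fx mollifier_integrable_mult[OF continuous_on_const[of _ "f x"]] mollifier_integrable[where 'a='a]
      by (simp add: mollify_def scaleR_diff_right integral_mollifier)
    then have "(norm (mollify \<epsilon> f x - f x))\<^sup>2 \<le> (\<integral>y. mollifier \<epsilon> y * (norm (f (x + y) - f x))\<^sup>2 \<partial>lborel)"
      using mollifier_Jensen[OF g_cont] by simp
    moreover have "integrable lborel (\<lambda>y. mollifier \<epsilon> y * (norm (f (x + y) - f x))\<^sup>2)"
      using mollifier_integrable_mult[OF continuous_on_power[OF continuous_on_norm[OF g_cont]]] by simp
    ultimately show ?thesis
      by (subst nn_integral_eq_integral) (auto simp: mollifier_nonneg intro: ennreal_leI)
  qed
  have "(\<integral>\<^sup>+x. ennreal ((norm (mollify \<epsilon> f x - f x))\<^sup>2) \<partial>lborel) \<le>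
      (\<integral>\<^sup>+x. (\<integral>\<^sup>+y. ennreal (mollifier \<epsilon> y * (norm (f (x + y) - f x))\<^sup>2) \<partial>lborel) \<partial>lborel)"
    by (intro nn_integral_mono pointwise)
  also have "\<dots> = (\<integral>\<^sup>+y. (\<integral>\<^sup>+x. ennreal (mollifier \<epsilon> y * (norm (f (x + y) - f x))\<^sup>2) \<partial>lborel) \<partial>lborel)"
    by (rule lborel_pair.Fubini') measurable
  also have "\<dots> \<le> (\<integral>\<^sup>+y. ennreal (mollifier \<epsilon> y * (\<epsilon>\<^sup>2 * ?E)) \<partial>(lborel :: 'a measure))"
  proof (rule nn_integral_mono)
    fix y :: 'a
    show "(\<integral>\<^sup>+x. ennreal (mollifier \<epsilon> y * (norm (f (x + y) - f x))\<^sup>2) \<partial>lborel) \<le> ennreal (mollifier \<epsilon> y * (\<epsilon>\<^sup>2 * ?E))"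
    proof (cases "norm y < \<epsilon>")
      case True
      have "integrable lborel (\<lambda>x. (norm (f (x + y) - f x))\<^sup>2)"
      proof -
        obtain K where K: "compact K" "\<And>x. x \<notin> K \<Longrightarrow> f x = 0" using Cc_inftyE[OF f] by metis
        show ?thesis
        proof (rule integrable_compact_support)
          show "compact (K \<union> (\<lambda>x. x - y) ` K)"
            using K(1) by (intro compact_Un compact_continuous_image continuous_intros)
          show "(norm (f (x + y) - f x))\<^sup>2 = 0" if "x \<notin> K \<union> (\<lambda>x. x - y) ` K" for x
          proof -
            have "x + y \<notin> K" using that by (force simp: image_iff)
            then show ?thesis using that K(2) by simp
          qed
          show "continuous_on UNIV (\<lambda>x. (norm (f (x + y) - f x))\<^sup>2)"
            by (intro continuous_intros continuous_on_translate fc)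
        qed
      qed
      moreover have "mollifier \<epsilon> y * (\<integral>x. (norm (f (x + y) - f x))\<^sup>2 \<partial>lborel) \<le> mollifier \<epsilon> y * (\<epsilon>\<^sup>2 * ?E)"
      proof (intro mult_left_mono mollifier_nonneg)
        have "(\<integral>x. (norm (f (x + y) - f x))\<^sup>2 \<partial>lborel) \<le> (norm y)\<^sup>2 * ?E"
          by (rule translation_energy[OF \<Omega> f])
        also have "\<dots> \<le> \<epsilon>\<^sup>2 * ?E"
          using True by (intro mult_right_mono power_mono dirichlet_energy_nonneg) auto
        finally show "(\<integral>x. (norm (f (x + y) - f x))\<^sup>2 \<partial>lborel) \<le> \<epsilon>\<^sup>2 * ?E" .
      qed
      ultimately show ?thesis
        by (subst nn_integral_eq_integral) (auto simp: mollifier_nonneg intro!: ennreal_leI)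
    qed (simp add: mollifier_eq_0)
  qed
  also have "\<dots> = ennreal (\<integral>y. mollifier \<epsilon> y * (\<epsilon>\<^sup>2 * ?E) \<partial>(lborel :: 'a measure))"
    using mollifier_integrable[where 'a='a]
    by (intro nn_integral_eq_integral AE_I2 mult_nonneg_nonneg mollifier_nonneg zero_le_power2 dirichlet_energy_nonneg) auto
  also have "\<dots> = ennreal (\<epsilon>\<^sup>2 * ?E)"
    by (simp add: integral_mollifier)
  finally have bound: "(\<integral>\<^sup>+x. ennreal ((norm (mollify \<epsilon> f x - f x))\<^sup>2) \<partial>lborel) \<le> ennreal (\<epsilon>\<^sup>2 * ?E)" .
  have int: "integrable lborel (\<lambda>x. (norm (mollify \<epsilon> f x - f x))\<^sup>2)"
    using bound by (intro integrableI_bounded) (auto simp: le_less_trans)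
  have "(\<integral>x. (norm (mollify \<epsilon> f x - f x))\<^sup>2 \<partial>lborel) \<le> \<epsilon>\<^sup>2 * ?E"
    using bound int dirichlet_energy_nonneg[of \<Omega> f] by (simp add: nn_integral_eq_integral)
  have intl: "integrable lebesgue (\<lambda>x. (norm (mollify \<epsilon> f x - f x))\<^sup>2)"
    using int by (simp add: integrable_completion)
  have into: "integrable (lebesgue_on \<Omega>) (\<lambda>x. (norm (mollify \<epsilon> f x - f x))\<^sup>2)"
    using integrable_mult_indicator[OF _ intl, of \<Omega>] \<Omega> by (subst integrable_restrict_space) auto
  then show "(\<lambda>x. mollify \<epsilon> f x - f x) \<in> L2 \<Omega>"
    by (intro L2I) (auto simp: measurable_completion measurable_restrict_space1)
  have "L2_norm_sq \<Omega> (\<lambda>x. mollify \<epsilon> f x - f x) = (\<integral>x. indicator \<Omega> x *\<^sub>R (norm (mollify \<epsilon> f x - f x))\<^sup>2 \<partial>lebesgue)"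
    unfolding L2_norm_sq_def using \<Omega> by (intro integral_restrict_space) auto
  also have "\<dots> \<le> (\<integral>x. (norm (mollify \<epsilon> f x - f x))\<^sup>2 \<partial>lebesgue)"
    using \<Omega> intl by (intro integral_mono integrable_mult_indicator) (auto simp: indicator_def)
  also have "\<dots> = (\<integral>x. (norm (mollify \<epsilon> f x - f x))\<^sup>2 \<partial>lborel)"
    by (rule integral_completion) simp
  also have "\<dots> \<le> \<epsilon>\<^sup>2 * ?E" by fact
  finally show "L2_norm_sq \<Omega> (\<lambda>x. mollify \<epsilon> f x - f x) \<le> \<epsilon>\<^sup>2 * ?E" .
qed

text \<open>The constant depends on \<epsilon> but not on f. Functions bounded in L^1 thus become
  uniformly bounded and equi-Lipschitz after mollification, as the theorem of Arzela and Ascoli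
  demands.\<close>

lemma mollify_bounds:
  "\<exists>C\<ge>0. \<forall>f \<Omega>. f \<in> Cc_infty \<Omega> \<longrightarrow>
    (\<forall>x. norm (mollify \<epsilon> f x) \<le> C * (\<integral>z. norm (f z) \<partial>(lborel :: 'a::euclidean_space measure))) \<and>
    (\<forall>x y. norm (mollify \<epsilon> f x - mollify \<epsilon> f y) \<le> C * norm (x - y) * (\<integral>z. norm (f z) \<partial>lborel))"
proof -
  obtain L where L: "0 \<le> L" "\<And>x y::'a. norm (complex_of_real (mollifier \<epsilon> x) - complex_of_real (mollifier \<epsilon> y)) \<le> L * norm (x - y)"
    using Cc_infty_Lipschitz[OF mollifier_Cc_infty] by metis
  obtain K where K: "0 < K" "\<And>x::'a. norm (complex_of_real (mollifier \<epsilon> x)) \<le> K"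
    using Cc_infty_bounded[OF mollifier_Cc_infty] by metis
  have int: "integrable lborel (\<lambda>z. f z * complex_of_real (mollifier \<epsilon> (z - x)))" if f: "f \<in> Cc_infty \<Omega>" for f \<Omega> and x :: 'a
    using Cc_infty_integrable_mult[OF f continuous_on_translate[OF Cc_infty_continuous[OF mollifier_Cc_infty], of "- x"]] by simp
  have le: "norm (\<integral>z. f z * g z \<partial>lborel) \<le> D * (\<integral>z. norm (f z) \<partial>(lborel :: 'a measure))"
    if f: "f \<in> Cc_infty \<Omega>" and g: "\<And>z. norm (g z) \<le> D" "integrable lborel (\<lambda>z. f z * g z)" for f \<Omega> and D :: real and g :: "'a \<Rightarrow> complex"
  proof -
    have "norm (\<integral>z. f z * g z \<partial>lborel) \<le> (\<integral>z. norm (f z * g z) \<partial>lborel)" by (rule integral_norm_bound)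
    also have "\<dots> \<le> (\<integral>z. D * norm (f z) \<partial>lborel)"
    proof (rule integral_mono)
      show "integrable lborel (\<lambda>z. D * norm (f z))" using Cc_infty_integrable[OF f] by simp
      show "norm (f z * g z) \<le> D * norm (f z)" for z
        using mult_left_mono[OF g(1)[of z], of "norm (f z)"] by (simp add: norm_mult mult.commute)
    qed (use g(2) in simp)
    finally show ?thesis by simp
  qed
  have b1: "norm (mollify \<epsilon> f x) \<le> max L K * (\<integral>z. norm (f z) \<partial>lborel)" if f: "f \<in> Cc_infty \<Omega>" for f \<Omega> and x :: 'a
    unfolding mollify_conv[OF Cc_infty_measurable[OF f]]
    using K(2) by (intro le[OF f] int[OF f]) (simp add: le_max_iff_disj)
  have b2: "norm (mollify \<epsilon> f x - mollify \<epsilon> f y) \<le> max L K * norm (x - y) * (\<integral>z. norm (f z) \<partial>lborel)"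
    if f: "f \<in> Cc_infty \<Omega>" for f \<Omega> and x y :: 'a
  proof -
    let ?g = "\<lambda>z. complex_of_real (mollifier \<epsilon> (z - x)) - complex_of_real (mollifier \<epsilon> (z - y))"
    have eq: "f z * ?g z = f z * complex_of_real (mollifier \<epsilon> (z - x)) - f z * complex_of_real (mollifier \<epsilon> (z - y))" for z
      by (simp add: right_diff_distrib)
    have "mollify \<epsilon> f x - mollify \<epsilon> f y = (\<integral>z. f z * ?g z \<partial>lborel)"
      unfolding eq mollify_conv[OF Cc_infty_measurable[OF f]] using int[OF f] by simp
    moreover have "norm (\<integral>z. f z * ?g z \<partial>lborel) \<le> (max L K * norm (x - y)) * (\<integral>z. norm (f z) \<partial>lborel)"
    proof (rule le[OF f])
      fix z :: 'a
      have "norm (?g z) \<le> L * norm ((z - x) - (z - y))" by (rule L(2))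
      also have "\<dots> \<le> max L K * norm (x - y)" by (simp add: norm_minus_commute mult_right_mono)
      finally show "norm (?g z) \<le> max L K * norm (x - y)" .
    next
      show "integrable lborel (\<lambda>z. f z * ?g z)" unfolding eq using int[OF f] by simp
    qed
    ultimately show ?thesis by simp
  qed
  have "0 \<le> max L K" using L(1) by simp
  then show ?thesis using b1 b2 by blast
qed

end

text \<open>For one tolerance e: with \<epsilon> small, mollification changes all F n by little, and
  the mollified functions have a uniformly convergent subsequence. Both \<epsilon> and the
  subsequence depend on e.\<close>

lemma Rellich_step:
  fixes F :: "nat \<Rightarrow> 'a::euclidean_space \<Rightarrow> complex"
  assumes \<Omega>: "open \<Omega>" "bounded \<Omega>" and F: "\<And>n. F n \<in> Cc_infty \<Omega>"
    and B: "\<And>n. L2_norm_sq \<Omega> (F n) \<le> B" "\<And>n. dirichlet_energy \<Omega> (F n) \<le> B" and e: "0 < e"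
  shows "\<exists>r. strict_mono (r :: nat \<Rightarrow> nat) \<and>
    (\<exists>N. \<forall>i\<ge>N. \<forall>j\<ge>N. L2_norm_sq \<Omega> (\<lambda>x. F (r i) x - F (r j) x) < e)"
proof -
  have B0: "0 \<le> B" using B(1)[of 0] L2_norm_sq_nonneg[of \<Omega> "F 0"] by simp
  let ?m = "L2_norm_sq \<Omega> (\<lambda>x. 1)"
  have m0: "0 \<le> ?m" by (rule L2_norm_sq_nonneg)
  \<comment> \<open>The difference is split as a + (b + c), with squared norm at most twice that of
    a plus four times those of b and c. The mollification errors a and c contribute at most 6
    \<epsilon>^2 B, which has to stay below e/2; hence the 12.\<close>
  define \<epsilon> where "\<epsilon> = sqrt (e / (12 * (B + 1)))"
  have \<epsilon>: "0 < \<epsilon>" using e B0 by (simp add: \<epsilon>_def)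
  have \<epsilon>B: "6 * (\<epsilon>\<^sup>2 * B) < e / 2"
  proof -
    have "\<epsilon>\<^sup>2 = e / (12 * (B + 1))" using e B0 by (simp add: \<epsilon>_def)
    then have "6 * (\<epsilon>\<^sup>2 * B) = e / 2 * (B / (B + 1))" using B0 by (simp add: field_simps)
    also have "\<dots> < e / 2 * 1" using e B0 by (intro mult_strict_left_mono) (simp_all add: divide_less_eq)
    finally show ?thesis by simp
  qed
  define \<Lambda> where "\<Lambda> = sqrt (B * ?m)"
  have \<Lambda>: "0 \<le> \<Lambda>" using B0 m0 by (simp add: \<Lambda>_def)
  have L1: "(\<integral>z. norm (F n z) \<partial>lborel) \<le> \<Lambda>" for n
  proof -
    have "(\<integral>z. norm (F n z) \<partial>lborel) = (\<integral>z. norm (F n z) \<partial>lebesgue_on \<Omega>)"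
      using Cc_infty_measurable[OF F] by (intro integral_lebesgue_on_eq_lborel[symmetric] \<Omega>) (auto simp: Cc_infty_vanishes[OF F])
    moreover have "(\<integral>z. norm (F n z) \<partial>lebesgue_on \<Omega>)\<^sup>2 \<le> B * ?m"
      using L2_integral_norm_bound[OF \<Omega>(2,1) Cc_infty_L2[OF F \<Omega>(1)], of n] mult_right_mono[OF B(1) m0, of n] by linarith
    ultimately show ?thesis unfolding \<Lambda>_def by (simp add: real_le_rsqrt)
  qed
  obtain C where C: "0 \<le> C"
    "\<And>f \<Omega> x. f \<in> Cc_infty \<Omega> \<Longrightarrow> norm (mollify \<epsilon> f x) \<le> C * (\<integral>z. norm (f z) \<partial>(lborel :: 'a measure))"
    "\<And>f \<Omega> x y. f \<in> Cc_infty \<Omega> \<Longrightarrow> norm (mollify \<epsilon> f x - mollify \<epsilon> f y) \<le> C * norm (x - y) * (\<integral>z. norm (f z) \<partial>(lborel :: 'a measure))"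
    using mollify_bounds[OF \<epsilon>, where 'a='a] by blast
  let ?m\<epsilon> = "\<lambda>n. mollify \<epsilon> (F n)"
  have S: "compact (closure \<Omega>)" using \<Omega>(2) by (simp add: compact_closure)
  have "\<exists>g r. strict_mono (r :: nat \<Rightarrow> nat) \<and>
      (\<forall>e>0. \<exists>N. \<forall>n x. n \<ge> N \<and> x \<in> closure \<Omega> \<longrightarrow> norm (?m\<epsilon> (r n) x - g x) < e)"
  proof (rule Arzela_Ascoli[OF S, of ?m\<epsilon> "C * \<Lambda>"])
    show "norm (?m\<epsilon> n x) \<le> C * \<Lambda>" for n x
      using C(2)[OF F[of n], of x] mult_left_mono[OF L1[of n] C(1)] by linarith
    fix x :: 'a and d :: real assume d: "0 < d"
    define \<delta> where "\<delta> = d / (C * \<Lambda> + 1)"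
    have CL: "0 \<le> C * \<Lambda>" using C(1) \<Lambda> by simp
    have \<delta>: "0 < \<delta>" using d CL by (simp add: \<delta>_def)
    have "norm (?m\<epsilon> n x - ?m\<epsilon> n y) < d" if "norm (x - y) < \<delta>" for n y
    proof -
      have "norm (?m\<epsilon> n x - ?m\<epsilon> n y) \<le> C * norm (x - y) * \<Lambda>"
        using C(3)[OF F[of n], of x y] mult_left_mono[OF L1[of n], of "C * norm (x - y)"] C(1) by simp
      also have "\<dots> = C * \<Lambda> * norm (x - y)" by simp
      also have "\<dots> \<le> C * \<Lambda> * \<delta>" using that CL by (intro mult_left_mono) auto
      also have "\<dots> < d" using d CL by (simp add: \<delta>_def divide_less_eq)
      finally show ?thesis .
    qed
    then show "\<exists>\<delta>. 0 < \<delta> \<and> (\<forall>n y. y \<in> closure \<Omega> \<and> norm (x - y) < \<delta> \<longrightarrow> norm (?m\<epsilon> n x - ?m\<epsilon> n y) < d)"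
      using \<delta> by blast
  qed blast
  then obtain g and r :: "nat \<Rightarrow> nat" where r: "strict_mono r"
    "\<And>e. 0 < e \<Longrightarrow> \<exists>N. \<forall>n x. n \<ge> N \<and> x \<in> closure \<Omega> \<longrightarrow> norm (?m\<epsilon> (r n) x - g x) < e" by blast
  \<comment> \<open>The middle term contributes at most 4 (2 \<eta>)^2 ?m, that is 16 \<eta>^2 ?m;
    the 32 keeps it below e/2.\<close>
  define \<eta> where "\<eta> = sqrt (e / (32 * (?m + 1)))"
  have \<eta>: "0 < \<eta>" using e m0 by (simp add: \<eta>_def)
  have \<eta>m: "4 * ((2 * \<eta>)\<^sup>2 * ?m) < e / 2"
  proof -
    have "\<eta>\<^sup>2 = e / (32 * (?m + 1))" using e m0 by (simp add: \<eta>_def)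
    then have "4 * ((2 * \<eta>)\<^sup>2 * ?m) = e / 2 * (?m / (?m + 1))" using m0 by (simp add: power_mult_distrib field_simps)
    also have "\<dots> < e / 2 * 1" using e m0 by (intro mult_strict_left_mono) (simp_all add: divide_less_eq)
    finally show ?thesis by simp
  qed
  obtain N where N: "\<And>n x. n \<ge> N \<Longrightarrow> x \<in> closure \<Omega> \<Longrightarrow> norm (?m\<epsilon> (r n) x - g x) < \<eta>"
    using r(2)[OF \<eta>] by blast
  have "L2_norm_sq \<Omega> (\<lambda>x. F (r i) x - F (r j) x) < e" if ij: "N \<le> i" "N \<le> j" for i j
  proof -
    let ?a = "\<lambda>x. F (r i) x - ?m\<epsilon> (r i) x" and ?b = "\<lambda>x. ?m\<epsilon> (r i) x - ?m\<epsilon> (r j) x" and ?c = "\<lambda>x. ?m\<epsilon> (r j) x - F (r j) x"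
    have err: "(\<lambda>x. ?m\<epsilon> n x - F n x) \<in> L2 \<Omega>" "L2_norm_sq \<Omega> (\<lambda>x. ?m\<epsilon> n x - F n x) \<le> \<epsilon>\<^sup>2 * B" for n
      using mollify_error[OF \<epsilon> \<Omega>(1) F, of n] mult_left_mono[OF B(2)[of n], of "\<epsilon>\<^sup>2"] by auto
    have moll_L2: "?m\<epsilon> n \<in> L2 \<Omega>" for n
      using L2_add[OF err(1) Cc_infty_L2[OF F \<Omega>(1)], of n n] by simp
    have a: "?a \<in> L2 \<Omega>" "L2_norm_sq \<Omega> ?a \<le> \<epsilon>\<^sup>2 * B"
      using err(2)[of "r i"] L2_norm_sq_uminus[of \<Omega> "F (r i)" "?m\<epsilon> (r i)"] L2_diff[OF Cc_infty_L2[OF F \<Omega>(1)] moll_L2] by auto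
    have b: "?b \<in> L2 \<Omega>" by (rule L2_diff[OF moll_L2 moll_L2])
    have bn: "L2_norm_sq \<Omega> ?b \<le> (2 * \<eta>)\<^sup>2 * ?m"
    proof -
      have "L2_norm_sq \<Omega> ?b \<le> (\<integral>x. (2 * \<eta>)\<^sup>2 * (norm (1 :: complex))\<^sup>2 \<partial>lebesgue_on \<Omega>)"
        unfolding L2_norm_sq_def
      proof (rule integral_mono[OF L2_integrable[OF b]])
        show "integrable (lebesgue_on \<Omega>) (\<lambda>x. (2 * \<eta>)\<^sup>2 * (norm (1 :: complex))\<^sup>2)"
          using L2_integrable[OF L2_const[OF \<Omega>(2,1), of 1]] by (intro integrable_mult_right)
        fix x assume "x \<in> space (lebesgue_on \<Omega>)"
        then have x: "x \<in> closure \<Omega>" using closure_subset by auto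
        have "norm (?b x) \<le> norm (?m\<epsilon> (r i) x - g x) + norm (?m\<epsilon> (r j) x - g x)"
          using norm_triangle_ineq4[of "?m\<epsilon> (r i) x - g x" "?m\<epsilon> (r j) x - g x"] by simp
        also have "\<dots> \<le> 2 * \<eta>" using N[OF ij(1) x] N[OF ij(2) x] by simp
        finally have "(norm (?b x))\<^sup>2 \<le> (2 * \<eta>)\<^sup>2" by (intro power_mono) auto
        then show "(norm (?b x))\<^sup>2 \<le> (2 * \<eta>)\<^sup>2 * (norm (1 :: complex))\<^sup>2" by simp
      qed
      also have "\<dots> = (2 * \<eta>)\<^sup>2 * ?m" by (simp only: L2_norm_sq_def integral_mult_right_zero)
      finally show ?thesis .
    qed
    have "L2_norm_sq \<Omega> (\<lambda>x. ?b x + ?c x) \<le> 2 * L2_norm_sq \<Omega> ?b + 2 * L2_norm_sq \<Omega> ?c"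
      by (rule L2_norm_sq_add_le[OF b err(1)])
    moreover have "L2_norm_sq \<Omega> (\<lambda>x. ?a x + (?b x + ?c x)) \<le> 2 * L2_norm_sq \<Omega> ?a + 2 * L2_norm_sq \<Omega> (\<lambda>x. ?b x + ?c x)"
      by (rule L2_norm_sq_add_le[OF a(1) L2_add[OF b err(1)]])
    moreover have "L2_norm_sq \<Omega> (\<lambda>x. ?a x + (?b x + ?c x)) = L2_norm_sq \<Omega> (\<lambda>x. F (r i) x - F (r j) x)"
      by (simp add: algebra_simps)
    ultimately show ?thesis using a(2) bn err(2)[of "r j"] \<epsilon>B \<eta>m by linarith
  qed
  then show ?thesis using r(1) by blast
qed

text \<open>\<open>Rellich_step\<close> gives a subsequence for each tolerance 1/(n + 1), and the
  diagonal sequence is eventually a subsequence of every one of them.\<close>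

lemma Rellich:
  fixes F :: "nat \<Rightarrow> 'a::euclidean_space \<Rightarrow> complex"
  assumes \<Omega>: "open \<Omega>" "bounded \<Omega>" and F: "\<And>n. F n \<in> Cc_infty \<Omega>"
    and B: "\<And>n. L2_norm_sq \<Omega> (F n) \<le> B" "\<And>n. dirichlet_energy \<Omega> (F n) \<le> B"
  shows "\<exists>r. strict_mono (r :: nat \<Rightarrow> nat) \<and>
    (\<forall>e>0. \<exists>N. \<forall>i\<ge>N. \<forall>j\<ge>N. L2_norm_sq \<Omega> (\<lambda>x. F (r i) x - F (r j) x) < e)"
proof -
  define P where "P n s \<longleftrightarrow> (\<exists>N. \<forall>i\<ge>N. \<forall>j\<ge>N. L2_norm_sq \<Omega> (\<lambda>x. F (s i) x - F (s j) x) < 1 / real (Suc n))"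
    for n and s :: "nat \<Rightarrow> nat"
  interpret subseqs P
  proof
    fix n and s :: "nat \<Rightarrow> nat"
    show "\<exists>r'. strict_mono r' \<and> P n (s \<circ> r')"
      using Rellich_step[OF \<Omega>, of "\<lambda>k. F (s k)" B "1 / real (Suc n)"] F B by (simp add: P_def)
  qed
  have "P k (diagseq \<circ> (+) (Suc k))" for k
  proof (rule diagseq_holds)
    fix r s :: "nat \<Rightarrow> nat" and n assume r: "strict_mono r" and "P n s"
    then obtain N where N: "\<And>i j. N \<le> i \<Longrightarrow> N \<le> j \<Longrightarrow> L2_norm_sq \<Omega> (\<lambda>x. F (s i) x - F (s j) x) < 1 / real (Suc n)"
      by (auto simp: P_def)
    have "N \<le> r i" if "N \<le> i" for i using seq_suble[OF r, of i] that by simp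
    then show "P n (s \<circ> r)" unfolding P_def using N by (intro exI[of _ N]) auto
  qed
  moreover have "\<exists>N. \<forall>i\<ge>N. \<forall>j\<ge>N. L2_norm_sq \<Omega> (\<lambda>x. F (diagseq i) x - F (diagseq j) x) < e"
    if e: "0 < e" and P: "\<And>k. P k (diagseq \<circ> (+) (Suc k))" for e
  proof -
    obtain k where k: "1 / real (Suc k) < e" using e nat_approx_posE by blast
    obtain N where N: "\<And>i j. N \<le> i \<Longrightarrow> N \<le> j \<Longrightarrow>
        L2_norm_sq \<Omega> (\<lambda>x. F (diagseq (Suc k + i)) x - F (diagseq (Suc k + j)) x) < 1 / real (Suc k)"
      using P[of k] by (auto simp: P_def)
    have "L2_norm_sq \<Omega> (\<lambda>x. F (diagseq i) x - F (diagseq j) x) < e"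
      if "N + Suc k \<le> i" "N + Suc k \<le> j" for i j
    proof -
      have "L2_norm_sq \<Omega> (\<lambda>x. F (diagseq (Suc k + (i - Suc k))) x - F (diagseq (Suc k + (j - Suc k))) x) < 1 / real (Suc k)"
        by (rule N) (use that in auto)
      then show ?thesis using that k by simp
    qed
    then show ?thesis by blast
  qed
  ultimately show ?thesis using subseq_diagseq by blast
qed

section \<open>The ground state\<close>

lemma integration_by_parts_on:
  assumes "open \<Omega>" "f \<in> Cc_infty \<Omega>" "\<phi> \<in> Cc_infty \<Omega>" "b \<in> Basis"
  shows "(\<integral>x. f x * partial_deriv b \<phi> x \<partial>lebesgue_on \<Omega>) = - (\<integral>x. partial_deriv b f x * \<phi> x \<partial>lebesgue_on \<Omega>)"
proof -
  have "(\<integral>x. g x * h x \<partial>lebesgue_on \<Omega>) = (\<integral>x. g x * h x \<partial>lborel)"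
    if "g \<in> Cc_infty \<Omega>" "h \<in> Cc_infty \<Omega>" for g h
    using Cc_infty_measurable[OF that(1)] Cc_infty_measurable[OF that(2)]
    by (intro integral_lebesgue_on_eq_lborel assms(1)) (auto simp: Cc_infty_vanishes[OF that(1)])
  then show ?thesis
    using integration_by_parts[OF assms(3) Cc_infty_smooth[OF assms(2)] assms(4)]
      assms Cc_infty_partial_deriv by metis
qed

lemma integral_mult_laplacian_on:
  assumes \<Omega>: "open \<Omega>" and f: "f \<in> L2 \<Omega>" and \<phi>: "\<phi> \<in> Cc_infty \<Omega>"
  shows "(\<integral>x. f x * laplacian \<phi> x \<partial>lebesgue_on \<Omega>) =
    (\<Sum>b\<in>Basis. \<integral>x. f x * partial_deriv b (partial_deriv b \<phi>) x \<partial>lebesgue_on \<Omega>)"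
  unfolding laplacian_def sum_distrib_left
  by (intro Bochner_Integration.integral_sum L2_integrable_mult[OF f] Cc_infty_L2[where \<Omega>' = \<Omega>, OF _ \<Omega>] Cc_infty_partial_deriv \<phi>)

text \<open>Pairings are bilinear here, as in the weak formulations. The conjugate is put on g so
  that the cross term becomes the real part of such a pairing.\<close>

lemma L2_norm_sq_add_cnj:
  assumes "f \<in> L2 \<Omega>" "g \<in> L2 \<Omega>"
  shows "L2_norm_sq \<Omega> (\<lambda>x. f x + complex_of_real t * cnj (g x)) =
    L2_norm_sq \<Omega> f + 2 * t * Re (\<integral>x. f x * g x \<partial>lebesgue_on \<Omega>) + t\<^sup>2 * L2_norm_sq \<Omega> g"
proof -
  let ?M = "lebesgue_on \<Omega>"
  have "(norm (z + complex_of_real t * cnj w))\<^sup>2 = (norm z)\<^sup>2 + 2 * t * Re (z * w) + t\<^sup>2 * (norm w)\<^sup>2" for z w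
    unfolding cmod_power2 by (simp add: power2_eq_square algebra_simps)
  then have "L2_norm_sq \<Omega> (\<lambda>x. f x + complex_of_real t * cnj (g x)) =
      (\<integral>x. (norm (f x))\<^sup>2 + 2 * t * Re (f x * g x) + t\<^sup>2 * (norm (g x))\<^sup>2 \<partial>?M)"
    by (simp only: L2_norm_sq_def)
  also have "\<dots> = L2_norm_sq \<Omega> f + 2 * t * (\<integral>x. Re (f x * g x) \<partial>?M) + t\<^sup>2 * L2_norm_sq \<Omega> g"
    using L2_integrable[OF assms(1)] L2_integrable[OF assms(2)] integrable_Re[OF L2_integrable_mult[OF assms]]
    by (simp add: L2_norm_sq_def del: times_complex.sel)
  also have "(\<integral>x. Re (f x * g x) \<partial>?M) = Re (\<integral>x. f x * g x \<partial>?M)"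
    by (rule integral_Re[OF L2_integrable_mult[OF assms]])
  finally show ?thesis .
qed

text \<open>The form Q, energy minus m times the squared norm, is non-negative on test functions.
  Integration by parts turns the expression under the square into minus the polar form of Q at f and
  the conjugate of g, so the inequality is the discriminant condition for Q along the line from f in
  the direction of that conjugate.\<close>

lemma quadratic_form_Cauchy_Schwarz:
  assumes \<Omega>: "open \<Omega>" and m: "\<And>\<phi>. \<phi> \<in> Cc_infty \<Omega> \<Longrightarrow> m * L2_norm_sq \<Omega> \<phi> \<le> dirichlet_energy \<Omega> \<phi>"
    and f: "f \<in> Cc_infty \<Omega>" and g: "g \<in> Cc_infty \<Omega>"
  shows "(Re ((\<integral>x. f x * laplacian g x \<partial>lebesgue_on \<Omega>) + complex_of_real m * (\<integral>x. f x * g x \<partial>lebesgue_on \<Omega>)))\<^sup>2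
    \<le> (dirichlet_energy \<Omega> f - m * L2_norm_sq \<Omega> f) * (dirichlet_energy \<Omega> g - m * L2_norm_sq \<Omega> g)"
proof -
  let ?M = "lebesgue_on \<Omega>"
  define D where "D = Re ((\<integral>x. f x * laplacian g x \<partial>?M) + complex_of_real m * (\<integral>x. f x * g x \<partial>?M))"
  have L2: "h \<in> L2 \<Omega>" if "h \<in> Cc_infty \<Omega>" for h using Cc_infty_L2[OF that \<Omega>] .
  have D: "- D = (\<Sum>b\<in>Basis. Re (\<integral>x. partial_deriv b f x * partial_deriv b g x \<partial>?M)) - m * Re (\<integral>x. f x * g x \<partial>?M)"
    using integration_by_parts_on[OF \<Omega> f Cc_infty_partial_deriv[OF g]]
    by (simp add: D_def integral_mult_laplacian_on[OF \<Omega> L2[OF f] g] sum_negf)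
  have "(- D)\<^sup>2 \<le> (dirichlet_energy \<Omega> f - m * L2_norm_sq \<Omega> f) * (dirichlet_energy \<Omega> g - m * L2_norm_sq \<Omega> g)"
  proof (rule discriminant_le)
    fix t :: real
    have bl: "bounded_linear (\<lambda>z. complex_of_real t * cnj z)"
      by (rule bounded_linear_compose[OF bounded_linear_mult_right bounded_linear_cnj])
    let ?h = "\<lambda>x. f x + complex_of_real t * cnj (g x)"
    have tg: "(\<lambda>x. complex_of_real t * cnj (g x)) \<in> Cc_infty \<Omega>"
      by (rule Cc_infty_bounded_linear[OF bl g])
    have h: "?h \<in> Cc_infty \<Omega>" by (rule Cc_infty_add[OF f tg])
    have "partial_deriv b ?h = (\<lambda>x. partial_deriv b f x + complex_of_real t * cnj (partial_deriv b g x))" for b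
      by (simp add: partial_deriv_add[OF Cc_infty_smooth[OF f] Cc_infty_smooth[OF tg]]
          partial_deriv_bounded_linear[OF bl Cc_infty_smooth[OF g]])
    then have "dirichlet_energy \<Omega> ?h = dirichlet_energy \<Omega> f +
        2 * t * (\<Sum>b\<in>Basis. Re (\<integral>x. partial_deriv b f x * partial_deriv b g x \<partial>?M)) + t\<^sup>2 * dirichlet_energy \<Omega> g"
      using Cc_infty_partial_deriv[OF f] Cc_infty_partial_deriv[OF g]
      by (simp add: dirichlet_energy_def L2_norm_sq_add_cnj[OF L2 L2] sum.distrib sum_distrib_left)
    moreover have "L2_norm_sq \<Omega> ?h = L2_norm_sq \<Omega> f + 2 * t * Re (\<integral>x. f x * g x \<partial>?M) + t\<^sup>2 * L2_norm_sq \<Omega> g"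
      by (rule L2_norm_sq_add_cnj[OF L2[OF f] L2[OF g]])
    ultimately have "dirichlet_energy \<Omega> ?h - m * L2_norm_sq \<Omega> ?h =
       (dirichlet_energy \<Omega> f - m * L2_norm_sq \<Omega> f) + 2 * t * (- D) + t\<^sup>2 * (dirichlet_energy \<Omega> g - m * L2_norm_sq \<Omega> g)"
      unfolding D by (simp add: algebra_simps)
    then show "0 \<le> (dirichlet_energy \<Omega> f - m * L2_norm_sq \<Omega> f) + 2 * t * (- D) + t\<^sup>2 * (dirichlet_energy \<Omega> g - m * L2_norm_sq \<Omega> g)"
      using m[OF h] by simp
  qed (use m[OF g] in simp)
  then show ?thesis unfolding power2_minus D_def .
qed

text \<open>Since the form tends to 0 along F n, its Cauchy-Schwarz inequality makes the polar form
  of F n with any fixed test function tend to 0. Both derivatives fall on the test function, so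
  convergence of F n against test functions is enough to pass to the limit.\<close>

lemma minimizing_limit_equation:
  assumes \<Omega>: "open \<Omega>" and m: "\<And>\<phi>. \<phi> \<in> Cc_infty \<Omega> \<Longrightarrow> m * L2_norm_sq \<Omega> \<phi> \<le> dirichlet_energy \<Omega> \<phi>"
    and F: "\<And>n. F n \<in> Cc_infty \<Omega>" "(\<lambda>n. dirichlet_energy \<Omega> (F n) - m * L2_norm_sq \<Omega> (F n)) \<longlonglongrightarrow> 0"
    and u: "\<And>\<phi>. \<phi> \<in> Cc_infty \<Omega> \<Longrightarrow>
      (\<lambda>n. \<integral>x. F n x * \<phi> x \<partial>lebesgue_on \<Omega>) \<longlonglongrightarrow> (\<integral>x. u x * \<phi> x \<partial>lebesgue_on \<Omega>)"
    and \<phi>: "\<phi> \<in> Cc_infty \<Omega>"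
  shows "(\<integral>x. u x * laplacian \<phi> x \<partial>lebesgue_on \<Omega>) = - complex_of_real m * (\<integral>x. u x * \<phi> x \<partial>lebesgue_on \<Omega>)"
proof -
  let ?D = "\<lambda>u \<phi>. (\<integral>x. u x * laplacian \<phi> x \<partial>lebesgue_on \<Omega>) + complex_of_real m * (\<integral>x. u x * \<phi> x \<partial>lebesgue_on \<Omega>)"
  have Re0: "Re (?D u \<phi>) = 0" if \<phi>: "\<phi> \<in> Cc_infty \<Omega>" for \<phi>
  proof -
    have "(\<lambda>n. ?D (F n) \<phi>) \<longlonglongrightarrow> ?D u \<phi>"
      by (intro tendsto_add tendsto_mult_left u laplacian_Cc_infty \<phi>)
    then have "(\<lambda>n. Re (?D (F n) \<phi>)) \<longlonglongrightarrow> Re (?D u \<phi>)" by (rule tendsto_Re)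
    moreover have "(\<lambda>n. Re (?D (F n) \<phi>)) \<longlonglongrightarrow> 0"
    proof (rule tendsto_0_of_power2_le)
      show "(Re (?D (F n) \<phi>))\<^sup>2 \<le> (dirichlet_energy \<Omega> (F n) - m * L2_norm_sq \<Omega> (F n)) * (dirichlet_energy \<Omega> \<phi> - m * L2_norm_sq \<Omega> \<phi>)" for n
        by (rule quadratic_form_Cauchy_Schwarz[OF \<Omega> m F(1) \<phi>])
      show "(\<lambda>n. (dirichlet_energy \<Omega> (F n) - m * L2_norm_sq \<Omega> (F n)) * (dirichlet_energy \<Omega> \<phi> - m * L2_norm_sq \<Omega> \<phi>)) \<longlonglongrightarrow> 0"
        by (rule tendsto_mult_left_zero[OF F(2)])
    qed
    ultimately show ?thesis by (rule LIMSEQ_unique)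
  qed
  \<comment> \<open>The estimate controls real parts only; testing with \<i> \<phi> supplies the
    imaginary part.\<close>
  have bl: "bounded_linear (\<lambda>z. \<i> * z)" by (rule bounded_linear_mult_right)
  have i\<phi>: "(\<lambda>x. \<i> * \<phi> x) \<in> Cc_infty \<Omega>" by (rule Cc_infty_bounded_linear[OF bl \<phi>])
  have "laplacian (\<lambda>x. \<i> * \<phi> x) = (\<lambda>x. \<i> * laplacian \<phi> x)"
    using smooth_partial_deriv[OF Cc_infty_smooth[OF \<phi>]]
    by (simp add: laplacian_def fun_eq_iff partial_deriv_bounded_linear[OF bl] Cc_infty_smooth[OF \<phi>] sum_distrib_left)
  then have "?D u (\<lambda>x. \<i> * \<phi> x) = \<i> * ?D u \<phi>"
    by (simp add: mult.left_commute[of _ \<i>] distrib_left)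
  then have "Im (?D u \<phi>) = 0" using Re0[OF i\<phi>] by simp
  then have "?D u \<phi> = 0" using Re0[OF \<phi>] by (simp only: complex_eq_iff zero_complex.sel)
  then show ?thesis by (simp add: add_eq_0_iff)
qed

lemma L2_norm_sq_cmult: "L2_norm_sq \<Omega> (\<lambda>x. c * f x) = (norm c)\<^sup>2 * L2_norm_sq \<Omega> f"
  by (simp add: L2_norm_sq_def norm_mult power_mult_distrib)

lemma partial_deriv_diff:
  assumes "smooth f" "smooth g"
  shows "partial_deriv b (\<lambda>x. f x - g x) = (\<lambda>x. partial_deriv b f x - partial_deriv b g x)"
  using partial_deriv_eq[OF has_derivative_diff[OF smooth_has_derivative[OF assms(1)]
        smooth_has_derivative[OF assms(2)]]]
  by (auto simp: partial_deriv_def)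

lemma L2_parallelogram:
  assumes "f \<in> L2 \<Omega>" "g \<in> L2 \<Omega>"
  shows "L2_norm_sq \<Omega> (\<lambda>x. f x + g x) + L2_norm_sq \<Omega> (\<lambda>x. f x - g x) = 2 * L2_norm_sq \<Omega> f + 2 * L2_norm_sq \<Omega> g"
proof -
  let ?M = "lebesgue_on \<Omega>"
  have "L2_norm_sq \<Omega> (\<lambda>x. f x + g x) + L2_norm_sq \<Omega> (\<lambda>x. f x - g x) =
      (\<integral>x. (norm (f x + g x))\<^sup>2 + (norm (f x - g x))\<^sup>2 \<partial>?M)"
    using L2_integrable[OF L2_add[OF assms]] L2_integrable[OF L2_diff[OF assms]]
    by (simp add: L2_norm_sq_def)
  also have "\<dots> = (\<integral>x. 2 * (norm (f x))\<^sup>2 + 2 * (norm (g x))\<^sup>2 \<partial>?M)"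
    by (intro Bochner_Integration.integral_cong refl) (unfold cmod_power2, simp add: power2_eq_square algebra_simps)
  also have "\<dots> = 2 * L2_norm_sq \<Omega> f + 2 * L2_norm_sq \<Omega> g"
    using L2_integrable[OF assms(1)] L2_integrable[OF assms(2)] by (simp add: L2_norm_sq_def)
  finally show ?thesis .
qed

lemma L2_norm_sq_eq_0_iff:
  assumes "f \<in> L2 \<Omega>"
  shows "L2_norm_sq \<Omega> f = 0 \<longleftrightarrow> (AE x in lebesgue_on \<Omega>. f x = 0)"
  unfolding L2_norm_sq_def
  by (subst integral_nonneg_eq_0_iff_AE[OF L2_integrable[OF assms]]) auto

lemma L2_norm_sq_cong_AE:
  assumes "f \<in> L2 \<Omega>" "g \<in> L2 \<Omega>" "AE x in lebesgue_on \<Omega>. f x = g x"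
  shows "L2_norm_sq \<Omega> f = L2_norm_sq \<Omega> g"
  unfolding L2_norm_sq_def
  using L2_integrable[OF assms(1)] L2_integrable[OF assms(2)] assms(3)
  by (intro integral_cong_AE borel_measurable_integrable) (auto elim: eventually_mono)

text \<open>The direct method, with a normalised minimising sequence of test functions for the
  Rayleigh quotient. Rellich's theorem makes a subsequence Cauchy in L^2, and the parallelogram law
  makes its gradients Cauchy as well, because \<open>H1_0\<close> asks for simultaneous
  approximation of u and its weak derivatives. The infimum m is thereby identified as an
  eigenvalue.\<close>

lemma ground_state:
  assumes \<Omega>: "open \<Omega>" "bounded \<Omega>" "\<Omega> \<noteq> {}"
  shows "\<exists>m. dirichlet_eigenvalue \<Omega> m \<and> (\<forall>\<phi>\<in>Cc_infty \<Omega>. m * L2_norm_sq \<Omega> \<phi> \<le> dirichlet_energy \<Omega> \<phi>)"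
proof -
  let ?N = "L2_norm_sq \<Omega>" and ?E = "dirichlet_energy \<Omega>"
  have L2: "h \<in> L2 \<Omega>" if "h \<in> Cc_infty \<Omega>" for h using Cc_infty_L2[OF that \<Omega>(1)] .
  define R where "R = {?E \<phi> |\<phi>. \<phi> \<in> Cc_infty \<Omega> \<and> ?N \<phi> = 1}"
  have scale: "\<exists>\<psi>\<in>Cc_infty \<Omega>. ?N \<psi> = 1 \<and> ?E \<psi> = ?E \<phi> / ?N \<phi>" if \<phi>: "\<phi> \<in> Cc_infty \<Omega>" and pos: "0 < ?N \<phi>" for \<phi>
  proof -
    let ?c = "complex_of_real (1 / sqrt (?N \<phi>))"
    have c: "(norm ?c)\<^sup>2 = 1 / ?N \<phi>" using pos by (simp add: norm_divide power_divide)
    have bl: "bounded_linear (\<lambda>z. ?c * z)" by (rule bounded_linear_mult_right)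
    have "(\<lambda>x. ?c * \<phi> x) \<in> Cc_infty \<Omega>" by (rule Cc_infty_bounded_linear[OF bl \<phi>])
    moreover have "?N (\<lambda>x. ?c * \<phi> x) = 1" using pos by (simp only: L2_norm_sq_cmult c) simp
    moreover have "?E (\<lambda>x. ?c * \<phi> x) = ?E \<phi> / ?N \<phi>"
      unfolding dirichlet_energy_def partial_deriv_bounded_linear[OF bl Cc_infty_smooth[OF \<phi>]] L2_norm_sq_cmult c
      by (simp add: sum_divide_distrib)
    ultimately show ?thesis by blast
  qed
  obtain a where a: "a \<in> \<Omega>" using \<Omega>(3) by blast
  obtain \<rho> where \<rho>: "0 < \<rho>" "cball a \<rho> \<subseteq> \<Omega>" using \<Omega>(1) a open_contains_cball by blast
  have b: "bump a \<rho> \<in> Cc_infty \<Omega>" by (rule bump_Cc_infty[OF \<rho>])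
  have "0 < ?N (bump a \<rho>)"
    unfolding L2_norm_sq_lborel[OF b \<Omega>(1)]
    by (rule lborel_integral_pos[where S = "ball a \<rho>"])
      (use \<rho>(1) Cc_infty_integrable_norm_sq[OF b] bump_eq_0_iff[OF \<rho>(1), of a] in auto)
  then have R_ne: "R \<noteq> {}" using scale[OF b] unfolding R_def by blast
  have R_bdd: "bdd_below R" unfolding R_def by (rule bdd_belowI[of _ 0]) (auto simp: dirichlet_energy_nonneg)
  define m where "m = Inf R"
  have m0: "0 \<le> m" unfolding m_def by (rule cInf_greatest[OF R_ne]) (auto simp: R_def dirichlet_energy_nonneg)
  have m: "m * ?N \<phi> \<le> ?E \<phi>" if \<phi>: "\<phi> \<in> Cc_infty \<Omega>" for \<phi>
  proof (cases "?N \<phi> = 0")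
    case False
    then have pos: "0 < ?N \<phi>" using L2_norm_sq_nonneg[of \<Omega> \<phi>] by simp
    then have "?E \<phi> / ?N \<phi> \<in> R" using scale[OF \<phi>] unfolding R_def by (metis (mono_tags, lifting) mem_Collect_eq)
    then have "m \<le> ?E \<phi> / ?N \<phi>" unfolding m_def by (rule cInf_lower[OF _ R_bdd])
    then show ?thesis using pos by (simp add: le_divide_eq)
  qed (simp add: dirichlet_energy_nonneg)
  have "\<exists>\<phi>\<in>Cc_infty \<Omega>. ?N \<phi> = 1 \<and> ?E \<phi> < m + 1 / real (Suc n)" for n
  proof -
    have "Inf R < m + 1 / real (Suc n)" by (simp add: m_def)
    then obtain y where "y \<in> R" "y < m + 1 / real (Suc n)" using cInf_lessD[OF R_ne] by blast
    then show ?thesis by (auto simp: R_def)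
  qed
  then obtain F0 where F0: "\<And>n. F0 n \<in> Cc_infty \<Omega>" "\<And>n. ?N (F0 n) = 1" "\<And>n. ?E (F0 n) < m + 1 / real (Suc n)" by metis
  have "?E (F0 n) \<le> m + 1" for n
    using F0(3)[of n] by (smt (verit) divide_le_eq_1_pos of_nat_0_less_iff of_nat_Suc of_nat_less_0_iff zero_less_Suc)
  then obtain r :: "nat \<Rightarrow> nat" where r: "strict_mono r"
    "\<And>e. 0 < e \<Longrightarrow> \<exists>N. \<forall>i\<ge>N. \<forall>j\<ge>N. ?N (\<lambda>x. F0 (r i) x - F0 (r j) x) < e"
    using Rellich[where F = F0 and B = "m + 1", OF \<Omega>(1,2) F0(1)] F0(2) m0 by auto
  define F where "F n = F0 (r n)" for n
  have F: "F n \<in> Cc_infty \<Omega>" "?N (F n) = 1" "?E (F n) < m + 1 / real (Suc n)" for n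
  proof -
    have "1 / real (Suc (r n)) \<le> 1 / real (Suc n)" using seq_suble[OF r(1), of n] by (intro divide_left_mono) auto
    then show "F n \<in> Cc_infty \<Omega>" "?N (F n) = 1" "?E (F n) < m + 1 / real (Suc n)"
      using F0(1)[of "r n"] F0(2)[of "r n"] F0(3)[of "r n"] by (auto simp: F_def)
  qed
  have Fm: "m \<le> ?E (F n)" for n using m[OF F(1)[of n]] F(2)[of n] by simp
  have E_lim: "(\<lambda>n. ?E (F n) - m * ?N (F n)) \<longlonglongrightarrow> 0"
  proof (rule Lim_null_comparison[OF always_eventually])
    show "\<forall>n. norm (?E (F n) - m * ?N (F n)) \<le> 1 / real (Suc n)"
    proof
      fix n show "norm (?E (F n) - m * ?N (F n)) \<le> 1 / real (Suc n)"
        using F(2)[of n] F(3)[of n] Fm[of n] by simp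
    qed
    show "(\<lambda>n. 1 / real (Suc n)) \<longlonglongrightarrow> 0" using LIMSEQ_inverse_real_of_nat by (simp add: inverse_eq_divide)
  qed
  have Fd: "(\<lambda>x. F i x - F j x) \<in> Cc_infty \<Omega>" "(\<lambda>x. F i x + F j x) \<in> Cc_infty \<Omega>" for i j
    using Cc_infty_diff[OF F(1) F(1)] Cc_infty_add[OF F(1) F(1)] by auto
  have dF: "partial_deriv b (F n) \<in> Cc_infty \<Omega>" if "b \<in> Basis" for b n
    by (rule Cc_infty_partial_deriv[OF F(1) that])
  have E_diff: "?E (\<lambda>x. F i x - F j x) = (\<Sum>b\<in>Basis. ?N (\<lambda>x. partial_deriv b (F i) x - partial_deriv b (F j) x))" for i j
    unfolding dirichlet_energy_def partial_deriv_diff[OF Cc_infty_smooth[OF F(1)] Cc_infty_smooth[OF F(1)]] ..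
  have E_sum: "?E (\<lambda>x. F i x + F j x) = (\<Sum>b\<in>Basis. ?N (\<lambda>x. partial_deriv b (F i) x + partial_deriv b (F j) x))" for i j
    unfolding dirichlet_energy_def partial_deriv_add[OF Cc_infty_smooth[OF F(1)] Cc_infty_smooth[OF F(1)]] ..
  have E_par: "?E (\<lambda>x. F i x + F j x) + ?E (\<lambda>x. F i x - F j x) = 2 * ?E (F i) + 2 * ?E (F j)" for i j
    unfolding E_diff E_sum
    by (simp add: dirichlet_energy_def sum_distrib_left L2_parallelogram[OF L2[OF dF] L2[OF dF]] flip: sum.distrib)
  \<comment> \<open>The lower bound m is applied to F i + F j. In the parallelogram laws of norm and
    energy the terms 4 m cancel, leaving the excess of the two energies over m and the L^2
    distance.\<close>
  have E_cauchy: "?E (\<lambda>x. F i x - F j x) \<le> 2 / real (Suc i) + 2 / real (Suc j) + m * ?N (\<lambda>x. F i x - F j x)" for i j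
  proof -
    have "?N (\<lambda>x. F i x + F j x) = 4 - ?N (\<lambda>x. F i x - F j x)"
      using L2_parallelogram[OF L2[OF F(1)] L2[OF F(1)], of i j] F(2) by simp
    then have "m * 4 - m * ?N (\<lambda>x. F i x - F j x) \<le> ?E (\<lambda>x. F i x + F j x)"
      using m[OF Fd(2), of i j] by (simp add: right_diff_distrib)
    then show ?thesis using E_par[of i j] F(3)[of i] F(3)[of j] by simp
  qed
  have E_small: "\<exists>N. \<forall>i\<ge>N. \<forall>j\<ge>N. ?E (\<lambda>x. F i x - F j x) < e" if e: "0 < e" for e
  proof -
    \<comment> \<open>Shares of the tolerance: the terms 2 / (i + 1) and 2 / (j + 1) are below e/3
      each, whence e/6 further on, and the norm term is at most e/3.\<close>
    have "0 < e / (3 * (m + 1))" using e m0 by simp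
    then obtain N1 where N1: "\<And>i j. N1 \<le> i \<Longrightarrow> N1 \<le> j \<Longrightarrow> ?N (\<lambda>x. F i x - F j x) < e / (3 * (m + 1))"
      using r(2) unfolding F_def by blast
    obtain N2 where N2: "1 / real (Suc N2) < e / 6" using e nat_approx_posE[of "e / 6"] by auto
    have "?E (\<lambda>x. F i x - F j x) < e" if ij: "max N1 N2 \<le> i" "max N1 N2 \<le> j" for i j
    proof -
      have s: "1 / real (Suc k) < e / 6" if "max N1 N2 \<le> k" for k
      proof -
        have "1 / real (Suc k) \<le> 1 / real (Suc N2)" using that by (intro divide_left_mono) auto
        then show ?thesis using N2 by simp
      qed
      have "m * ?N (\<lambda>x. F i x - F j x) \<le> m * (e / (3 * (m + 1)))"
        using N1[of i j] ij m0 by (intro mult_left_mono) auto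
      also have "\<dots> = e / 3 * (m / (m + 1))" using m0 by (simp add: field_simps)
      also have "\<dots> \<le> e / 3 * 1" using e m0 by (intro mult_left_mono) (simp_all add: divide_le_eq)
      finally show ?thesis using E_cauchy[of i j] s[OF ij(1)] s[OF ij(2)] by simp
    qed
    then show ?thesis by blast
  qed
  obtain u where u: "u \<in> L2 \<Omega>" "(\<lambda>n. ?N (\<lambda>x. F n x - u x)) \<longlonglongrightarrow> 0"
    using L2_complete[OF \<Omega>(2,1), of F] L2[OF F(1)] r(2) unfolding F_def by blast
  have "\<forall>b\<in>Basis. \<exists>g. g \<in> L2 \<Omega> \<and> (\<lambda>n. ?N (\<lambda>x. partial_deriv b (F n) x - g x)) \<longlonglongrightarrow> 0"
  proof
    fix b :: 'a assume b: "b \<in> Basis"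
    have "\<exists>N. \<forall>i\<ge>N. \<forall>j\<ge>N. ?N (\<lambda>x. partial_deriv b (F i) x - partial_deriv b (F j) x) < e" if e: "0 < e" for e
    proof -
      have "?N (\<lambda>x. partial_deriv b (F i) x - partial_deriv b (F j) x) \<le> ?E (\<lambda>x. F i x - F j x)" for i j
        unfolding E_diff using b by (intro member_le_sum) (auto simp: L2_norm_sq_nonneg)
      then show ?thesis using E_small[OF e] by (meson le_less_trans)
    qed
    from L2_complete[OF \<Omega>(2,1), of "\<lambda>n. partial_deriv b (F n)", OF L2[OF dF[OF b]] this]
    show "\<exists>g. g \<in> L2 \<Omega> \<and> (\<lambda>n. ?N (\<lambda>x. partial_deriv b (F n) x - g x)) \<longlonglongrightarrow> 0" by blast
  qed
  from bchoice[OF this] obtain g where g: "\<And>b. b \<in> Basis \<Longrightarrow> g b \<in> L2 \<Omega>"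
    "\<And>b. b \<in> Basis \<Longrightarrow> (\<lambda>n. ?N (\<lambda>x. partial_deriv b (F n) x - g b x)) \<longlonglongrightarrow> 0" by blast
  have weak: "weak_partial_deriv \<Omega> b u (g b)" if b: "b \<in> Basis" for b
    unfolding weak_partial_deriv_def
  proof
    fix \<phi> assume \<phi>: "\<phi> \<in> Cc_infty \<Omega>"
    have "(\<lambda>n. \<integral>x. F n x * partial_deriv b \<phi> x \<partial>lebesgue_on \<Omega>) \<longlonglongrightarrow> (\<integral>x. u x * partial_deriv b \<phi> x \<partial>lebesgue_on \<Omega>)"
      by (rule L2_tendsto_mult[OF L2[OF F(1)] u(1) L2[OF Cc_infty_partial_deriv[OF \<phi> b]] u(2)])
    moreover have "(\<lambda>n. - (\<integral>x. partial_deriv b (F n) x * \<phi> x \<partial>lebesgue_on \<Omega>)) \<longlonglongrightarrow> - (\<integral>x. g b x * \<phi> x \<partial>lebesgue_on \<Omega>)"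
      by (intro tendsto_minus L2_tendsto_mult[OF L2[OF dF[OF b]] g(1)[OF b] L2[OF \<phi>] g(2)[OF b]])
    ultimately show "(\<integral>x. u x * partial_deriv b \<phi> x \<partial>lebesgue_on \<Omega>) = - (\<integral>x. g b x * \<phi> x \<partial>lebesgue_on \<Omega>)"
      unfolding integration_by_parts_on[OF \<Omega>(1) F(1) \<phi> b] by (rule LIMSEQ_unique)
  qed
  have approx: "\<exists>\<phi>\<in>Cc_infty \<Omega>. ?N (\<lambda>x. u x - \<phi> x) + (\<Sum>b\<in>Basis. ?N (\<lambda>x. g b x - partial_deriv b \<phi> x)) < e" if e: "0 < e" for e
  proof -
    have "(\<lambda>n. ?N (\<lambda>x. F n x - u x) + (\<Sum>b\<in>Basis. ?N (\<lambda>x. partial_deriv b (F n) x - g b x))) \<longlonglongrightarrow> 0 + (\<Sum>b\<in>(Basis :: 'a set). 0)"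
      by (intro tendsto_add tendsto_sum u(2) g(2))
    then have "eventually (\<lambda>n. ?N (\<lambda>x. F n x - u x) + (\<Sum>b\<in>Basis. ?N (\<lambda>x. partial_deriv b (F n) x - g b x)) < e) sequentially"
      using e by (intro order_tendstoD(2)[where y = 0]) simp_all
    then obtain n where "?N (\<lambda>x. F n x - u x) + (\<Sum>b\<in>Basis. ?N (\<lambda>x. partial_deriv b (F n) x - g b x)) < e"
      using eventually_happens trivial_limit_sequentially by blast
    then show ?thesis
      using F(1)[of n] by (intro bexI[of _ "F n"]) (simp_all add: L2_norm_sq_uminus[of \<Omega> u] L2_norm_sq_uminus[of \<Omega> "g _"])
  qed
  have H: "u \<in> H1_0 \<Omega>"
    unfolding H1_0_def using u(1) g(1) weak approx by (intro CollectI conjI exI[of _ g]) auto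
  have eq: "distr_laplacian \<Omega> u (\<lambda>x. - (complex_of_real m * u x))"
    unfolding distr_laplacian_def
  proof
    fix \<phi> assume \<phi>: "\<phi> \<in> Cc_infty \<Omega>"
    have "(\<integral>x. u x * laplacian \<phi> x \<partial>lebesgue_on \<Omega>) = - complex_of_real m * (\<integral>x. u x * \<phi> x \<partial>lebesgue_on \<Omega>)"
    proof (rule minimizing_limit_equation[OF \<Omega>(1) _ F(1) E_lim _ \<phi>])
      show "m * ?N \<psi> \<le> ?E \<psi>" if "\<psi> \<in> Cc_infty \<Omega>" for \<psi> by (rule m[OF that])
      show "(\<lambda>n. \<integral>x. F n x * \<psi> x \<partial>lebesgue_on \<Omega>) \<longlonglongrightarrow> (\<integral>x. u x * \<psi> x \<partial>lebesgue_on \<Omega>)"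
        if "\<psi> \<in> Cc_infty \<Omega>" for \<psi>
        by (rule L2_tendsto_mult[OF L2[OF F(1)] u(1) L2[OF that] u(2)])
    qed
    then show "(\<integral>x. u x * laplacian \<phi> x \<partial>lebesgue_on \<Omega>) = (\<integral>x. - (complex_of_real m * u x) * \<phi> x \<partial>lebesgue_on \<Omega>)"
      by (simp add: mult.assoc)
  qed
  have nz: "\<not> (AE x in lebesgue_on \<Omega>. u x = 0)"
  proof
    assume "AE x in lebesgue_on \<Omega>. u x = 0"
    then have "?N (\<lambda>x. F n x - u x) = ?N (F n)" for n
      by (intro L2_norm_sq_cong_AE L2_diff L2[OF F(1)] u(1)) (auto elim: eventually_mono)
    then show False using u(2) F(2) by (simp add: LIMSEQ_const_iff)
  qed
  have "dirichlet_eigenvalue \<Omega> m"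
    unfolding dirichlet_eigenvalue_def dirichlet_laplacian_def
    using nz H eq L2_cmult[OF u(1)] by blast
  then show ?thesis using m by blast
qed

text \<open>The regularised modulus sqrt(|f|^2 + \<delta>^2) - \<delta>. Adding \<delta>^2 makes the
  root smooth, and subtracting \<delta> restores the compact support. Its partial derivatives are
  the real inner product of f with the derivative of f, divided by the root, hence no larger than
  those of f, so the energy does not grow.\<close>

lemma smooth_modulus:
  assumes \<Omega>: "open \<Omega>" and f: "f \<in> Cc_infty \<Omega>" and \<delta>: "0 < \<delta>"
  shows "\<exists>p. (\<lambda>x. complex_of_real (p x)) \<in> Cc_infty \<Omega> \<and> (\<forall>x. 0 \<le> p x) \<and> (\<forall>x. \<bar>p x - norm (f x)\<bar> \<le> \<delta>) \<and>
    dirichlet_energy \<Omega> (\<lambda>x. complex_of_real (p x)) \<le> dirichlet_energy \<Omega> f"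
proof -
  let ?s = "\<lambda>x. (norm (f x))\<^sup>2 + \<delta>\<^sup>2"
  define p where "p x = sqrt (?s x) - \<delta>" for x
  note sf = Cc_infty_smooth[OF f]
  have s_pos: "0 < ?s x" for x using \<delta> by (simp add: add_nonneg_pos)
  have "smooth (\<lambda>x. f x * cnj (f x) + complex_of_real (\<delta>\<^sup>2))"
    by (intro smooth_add smooth_mult smooth_cnj smooth_const sf)
  then have "smooth (\<lambda>x. complex_of_real (?s x))"
    by (simp only: of_real_add complex_norm_square)
  from smooth_diff[OF smooth_sqrt[OF this s_pos] smooth_const[of "complex_of_real \<delta>"]]
  have p_smooth: "smooth (\<lambda>x. complex_of_real (p x))" by (simp add: p_def)
  obtain K where K: "compact K" "K \<subseteq> \<Omega>" "\<And>x. x \<notin> K \<Longrightarrow> f x = 0" using Cc_inftyE[OF f] by metis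
  have p: "(\<lambda>x. complex_of_real (p x)) \<in> Cc_infty \<Omega>"
    by (rule Cc_inftyI[OF p_smooth K(1,2)]) (use K(3) \<delta> in \<open>simp add: p_def\<close>)
  have p0: "0 \<le> p x" for x using \<delta> by (simp add: p_def real_le_rsqrt)
  have pf: "\<bar>p x - norm (f x)\<bar> \<le> \<delta>" for x
  proof -
    have "norm (f x) \<le> sqrt (?s x)" by (rule real_le_rsqrt) simp
    moreover have "sqrt (?s x) \<le> norm (f x) + \<delta>" using \<delta> by (intro real_le_lsqrt) (simp_all add: power2_sum)
    ultimately show ?thesis using \<delta> by (simp add: p_def)
  qed
  have dp: "norm (partial_deriv b (\<lambda>x. complex_of_real (p x)) x) \<le> norm (partial_deriv b f x)" for b x
  proof -
    let ?f' = "frechet_derivative f (at x)"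
    have "((\<lambda>x. f x \<bullet> f x + \<delta>\<^sup>2) has_derivative (\<lambda>h. 2 * (f x \<bullet> ?f' h))) (at x)"
      by (auto intro!: derivative_eq_intros smooth_has_derivative[OF sf] simp: inner_commute)
    then have "(?s has_derivative (\<lambda>h. 2 * (f x \<bullet> ?f' h))) (at x)"
      by (simp add: power2_norm_eq_inner)
    from has_derivative_diff[OF has_derivative_real_sqrt[OF s_pos this] has_derivative_const[of \<delta>]]
    have "(p has_derivative (\<lambda>h. (f x \<bullet> ?f' h) * inverse (sqrt (?s x)))) (at x)"
      unfolding p_def[abs_def] by simp
    from partial_deriv_eq[OF has_derivative_of_real[OF this], of b]
    have eq: "partial_deriv b (\<lambda>x. complex_of_real (p x)) x = complex_of_real ((f x \<bullet> partial_deriv b f x) / sqrt (?s x))"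
      by (simp add: partial_deriv_def divide_inverse)
    have "\<bar>f x \<bullet> partial_deriv b f x\<bar> \<le> norm (f x) * norm (partial_deriv b f x)" by (rule Cauchy_Schwarz_ineq2)
    also have "\<dots> \<le> sqrt (?s x) * norm (partial_deriv b f x)"
      by (intro mult_right_mono real_le_rsqrt) auto
    finally show ?thesis
      using s_pos[of x] unfolding eq norm_of_real by (simp add: divide_le_eq mult.commute)
  qed
  have "dirichlet_energy \<Omega> (\<lambda>x. complex_of_real (p x)) \<le> dirichlet_energy \<Omega> f"
    unfolding dirichlet_energy_def
  proof (rule sum_mono)
    fix b :: 'a assume b: "b \<in> Basis"
    show "L2_norm_sq \<Omega> (partial_deriv b (\<lambda>x. complex_of_real (p x))) \<le> L2_norm_sq \<Omega> (partial_deriv b f)"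
      unfolding L2_norm_sq_def
      by (intro integral_mono L2_integrable Cc_infty_L2[OF _ \<Omega>, where \<Omega>' = \<Omega>] Cc_infty_partial_deriv p f b power_mono dp) auto
  qed
  then show ?thesis using p p0 pf by blast
qed

section \<open>Strict domain monotonicity of the first eigenvalue\<close>

lemma sum_dir_deriv_orthogonal:
  fixes A :: "'a::euclidean_space \<Rightarrow> 'a"
  assumes A: "orthogonal_transformation A"
  shows "(\<Sum>b\<in>Basis. (norm (dir_deriv (A b) f y))\<^sup>2) = (\<Sum>b\<in>Basis. (norm (partial_deriv b f y))\<^sup>2)"
proof -
  let ?w = "\<lambda>c. partial_deriv c f y"
  have "(\<Sum>b\<in>Basis. A i \<bullet> b * (A j \<bullet> b)) = i \<bullet> j" if "i \<in> Basis" "j \<in> Basis" for i j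
    using A euclidean_inner[of "A i" "A j"] by (simp add: orthogonal_transformation_def)
  \<comment> \<open>Orthonormality of the vectors A b sums over their coordinates; the relation
    wanted sums over b, the other index of the matrix.\<close>
  from orthonormal_rows_imp_columns[where a = "\<lambda>b i. A i \<bullet> b", OF this]
  have cols: "(\<Sum>b\<in>Basis. (A b \<bullet> c) * (A b \<bullet> d)) = c \<bullet> d" if "c \<in> Basis" "d \<in> Basis" for c d
    using that by blast
  have "(\<Sum>b\<in>Basis. (norm (dir_deriv (A b) f y))\<^sup>2) =
      (\<Sum>b\<in>Basis. \<Sum>c\<in>Basis. \<Sum>d\<in>Basis. ((A b \<bullet> c) * (A b \<bullet> d)) * (?w c \<bullet> ?w d))"
    unfolding dir_deriv_def power2_norm_eq_inner inner_sum_left inner_sum_right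
    by (simp add: sum_distrib_left mult_ac inner_commute)
  also have "\<dots> = (\<Sum>c\<in>Basis. \<Sum>d\<in>Basis. \<Sum>b\<in>Basis. ((A b \<bullet> c) * (A b \<bullet> d)) * (?w c \<bullet> ?w d))"
    by (subst sum.swap, rule sum.cong[OF refl], subst sum.swap) simp
  also have "\<dots> = (\<Sum>c\<in>Basis. \<Sum>d\<in>Basis. (c \<bullet> d) *\<^sub>R (?w c \<bullet> ?w d))"
    by (simp add: cols flip: sum_distrib_right)
  also have "\<dots> = (\<Sum>c\<in>Basis. ?w c \<bullet> ?w c)"
    by (intro sum.cong refl sum_Basis_inner)
  finally show ?thesis by (simp add: power2_norm_eq_inner)
qed

lemma lborel_integral_isometry:
  fixes A :: "'a::euclidean_space \<Rightarrow> 'a" and g :: "'a \<Rightarrow> 'b::{banach, second_countable_topology}"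
  assumes A: "orthogonal_transformation A" and g: "g \<in> borel_measurable borel"
  shows "(\<integral>x. g (A x + v) \<partial>lborel) = integral\<^sup>L lborel g"
proof -
  have m: "(\<lambda>x. A x + v) \<in> borel_measurable borel"
    using linear_continuous_on[OF linear_conv_bounded_linear[THEN iffD1, OF orthogonal_transformation_linear[OF A]], of UNIV]
    by (intro borel_measurable_continuous_onI continuous_intros)
  have "integral\<^sup>L lborel g = integral\<^sup>L (distr lborel borel (\<lambda>x. A x + v)) g"
    by (simp add: lborel_isometry[where \<tau> = "\<lambda>x. A x + v" and v = v, OF A])
  also have "\<dots> = (\<integral>x. g (A x + v) \<partial>lborel)"
    by (rule integral_distr) (use m g in auto)
  finally show ?thesis ..
qed

lemma Cc_infty_isometry:
  fixes A :: "'a::euclidean_space \<Rightarrow> 'a"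
  assumes A: "orthogonal_transformation A" and f: "f \<in> Cc_infty \<Omega>\<^sub>1"
    and sub: "\<And>x. A x + v \<in> \<Omega>\<^sub>1 \<Longrightarrow> x \<in> \<Omega>\<^sub>2"
  shows "(\<lambda>x. f (A x + v)) \<in> Cc_infty \<Omega>\<^sub>2"
proof -
  have lin: "linear (inv A)"
    by (rule orthogonal_transformation_linear[OF orthogonal_transformation_inv[OF A]])
  have inv: "A (inv A x) = x" "inv A (A x) = x" for x
    using orthogonal_transformation_bij[OF A] by (simp_all add: bij_is_surj bij_is_inj surj_f_inv_f)
  obtain K where K: "compact K" "K \<subseteq> \<Omega>\<^sub>1" "\<And>x. x \<notin> K \<Longrightarrow> f x = 0" using Cc_inftyE[OF f] by metis
  show ?thesis
  proof (rule Cc_inftyI)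
    show "smooth (\<lambda>x. f (A x + v))"
      by (rule smooth_affine[OF orthogonal_transformation_linear[OF A] Cc_infty_smooth[OF f]])
    show "compact ((\<lambda>y. inv A (y - v)) ` K)"
      using lin K(1) by (intro compact_continuous_image continuous_intros
          continuous_on_compose2[OF linear_continuous_on[OF linear_conv_bounded_linear[THEN iffD1, OF lin], of UNIV]]) auto
    show "(\<lambda>y. inv A (y - v)) ` K \<subseteq> \<Omega>\<^sub>2" using K(2) sub by (auto simp: inv)
    show "f (A x + v) = 0" if "x \<notin> (\<lambda>y. inv A (y - v)) ` K" for x
    proof (rule K(3))
      have "x = inv A ((A x + v) - v)" by (simp add: inv)
      then show "A x + v \<notin> K" using that by blast
    qed
  qed
qed

text \<open>The preimage of \<Omega>_1 may be a proper part of \<Omega>_2. The equalities hold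
  nevertheless, because the compact supports lie inside the sets and the integrals can be taken over
  the whole space.\<close>

lemma isometry_invariance:
  fixes A :: "'a::euclidean_space \<Rightarrow> 'a"
  assumes A: "orthogonal_transformation A" and f: "f \<in> Cc_infty \<Omega>\<^sub>1"
    and sub: "\<And>x. A x + v \<in> \<Omega>\<^sub>1 \<Longrightarrow> x \<in> \<Omega>\<^sub>2" and \<Omega>: "open \<Omega>\<^sub>1" "open \<Omega>\<^sub>2"
  shows "L2_norm_sq \<Omega>\<^sub>2 (\<lambda>x. f (A x + v)) = L2_norm_sq \<Omega>\<^sub>1 f"
    and "dirichlet_energy \<Omega>\<^sub>2 (\<lambda>x. f (A x + v)) = dirichlet_energy \<Omega>\<^sub>1 f"
proof -
  let ?g = "\<lambda>x. f (A x + v)"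
  have g: "?g \<in> Cc_infty \<Omega>\<^sub>2" by (rule Cc_infty_isometry[OF A f sub])
  have df: "partial_deriv b f \<in> Cc_infty \<Omega>\<^sub>1" if "b \<in> Basis" for b by (rule Cc_infty_partial_deriv[OF f that])
  have dg: "partial_deriv b ?g \<in> Cc_infty \<Omega>\<^sub>2" if "b \<in> Basis" for b by (rule Cc_infty_partial_deriv[OF g that])
  note lin = orthogonal_transformation_linear[OF A]
  show "L2_norm_sq \<Omega>\<^sub>2 ?g = L2_norm_sq \<Omega>\<^sub>1 f"
    unfolding L2_norm_sq_lborel[OF g \<Omega>(2)] L2_norm_sq_lborel[OF f \<Omega>(1)]
    using lborel_integral_isometry[OF A, of "\<lambda>x. (norm (f x))\<^sup>2"] Cc_infty_measurable[OF f] by simp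
  have deriv: "partial_deriv b ?g x = dir_deriv (A b) f (A x + v)" for b x
  proof -
    have "((\<lambda>x. A x + v) has_derivative A) (at x)"
      using lin by (auto intro!: derivative_eq_intros linear_imp_has_derivative)
    from partial_deriv_eq[OF has_derivative_compose[OF this smooth_has_derivative_sum[OF Cc_infty_smooth[OF f]]], of b]
    show ?thesis by (simp add: dir_deriv_def)
  qed
  have "dirichlet_energy \<Omega>\<^sub>2 ?g = (\<integral>x. (\<Sum>b\<in>Basis. (norm (partial_deriv b ?g x))\<^sup>2) \<partial>lborel)"
    using Cc_infty_integrable_norm_sq[OF dg]
    by (simp add: dirichlet_energy_def L2_norm_sq_lborel[OF dg \<Omega>(2)] Bochner_Integration.integral_sum)
  also have "\<dots> = (\<integral>x. (\<Sum>b\<in>Basis. (norm (partial_deriv b f (A x + v)))\<^sup>2) \<partial>lborel)"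
    by (simp add: deriv sum_dir_deriv_orthogonal[OF A])
  also have "\<dots> = (\<integral>x. (\<Sum>b\<in>Basis. (norm (partial_deriv b f x))\<^sup>2) \<partial>lborel)"
  proof (rule lborel_integral_isometry[OF A])
    show "(\<lambda>x. \<Sum>b\<in>Basis. (norm (partial_deriv b f x))\<^sup>2) \<in> borel_measurable borel"
      using Cc_infty_measurable[OF df] by (intro borel_measurable_sum) simp
  qed
  also have "\<dots> = dirichlet_energy \<Omega>\<^sub>1 f"
    using Cc_infty_integrable_norm_sq[OF df]
    by (simp add: dirichlet_energy_def L2_norm_sq_lborel[OF df \<Omega>(1)] Bochner_Integration.integral_sum)
  finally show "dirichlet_energy \<Omega>\<^sub>2 ?g = dirichlet_energy \<Omega>\<^sub>1 f" .
qed

section \<open>Convergence of norms and approximation of eigenfunctions\<close>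

lemma L2_cnj: "f \<in> L2 \<Omega> \<Longrightarrow> (\<lambda>x. cnj (f x)) \<in> L2 \<Omega>"
  by (intro L2I borel_measurable_continuous_on[OF continuous_on_cnj[OF continuous_on_id]])
    (simp_all add: L2_measurable L2_integrable)

lemma L2_norm: "f \<in> L2 \<Omega> \<Longrightarrow> (\<lambda>x. complex_of_real (norm (f x))) \<in> L2 \<Omega>"
  using L2_measurable[of f \<Omega>] L2_integrable[of f \<Omega>] by (intro L2I) simp_all

lemma L2_norm_sq_mono:
  assumes "f \<in> L2 \<Omega>" "g \<in> L2 \<Omega>" "\<And>x. norm (f x) \<le> norm (g x)"
  shows "L2_norm_sq \<Omega> f \<le> L2_norm_sq \<Omega> g"
  unfolding L2_norm_sq_def using assms by (intro integral_mono L2_integrable power_mono) auto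

lemma L2_norm_sq_tendsto:
  assumes F: "\<And>n. F n \<in> L2 \<Omega>" "f \<in> L2 \<Omega>" "(\<lambda>n. L2_norm_sq \<Omega> (\<lambda>x. F n x - f x)) \<longlonglongrightarrow> 0"
  shows "(\<lambda>n. L2_norm_sq \<Omega> (F n)) \<longlonglongrightarrow> L2_norm_sq \<Omega> f"
proof -
  let ?d = "\<lambda>n x. cnj (F n x - f x)"
  have d: "?d n \<in> L2 \<Omega>" for n by (rule L2_cnj[OF L2_diff[OF F(1,2)]])
  have dn: "L2_norm_sq \<Omega> (?d n) = L2_norm_sq \<Omega> (\<lambda>x. F n x - f x)" for n
    unfolding L2_norm_sq_def complex_mod_cnj ..
  have eq: "L2_norm_sq \<Omega> (F n) = L2_norm_sq \<Omega> f + 2 * Re (\<integral>x. f x * ?d n x \<partial>lebesgue_on \<Omega>) + L2_norm_sq \<Omega> (\<lambda>x. F n x - f x)" for n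
    using L2_norm_sq_add_cnj[OF F(2) d, of 1 n] unfolding dn by simp
  have "(\<lambda>n. norm (\<integral>x. f x * ?d n x \<partial>lebesgue_on \<Omega>)) \<longlonglongrightarrow> 0"
  proof (rule tendsto_0_of_power2_le)
    show "(norm (\<integral>x. f x * ?d n x \<partial>lebesgue_on \<Omega>))\<^sup>2 \<le> L2_norm_sq \<Omega> f * L2_norm_sq \<Omega> (\<lambda>x. F n x - f x)" for n
      using L2_Cauchy_Schwarz_norm[OF F(2) d, of n] unfolding dn .
    show "(\<lambda>n. L2_norm_sq \<Omega> f * L2_norm_sq \<Omega> (\<lambda>x. F n x - f x)) \<longlonglongrightarrow> 0"
      by (rule tendsto_mult_right_zero[OF F(3)])
  qed
  from tendsto_Re[OF tendsto_norm_zero_cancel[OF this]]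
  have "(\<lambda>n. L2_norm_sq \<Omega> f + 2 * Re (\<integral>x. f x * ?d n x \<partial>lebesgue_on \<Omega>) + L2_norm_sq \<Omega> (\<lambda>x. F n x - f x)) \<longlonglongrightarrow> L2_norm_sq \<Omega> f + 2 * Re 0 + 0"
    by (intro tendsto_add tendsto_mult_left tendsto_const F(3))
  then show ?thesis by (simp add: eq)
qed

lemma of_real_L2_norm_sq:
  assumes "f \<in> L2 \<Omega>"
  shows "complex_of_real (L2_norm_sq \<Omega> f) = (\<integral>x. f x * cnj (f x) \<partial>lebesgue_on \<Omega>)"
proof -
  have "complex_of_real (L2_norm_sq \<Omega> f) = (\<integral>x. complex_of_real ((norm (f x))\<^sup>2) \<partial>lebesgue_on \<Omega>)"
    by (simp add: L2_norm_sq_def flip: integral_complex_of_real)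
  then show ?thesis by (simp only: complex_norm_square)
qed

text \<open>Extracts from an eigenfunction what survives transport to another domain: test functions
  converging to it in L^2 along which energy and \<mu> times the squared norm approach each other.
  The weak derivatives g identify the limit of the energies.\<close>

lemma eigenfunction_approximation:
  assumes \<Omega>: "open \<Omega>" and ev: "dirichlet_eigenvalue \<Omega> \<mu>"
  shows "\<exists>u F. u \<in> L2 \<Omega> \<and> 0 < L2_norm_sq \<Omega> u \<and> (\<forall>n. F n \<in> Cc_infty \<Omega>) \<and>
    (\<lambda>n. L2_norm_sq \<Omega> (\<lambda>x. F n x - u x)) \<longlonglongrightarrow> 0 \<and>
    (\<lambda>n. dirichlet_energy \<Omega> (F n) - \<mu> * L2_norm_sq \<Omega> (F n)) \<longlonglongrightarrow> 0"
proof -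
  let ?N = "L2_norm_sq \<Omega>" and ?M = "lebesgue_on \<Omega>"
  have L2: "h \<in> L2 \<Omega>" if "h \<in> Cc_infty \<Omega>" for h using Cc_infty_L2[OF that \<Omega>] .
  obtain u where u: "\<not> (AE x in ?M. u x = 0)" "u \<in> H1_0 \<Omega>"
    and eq: "distr_laplacian \<Omega> u (\<lambda>x. - (complex_of_real \<mu> * u x))"
    using ev unfolding dirichlet_eigenvalue_def dirichlet_laplacian_def by blast
  obtain g where uL2: "u \<in> L2 \<Omega>" and g: "\<And>b. b \<in> Basis \<Longrightarrow> g b \<in> L2 \<Omega>" "\<And>b. b \<in> Basis \<Longrightarrow> weak_partial_deriv \<Omega> b u (g b)"
    and approx: "\<And>e. 0 < e \<Longrightarrow> \<exists>\<phi>\<in>Cc_infty \<Omega>. ?N (\<lambda>x. u x - \<phi> x) + (\<Sum>b\<in>Basis. ?N (\<lambda>x. g b x - partial_deriv b \<phi> x)) < e"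
    using u(2) unfolding H1_0_def by blast
  have pos: "0 < ?N u" using u(1) L2_norm_sq_eq_0_iff[OF uL2] L2_norm_sq_nonneg[of \<Omega> u] by linarith
  have "\<exists>\<phi>\<in>Cc_infty \<Omega>. ?N (\<lambda>x. u x - \<phi> x) + (\<Sum>b\<in>Basis. ?N (\<lambda>x. g b x - partial_deriv b \<phi> x)) < 1 / real (Suc n)" for n
    by (rule approx) simp
  then have "\<forall>n. \<exists>\<phi>. \<phi> \<in> Cc_infty \<Omega> \<and> ?N (\<lambda>x. u x - \<phi> x) + (\<Sum>b\<in>Basis. ?N (\<lambda>x. g b x - partial_deriv b \<phi> x)) < 1 / real (Suc n)"
    by blast
  from choice[OF this] obtain F where F: "\<And>n. F n \<in> Cc_infty \<Omega>"
    "\<And>n. ?N (\<lambda>x. u x - F n x) + (\<Sum>b\<in>Basis. ?N (\<lambda>x. g b x - partial_deriv b (F n) x)) < 1 / real (Suc n)"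
    by blast
  have null: "(\<lambda>n. 1 / real (Suc n)) \<longlonglongrightarrow> 0"
    using LIMSEQ_inverse_real_of_nat by (simp add: inverse_eq_divide)
  have dF: "partial_deriv b (F n) \<in> Cc_infty \<Omega>" if "b \<in> Basis" for b n by (rule Cc_infty_partial_deriv[OF F(1) that])
  have S0: "0 \<le> (\<Sum>b\<in>Basis. ?N (\<lambda>x. g b x - partial_deriv b (F n) x))" for n
    by (intro sum_nonneg L2_norm_sq_nonneg)
  have Fu: "(\<lambda>n. ?N (\<lambda>x. F n x - u x)) \<longlonglongrightarrow> 0"
  proof (rule Lim_null_comparison[OF always_eventually null], intro allI)
    fix n show "norm (?N (\<lambda>x. F n x - u x)) \<le> 1 / real (Suc n)"
      using F(2)[of n] S0[of n] L2_norm_sq_nonneg[of \<Omega> "\<lambda>x. F n x - u x"] L2_norm_sq_uminus[of \<Omega> u "F n"] by simp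
  qed
  have Fg: "(\<lambda>n. ?N (\<lambda>x. partial_deriv b (F n) x - g b x)) \<longlonglongrightarrow> 0" if b: "b \<in> Basis" for b
  proof (rule Lim_null_comparison[OF always_eventually null], intro allI)
    fix n
    have "?N (\<lambda>x. g b x - partial_deriv b (F n) x) \<le> (\<Sum>b\<in>Basis. ?N (\<lambda>x. g b x - partial_deriv b (F n) x))"
      using b by (intro member_le_sum) (auto simp: L2_norm_sq_nonneg)
    then show "norm (?N (\<lambda>x. partial_deriv b (F n) x - g b x)) \<le> 1 / real (Suc n)"
      using F(2)[of n] L2_norm_sq_nonneg[of \<Omega> "\<lambda>x. u x - F n x"]
        L2_norm_sq_nonneg[of \<Omega> "\<lambda>x. partial_deriv b (F n) x - g b x"] L2_norm_sq_uminus[of \<Omega> "g b" "partial_deriv b (F n)"] by simp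
  qed
  have energy_lim: "(\<lambda>n. dirichlet_energy \<Omega> (F n)) \<longlonglongrightarrow> (\<Sum>b\<in>Basis. ?N (g b))"
    unfolding dirichlet_energy_def by (intro tendsto_sum L2_norm_sq_tendsto L2 dF g(1) Fg)
  have N_lim: "(\<lambda>n. ?N (F n)) \<longlonglongrightarrow> ?N u" by (rule L2_norm_sq_tendsto[OF L2[OF F(1)] uL2 Fu])
  \<comment> \<open>Testing the equation with $\bar F_n$ and passing to the limit gives $\|g\|^2 = \mu\|u\|^2$.\<close>
  have weak: "(\<Sum>b\<in>Basis. \<integral>x. g b x * partial_deriv b \<phi> x \<partial>?M) = complex_of_real \<mu> * (\<integral>x. u x * \<phi> x \<partial>?M)"
    if \<phi>: "\<phi> \<in> Cc_infty \<Omega>" for \<phi>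
  proof -
    have "(\<integral>x. u x * laplacian \<phi> x \<partial>?M) = - (complex_of_real \<mu> * (\<integral>x. u x * \<phi> x \<partial>?M))"
      using eq[unfolded distr_laplacian_def, rule_format, OF \<phi>] by (simp add: mult.assoc)
    moreover have "(\<integral>x. u x * laplacian \<phi> x \<partial>?M) = (\<Sum>b\<in>Basis. - (\<integral>x. g b x * partial_deriv b \<phi> x \<partial>?M))"
      unfolding integral_mult_laplacian_on[OF \<Omega> uL2 \<phi>]
      using g(2)[unfolded weak_partial_deriv_def, rule_format, OF _ Cc_infty_partial_deriv[OF \<phi>]]
      by (intro sum.cong) auto
    ultimately show ?thesis by (simp add: sum_negf)
  qed
  have lim2: "(\<lambda>n. complex_of_real \<mu> * (\<integral>x. u x * cnj (F n x) \<partial>?M)) \<longlonglongrightarrow> complex_of_real \<mu> * (\<integral>x. u x * cnj (u x) \<partial>?M)"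
    and lim3: "(\<lambda>n. \<Sum>b\<in>Basis. \<integral>x. g b x * cnj (partial_deriv b (F n) x) \<partial>?M) \<longlonglongrightarrow> (\<Sum>b\<in>Basis. \<integral>x. g b x * cnj (g b x) \<partial>?M)"
  proof -
    have cnj_lim: "(\<lambda>n. \<integral>x. h x * cnj (H n x) \<partial>?M) \<longlonglongrightarrow> (\<integral>x. h x * cnj (h x) \<partial>?M)"
      if "\<And>n. H n \<in> L2 \<Omega>" "h \<in> L2 \<Omega>" "(\<lambda>n. ?N (\<lambda>x. H n x - h x)) \<longlonglongrightarrow> 0" for H h
    proof -
      have "(\<lambda>n. ?N (\<lambda>x. cnj (H n x) - cnj (h x))) \<longlonglongrightarrow> 0"
        using that(3) unfolding L2_norm_sq_def complex_cnj_diff[symmetric] complex_mod_cnj .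
      from L2_tendsto_mult[OF L2_cnj[OF that(1)] L2_cnj[OF that(2)] that(2) this]
      show ?thesis by (simp add: mult.commute)
    qed
    show "(\<lambda>n. complex_of_real \<mu> * (\<integral>x. u x * cnj (F n x) \<partial>?M)) \<longlonglongrightarrow> complex_of_real \<mu> * (\<integral>x. u x * cnj (u x) \<partial>?M)"
      by (intro tendsto_mult_left cnj_lim L2 F(1) uL2 Fu)
    show "(\<lambda>n. \<Sum>b\<in>Basis. \<integral>x. g b x * cnj (partial_deriv b (F n) x) \<partial>?M) \<longlonglongrightarrow> (\<Sum>b\<in>Basis. \<integral>x. g b x * cnj (g b x) \<partial>?M)"
      by (intro tendsto_sum cnj_lim L2 dF g(1) Fg)
  qed
  have "(\<Sum>b\<in>Basis. \<integral>x. g b x * cnj (partial_deriv b (F n) x) \<partial>?M) = complex_of_real \<mu> * (\<integral>x. u x * cnj (F n x) \<partial>?M)" for n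
    using weak[OF Cc_infty_bounded_linear[OF bounded_linear_cnj F(1)]]
    by (simp add: partial_deriv_bounded_linear[OF bounded_linear_cnj Cc_infty_smooth[OF F(1)]])
  with lim3 have "(\<lambda>n. complex_of_real \<mu> * (\<integral>x. u x * cnj (F n x) \<partial>?M)) \<longlonglongrightarrow> (\<Sum>b\<in>Basis. \<integral>x. g b x * cnj (g b x) \<partial>?M)"
    by (simp only:)
  from LIMSEQ_unique[OF this lim2]
  have "(\<Sum>b\<in>Basis. \<integral>x. g b x * cnj (g b x) \<partial>?M) = complex_of_real \<mu> * (\<integral>x. u x * cnj (u x) \<partial>?M)" .
  then have "complex_of_real (\<Sum>b\<in>Basis. ?N (g b)) = complex_of_real (\<mu> * ?N u)"
    using of_real_L2_norm_sq[OF g(1)] of_real_L2_norm_sq[OF uL2] by simp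
  then have "(\<Sum>b\<in>Basis. ?N (g b)) = \<mu> * ?N u" by (simp only: of_real_eq_iff)
  then have "(\<lambda>n. dirichlet_energy \<Omega> (F n) - \<mu> * ?N (F n)) \<longlonglongrightarrow> \<mu> * ?N u - \<mu> * ?N u"
    using energy_lim N_lim by (intro tendsto_intros) simp_all
  then show ?thesis using uL2 pos F(1) Fu by (intro exI[of _ u] exI[of _ F]) simp
qed

text \<open>Test functions approximating the eigenfunction are transported instead of the
  eigenfunction itself. Their regularised moduli, composed with the rigid motion, are test functions
  on \<Omega>_2 that vanish on G and nearly minimise the form there. Their L^2 limit solves the
  equation on \<Omega>_2 and vanishes on G, hence everywhere, although the norms converge to that of
  u, which is positive.\<close>

lemma eigenvalue_domain_rigidity:
  fixes A :: "'a::euclidean_space \<Rightarrow> 'a"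
  assumes \<Omega>\<^sub>1: "open \<Omega>\<^sub>1" "bounded \<Omega>\<^sub>1" and \<Omega>\<^sub>2: "open \<Omega>\<^sub>2" "bounded \<Omega>\<^sub>2" "connected \<Omega>\<^sub>2"
    and A: "orthogonal_transformation A" and sub: "\<And>x. A x + v \<in> \<Omega>\<^sub>1 \<Longrightarrow> x \<in> \<Omega>\<^sub>2"
    and G: "open G" "G \<noteq> {}" "G \<subseteq> \<Omega>\<^sub>2" "\<And>x. x \<in> G \<Longrightarrow> A x + v \<notin> \<Omega>\<^sub>1"
    and ev: "dirichlet_eigenvalue \<Omega>\<^sub>1 \<mu>" "first_dirichlet_eigenvalue \<Omega>\<^sub>2 \<mu>"
  shows False
proof -
  let ?M = "lebesgue_on \<Omega>\<^sub>2"
  have "\<Omega>\<^sub>2 \<noteq> {}" using G(2,3) by blast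
  then obtain m where "dirichlet_eigenvalue \<Omega>\<^sub>2 m" and m: "\<And>\<phi>. \<phi> \<in> Cc_infty \<Omega>\<^sub>2 \<Longrightarrow> m * L2_norm_sq \<Omega>\<^sub>2 \<phi> \<le> dirichlet_energy \<Omega>\<^sub>2 \<phi>"
    using ground_state[OF \<Omega>\<^sub>2(1,2)] by blast
  \<comment> \<open>m bounds the Rayleigh quotients from below and is an eigenvalue, so the least
    eigenvalue \<mu> is a lower bound for the quotients too.\<close>
  then have "\<mu> \<le> m" using ev(2) by (simp add: first_dirichlet_eigenvalue_def)
  then have \<mu>: "\<mu> * L2_norm_sq \<Omega>\<^sub>2 \<phi> \<le> dirichlet_energy \<Omega>\<^sub>2 \<phi>" if "\<phi> \<in> Cc_infty \<Omega>\<^sub>2" for \<phi>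
    using m[OF that] mult_right_mono[OF \<open>\<mu> \<le> m\<close> L2_norm_sq_nonneg[of \<Omega>\<^sub>2 \<phi>]] by linarith
  obtain u F where u: "u \<in> L2 \<Omega>\<^sub>1" "0 < L2_norm_sq \<Omega>\<^sub>1 u" and F: "\<And>n. F n \<in> Cc_infty \<Omega>\<^sub>1"
    and Fu: "(\<lambda>n. L2_norm_sq \<Omega>\<^sub>1 (\<lambda>x. F n x - u x)) \<longlonglongrightarrow> 0"
    and FE: "(\<lambda>n. dirichlet_energy \<Omega>\<^sub>1 (F n) - \<mu> * L2_norm_sq \<Omega>\<^sub>1 (F n)) \<longlonglongrightarrow> 0"
    using eigenfunction_approximation[OF \<Omega>\<^sub>1(1) ev(1)] by auto
  have L21: "h \<in> L2 \<Omega>\<^sub>1" if "h \<in> Cc_infty \<Omega>\<^sub>1" for h using Cc_infty_L2[OF that \<Omega>\<^sub>1(1)] .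
  have L22: "h \<in> L2 \<Omega>\<^sub>2" if "h \<in> Cc_infty \<Omega>\<^sub>2" for h using Cc_infty_L2[OF that \<Omega>\<^sub>2(1)] .
  have FN: "(\<lambda>n. L2_norm_sq \<Omega>\<^sub>1 (F n)) \<longlonglongrightarrow> L2_norm_sq \<Omega>\<^sub>1 u"
    by (rule L2_norm_sq_tendsto[OF L21[OF F] u(1) Fu])
  \<comment> \<open>Energies are non-negative and converge to \<mu> times the squared norm of u. The
    sign makes non-negative solutions of the equation superharmonic.\<close>
  have \<mu>0: "0 \<le> \<mu>"
  proof -
    have "(\<lambda>n. dirichlet_energy \<Omega>\<^sub>1 (F n) - \<mu> * L2_norm_sq \<Omega>\<^sub>1 (F n) + \<mu> * L2_norm_sq \<Omega>\<^sub>1 (F n)) \<longlonglongrightarrow> 0 + \<mu> * L2_norm_sq \<Omega>\<^sub>1 u"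
      by (intro tendsto_add FE tendsto_mult_left FN)
    then have "(\<lambda>n. dirichlet_energy \<Omega>\<^sub>1 (F n)) \<longlonglongrightarrow> \<mu> * L2_norm_sq \<Omega>\<^sub>1 u" by simp
    then have "0 \<le> \<mu> * L2_norm_sq \<Omega>\<^sub>1 u"
      by (rule LIMSEQ_le_const) (auto simp: dirichlet_energy_nonneg)
    then show ?thesis using u(2) by (simp add: zero_le_mult_iff)
  qed
  have "\<forall>n. \<exists>p. (\<lambda>x. complex_of_real (p x)) \<in> Cc_infty \<Omega>\<^sub>1 \<and> (\<forall>x. 0 \<le> p x) \<and>
      (\<forall>x. \<bar>p x - norm (F n x)\<bar> \<le> 1 / real (Suc n)) \<and>
      dirichlet_energy \<Omega>\<^sub>1 (\<lambda>x. complex_of_real (p x)) \<le> dirichlet_energy \<Omega>\<^sub>1 (F n)"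
    using smooth_modulus[OF \<Omega>\<^sub>1(1) F] by simp
  from choice[OF this] obtain p where p: "\<And>n. (\<lambda>x. complex_of_real (p n x)) \<in> Cc_infty \<Omega>\<^sub>1" "\<And>n x. 0 \<le> p n x"
    "\<And>n x. \<bar>p n x - norm (F n x)\<bar> \<le> 1 / real (Suc n)"
    "\<And>n. dirichlet_energy \<Omega>\<^sub>1 (\<lambda>x. complex_of_real (p n x)) \<le> dirichlet_energy \<Omega>\<^sub>1 (F n)" by blast
  define P where "P n x = complex_of_real (p n x)" for n x
  have P: "P n \<in> Cc_infty \<Omega>\<^sub>1" for n using p(1) by (simp add: P_def[abs_def])
  let ?u = "\<lambda>x. complex_of_real (norm (u x))"
  have uL2: "?u \<in> L2 \<Omega>\<^sub>1" by (rule L2_norm[OF u(1)])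
  have Nu: "L2_norm_sq \<Omega>\<^sub>1 ?u = L2_norm_sq \<Omega>\<^sub>1 u" by (simp add: L2_norm_sq_def)
  have null: "(\<lambda>n. 1 / real (Suc n)) \<longlonglongrightarrow> 0"
    using LIMSEQ_inverse_real_of_nat by (simp add: inverse_eq_divide)
  have Pu: "(\<lambda>n. L2_norm_sq \<Omega>\<^sub>1 (\<lambda>x. P n x - ?u x)) \<longlonglongrightarrow> 0"
  proof (rule Lim_null_comparison[OF always_eventually])
    let ?c = "\<lambda>n x. complex_of_real (1 / real (Suc n)) * 1 :: complex" and ?d = "\<lambda>n x. complex_of_real (norm (F n x - u x))"
    have cL2: "?c n \<in> L2 \<Omega>\<^sub>1" for n by (intro L2_cmult L2_const \<Omega>\<^sub>1)
    have dL2: "?d n \<in> L2 \<Omega>\<^sub>1" for n by (intro L2_norm L2_diff L21 F u(1))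
    show "\<forall>n. norm (L2_norm_sq \<Omega>\<^sub>1 (\<lambda>x. P n x - ?u x)) \<le> 2 * ((1 / real (Suc n))\<^sup>2 * L2_norm_sq \<Omega>\<^sub>1 (\<lambda>x. 1)) + 2 * L2_norm_sq \<Omega>\<^sub>1 (\<lambda>x. F n x - u x)"
    proof
      fix n
      have "L2_norm_sq \<Omega>\<^sub>1 (\<lambda>x. P n x - ?u x) \<le> L2_norm_sq \<Omega>\<^sub>1 (\<lambda>x. ?c n x + ?d n x)"
      proof (rule L2_norm_sq_mono[OF L2_diff[OF L21[OF P] uL2] L2_add[OF cL2 dL2]])
        fix x
        have "\<bar>p n x - norm (u x)\<bar> \<le> 1 / real (Suc n) + norm (F n x - u x)"
          using p(3)[of n x] norm_triangle_ineq3[of "F n x" "u x"] by linarith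
        moreover have "norm (P n x - ?u x) = \<bar>p n x - norm (u x)\<bar>"
          by (simp add: P_def flip: of_real_diff)
        moreover have "norm (?c n x + ?d n x) = 1 / real (Suc n) + norm (F n x - u x)"
        proof -
          have "?c n x + ?d n x = complex_of_real (1 / real (Suc n) + norm (F n x - u x))" by simp
          then show ?thesis by (simp only: norm_of_real) simp
        qed
        ultimately show "norm (P n x - ?u x) \<le> norm (?c n x + ?d n x)" by simp
      qed
      also have "\<dots> \<le> 2 * L2_norm_sq \<Omega>\<^sub>1 (?c n) + 2 * L2_norm_sq \<Omega>\<^sub>1 (?d n)"
        by (rule L2_norm_sq_add_le[OF cL2 dL2])
      also have "L2_norm_sq \<Omega>\<^sub>1 (?c n) = (1 / real (Suc n))\<^sup>2 * L2_norm_sq \<Omega>\<^sub>1 (\<lambda>x. 1)"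
        unfolding L2_norm_sq_cmult by (simp only: norm_of_real power2_abs)
      also have "L2_norm_sq \<Omega>\<^sub>1 (?d n) = L2_norm_sq \<Omega>\<^sub>1 (\<lambda>x. F n x - u x)" by (simp add: L2_norm_sq_def)
      finally show "norm (L2_norm_sq \<Omega>\<^sub>1 (\<lambda>x. P n x - ?u x)) \<le> 2 * ((1 / real (Suc n))\<^sup>2 * L2_norm_sq \<Omega>\<^sub>1 (\<lambda>x. 1)) + 2 * L2_norm_sq \<Omega>\<^sub>1 (\<lambda>x. F n x - u x)"
        by (simp only: real_norm_def abs_of_nonneg[OF L2_norm_sq_nonneg])
    qed
    have "(\<lambda>n. 2 * ((1 / real (Suc n))\<^sup>2 * L2_norm_sq \<Omega>\<^sub>1 (\<lambda>x. 1)) + 2 * L2_norm_sq \<Omega>\<^sub>1 (\<lambda>x. F n x - u x)) \<longlonglongrightarrow> 2 * (0\<^sup>2 * L2_norm_sq \<Omega>\<^sub>1 (\<lambda>x. 1)) + 2 * 0"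
      by (intro tendsto_add tendsto_mult_left tendsto_mult_right tendsto_power null Fu)
    then show "(\<lambda>n. 2 * ((1 / real (Suc n))\<^sup>2 * L2_norm_sq \<Omega>\<^sub>1 (\<lambda>x. 1)) + 2 * L2_norm_sq \<Omega>\<^sub>1 (\<lambda>x. F n x - u x)) \<longlonglongrightarrow> 0" by simp
  qed
  have PN: "(\<lambda>n. L2_norm_sq \<Omega>\<^sub>1 (P n)) \<longlonglongrightarrow> L2_norm_sq \<Omega>\<^sub>1 u"
    using L2_norm_sq_tendsto[OF L21[OF P] uL2 Pu] by (simp only: Nu)
  define H where "H n x = P n (A x + v)" for n x
  have H: "H n \<in> Cc_infty \<Omega>\<^sub>2" for n unfolding H_def by (rule Cc_infty_isometry[OF A P sub])
  have HN: "L2_norm_sq \<Omega>\<^sub>2 (H n) = L2_norm_sq \<Omega>\<^sub>1 (P n)" for n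
    unfolding H_def by (rule isometry_invariance(1)[OF A P sub \<Omega>\<^sub>1(1) \<Omega>\<^sub>2(1)])
  have HE: "dirichlet_energy \<Omega>\<^sub>2 (H n) = dirichlet_energy \<Omega>\<^sub>1 (P n)" for n
    unfolding H_def by (rule isometry_invariance(2)[OF A P sub \<Omega>\<^sub>1(1) \<Omega>\<^sub>2(1)])
  \<comment> \<open>Squeezed between the Rayleigh bound on \<Omega>_2 and the values for F n:
    passing to the moduli does not raise the energy and changes the squared norm by a null
    sequence.\<close>
  have HQ: "(\<lambda>n. dirichlet_energy \<Omega>\<^sub>2 (H n) - \<mu> * L2_norm_sq \<Omega>\<^sub>2 (H n)) \<longlonglongrightarrow> 0"
  proof (rule tendsto_sandwich[OF always_eventually always_eventually tendsto_const])
    show "\<forall>n. 0 \<le> dirichlet_energy \<Omega>\<^sub>2 (H n) - \<mu> * L2_norm_sq \<Omega>\<^sub>2 (H n)" using \<mu>[OF H] by simp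
    show "\<forall>n. dirichlet_energy \<Omega>\<^sub>2 (H n) - \<mu> * L2_norm_sq \<Omega>\<^sub>2 (H n) \<le>
       (dirichlet_energy \<Omega>\<^sub>1 (F n) - \<mu> * L2_norm_sq \<Omega>\<^sub>1 (F n)) + \<mu> * (L2_norm_sq \<Omega>\<^sub>1 (F n) - L2_norm_sq \<Omega>\<^sub>1 (P n))"
      using p(4) unfolding HN HE P_def[symmetric] by (simp add: algebra_simps)
    have "(\<lambda>n. (dirichlet_energy \<Omega>\<^sub>1 (F n) - \<mu> * L2_norm_sq \<Omega>\<^sub>1 (F n)) + \<mu> * (L2_norm_sq \<Omega>\<^sub>1 (F n) - L2_norm_sq \<Omega>\<^sub>1 (P n)))
      \<longlonglongrightarrow> 0 + \<mu> * (L2_norm_sq \<Omega>\<^sub>1 u - L2_norm_sq \<Omega>\<^sub>1 u)"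
      by (intro tendsto_add tendsto_mult_left tendsto_diff FE FN PN)
    then show "(\<lambda>n. (dirichlet_energy \<Omega>\<^sub>1 (F n) - \<mu> * L2_norm_sq \<Omega>\<^sub>1 (F n)) + \<mu> * (L2_norm_sq \<Omega>\<^sub>1 (F n) - L2_norm_sq \<Omega>\<^sub>1 (P n))) \<longlonglongrightarrow> 0"
      by simp
  qed
  have "\<exists>N. \<forall>i\<ge>N. \<forall>j\<ge>N. L2_norm_sq \<Omega>\<^sub>2 (\<lambda>x. H i x - H j x) < e" if e: "0 < e" for e
  proof -
    have "0 < e / 4" using e by simp
    then obtain N where N: "\<And>n. N \<le> n \<Longrightarrow> norm (L2_norm_sq \<Omega>\<^sub>1 (\<lambda>x. P n x - ?u x) - 0) < e / 4"
      using LIMSEQ_D[OF Pu] by blast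
    have "L2_norm_sq \<Omega>\<^sub>2 (\<lambda>x. H i x - H j x) < e" if ij: "N \<le> i" "N \<le> j" for i j
    proof -
      have "L2_norm_sq \<Omega>\<^sub>2 (\<lambda>x. H i x - H j x) = L2_norm_sq \<Omega>\<^sub>1 (\<lambda>x. P i x - P j x)"
        unfolding H_def by (rule isometry_invariance(1)[OF A Cc_infty_diff[OF P P] sub \<Omega>\<^sub>1(1) \<Omega>\<^sub>2(1)])
      also have "\<dots> = L2_norm_sq \<Omega>\<^sub>1 (\<lambda>x. (P i x - ?u x) + (?u x - P j x))" by simp
      also have "\<dots> \<le> 2 * L2_norm_sq \<Omega>\<^sub>1 (\<lambda>x. P i x - ?u x) + 2 * L2_norm_sq \<Omega>\<^sub>1 (\<lambda>x. ?u x - P j x)"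
        by (rule L2_norm_sq_add_le[OF L2_diff[OF L21[OF P] uL2] L2_diff[OF uL2 L21[OF P]]])
      also have "\<dots> < e"
        using N[OF ij(1)] N[OF ij(2)] L2_norm_sq_uminus[of \<Omega>\<^sub>1 ?u "P j"] by (simp add: abs_less_iff)
      finally show ?thesis .
    qed
    then show ?thesis by blast
  qed
  from L2_complete[OF \<Omega>\<^sub>2(2,1) L22[OF H] this]
  obtain U where U: "U \<in> L2 \<Omega>\<^sub>2" "(\<lambda>n. L2_norm_sq \<Omega>\<^sub>2 (\<lambda>x. H n x - U x)) \<longlonglongrightarrow> 0" by blast
  \<comment> \<open>U is determined only up to null sets. The H n are non-negative, so they converge
    to its modulus as well, which is non-negative everywhere, as the minimum principle
    requires.\<close>
  let ?U = "\<lambda>x. complex_of_real (norm (U x))"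
  have UL2: "?U \<in> L2 \<Omega>\<^sub>2" by (rule L2_norm[OF U(1)])
  have HU: "(\<lambda>n. L2_norm_sq \<Omega>\<^sub>2 (\<lambda>x. H n x - ?U x)) \<longlonglongrightarrow> 0"
  proof (rule Lim_null_comparison[OF always_eventually U(2)], intro allI)
    fix n
    have "L2_norm_sq \<Omega>\<^sub>2 (\<lambda>x. H n x - ?U x) \<le> L2_norm_sq \<Omega>\<^sub>2 (\<lambda>x. H n x - U x)"
    proof (rule L2_norm_sq_mono[OF L2_diff[OF L22[OF H] UL2] L2_diff[OF L22[OF H] U(1)]])
      fix x
      have Hx: "H n x = complex_of_real (norm (H n x))" using p(2)[of n "A x + v"] by (simp add: H_def P_def)
      have "norm (H n x - ?U x) = \<bar>norm (H n x) - norm (U x)\<bar>"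
        by (subst Hx) (simp flip: of_real_diff)
      then show "norm (H n x - ?U x) \<le> norm (H n x - U x)"
        using norm_triangle_ineq3[of "H n x" "U x"] by simp
    qed
    then show "norm (L2_norm_sq \<Omega>\<^sub>2 (\<lambda>x. H n x - ?U x)) \<le> L2_norm_sq \<Omega>\<^sub>2 (\<lambda>x. H n x - U x)"
      by (simp add: L2_norm_sq_nonneg)
  qed
  have equation: "(\<integral>x. ?U x * laplacian \<phi> x \<partial>?M) = - complex_of_real \<mu> * (\<integral>x. ?U x * \<phi> x \<partial>?M)"
    if \<phi>: "\<phi> \<in> Cc_infty \<Omega>\<^sub>2" for \<phi>
  proof (rule minimizing_limit_equation[OF \<Omega>\<^sub>2(1) _ H HQ _ \<phi>])
    show "\<mu> * L2_norm_sq \<Omega>\<^sub>2 \<psi> \<le> dirichlet_energy \<Omega>\<^sub>2 \<psi>" if "\<psi> \<in> Cc_infty \<Omega>\<^sub>2" for \<psi> by (rule \<mu>[OF that])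
    show "(\<lambda>n. \<integral>x. H n x * \<psi> x \<partial>?M) \<longlonglongrightarrow> (\<integral>x. ?U x * \<psi> x \<partial>?M)" if "\<psi> \<in> Cc_infty \<Omega>\<^sub>2" for \<psi>
      by (rule L2_tendsto_mult[OF L22[OF H] UL2 L22[OF that] HU])
  qed
  have "AE x in ?M. norm (U x) = 0"
  proof (rule strong_minimum_principle[OF \<Omega>\<^sub>2(1,3) _ norm_ge_zero _ G(1,3,2)])
    show "integrable ?M (\<lambda>x. norm (U x))" using L2_imp_integrable[OF \<Omega>\<^sub>2(2,1) U(1)] by simp
    fix x :: 'a and r :: real assume r: "0 < r" "cball x r \<subseteq> \<Omega>\<^sub>2"
    have b: "bump x r \<in> Cc_infty \<Omega>\<^sub>2" by (rule bump_Cc_infty[OF r])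
    have re: "Re (\<integral>z. ?U z * \<psi> z \<partial>?M) = (\<integral>z. norm (U z) * Re (\<psi> z) \<partial>?M)" if "\<psi> \<in> Cc_infty \<Omega>\<^sub>2" for \<psi>
      using integral_Re[OF L2_integrable_mult[OF UL2 L22[OF that]]] by simp
    have "(\<integral>z. Re (laplacian (bump x r) z) * norm (U z) \<partial>?M) = Re (\<integral>z. ?U z * laplacian (bump x r) z \<partial>?M)"
      by (simp add: re[OF laplacian_Cc_infty[OF b]] mult.commute)
    also have "\<dots> = - \<mu> * (\<integral>z. norm (U z) * Re (bump x r z) \<partial>?M)"
      unfolding equation[OF b] by (simp add: re[OF b])
    also have "\<dots> \<le> 0"
      using \<mu>0 by (simp add: bump_def flat_nonneg Bochner_Integration.integral_nonneg)
    finally show "(\<integral>z. Re (laplacian (bump x r) z) * norm (U z) \<partial>?M) \<le> 0" .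
  next
    have GM: "G \<in> sets ?M" using G(1,3) \<Omega>\<^sub>2(1) by (auto simp: sets_restrict_space_iff)
    have int: "integrable ?M (\<lambda>x. indicator G x * (norm (U x))\<^sup>2)"
      using integrable_mult_indicator[OF GM L2_integrable[OF U(1)]] by simp
    have le: "(\<integral>x. indicator G x * (norm (U x))\<^sup>2 \<partial>?M) \<le> L2_norm_sq \<Omega>\<^sub>2 (\<lambda>x. H n x - ?U x)" for n
      unfolding L2_norm_sq_def
    proof (rule integral_mono[OF int L2_integrable[OF L2_diff[OF L22[OF H] UL2]]])
      fix x
      have "H n x = 0" if "x \<in> G" unfolding H_def by (rule Cc_infty_vanishes[OF P G(4)[OF that]])
      then show "indicator G x * (norm (U x))\<^sup>2 \<le> (norm (H n x - ?U x))\<^sup>2" by (cases "x \<in> G") auto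
    qed
    have "(\<integral>x. indicator G x * (norm (U x))\<^sup>2 \<partial>?M) \<le> 0"
      by (rule LIMSEQ_le_const[OF HU]) (use le in auto)
    then have "(\<integral>x. indicator G x * (norm (U x))\<^sup>2 \<partial>?M) = 0"
      by (intro order.antisym Bochner_Integration.integral_nonneg) auto
    then have "AE x in ?M. indicator G x * (norm (U x))\<^sup>2 = 0"
      using integral_nonneg_eq_0_iff_AE[OF int] by auto
    then show "AE x in ?M. x \<in> G \<longrightarrow> norm (U x) = 0" by (auto elim: eventually_mono)
  qed
  then have "AE x in ?M. ?U x = 0" by simp
  then have "L2_norm_sq \<Omega>\<^sub>2 ?U = 0" using L2_norm_sq_eq_0_iff[OF UL2] by blast
  then have "(\<lambda>n. L2_norm_sq \<Omega>\<^sub>2 (H n)) \<longlonglongrightarrow> 0"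
    using L2_norm_sq_tendsto[OF L22[OF H] UL2 HU] by simp
  then have "(\<lambda>n. L2_norm_sq \<Omega>\<^sub>1 (P n)) \<longlonglongrightarrow> 0" by (simp only: HN)
  from LIMSEQ_unique[OF PN this] show False using u(2) by simp
qed

section \<open>Excluding a remainder of \<Omega>_2 outside the rigid piece\<close>

theorem theorem1p1:
  fixes \<Omega>\<^sub>1 \<Omega>\<^sub>2 :: "(real ^ 'd) set"
    and U :: "((real ^ 'd) \<Rightarrow>\<^sub>C complex) \<Rightarrow> ((real ^ 'd) \<Rightarrow>\<^sub>C complex)"
  assumes "\<Omega>\<^sub>1 \<noteq> {}" "bounded \<Omega>\<^sub>1" "open \<Omega>\<^sub>1" "lipschitz_boundary \<Omega>\<^sub>1"
    and "\<Omega>\<^sub>2 \<noteq> {}" "bounded \<Omega>\<^sub>2" "open \<Omega>\<^sub>2" "lipschitz_boundary \<Omega>\<^sub>2"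
    and "connected \<Omega>\<^sub>1"
    and "bounded_operator_C_0 \<Omega>\<^sub>1 \<Omega>\<^sub>2 U"
    and "\<exists>f\<in>C_0 \<Omega>\<^sub>1. U f \<noteq> 0"
    and disjointness:
      "\<And>f g. f \<in> C_0 \<Omega>\<^sub>1 \<Longrightarrow> g \<in> C_0 \<Omega>\<^sub>1 \<Longrightarrow>
         (\<forall>x\<in>\<Omega>\<^sub>1. apply_bcontfun f x * apply_bcontfun g x = 0) \<Longrightarrow>
         (\<forall>x\<in>\<Omega>\<^sub>2. apply_bcontfun (U f) x * apply_bcontfun (U g) x = 0)"
    and intertwining:
      "\<And>f. f \<in> Cc_infty \<Omega>\<^sub>1 \<Longrightarrow>
         distr_laplacian \<Omega>\<^sub>2 (apply_bcontfun (U (Bcontfun f)))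
                            (apply_bcontfun (U (Bcontfun (laplacian f))))"
    and "measure lebesgue \<Omega>\<^sub>1 = measure lebesgue \<Omega>\<^sub>2 \<or>
         C_0 \<Omega>\<^sub>2 \<subseteq> closure (U ` C_0 \<Omega>\<^sub>1) \<or>
         (connected \<Omega>\<^sub>2 \<and>
          (\<exists>\<mu>. first_dirichlet_eigenvalue \<Omega>\<^sub>1 \<mu> \<and> first_dirichlet_eigenvalue \<Omega>\<^sub>2 \<mu>))"
  shows "congruent_sets \<Omega>\<^sub>1 \<Omega>\<^sub>2 \<and>
    (\<exists>\<tau> c. is_isometry \<tau> \<and> \<tau> ` \<Omega>\<^sub>2 = \<Omega>\<^sub>1 \<and> c \<noteq> 0 \<and>
       (\<forall>f\<in>C_0 \<Omega>\<^sub>1. \<forall>x\<in>\<Omega>\<^sub>2. apply_bcontfun (U f) x = c * apply_bcontfun f (\<tau> x)))"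
proof -
  have "\<exists>\<tau> w. (\<forall>f\<in>C_0 \<Omega>\<^sub>1. \<forall>x. apply_bcontfun (U f) x = w x * apply_bcontfun f (\<tau> x)) \<and>
      (\<forall>x. w x \<noteq> 0 \<longrightarrow> x \<in> \<Omega>\<^sub>2 \<and> \<tau> x \<in> \<Omega>\<^sub>1)"
    by (rule operator_representation[OF assms(3,10)]) (fact disjointness, blast)
  then obtain \<tau> w where rep: "\<And>f x. f \<in> C_0 \<Omega>\<^sub>1 \<Longrightarrow> apply_bcontfun (U f) x = w x * apply_bcontfun f (\<tau> x)"
    and w: "\<And>x. w x \<noteq> 0 \<Longrightarrow> x \<in> \<Omega>\<^sub>2 \<and> \<tau> x \<in> \<Omega>\<^sub>1" by blast
  obtain f0 where f0: "f0 \<in> C_0 \<Omega>\<^sub>1" "U f0 \<noteq> 0" using assms(11) by blast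
  then obtain x0 where "apply_bcontfun (U f0) x0 \<noteq> 0" by (metis bcontfun_eqI zero_bcontfun.rep_eq)
  then have x0: "w x0 \<noteq> 0" using rep[OF f0(1), of x0] by auto
  have "\<exists>A v. orthogonal_transformation A \<and>
      (\<forall>x. A x + v \<in> \<Omega>\<^sub>1 \<longrightarrow> x \<in> \<Omega>\<^sub>2 \<and> w x = w x0 \<and> \<tau> x = A x + v)"
    by (rule operator_global_structure[where U = U and w = w and \<tau> = \<tau>])
      (fact assms(3,7,6,9,10) intertwining rep w x0)+
  then obtain A v where A: "orthogonal_transformation A"
    and V: "\<And>x. A x + v \<in> \<Omega>\<^sub>1 \<Longrightarrow> x \<in> \<Omega>\<^sub>2 \<and> w x = w x0 \<and> \<tau> x = A x + v" by blast
  define \<sigma> where "\<sigma> x = A x + v" for x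
  define \<sigma>' where "\<sigma>' y = inv A (y - v)" for y
  have lin: "linear A" by (rule orthogonal_transformation_linear[OF A])
  have A': "orthogonal_transformation (inv A)" by (rule orthogonal_transformation_inv[OF A])
  have inv: "\<sigma> (\<sigma>' y) = y" "\<sigma>' (\<sigma> x) = x" for x y
    using orthogonal_transformation_bij[OF A] by (simp_all add: \<sigma>_def \<sigma>'_def bij_is_surj bij_is_inj surj_f_inv_f)
  have iso: "is_isometry \<sigma>" "is_isometry \<sigma>'"
    using orthogonal_transformation_isometry A A'
    by (simp_all add: is_isometry_def \<sigma>_def \<sigma>'_def dist_norm orthogonal_transformation_norm
        flip: linear_diff[OF lin] linear_diff[OF orthogonal_transformation_linear[OF A']])
  have \<sigma>_cont: "continuous_on UNIV \<sigma>"
    unfolding \<sigma>_def using linear_continuous_on[OF linear_conv_bounded_linear[THEN iffD1, OF lin]]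
    by (intro continuous_intros)
  have all: "\<sigma> x \<in> \<Omega>\<^sub>1" if x: "x \<in> \<Omega>\<^sub>2" for x
  proof (rule ccontr)
    assume nx: "\<sigma> x \<notin> \<Omega>\<^sub>1"
    have "\<sigma>' -` \<Omega>\<^sub>2 = \<sigma> ` \<Omega>\<^sub>2" using inv by (auto intro: rev_image_eqI)
    moreover have "continuous_on UNIV \<sigma>'"
      unfolding \<sigma>'_def
      by (rule continuous_on_compose2[OF linear_continuous_on[OF linear_conv_bounded_linear[THEN iffD1, OF orthogonal_transformation_linear[OF A']], of UNIV]])
        (auto intro!: continuous_intros)
    ultimately have open_image: "open (\<sigma> ` \<Omega>\<^sub>2)"
      using open_vimage[OF assms(7), of \<sigma>'] by simp
    \<comment> \<open>The exterior property is used for \<Omega>_1 at \<sigma> x, inside the open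
      image of \<Omega>_2; pulled back, it gives an open part of \<Omega>_2 that \<sigma> maps
      outside \<Omega>_1.\<close>
    obtain G' where G': "open G'" "G' \<noteq> {}" "G' \<subseteq> \<sigma> ` \<Omega>\<^sub>2" "G' \<inter> \<Omega>\<^sub>1 = {}"
      using lipschitz_boundary_exterior[OF assms(4) nx open_image] x by blast
    define G where "G = \<sigma> -` G'"
    have G: "open G" "G \<noteq> {}" "G \<subseteq> \<Omega>\<^sub>2" "\<And>x. x \<in> G \<Longrightarrow> A x + v \<notin> \<Omega>\<^sub>1"
    proof -
      show "open G" unfolding G_def by (rule open_vimage[OF G'(1) \<sigma>_cont])
      obtain y where "y \<in> G'" using G'(2) by blast
      then have "\<sigma>' y \<in> G" using inv by (simp add: G_def)
      then show "G \<noteq> {}" by blast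
      show "G \<subseteq> \<Omega>\<^sub>2"
      proof
        fix z assume "z \<in> G"
        then obtain z' where "z' \<in> \<Omega>\<^sub>2" "\<sigma> z = \<sigma> z'" using G'(3) by (auto simp: G_def)
        then show "z \<in> \<Omega>\<^sub>2" using inv(2) by metis
      qed
      show "A x + v \<notin> \<Omega>\<^sub>1" if "x \<in> G" for x using that G'(4) by (auto simp: G_def \<sigma>_def)
    qed
    from assms(14) show False
    proof (elim disjE)
      \<comment> \<open>The rigid piece already has the full measure of \<Omega>_1, which leaves
        none for the disjoint open set G.\<close>
      assume eq: "measure lebesgue \<Omega>\<^sub>1 = measure lebesgue \<Omega>\<^sub>2"
      have m: "\<sigma> \<in> borel_measurable borel" by (rule borel_measurable_continuous_onI[OF \<sigma>_cont])
      have "emeasure lborel \<Omega>\<^sub>1 = emeasure (distr lborel borel \<sigma>) \<Omega>\<^sub>1"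
        by (simp add: lborel_isometry[OF A \<sigma>_def])
      also have "\<dots> = emeasure lborel (\<sigma> -` \<Omega>\<^sub>1)"
        using m assms(3) by (simp add: emeasure_distr)
      finally have 1: "emeasure lborel \<Omega>\<^sub>1 = emeasure lborel (\<sigma> -` \<Omega>\<^sub>1)" .
      have oV: "open (\<sigma> -` \<Omega>\<^sub>1)" by (rule open_vimage[OF assms(3) \<sigma>_cont])
      have "emeasure lborel (\<sigma> -` \<Omega>\<^sub>1) + emeasure lborel G = emeasure lborel (\<sigma> -` \<Omega>\<^sub>1 \<union> G)"
        using oV G by (intro plus_emeasure) (auto simp: \<sigma>_def)
      also have "\<dots> \<le> emeasure lborel \<Omega>\<^sub>2"
        using V G(3) assms(7) by (intro emeasure_mono) (auto simp: \<sigma>_def)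
      also have "\<dots> = emeasure lborel \<Omega>\<^sub>1"
      proof -
        have "emeasure lebesgue S = ennreal (measure lebesgue S)" if "bounded S" "open S" for S :: "(real ^ 'd) set"
          using emeasure_bounded_finite[OF that(1)] that(2) by (intro emeasure_eq_ennreal_measure) auto
        then show ?thesis using eq assms(2,3,6,7) by simp
      qed
      finally have "emeasure lborel \<Omega>\<^sub>1 + emeasure lborel G \<le> emeasure lborel \<Omega>\<^sub>1 + 0" using 1 by simp
      moreover have "emeasure lborel \<Omega>\<^sub>1 \<noteq> \<infinity>" using emeasure_bounded_finite[OF assms(2)] by auto
      ultimately have "emeasure lborel G = 0"
        by (simp add: ennreal_add_left_cancel_le)
      then have "G \<in> null_sets lebesgue" using G(1) by (intro null_sets_completionI) (simp add: null_sets_def)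
      then show False using open_not_negligible[OF G(1,2)] by (simp add: negligible_iff_null_sets)
    next
      assume dense: "C_0 \<Omega>\<^sub>2 \<subseteq> closure (U ` C_0 \<Omega>\<^sub>1)"
      \<comment> \<open>All functions in the range satisfy one fixed linear relation between their
        values at x and at another point y. The relation passes to uniform limits, but a bump at x
        that vanishes at y violates it.\<close>
      have "\<exists>y a. y \<noteq> x \<and> (\<forall>f\<in>C_0 \<Omega>\<^sub>1. w x0 * apply_bcontfun (U f) x = a * apply_bcontfun (U f) y)"
      proof (cases "w x = 0")
        case True
        \<comment> \<open>All U f vanish at x, so a = 0 and any y different from x will do; this one
          is mapped into \<Omega>_1 by \<sigma>, unlike x.\<close>
        have "\<sigma>' (\<tau> x0) \<noteq> x" using nx w[OF x0] inv by auto
        then show ?thesis using True by (intro exI[of _ "\<sigma>' (\<tau> x0)"] exI[of _ 0]) (auto simp: rep)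
      next
        case False
        \<comment> \<open>The point of the rigid piece at which U f also reads the value of f at
          \<tau> x. The weights at x and at this point are w x and w x0, which explains the two
          factors in the relation.\<close>
        let ?y = "\<sigma>' (\<tau> x)"
        have "\<sigma> ?y \<in> \<Omega>\<^sub>1" using w[OF False] inv by simp
        then have y: "w ?y = w x0" "\<tau> ?y = \<tau> x" using V[of ?y] inv by (auto simp: \<sigma>_def)
        have "?y \<noteq> x" using nx \<open>\<sigma> ?y \<in> \<Omega>\<^sub>1\<close> by auto
        then show ?thesis using y by (intro exI[of _ ?y] exI[of _ "w x"]) (auto simp: rep)
      qed
      then obtain y a where y: "y \<noteq> x" "\<And>f. f \<in> C_0 \<Omega>\<^sub>1 \<Longrightarrow> w x0 * apply_bcontfun (U f) x = a * apply_bcontfun (U f) y" by blast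
      obtain r where r: "0 < r" "cball x r \<subseteq> \<Omega>\<^sub>2" using assms(7) x open_contains_cball by blast
      define s where "s = min r (dist x y)"
      have s: "0 < s" "cball x s \<subseteq> \<Omega>\<^sub>2" "s \<le> dist x y" using r y(1) by (auto simp: s_def)
      have b: "bump x s \<in> Cc_infty \<Omega>\<^sub>2" by (rule bump_Cc_infty[OF s(1,2)])
      obtain g where g: "\<And>n. g n \<in> U ` C_0 \<Omega>\<^sub>1" "g \<longlonglongrightarrow> Bcontfun (bump x s)"
        using dense Bcontfun_C_0[OF b] closure_sequential by blast
      have lim: "(\<lambda>n. apply_bcontfun (g n) z) \<longlonglongrightarrow> bump x s z" for z
      proof (rule metric_tendsto_imp_tendsto[OF g(2)])
        show "\<forall>\<^sub>F n in sequentially. dist (apply_bcontfun (g n) z) (bump x s z) \<le> dist (g n) (Bcontfun (bump x s))"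
          using dist_bounded[of _ z "Bcontfun (bump x s)"] by (simp add: apply_Bcontfun[OF b])
      qed
      have "w x0 * apply_bcontfun (g n) x = a * apply_bcontfun (g n) y" for n using g(1)[of n] y(2) by auto
      then have "(\<lambda>n. a * apply_bcontfun (g n) y) \<longlonglongrightarrow> w x0 * bump x s x"
        using tendsto_mult_left[OF lim[of x], of "w x0"] by simp
      from LIMSEQ_unique[OF this tendsto_mult_left[OF lim[of y]]]
      have "w x0 * bump x s x = a * bump x s y" .
      moreover have "bump x s y = 0" using bump_eq_0_iff[OF s(1), of x y] s(3) by simp
      moreover have "bump x s x \<noteq> 0" using bump_eq_0_iff[OF s(1), of x x] s(1) by simp
      ultimately show False using x0 by simp
    next
      assume ev: "connected \<Omega>\<^sub>2 \<and> (\<exists>\<mu>. first_dirichlet_eigenvalue \<Omega>\<^sub>1 \<mu> \<and> first_dirichlet_eigenvalue \<Omega>\<^sub>2 \<mu>)"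
      then obtain \<mu> where \<mu>: "dirichlet_eigenvalue \<Omega>\<^sub>1 \<mu>" "first_dirichlet_eigenvalue \<Omega>\<^sub>2 \<mu>"
        by (auto simp: first_dirichlet_eigenvalue_def[of \<Omega>\<^sub>1])
      show False
        by (rule eigenvalue_domain_rigidity[OF assms(3,2,7,6) _ A _ G \<mu>]) (use ev V in auto)
    qed
  qed
  have image: "\<sigma> ` \<Omega>\<^sub>2 = \<Omega>\<^sub>1"
  proof
    show "\<Omega>\<^sub>1 \<subseteq> \<sigma> ` \<Omega>\<^sub>2"
    proof
      fix y assume "y \<in> \<Omega>\<^sub>1"
      then have "\<sigma>' y \<in> \<Omega>\<^sub>2" using V[of "\<sigma>' y"] inv(1)[of y] by (simp add: \<sigma>_def)
      then show "y \<in> \<sigma> ` \<Omega>\<^sub>2" using inv(1)[of y] by (metis image_eqI)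
    qed
  qed (use all in auto)
  then have "\<sigma>' ` \<Omega>\<^sub>1 = \<Omega>\<^sub>2" by (simp add: image_image inv(2) flip: image)
  then have "congruent_sets \<Omega>\<^sub>1 \<Omega>\<^sub>2" using iso(2) by (auto simp: congruent_sets_def)
  moreover have "apply_bcontfun (U f) x = w x0 * apply_bcontfun f (\<sigma> x)" if "f \<in> C_0 \<Omega>\<^sub>1" "x \<in> \<Omega>\<^sub>2" for f x
    using rep[OF that(1), of x] V[of x] all[OF that(2)] by (simp add: \<sigma>_def)
  ultimately show ?thesis using iso(1) image x0 by blast
qed

end
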